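(* Let $p\ge 1$, $q\ge 1$ be integers with $p+q$ even, and let $m\ge 0$ be an integer satisfying $m+3\le (p+q)/2$. Let $M^{+}(m)$ and $M^{-}(m)$ be the $(\mathfrak g,K)$-modules for $\mathrm O(p,q)$ defined in the context. Then: (1) The $K$-type formula of $M^{\pm}(m)$ is $$M^{\pm}(m)\big|_{K}\;\simeq\;\bigoplus_{\substack{k,l\ge 0\\ k-l+\frac{p-q}{2}\in\Lambda_m}}\mathcal H^k(\mathbb R^p)\otimes\mathcal H^l(\mathbb R^q),$$ where $\Lambda_m=\{-m,-m+2,-m+4,\dots,m-2,m\}$. (2) Suppose further that $p,q\ge 2$. Then $M^{+}(m)$ and $M^{-}(m)$ are irreducible $(\mathfrak g,K)$-modules.
   Context: Notation: $\mathbb N=\{0,1,2,\dots\}$. $G=\mathrm O(p,q)=\{g\in \mathrm{GL}_{p+q}(\mathbb R): {}^tg I_{p,q}g=I_{p,q}\}$ with $I_{p,q}=\mathrm{diag}(1_p,-1_q)$; $K\simeq \mathrm O(p)\times \mathrm O(q)$ is the block-diagonal maximal compact subgroup; $\mathfrak g=\mathfrak o(p,q)\otimes_{\mathbb R}\mathbb C$. With $E_{a,b}$ the matrix units, $\mathfrak g$ is spanned by $X^+_{i,j}=E_{i,j}-E_{j,i}$ ($1\le i,j\le p$), $X^+_{p+i,p+j}=E_{p+i,p+j}-E_{p+j,p+i}$ ($1\le i,j\le q$), and $X^-_{i,j}=E_{i,p+j}+E_{p+j,i}$ ($1\le i\le p$, $1\le j\le q$). Let $x=(x_1,\dots,x_p)$,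 $y=(y_1,\dots,y_q)$ be the coordinates on $V=\mathbb R^p\times\mathbb R^q$. $\mathfrak g$ acts by the linear map $\pi$ into polynomial-coefficient differential operators on $V$: $\pi(X^+_{i,j})=-x_j\partial_{x_i}+x_i\partial_{x_j}$, $\pi(X^+_{p+i,p+j})=-y_j\partial_{y_i}+y_i\partial_{y_j}$, $\pi(X^-_{i,j})=\sqrt{-1}\,(x_iy_j+\partial_{x_i}\partial_{y_j})$; this is a Lie algebra homomorphism. $K$ acts on functions on $V$ by $(a,d)\cdot f(x,y)=f(a^{-1}x,d^{-1}y)$. Put $E_x=\sum x_i\partial_{x_i}$, $r_x^2=\sum x_i^2$, $\Delta_x=\sum\partial_{x_i}^2$, $E_y=\sum y_j\partial_{y_j}$, $r_y^2=\sum y_j^2$, $\Delta_y=\sum\partial_{y_j}^2$, $\rho_x=r_x^2/2$, $\rho_y=r_y^2/2$, and $H=-E_x-\frac p2+E_y+\frac q2$, $X^+=-\frac12(\Delta_x+r_y^2)$, $X^-=\frac12(r_x^2+\Delta_y)$. These satisfy $[H,X^\pm]=\pm2X^\pm$, $[X^+,X^-]=H$ and commute with $\pi(\mathfrak g)$. $\mathcal H^k(\mathbb R^n)$ is the space of homogeneous harmonic polynomials of degree $k$ on $\mathbb R^n$, viewed as an $\mathrm O(n)$-module. For $\alpha\in\mathbb C\setminus(-\mathbb N)$ let $\Psi_\alpha(u)=\sum_{n\ge0}\frac{(-1)^n}{n!\,(\alpha)_n}u^n$ with $(\alpha)_n=\alpha(\alpha+1)\cdots(\alpha+n-1)$, and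 $\psi_\alpha=\Psi_\alpha(r_x^2r_y^2/4)=\Psi_\alpha(\rho_x\rho_y)$. Let $\mathcal E$ be the complex linear span of all functions $h_1(x)h_2(y)\rho_x^a\rho_y^b\psi_\alpha$ with $h_1\in\mathcal H^k(\mathbb R^p)$, $h_2\in\mathcal H^l(\mathbb R^q)$, $k,l,a,b\in\mathbb N$, $\alpha\in\mathbb C\setminus(-\mathbb N)$. $\mathcal E$ is stable under $\mathfrak g$, $K$ and $H,X^\pm$. For $m\in\mathbb N$, $M^{+}(m)$ consists of $0$ and all $f\in\mathcal E$ with $Hf=mf$, $X^+f=0$, $(X^-)^jf\ne0$ for $1\le j\le m$, and $(X^-)^{m+1}f=0$; $M^{-}(m)$ consists of $0$ and all $f\in\mathcal E$ with $Hf=-mf$, $X^-f=0$, $(X^+)^jf\neq0$ for $1\le j\le m$, and $(X^+)^{m+1}f=0$. They carry the restricted actions of $\mathfrak g$ (via $\pi$) and $K$. *)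

theory Defs
  imports "HOL-Analysis.Analysis" "HOL-Library.Function_Algebras"
begin

text \<open>The integers \<open>p, q \<ge> 1\<close> are \<open>CARD('p)\<close> and \<open>CARD('q)\<close> for finite index types.
  Vector space operations on functions are pointwise
  (\<^theory>\<open>HOL-Library.Function_Algebras\<close>).\<close>

type_synonym ('p, 'q) V = "(real^'p) \<times> (real^'q)"
type_synonym ('p, 'q) cfun = "('p, 'q) V \<Rightarrow> complex"
type_synonym ('p, 'q) cmat = "complex^('p + 'q)^('p + 'q)"
type_synonym ('p, 'q) rmat2 = "(real^'p^'p) \<times> (real^'q^'q)"

definition cscale :: "complex \<Rightarrow> ('a \<Rightarrow> complex) \<Rightarrow> 'a \<Rightarrow> complex" where
  "cscale c f = (\<lambda>v. c * f v)"

interpretation cfun: vector_space cscale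
  by unfold_locales (auto simp: cscale_def fun_eq_iff algebra_simps)


subsection \<open>The group \<open>K\<close> and the complexified Lie algebra of \<open>O(p,q)\<close>\<close>

definition I_pq :: "('p::finite, 'q::finite) cmat" where
  "I_pq = (\<chi> a b. if a = b then (case a of Inl _ \<Rightarrow> 1 | Inr _ \<Rightarrow> -1) else 0)"

text \<open>The complexification of \<open>{X. X\<^sup>t I_pq + I_pq X = 0}\<close>, with the commutator as
  bracket; lemma \<open>opq_decomposition\<close> below expands its elements in the spanning
  matrices \<open>X_pp\<close>, \<open>X_qq\<close>, \<open>X_pq\<close>.\<close>

definition opq :: "('p::finite, 'q::finite) cmat set" where
  "opq = {A. transpose A ** I_pq + I_pq ** A = 0}"

definition lie_bracket :: "complex^'n^'n \<Rightarrow> complex^'n^'n \<Rightarrow> complex^'n::finite^'n" where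
  "lie_bracket A B = A ** B - B ** A"

definition mscale :: "complex \<Rightarrow> complex^'n^'m \<Rightarrow> complex^'n::finite^'m::finite" where
  "mscale c A = (\<chi> i j. c * A $ i $ j)"

definition E_unit :: "'n \<Rightarrow> 'n \<Rightarrow> complex^'n::finite^'n" where
  "E_unit a b = (\<chi> i j. if i = a \<and> j = b then 1 else 0)"

definition X_pp :: "'p \<Rightarrow> 'p \<Rightarrow> ('p::finite, 'q::finite) cmat" where
  "X_pp i j = E_unit (Inl i) (Inl j) - E_unit (Inl j) (Inl i)"

definition X_qq :: "'q \<Rightarrow> 'q \<Rightarrow> ('p::finite, 'q::finite) cmat" where
  "X_qq i j = E_unit (Inr i) (Inr j) - E_unit (Inr j) (Inr i)"

definition X_pq :: "'p \<Rightarrow> 'q \<Rightarrow> ('p::finite, 'q::finite) cmat" where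
  "X_pq i j = E_unit (Inl i) (Inr j) + E_unit (Inr j) (Inl i)"

text \<open>An element \<open>(a, d)\<close> of \<open>K = O(p) \<times> O(q)\<close> stands for the block-diagonal matrix
  \<open>blk (a, d)\<close>; the same embedding is used for the Lie algebra of \<open>K\<close>.\<close>

definition K_grp :: "('p::finite, 'q::finite) rmat2 set" where
  "K_grp = {(a, d). orthogonal_matrix a \<and> orthogonal_matrix d}"

definition K_one :: "('p::finite, 'q::finite) rmat2" where
  "K_one = (mat 1, mat 1)"

definition K_mult :: "('p::finite, 'q::finite) rmat2 \<Rightarrow> ('p, 'q) rmat2 \<Rightarrow> ('p, 'q) rmat2" where
  "K_mult k k' = (fst k ** fst k', snd k ** snd k')"

definition K_inv :: "('p::finite, 'q::finite) rmat2 \<Rightarrow> ('p, 'q) rmat2" where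
  "K_inv k = (matrix_inv (fst k), matrix_inv (snd k))"

definition blk :: "('p::finite, 'q::finite) rmat2 \<Rightarrow> ('p, 'q) cmat" where
  "blk k = (\<chi> r s. case (r, s) of
      (Inl i, Inl j) \<Rightarrow> complex_of_real (fst k $ i $ j)
    | (Inr i, Inr j) \<Rightarrow> complex_of_real (snd k $ i $ j)
    | _ \<Rightarrow> 0)"


subsection \<open>Differential operators\<close>

definition dir_deriv :: "'v::real_normed_vector \<Rightarrow> ('v \<Rightarrow> complex) \<Rightarrow> 'v \<Rightarrow> complex" where
  "dir_deriv u f v = vector_derivative (\<lambda>t. f (v + t *\<^sub>R u)) (at 0)"

definition dx :: "'p \<Rightarrow> ('p::finite, 'q::finite) cfun \<Rightarrow> ('p, 'q) cfun" where
  "dx i = dir_deriv (axis i 1, 0)"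

definition dy :: "'q \<Rightarrow> ('p::finite, 'q::finite) cfun \<Rightarrow> ('p, 'q) cfun" where
  "dy j = dir_deriv (0, axis j 1)"

definition xc :: "'p \<Rightarrow> ('p::finite, 'q::finite) cfun" where
  "xc i v = complex_of_real (fst v $ i)"

definition yc :: "'q \<Rightarrow> ('p::finite, 'q::finite) cfun" where
  "yc j v = complex_of_real (snd v $ j)"

definition rx2 :: "('p::finite, 'q::finite) cfun" where
  "rx2 v = (\<Sum>i\<in>UNIV. (xc i v)\<^sup>2)"

definition ry2 :: "('p::finite, 'q::finite) cfun" where
  "ry2 v = (\<Sum>j\<in>UNIV. (yc j v)\<^sup>2)"

definition rho_x :: "('p::finite, 'q::finite) cfun" where
  "rho_x v = rx2 v / 2"

definition rho_y :: "('p::finite, 'q::finite) cfun" where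
  "rho_y v = ry2 v / 2"

definition Euler_x :: "('p::finite, 'q::finite) cfun \<Rightarrow> ('p, 'q) cfun" where
  "Euler_x f v = (\<Sum>i\<in>UNIV. xc i v * dx i f v)"

definition Euler_y :: "('p::finite, 'q::finite) cfun \<Rightarrow> ('p, 'q) cfun" where
  "Euler_y f v = (\<Sum>j\<in>UNIV. yc j v * dy j f v)"

definition Lap_x :: "('p::finite, 'q::finite) cfun \<Rightarrow> ('p, 'q) cfun" where
  "Lap_x f v = (\<Sum>i\<in>UNIV. dx i (dx i f) v)"

definition Lap_y :: "('p::finite, 'q::finite) cfun \<Rightarrow> ('p, 'q) cfun" where
  "Lap_y f v = (\<Sum>j\<in>UNIV. dy j (dy j f) v)"

definition H_op :: "('p::finite, 'q::finite) cfun \<Rightarrow> ('p, 'q) cfun" where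
  "H_op f v = - Euler_x f v - (of_nat CARD('p) / 2) * f v
              + Euler_y f v + (of_nat CARD('q) / 2) * f v"

definition Xplus :: "('p::finite, 'q::finite) cfun \<Rightarrow> ('p, 'q) cfun" where
  "Xplus f v = - (1/2) * (Lap_x f v + ry2 v * f v)"

definition Xminus :: "('p::finite, 'q::finite) cfun \<Rightarrow> ('p, 'q) cfun" where
  "Xminus f v = (1/2) * (rx2 v * f v + Lap_y f v)"


subsection \<open>The actions of the Lie algebra and of \<open>K\<close>\<close>

definition pi_pp :: "'p \<Rightarrow> 'p \<Rightarrow> ('p::finite, 'q::finite) cfun \<Rightarrow> ('p, 'q) cfun" where
  "pi_pp i j f v = - xc j v * dx i f v + xc i v * dx j f v"

definition pi_qq :: "'q \<Rightarrow> 'q \<Rightarrow> ('p::finite, 'q::finite) cfun \<Rightarrow> ('p, 'q) cfun" where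
  "pi_qq i j f v = - yc j v * dy i f v + yc i v * dy j f v"

definition pi_pq :: "'p \<Rightarrow> 'q \<Rightarrow> ('p::finite, 'q::finite) cfun \<Rightarrow> ('p, 'q) cfun" where
  "pi_pq i j f v = \<i> * (xc i v * yc j v * f v + dx i (dy j f) v)"

text \<open>The linear extension of \<open>X_pp i j \<mapsto> pi_pp i j\<close>, \<open>X_qq i j \<mapsto> pi_qq i j\<close>,
  \<open>X_pq i j \<mapsto> pi_pq i j\<close> to \<open>opq\<close>. The factors \<open>1/2\<close> occur because both \<open>(i,j)\<close> and
  \<open>(j,i)\<close> are summed over in the skew-symmetric blocks; compare \<open>opq_decomposition\<close>.\<close>

definition pi_op :: "('p::finite, 'q::finite) cmat \<Rightarrow> ('p, 'q) cfun \<Rightarrow> ('p, 'q) cfun" where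
  "pi_op A f v =
      (1/2) * (\<Sum>i\<in>UNIV. \<Sum>j\<in>UNIV. A $ Inl i $ Inl j * pi_pp i j f v)
    + (1/2) * (\<Sum>i\<in>UNIV. \<Sum>j\<in>UNIV. A $ Inr i $ Inr j * pi_qq i j f v)
    + (\<Sum>i\<in>UNIV. \<Sum>j\<in>UNIV. A $ Inl i $ Inr j * pi_pq i j f v)"

definition K_act :: "('p::finite, 'q::finite) rmat2 \<Rightarrow> ('p, 'q) cfun \<Rightarrow> ('p, 'q) cfun" where
  "K_act k f v = f (matrix_inv (fst k) *v fst v, matrix_inv (snd k) *v snd v)"

lemma opq_iff:
  fixes A :: "('p::finite, 'q::finite) cmat"
  shows "A \<in> opq \<longleftrightarrow>
    (\<forall>i j. A $ Inl i $ Inl j = - A $ Inl j $ Inl i) \<and>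
    (\<forall>i j. A $ Inr i $ Inr j = - A $ Inr j $ Inr i) \<and>
    (\<forall>i j. A $ Inr j $ Inl i = A $ Inl i $ Inr j)"
proof -
  define s :: "'p + 'q \<Rightarrow> complex" where "s a = (case a of Inl _ \<Rightarrow> 1 | Inr _ \<Rightarrow> -1)" for a
  have e: "(transpose A ** I_pq + I_pq ** A) $ a $ b = A $ b $ a * s b + s a * A $ a $ b" for a b
    by (simp add: matrix_matrix_mult_def transpose_def I_pq_def s_def[symmetric]
        if_distrib if_distribR cong: if_cong)
  have *: "A \<in> opq \<longleftrightarrow> (\<forall>a b. A $ b $ a * s b + s a * A $ a $ b = 0)"
    unfolding opq_def mem_Collect_eq vec_eq_iff e by simp
  show ?thesis
  proof (intro iffI conjI allI)
    assume "A \<in> opq"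
    then have h: "A $ b $ a * s b + s a * A $ a $ b = 0" for a b
      using * by blast
    show "A $ Inl i $ Inl j = - A $ Inl j $ Inl i" for i j
      using h[of "Inl i" "Inl j"] by (simp add: s_def add_eq_0_iff)
    show "A $ Inr i $ Inr j = - A $ Inr j $ Inr i" for i j
      using h[of "Inr j" "Inr i"] by (simp add: s_def add_eq_0_iff)
    show "A $ Inr j $ Inl i = A $ Inl i $ Inr j" for i j
      using h[of "Inl i" "Inr j"] by (simp add: s_def)
  next
    assume h: "(\<forall>i j. A $ Inl i $ Inl j = - A $ Inl j $ Inl i) \<and>
      (\<forall>i j. A $ Inr i $ Inr j = - A $ Inr j $ Inr i) \<and>
      (\<forall>i j. A $ Inr j $ Inl i = A $ Inl i $ Inr j)"
    have 1: "A $ Inl i $ Inl j = - A $ Inl j $ Inl i"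
      and 2: "A $ Inr i' $ Inr j' = - A $ Inr j' $ Inr i'"
      and 3: "A $ Inr j' $ Inl i = A $ Inl i $ Inr j'" for i j i' j'
      using h by blast+
    have "A $ b $ a * s b + s a * A $ a $ b = 0" for a b
    proof (cases a; cases b)
      fix i j assume [simp]: "a = Inl i" "b = Inl j"
      show ?thesis using 1[of i j] by (simp add: s_def)
    next
      fix i j assume [simp]: "a = Inr i" "b = Inr j"
      show ?thesis using 2[of i j] by (simp add: s_def)
    next
      fix i j assume [simp]: "a = Inl i" "b = Inr j"
      show ?thesis using 3[of j i] by (simp add: s_def)
    next
      fix i j assume [simp]: "a = Inr i" "b = Inl j"
      show ?thesis using 3[of i j] by (simp add: s_def)
    qed
    then show "A \<in> opq" using * by blast
  qed
qed

lemma opq_decomposition: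
  fixes A :: "('p::finite, 'q::finite) cmat"
  assumes "A \<in> opq"
  shows "A = (\<Sum>i\<in>UNIV. \<Sum>j\<in>UNIV. mscale (A $ Inl i $ Inl j / 2) (X_pp i j))
           + (\<Sum>i\<in>UNIV. \<Sum>j\<in>UNIV. mscale (A $ Inr i $ Inr j / 2) (X_qq i j))
           + (\<Sum>i\<in>UNIV. \<Sum>j\<in>UNIV. mscale (A $ Inl i $ Inr j) (X_pq i j))"
proof -
  have d: "(\<Sum>i\<in>UNIV. \<Sum>j\<in>UNIV. if P i \<and> Q j then f i j else 0) =
      (\<Sum>i\<in>UNIV. if P i then (\<Sum>j\<in>UNIV. if Q j then f i j else 0) else 0)"
    for P :: "'i::finite \<Rightarrow> bool" and Q :: "'j::finite \<Rightarrow> bool" and f :: "'i \<Rightarrow> 'j \<Rightarrow> complex"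
    by (intro sum.cong) auto
  have d': "(\<Sum>j\<in>UNIV. \<Sum>i\<in>UNIV. if P i \<and> Q j then f i j else 0) =
      (\<Sum>i\<in>UNIV. if P i then (\<Sum>j\<in>UNIV. if Q j then f i j else 0) else 0)"
    for P :: "'i::finite \<Rightarrow> bool" and Q :: "'j::finite \<Rightarrow> bool" and f :: "'i \<Rightarrow> 'j \<Rightarrow> complex"
    by (subst sum.swap) (rule d)
  have D: "c * (if P then 1 else 0) = (if P then c else 0)" for c :: complex and P by simp
  note r = mscale_def X_pp_def X_qq_def X_pq_def E_unit_def right_diff_distrib distrib_left
    sum_subtractf sum.distrib D d d'
  have sk: "A $ Inl i $ Inl j = - A $ Inl j $ Inl i" "A $ Inr i' $ Inr j' = - A $ Inr j' $ Inr i'"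
    "A $ Inr j' $ Inl i = A $ Inl i $ Inr j'" for i j i' j'
    using assms unfolding opq_iff by blast+
  show ?thesis
    unfolding vec_eq_iff split_sum_all
  proof (intro conjI allI, goal_cases)
    case (1 i j) then show ?case using sk(1)[of j i] by (simp add: r)
  next
    case (2 i j) then show ?case by (simp add: r)
  next
    case (3 i j) then show ?case using sk(3) by (simp add: r)
  next
    case (4 i j) then show ?case using sk(2)[of j i] by (simp add: r)
  qed
qed

lemma X_in_opq: "X_pp i j \<in> opq" "X_qq i' j' \<in> opq" "X_pq i j' \<in> opq"
  unfolding opq_iff X_pp_def X_qq_def X_pq_def E_unit_def
  by (intro conjI allI;
      simp only: vector_minus_component vector_add_component vec_lambda_beta minus_diff_eq
        sum.inject sum.distinct conj_commute simp_thms if_False diff_0_right add_0_right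
        minus_zero add.commute)+

lemma pi_op_X:
  "pi_op (X_pp i j) f = pi_pp i j f"
  "pi_op (X_qq i' j') f = pi_qq i' j' f"
  "pi_op (X_pq i j') f = pi_pq i j' f"
proof -
  have d: "(\<Sum>a\<in>UNIV. \<Sum>b\<in>UNIV. if a = x \<and> b = y then g a b else 0) = g x y"
    for x :: "'i::finite" and y :: "'j::finite" and g :: "'i \<Rightarrow> 'j \<Rightarrow> complex"
  proof -
    have "(\<Sum>a\<in>UNIV. \<Sum>b\<in>UNIV. if a = x \<and> b = y then g a b else 0) =
        (\<Sum>a\<in>UNIV. if a = x then (\<Sum>b\<in>UNIV. if b = y then g a b else 0) else 0)"
      by (intro sum.cong) auto
    then show ?thesis by simp
  qed
  have D: "(if P then 1 else 0) * c = (if P then c else 0)" for c :: complex and P by simp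
  have sk_pp: "(pi_pp i j f v - pi_pp j i f v) / 2 = pi_pp i j f v" for v
    by (simp add: pi_pp_def)
  have sk_qq: "(pi_qq i' j' f v - pi_qq j' i' f v) / 2 = pi_qq i' j' f v" for v
    by (simp add: pi_qq_def)
  note r = pi_op_def X_pp_def X_qq_def X_pq_def E_unit_def left_diff_distrib distrib_right
    sum_subtractf sum.distrib D d
  show "pi_op (X_pp i j) f = pi_pp i j f"
    by (rule ext) (simp add: r sk_pp)
  show "pi_op (X_qq i' j') f = pi_qq i' j' f"
    by (rule ext) (simp add: r sk_qq)
  show "pi_op (X_pq i j') f = pi_pq i j' f"
    by (rule ext) (simp add: r)
qed


subsection \<open>\<open>(\<gg>,K)\<close>-modules of functions\<close>

text \<open>The axioms are those of a \<open>(\<gg>,K)\<close>-module, for a space \<open>M\<close> of complex functions,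
  a \<open>\<gg>\<close>-action \<open>rep\<close> and a \<open>K\<close>-action \<open>act\<close>. Every vector lies in a finite-dimensional
  \<open>K\<close>-stable subspace; since the topology of such a subspace is that of pointwise
  convergence, continuity and differentiability of the action are stated pointwise.
  The last axiom says that the restriction of \<open>rep\<close> to the Lie algebra of \<open>K\<close> is the
  differential of \<open>act\<close>; elements of that Lie algebra are velocities at the identity
  of curves in \<open>K\<close>.\<close>

definition gK_stable ::
  "(('p::finite, 'q::finite) cmat \<Rightarrow> ('v \<Rightarrow> complex) \<Rightarrow> 'v \<Rightarrow> complex) \<Rightarrow>
   (('p, 'q) rmat2 \<Rightarrow> ('v \<Rightarrow> complex) \<Rightarrow> 'v \<Rightarrow> complex) \<Rightarrow> ('v \<Rightarrow> complex) set \<Rightarrow> bool" where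
  "gK_stable rep act M \<longleftrightarrow>
     cfun.subspace M \<and>
     (\<forall>A\<in>opq. \<forall>f\<in>M. rep A f \<in> M) \<and>
     (\<forall>k\<in>K_grp. \<forall>f\<in>M. act k f \<in> M)"

definition gK_module ::
  "(('p::finite, 'q::finite) cmat \<Rightarrow> ('v \<Rightarrow> complex) \<Rightarrow> 'v \<Rightarrow> complex) \<Rightarrow>
   (('p, 'q) rmat2 \<Rightarrow> ('v \<Rightarrow> complex) \<Rightarrow> 'v \<Rightarrow> complex) \<Rightarrow> ('v \<Rightarrow> complex) set \<Rightarrow> bool" where
  "gK_module rep act M \<longleftrightarrow>
     gK_stable rep act M \<and>
     \<comment> \<open>\<open>rep\<close> is a representation of the complex Lie algebra \<open>opq\<close>\<close>
     (\<forall>A\<in>opq. \<forall>f\<in>M. \<forall>g\<in>M. rep A (f + g) = rep A f + rep A g) \<and>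
     (\<forall>A\<in>opq. \<forall>c. \<forall>f\<in>M. rep A (cscale c f) = cscale c (rep A f)) \<and>
     (\<forall>A\<in>opq. \<forall>B\<in>opq. \<forall>f\<in>M. rep (A + B) f = rep A f + rep B f) \<and>
     (\<forall>A\<in>opq. \<forall>c. \<forall>f\<in>M. rep (mscale c A) f = cscale c (rep A f)) \<and>
     (\<forall>A\<in>opq. \<forall>B\<in>opq. \<forall>f\<in>M.
        rep (lie_bracket A B) f = rep A (rep B f) - rep B (rep A f)) \<and>
     \<comment> \<open>\<open>act\<close> is a locally finite continuous representation of \<open>K\<close>\<close>
     (\<forall>k\<in>K_grp. \<forall>f\<in>M. \<forall>g\<in>M. act k (f + g) = act k f + act k g) \<and>
     (\<forall>k\<in>K_grp. \<forall>c. \<forall>f\<in>M. act k (cscale c f) = cscale c (act k f)) \<and>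
     (\<forall>f\<in>M. act K_one f = f) \<and>
     (\<forall>k\<in>K_grp. \<forall>k'\<in>K_grp. \<forall>f\<in>M. act (K_mult k k') f = act k (act k' f)) \<and>
     (\<forall>f\<in>M. \<exists>W B. f \<in> W \<and> W \<subseteq> M \<and> cfun.subspace W \<and> finite B \<and> W \<subseteq> cfun.span B \<and>
        (\<forall>k\<in>K_grp. \<forall>g\<in>W. act k g \<in> W)) \<and>
     (\<forall>f\<in>M. \<forall>v. continuous_on K_grp (\<lambda>k. act k f v)) \<and>
     \<comment> \<open>compatibility of the two actions\<close>
     (\<forall>k\<in>K_grp. \<forall>A\<in>opq. \<forall>f\<in>M.
        act k (rep A f) = rep (blk k ** A ** blk (K_inv k)) (act k f)) \<and>
     (\<forall>\<gamma> X. (\<forall>t::real. \<gamma> t \<in> K_grp) \<and> \<gamma> 0 = K_one \<and> (\<gamma> has_vector_derivative X) (at 0) \<longrightarrow>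
        (\<forall>f\<in>M. \<forall>v. ((\<lambda>t. act (\<gamma> t) f v) has_vector_derivative rep (blk X) f v) (at 0)))"

definition irreducible_gK_module ::
  "(('p::finite, 'q::finite) cmat \<Rightarrow> ('v \<Rightarrow> complex) \<Rightarrow> 'v \<Rightarrow> complex) \<Rightarrow>
   (('p, 'q) rmat2 \<Rightarrow> ('v \<Rightarrow> complex) \<Rightarrow> 'v \<Rightarrow> complex) \<Rightarrow> ('v \<Rightarrow> complex) set \<Rightarrow> bool" where
  "irreducible_gK_module rep act M \<longleftrightarrow>
     gK_module rep act M \<and> M \<noteq> {0} \<and>
     (\<forall>N. N \<subseteq> M \<and> gK_stable rep act N \<longrightarrow> N = {0} \<or> N = M)"


subsection \<open>Harmonic polynomials, the space \<open>\<E>\<close>, and the modules \<open>M\<^sup>\<plusminus>(m)\<close>\<close>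

definition harmonic :: "nat \<Rightarrow> (real^'n::finite \<Rightarrow> complex) set" where
  "harmonic k = {h. polynomial_function h \<and>
     (\<forall>t x. h (t *\<^sub>R x) = complex_of_real t ^ k * h x) \<and>
     (\<forall>x. (\<Sum>i\<in>UNIV. dir_deriv (axis i 1) (dir_deriv (axis i 1) h) x) = 0)}"

definition Psi :: "complex \<Rightarrow> complex \<Rightarrow> complex" where
  "Psi \<alpha> u = (\<Sum>n. (-1) ^ n / (fact n * pochhammer \<alpha> n) * u ^ n)"

definition psi :: "complex \<Rightarrow> ('p::finite, 'q::finite) cfun" where
  "psi \<alpha> v = Psi \<alpha> (rho_x v * rho_y v)"

definition E_space :: "('p::finite, 'q::finite) cfun set" where
  "E_space = cfun.span
     {(\<lambda>v. h1 (fst v) * h2 (snd v) * rho_x v ^ a * rho_y v ^ b * psi \<alpha> v)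
      | h1 h2 k l a b \<alpha>. h1 \<in> harmonic k \<and> h2 \<in> harmonic l \<and> \<alpha> \<notin> \<int>\<^sub>\<le>\<^sub>0}"

definition M_plus :: "nat \<Rightarrow> ('p::finite, 'q::finite) cfun set" where
  "M_plus m = {0} \<union> {f \<in> E_space. H_op f = cscale (of_nat m) f \<and> Xplus f = 0 \<and>
     (\<forall>j\<in>{1..m}. (Xminus ^^ j) f \<noteq> 0) \<and> (Xminus ^^ (m + 1)) f = 0}"

definition M_minus :: "nat \<Rightarrow> ('p::finite, 'q::finite) cfun set" where
  "M_minus m = {0} \<union> {f \<in> E_space. H_op f = cscale (- of_nat m) f \<and> Xminus f = 0 \<and>
     (\<forall>j\<in>{1..m}. (Xplus ^^ j) f \<noteq> 0) \<and> (Xplus ^^ (m + 1)) f = 0}"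


subsection \<open>\<open>K\<close>-types\<close>

text \<open>The outer tensor product \<open>\<H>\<^sup>k(\<real>\<^sup>p) \<otimes> \<H>\<^sup>l(\<real>\<^sup>q)\<close> in its standard realization as a
  space of functions on \<open>\<real>\<^sup>p \<times> \<real>\<^sup>q\<close>, where \<open>h1 \<otimes> h2\<close> is \<open>(x, y) \<mapsto> h1 x * h2 y\<close> and
  \<open>O(p) \<times> O(q)\<close> acts by \<open>K_act\<close> (lemmas \<open>K_act_tensor\<close> and \<open>tensor_independent\<close>).\<close>

definition harmonic_tensor :: "nat \<Rightarrow> nat \<Rightarrow> ('p::finite, 'q::finite) cfun set" where
  "harmonic_tensor k l = cfun.span
     {(\<lambda>v. h1 (fst v) * h2 (snd v)) | h1 h2. h1 \<in> harmonic k \<and> h2 \<in> harmonic l}"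

lemma K_act_tensor:
  "K_act (a, d) (\<lambda>v. h1 (fst v) * h2 (snd v)) =
     (\<lambda>v. h1 (matrix_inv a *v fst v) * h2 (matrix_inv d *v snd v))"
  by (simp add: K_act_def fun_eq_iff)

lemma tensor_independent:
  fixes B :: "('a \<Rightarrow> complex) set" and g :: "('a \<Rightarrow> complex) \<Rightarrow> 'b \<Rightarrow> complex"
  assumes "cfun.independent B" "finite B"
    and "(\<Sum>b\<in>B. (\<lambda>v. b (fst v) * g b (snd v))) = 0" and "b \<in> B"
  shows "g b = 0"
proof (rule ext)
  fix y
  have "(\<Sum>b\<in>B. cscale (g b y) b) = 0"
  proof (rule ext)
    fix x
    have "(\<Sum>b\<in>B. (\<lambda>v. b (fst v) * g b (snd v))) (x, y) = 0"
      using assms(3) by simp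
    moreover have *: "sum F B z = (\<Sum>b\<in>B. F b z)" for F :: "('a \<Rightarrow> complex) \<Rightarrow> 'c \<Rightarrow> complex" and z
      by (induction B rule: infinite_finite_induct) auto
    ultimately show "(\<Sum>b\<in>B. cscale (g b y) b) x = 0 x"
      by (simp add: * cscale_def mult.commute)
  qed
  then show "g b y = 0 y"
    using assms cfun.independentD[of B B "\<lambda>b. g b y" b] by simp
qed

text \<open>The algebraic direct sum of a family of function spaces, as finitely supported families.\<close>

definition direct_sum :: "'i set \<Rightarrow> ('i \<Rightarrow> ('a \<Rightarrow> complex) set) \<Rightarrow> ('i \<Rightarrow> 'a \<Rightarrow> complex) set" where
  "direct_sum I W = {F. (\<forall>i\<in>I. F i \<in> W i) \<and> (\<forall>i. i \<notin> I \<longrightarrow> F i = 0) \<and> finite {i. F i \<noteq> 0}}"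

text \<open>\<open>M \<simeq> \<Oplus>\<^sub>i W i\<close> as \<open>K\<close>-modules.\<close>

definition K_iso_direct_sum ::
  "('p::finite, 'q::finite) cfun set \<Rightarrow> 'i set \<Rightarrow> ('i \<Rightarrow> ('p, 'q) cfun set) \<Rightarrow> bool" where
  "K_iso_direct_sum M I W \<longleftrightarrow>
     (\<exists>T. bij_betw T (direct_sum I W) M \<and>
        (\<forall>F\<in>direct_sum I W. \<forall>G\<in>direct_sum I W. T (F + G) = T F + T G) \<and>
        (\<forall>c. \<forall>F\<in>direct_sum I W. T (\<lambda>i. cscale c (F i)) = cscale c (T F)) \<and>
        (\<forall>k\<in>K_grp. \<forall>F\<in>direct_sum I W. T (\<lambda>i. K_act k (F i)) = K_act k (T F)))"

definition Lambda :: "nat \<Rightarrow> real set" where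
  "Lambda m = {- real m + 2 * real i | i. i \<le> m}"

text \<open>\<open>K_type_index p q m\<close> consists of the pairs \<open>(k, l)\<close> occurring in \<open>M\<^sup>\<plusminus>(m)\<close>.\<close>

definition K_type_index :: "nat \<Rightarrow> nat \<Rightarrow> nat \<Rightarrow> (nat \<times> nat) set" where
  "K_type_index p q m =
     {(k, l). real k - real l + (real p - real q) / 2 \<in> Lambda m}"

end

theory Submission
  imports Defs
begin

text \<open>The coordinates and the \<open>\<psi>\<^sub>\<alpha>\<close> generate an algebra closed under all operators
  involved. A combination of the two Casimir operators and the two parities has distinct eigenvalues
  on the \<open>K\<close>-types \<open>\<H>\<^sup>k \<otimes> \<H>\<^sup>l\<close>, so every stable subspace of \<open>\<E>\<close> is the sum of its isotypic
  parts. In the part of type \<open>(k, l)\<close> the equation \<open>X\<^sup>+ f = 0\<close> is a second-order ordinary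
  differential equation in \<open>\<rho>\<^sub>x \<rho>\<^sub>y\<close> with a single solution regular at \<open>0\<close>; hence a solution of weight
  \<open>m\<close> has the form \<open>F \<rho>\<^sub>y\<^sup>j \<psi>\<^sub>\<kappa>\<close> with \<open>F \<in> \<H>\<^sup>k \<otimes> \<H>\<^sup>l\<close>, \<open>\<kappa> = k + p/2\<close> and
  \<open>2 k + p + 2 m = 2 l + q + 4 j\<close>, and \<open>(X\<^sup>-)\<^sup>m\<^sup>+\<^sup>1 f = 0\<close> amounts to \<open>j \<le> m\<close>. By \<open>\<ss>\<ll>\<^sub>2\<close>-theory
  \<open>(X\<^sup>-)\<^sup>m\<close> is an isomorphism from \<open>M\<^sup>+(m)\<close> to \<open>M\<^sup>-(m)\<close>. For irreducibility, \<open>\<pi>(X\<^sup>-\<^sub>i\<^sub>j)\<close> maps a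
  \<open>K\<close>-type to its four neighbours, with coefficients that vanish only at the boundary of the band of
  occurring \<open>K\<close>-types; the \<open>K\<close>-types are irreducible and, as \<open>m + 3 \<le> (p + q) / 2\<close>, the band is
  connected.\<close>

subsection \<open>The entire functions \<open>\<Psi>\<^sub>\<alpha>\<close>\<close>

text \<open>The generators of \<E> are linearly dependent: \<open>Psi_contiguous\<close> relates the
  parameters \<alpha>, \<alpha> + 1, \<alpha> + 2, so an element of \<E> has no canonical
  coordinates. Instead, a vector of one K-type and one degree b - a is shown to have some
  description, at each point, by an entire series in u = rho_x rho_y; on a ray in x the values of u
  fill the positive half-line, which turns X^+ f = 0 into an identity of formal power series. The
  same relation is also an asset: it is the differential equation of \<Psi>_\<kappa> in disguise,
  and it collapses the radial factors of \<open>pi_pq\<close> to single ones with parameter \<kappa>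
  + 1 or \<kappa> - 1, those of the neighbouring K-types. The bound on m acts through the
  coefficient of the move (1, 1), which is (\<kappa> - d - 1) / \<kappa> with d the exponent of
  rho_y: 4 (\<kappa> - d - 1) = 2 k + 2 l + p + q - 2 m - 4. Statements about y come from those
  about x by exchanging the factors, which also turns lowest into highest weight vectors.\<close>

definition Psi_fps :: "complex \<Rightarrow> complex fps" where
  "Psi_fps \<alpha> = Abs_fps (\<lambda>n. (-1) ^ n / (fact n * pochhammer \<alpha> n))"

lemma Psi_eq_eval_fps: "Psi \<alpha> u = eval_fps (Psi_fps \<alpha>) u"
  by (simp add: Psi_def eval_fps_def Psi_fps_def)

lemma Psi_fps_nth_0 [simp]: "fps_nth (Psi_fps \<alpha>) 0 = 1"
  by (simp add: Psi_fps_def)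

lemma nonpos_Int_add_1: "\<alpha> \<notin> \<int>\<^sub>\<le>\<^sub>0 \<Longrightarrow> \<alpha> + 1 \<notin> \<int>\<^sub>\<le>\<^sub>0" for \<alpha> :: complex
  by (metis plus_one_in_nonpos_Ints_imp)

lemma Psi_fps_conv_radius:
  assumes "\<alpha> \<notin> \<int>\<^sub>\<le>\<^sub>0"
  shows "fps_conv_radius (Psi_fps \<alpha>) = \<infinity>"
proof -
  have nz: "pochhammer \<alpha> n \<noteq> 0" for n
    using assms by (auto simp: pochhammer_eq_0_iff)
  have "norm (fps_nth (Psi_fps \<alpha>) n) / norm (fps_nth (Psi_fps \<alpha>) (Suc n)) =
      norm ((\<alpha> + of_nat n) * of_nat (Suc n))" for n
    using nz[of n] nz[of "Suc n"]
    by (simp add: Psi_fps_def norm_divide norm_mult norm_power pochhammer_Suc fact_Suc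
        del: of_nat_Suc)
  moreover have "filterlim (\<lambda>n. norm ((\<alpha> + of_nat n) * of_nat (Suc n))) at_top sequentially"
  proof (rule filterlim_at_top_mono)
    show "filterlim (\<lambda>n. real n - norm \<alpha>) at_top sequentially"
      using filterlim_tendsto_add_at_top[OF tendsto_const[of "- norm \<alpha>"] filterlim_real_sequentially]
      by (simp add: add.commute)
    show "\<forall>\<^sub>F n in sequentially. real n - norm \<alpha> \<le> norm ((\<alpha> + of_nat n) * of_nat (Suc n))"
    proof (intro always_eventually allI)
      fix n
      have "real n - norm \<alpha> \<le> norm (\<alpha> + of_nat n)"
        using norm_triangle_ineq2[of "of_nat n" "- \<alpha>"] by (simp add: add.commute)
      also have "\<dots> \<le> norm (\<alpha> + of_nat n) * real (Suc n)"
        by (simp add: mult_le_cancel_left1)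
      finally show "real n - norm \<alpha> \<le> norm ((\<alpha> + of_nat n) * of_nat (Suc n))"
        by (simp add: norm_mult del: of_nat_Suc)
    qed
  qed
  ultimately have "(\<lambda>n. ereal (norm (fps_nth (Psi_fps \<alpha>) n) / norm (fps_nth (Psi_fps \<alpha>) (Suc n))))
      \<longlonglongrightarrow> \<infinity>"
    by (simp add: tendsto_PInfty_eq_at_top)
  then show ?thesis
    unfolding fps_conv_radius_def by (intro conv_radius_ratio_limit_ereal_nonzero) auto
qed

text \<open>Coefficientwise this is \<open>pochhammer_rec\<close>. With the convention 1 / 0 = 0 it
  is true at every \<alpha>, so \<open>ode_fps_generator\<close> can be stated for every \<alpha> as
  well.\<close>

lemma Psi_fps_deriv:
  "fps_deriv (Psi_fps \<alpha>) = fps_const (- 1 / \<alpha>) * Psi_fps (\<alpha> + 1)"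
proof (rule fps_ext)
  fix n
  have "fact (Suc n) = (of_nat (Suc n) * fact n :: complex)" "of_nat (Suc n) \<noteq> (0 :: complex)"
    by (simp_all del: of_nat_Suc)
  then show "fps_nth (fps_deriv (Psi_fps \<alpha>)) n = fps_nth (fps_const (- 1 / \<alpha>) * Psi_fps (\<alpha> + 1)) n"
    by (simp add: Psi_fps_def pochhammer_rec del: of_nat_Suc fact_Suc)
qed

text \<open>The three-term recurrence of Bessel functions: up to normalisation \<Psi>_\<alpha>(u) is
  u^((1-\<alpha>)/2) J_(\<alpha>-1)(2 sqrt u). In degree k + 1 it reduces to the two ways of
  splitting a Pochhammer symbol with k + 2 factors, recorded as \<open>2\<close> in the
  proof.\<close>

lemma Psi_fps_contiguous:
  assumes "\<alpha> \<notin> \<int>\<^sub>\<le>\<^sub>0"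
  shows "fps_const \<alpha> * Psi_fps \<alpha> =
    fps_const \<alpha> * Psi_fps (\<alpha> + 1) - fps_const (1 / (\<alpha> + 1)) * (fps_X * Psi_fps (\<alpha> + 2))"
proof (rule fps_ext)
  fix n
  have nz: "pochhammer \<alpha> n \<noteq> 0" for n
    using assms by (auto simp: pochhammer_eq_0_iff)
  show "fps_nth (fps_const \<alpha> * Psi_fps \<alpha>) n = fps_nth (fps_const \<alpha> * Psi_fps (\<alpha> + 1)
      - fps_const (1 / (\<alpha> + 1)) * (fps_X * Psi_fps (\<alpha> + 2))) n"
  proof (cases n)
    case (Suc k)
    define w where "w = pochhammer (\<alpha> + 2) k"
    have 1: "pochhammer (\<alpha> + 1) (Suc k) = (\<alpha> + 1) * w"
      by (simp add: pochhammer_rec w_def add.assoc)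
    have 2: "pochhammer \<alpha> (Suc k) * (\<alpha> + of_nat (Suc k)) = \<alpha> * (\<alpha> + 1) * w"
      using pochhammer_rec[of \<alpha> "Suc k"] by (simp add: 1 pochhammer_Suc[of \<alpha> "Suc k"] del: of_nat_Suc)
    have nz': "\<alpha> \<noteq> 0" "\<alpha> + 1 \<noteq> 0" "w \<noteq> 0" "\<alpha> + of_nat (Suc k) \<noteq> 0" "pochhammer \<alpha> (Suc k) \<noteq> 0"
      using nz[of "Suc (Suc k)"] nz[of "Suc k"] 2
      by (auto simp: pochhammer_Suc[of \<alpha> "Suc k"] simp del: of_nat_Suc)
    have p: "pochhammer \<alpha> (Suc k) = \<alpha> * (\<alpha> + 1) * w / (\<alpha> + of_nat (Suc k))"
      using 2 nz' by (simp add: field_simps del: of_nat_Suc)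
    obtain N F s where N: "N = (of_nat (Suc k) :: complex)" "F = (fact k :: complex)"
        "s = (- 1 :: complex) ^ k"
      by blast
    have f: "fact (Suc k) = N * F" "N \<noteq> 0" "F \<noteq> 0" "\<alpha> + N \<noteq> 0"
      using nz' by (simp_all add: N del: of_nat_Suc)
    have "\<alpha> * (- s / (N * F * (\<alpha> * (\<alpha> + 1) * w / (\<alpha> + N)))) =
        \<alpha> * (- s / (N * F * ((\<alpha> + 1) * w))) - 1 / (\<alpha> + 1) * (s / (F * w))"
      using f(2-) nz'(1-3) by (simp add: divide_simps) (simp add: algebra_simps)
    then show ?thesis
      unfolding Suc Psi_fps_def
      by (simp add: 1 p f(1) N[symmetric] w_def[symmetric] del: of_nat_Suc fact_Suc)
  qed (simp add: Psi_fps_def)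
qed

text \<open>Positive reals are the only nonzero values of rho_x rho_y, hence this form. After
  division by the leading power of the variable the constant coefficient is nonzero, yet it is a
  limit of zeros from the right.\<close>

lemma fps_eq_0_if_eval_pos:
  fixes g :: "complex fps"
  assumes rad: "fps_conv_radius g = \<infinity>"
    and zero: "\<And>u::real. u > 0 \<Longrightarrow> eval_fps g (of_real u) = 0"
  shows "g = 0"
proof (rule ccontr)
  assume "g \<noteq> 0"
  define h where "h = fps_shift (subdegree g) g"
  have h0: "fps_nth h 0 \<noteq> 0"
    using \<open>g \<noteq> 0\<close> by (simp add: h_def)
  have hrad: "fps_conv_radius h = \<infinity>"
    using rad by (simp add: h_def)
  have "eval_fps h (of_real u) = 0" if "u > 0" for u :: real
    using that zero[OF that] rad by (simp add: h_def eval_fps_shift)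
  moreover have "((\<lambda>u::real. eval_fps h (of_real u)) \<longlongrightarrow> eval_fps h (of_real 0)) (at_right 0)"
  proof -
    have "isCont (eval_fps h) (of_real 0)"
      using hrad by (intro continuous_eval_fps) auto
    moreover have "((\<lambda>u::real. of_real u :: complex) \<longlongrightarrow> of_real 0) (at_right 0)"
      by (intro tendsto_of_real tendsto_ident_at)
    ultimately show ?thesis
      by (rule isCont_tendsto_compose)
  qed
  ultimately have "((\<lambda>u::real. 0::complex) \<longlongrightarrow> eval_fps h (of_real 0)) (at_right 0)"
    by (rule_tac Lim_transform_eventually) (auto simp: eventually_at_right_less intro: eventually_mono[OF eventually_at_right_less])
  then have "eval_fps h 0 = 0"
    using tendsto_unique[OF _ _ tendsto_const] by (metis of_real_0 trivial_limit_at_right_real)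
  then show False
    using h0 by (simp add: eval_fps_at_0)
qed

text \<open>At u = 0 the equation u g'' + \<kappa> g' + g = 0 has the exponents 0 and 1 - \<kappa>.
  A power series solution obeys (n + 1) (\<kappa> + n) g_(n+1) = - g_n, and no factor \<kappa> + n
  vanishes, so the constant term determines it.\<close>

lemma Psi_fps_unique:
  fixes g :: "complex fps"
  assumes ode: "fps_X * fps_deriv (fps_deriv g) + fps_const \<kappa> * fps_deriv g + g = 0"
    and k: "\<kappa> \<notin> \<int>\<^sub>\<le>\<^sub>0"
  shows "g = fps_const (fps_nth g 0) * Psi_fps \<kappa>"
proof (rule fps_ext)
  fix n
  have rec: "of_nat (Suc n) * (\<kappa> + of_nat n) * fps_nth g (Suc n) = - fps_nth g n" for n
  proof -
    have "fps_nth (fps_X * fps_deriv (fps_deriv g) + fps_const \<kappa> * fps_deriv g + g) n = 0"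
      by (simp add: ode)
    then show ?thesis
      by (cases n) (simp_all add: algebra_simps eq_neg_iff_add_eq_0)
  qed
  have nz: "pochhammer \<kappa> n \<noteq> 0" for n
    using k by (auto simp: pochhammer_eq_0_iff)
  show "fps_nth g n = fps_nth (fps_const (fps_nth g 0) * Psi_fps \<kappa>) n"
  proof (induction n)
    case (Suc n)
    have nz': "\<kappa> + of_nat n \<noteq> 0" "of_nat (Suc n) \<noteq> (0::complex)"
      using nz[of "Suc n"] by (auto simp: pochhammer_Suc simp del: of_nat_Suc)
    have "fps_nth g (Suc n) = - fps_nth g n / (of_nat (Suc n) * (\<kappa> + of_nat n))"
      using rec[of n] nz' by (intro eq_divide_imp) (simp_all only: mult.commute mult_eq_0_iff simp_thms)
    also have "\<dots> = fps_nth (fps_const (fps_nth g 0) * Psi_fps \<kappa>) (Suc n)"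
      using nz' unfolding Suc
      by (simp add: Psi_fps_def pochhammer_Suc fact_Suc del: of_nat_Suc)
    finally show ?case .
  qed simp
qed

lemma Psi_has_field_derivative:
  assumes "\<alpha> \<notin> \<int>\<^sub>\<le>\<^sub>0"
  shows "(Psi \<alpha> has_field_derivative - (1 / \<alpha>) * Psi (\<alpha> + 1) u) (at u)"
proof -
  have "(eval_fps (Psi_fps \<alpha>) has_field_derivative eval_fps (fps_deriv (Psi_fps \<alpha>)) u) (at u)"
    using assms by (intro has_field_derivative_eval_fps) (simp add: Psi_fps_conv_radius)
  then show ?thesis
    using Psi_fps_conv_radius[OF nonpos_Int_add_1[OF assms]]
    by (simp add: Psi_fps_deriv eval_fps_mult Psi_eq_eval_fps[abs_def])
qed

lemma Psi_contiguous:
  assumes "\<alpha> \<notin> \<int>\<^sub>\<le>\<^sub>0"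
  shows "\<alpha> * Psi \<alpha> u = \<alpha> * Psi (\<alpha> + 1) u - 1 / (\<alpha> + 1) * (u * Psi (\<alpha> + 2) u)"
proof -
  have r: "fps_conv_radius (Psi_fps \<alpha>) = \<infinity>" "fps_conv_radius (Psi_fps (\<alpha> + 1)) = \<infinity>"
    "fps_conv_radius (Psi_fps (\<alpha> + 2)) = \<infinity>"
    using assms nonpos_Int_add_1[of \<alpha>] nonpos_Int_add_1[of "\<alpha> + 1"]
    by (simp_all add: Psi_fps_conv_radius add.assoc)
  have m: "fps_conv_radius (fps_const c * f) = \<infinity>" "fps_conv_radius (fps_X * f) = \<infinity>"
    if "fps_conv_radius f = \<infinity>" for c and f :: "complex fps"
    using fps_conv_radius_mult[of "fps_const c" f] fps_conv_radius_mult[of fps_X f] that by auto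
  show ?thesis
    using arg_cong[OF Psi_fps_contiguous[OF assms], of "\<lambda>f. eval_fps f u"] r
    by (simp add: Psi_eq_eval_fps eval_fps_diff eval_fps_mult m)
qed

subsection \<open>Derivations of the algebra generated by coordinates and the \<open>\<psi>\<^sub>\<alpha>\<close>\<close>

text \<open>Constants are kept as elements \<open>cc c\<close> of the commutative ring of functions,
  so that operator identities can be left to ring normalisation.\<close>

definition cc :: "complex \<Rightarrow> 'a \<Rightarrow> complex" where
  "cc c = (\<lambda>_. c)"

lemma cc_apply: "cc c v = c"
  by (simp add: cc_def)

lemma cscale_conv: "cscale c f = cc c * f"
  by (simp add: cscale_def cc_def times_fun_def)

lemma cscale_apply: "cscale c f v = c * f v"
  by (simp add: cscale_def)

lemma sum_fun_apply: "sum F B v = (\<Sum>b\<in>B. F b v)"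
  for F :: "'i \<Rightarrow> 'a \<Rightarrow> complex"
  by (induction B rule: infinite_finite_induct) auto

text \<open>The induction methods eta-expand function-valued terms; evaluation at points as a
  default simplification rule would then destroy the ring structure of the goals.\<close>

declare plus_fun_apply [simp del] times_fun_apply [simp del] zero_fun_apply [simp del]
  one_fun_apply [simp del]

lemma minus_fun_apply': "(- f) v = - f v" "(f - g) v = f v - g v" "(f ^ n) v = f v ^ n"
  for f :: "'a \<Rightarrow> complex"
  by (simp_all, induction n) (simp_all add: one_fun_apply times_fun_apply)

lemmas pw = plus_fun_apply times_fun_apply zero_fun_apply one_fun_apply minus_fun_apply'
  cc_apply cscale_apply sum_fun_apply

lemma cc_hom: "cc 0 = 0" "cc 1 = 1" "cc (a + b) = cc a + cc b" "cc (a - b) = cc a - cc b"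
  "cc (a * b) = cc a * cc b" "cc (- a) = - cc a"
  by (auto simp: fun_eq_iff pw)

lemma dir_deriv_eq:
  assumes "(f has_derivative f') (at v)"
  shows "dir_deriv u f v = f' u"
proof -
  have "((\<lambda>t::real. v + t *\<^sub>R u) has_derivative (\<lambda>t. t *\<^sub>R u)) (at 0)"
    by (auto intro!: derivative_eq_intros)
  moreover have "(f has_derivative f') (at (v + 0 *\<^sub>R u))"
    using assms by simp
  ultimately have "((\<lambda>t. f (v + t *\<^sub>R u)) has_derivative (\<lambda>t. f' (t *\<^sub>R u))) (at (0::real))"
    by (rule has_derivative_compose)
  moreover have "f' (t *\<^sub>R u) = t *\<^sub>R f' u" for t
    using assms by (meson has_derivative_linear linear_cmul)
  ultimately show ?thesis
    unfolding dir_deriv_def by (intro vector_derivative_at) (simp add: has_vector_derivative_def)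
qed

lemma dir_deriv_const [simp]: "dir_deriv u (cc c) = 0"
  unfolding cc_def by (rule ext) (simp add: dir_deriv_eq[OF has_derivative_const] pw)

definition diffble :: "('v::real_normed_vector \<Rightarrow> complex) \<Rightarrow> bool" where
  "diffble f \<longleftrightarrow> (\<forall>v. f differentiable at v)"

lemma diffbleD: "diffble f \<Longrightarrow> (f has_derivative frechet_derivative f (at v)) (at v)"
  by (simp add: diffble_def frechet_derivative_works)

lemma diffbleI: "(\<And>v. (f has_derivative f' v) (at v)) \<Longrightarrow> diffble f"
  unfolding diffble_def differentiable_def by blast

lemma diffble_cc [simp]: "diffble (cc c)"
  by (simp add: diffble_def cc_def)

lemma diffble_add [simp]: "diffble f \<Longrightarrow> diffble g \<Longrightarrow> diffble (f + g)"
  by (simp add: diffble_def plus_fun_def differentiable_add)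

lemma diffble_mult [simp]: "diffble f \<Longrightarrow> diffble g \<Longrightarrow> diffble (f * g)"
  by (simp add: diffble_def times_fun_def differentiable_mult)

lemma dir_deriv_add:
  assumes "diffble f" "diffble g"
  shows "dir_deriv u (f + g) = dir_deriv u f + dir_deriv u g"
proof (rule ext)
  fix v
  show "dir_deriv u (f + g) v = (dir_deriv u f + dir_deriv u g) v"
    using dir_deriv_eq[OF has_derivative_add[OF assms[THEN diffbleD[of _ v]]]]
    by (simp add: pw plus_fun_def dir_deriv_eq[OF diffbleD[OF assms(1)]]
        dir_deriv_eq[OF diffbleD[OF assms(2)]])
qed

lemma dir_deriv_mult:
  assumes "diffble f" "diffble g"
  shows "dir_deriv u (f * g) = dir_deriv u f * g + f * dir_deriv u g"
proof (rule ext)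
  fix v
  show "dir_deriv u (f * g) v = (dir_deriv u f * g + f * dir_deriv u g) v"
    using dir_deriv_eq[OF has_derivative_mult[OF assms[THEN diffbleD[of _ v]]]]
    by (simp add: pw times_fun_def dir_deriv_eq[OF diffbleD[OF assms(1)]]
        dir_deriv_eq[OF diffbleD[OF assms(2)]] add.commute)
qed

lemma dir_deriv_fst:
  "dir_deriv (u, w) (\<lambda>v. h (fst v)) = (\<lambda>v. dir_deriv u h (fst v))"
  by (simp add: dir_deriv_def fun_eq_iff)

lemma dir_deriv_snd:
  "dir_deriv (u, w) (\<lambda>v. h (snd v)) = (\<lambda>v. dir_deriv w h (snd v))"
  by (simp add: dir_deriv_def fun_eq_iff)

lemma dir_deriv_0 [simp]: "dir_deriv 0 f = 0"
  by (simp add: dir_deriv_def fun_eq_iff pw)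

text \<open>Sum and product rules for \<open>dir_deriv\<close> presuppose differentiability, which
  holds throughout this algebra. The derivatives of \<psi>_\<alpha> are multiples of
  \<psi>_(\<alpha>+1), so differentiation does not lead out of it, and identities between
  derivations can be checked on the generators by induction.\<close>

inductive_set alg :: "('p::finite, 'q::finite) cfun set" where
  const: "cc c \<in> alg"
| xc: "xc i \<in> alg"
| yc: "yc j \<in> alg"
| psi: "\<alpha> \<notin> \<int>\<^sub>\<le>\<^sub>0 \<Longrightarrow> psi \<alpha> \<in> alg"
| add: "f \<in> alg \<Longrightarrow> g \<in> alg \<Longrightarrow> f + g \<in> alg"
| mult: "f \<in> alg \<Longrightarrow> g \<in> alg \<Longrightarrow> f * g \<in> alg"

declare alg.intros [simp, intro]

lemma alg_0 [simp, intro]: "0 \<in> alg" and alg_1 [simp, intro]: "1 \<in> alg"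
  using alg.const[of 0] alg.const[of 1] by (simp_all add: cc_hom)

lemma alg_minus [simp, intro]: "f \<in> alg \<Longrightarrow> - f \<in> alg"
  using alg.mult[OF alg.const[of "-1"], of f] by (simp add: cc_hom)

lemma alg_diff [simp, intro]: "f \<in> alg \<Longrightarrow> g \<in> alg \<Longrightarrow> f - g \<in> alg"
  using alg.add[OF _ alg_minus[of g], of f] by simp

lemma alg_power [simp, intro]: "f \<in> alg \<Longrightarrow> f ^ n \<in> alg"
  by (induction n) auto

lemma alg_cscale [simp, intro]: "f \<in> alg \<Longrightarrow> cscale c f \<in> alg"
  by (simp add: cscale_conv)

lemma alg_sum [simp, intro]: "(\<And>i. i \<in> I \<Longrightarrow> F i \<in> alg) \<Longrightarrow> sum F I \<in> alg"
  by (induction I rule: infinite_finite_induct) auto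

lemma alg_subspace: "cfun.subspace alg"
  by (simp add: cfun.subspace_def)

lemma xc_has_derivative: "(xc i has_derivative xc i) F"
  and yc_has_derivative: "(yc j has_derivative yc j) F"
  unfolding xc_def[abs_def] yc_def[abs_def]
  by (intro bounded_linear_imp_has_derivative bounded_linear_compose[OF bounded_linear_of_real]
       bounded_linear_compose[OF bounded_linear_vec_nth] bounded_linear_fst bounded_linear_snd)+

lemma diffble_xc [simp]: "diffble (xc i)" and diffble_yc [simp]: "diffble (yc j)"
  by (rule diffbleI[OF xc_has_derivative] diffbleI[OF yc_has_derivative])+

lemma rho_x_conv: "rho_x = cc (1/2) * (\<Sum>i\<in>UNIV. xc i * xc i)"
  and rho_y_conv: "rho_y = cc (1/2) * (\<Sum>i\<in>UNIV. yc i * yc i)"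
  and rx2_conv: "rx2 = (\<Sum>i\<in>UNIV. xc i * xc i)"
  and ry2_conv: "ry2 = (\<Sum>i\<in>UNIV. yc i * yc i)"
  by (auto simp: fun_eq_iff rho_x_def rho_y_def rx2_def ry2_def power2_eq_square pw)

lemma rx2_rho: "rx2 = cc 2 * rho_x" and ry2_rho: "ry2 = cc 2 * rho_y"
  by (auto simp: fun_eq_iff rho_x_def rho_y_def pw)

lemma alg_rho [simp, intro]: "rho_x \<in> alg" "rho_y \<in> alg" "rx2 \<in> alg" "ry2 \<in> alg"
  by (auto simp: rho_x_conv rho_y_conv rx2_conv ry2_conv)

lemma diffble_sum [simp]: "(\<And>i. i \<in> I \<Longrightarrow> diffble (F i)) \<Longrightarrow> diffble (sum F I)"
proof (induction I rule: infinite_finite_induct)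
  case (infinite A)
  then show ?case using diffble_cc[of 0] by (simp add: cc_hom)
next
  case empty
  then show ?case using diffble_cc[of 0] by (simp add: cc_hom)
qed auto

lemma diffble_rho [simp]: "diffble rho_x" "diffble rho_y"
  by (simp_all add: rho_x_conv rho_y_conv)

lemma psi_has_derivative:
  assumes "\<alpha> \<notin> \<int>\<^sub>\<le>\<^sub>0"
  shows "(psi \<alpha> has_derivative
    (\<lambda>u. - (1 / \<alpha>) * psi (\<alpha> + 1) v * frechet_derivative (rho_x * rho_y) (at v) u)) (at v)"
proof -
  have "((rho_x * rho_y) has_derivative frechet_derivative (rho_x * rho_y) (at v)) (at v)"
    by (rule diffbleD) simp
  moreover have "(Psi \<alpha> has_derivative (*) (- (1 / \<alpha>) * Psi (\<alpha> + 1) ((rho_x * rho_y) v)))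
      (at ((rho_x * rho_y) v))"
    using Psi_has_field_derivative[OF assms] by (simp add: has_field_derivative_def)
  ultimately have "((\<lambda>v. Psi \<alpha> ((rho_x * rho_y) v)) has_derivative
    (\<lambda>u. - (1 / \<alpha>) * Psi (\<alpha> + 1) ((rho_x * rho_y) v) * frechet_derivative (rho_x * rho_y) (at v) u)) (at v)"
    by (rule has_derivative_compose)
  then show ?thesis
    by (simp add: psi_def[abs_def] pw)
qed

lemma diffble_psi [simp]: "\<alpha> \<notin> \<int>\<^sub>\<le>\<^sub>0 \<Longrightarrow> diffble (psi \<alpha>)"
  using psi_has_derivative by (rule diffbleI)

lemma alg_diffble [simp]: "f \<in> alg \<Longrightarrow> diffble f"
  by (induction rule: alg.induct) auto

lemma dir_deriv_psi:
  assumes "\<alpha> \<notin> \<int>\<^sub>\<le>\<^sub>0"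
  shows "dir_deriv u (psi \<alpha>) =
    cc (- (1 / \<alpha>)) * (dir_deriv u rho_x * rho_y + rho_x * dir_deriv u rho_y) * psi (\<alpha> + 1)"
proof -
  have "dir_deriv u (psi \<alpha>) = cc (- (1 / \<alpha>)) * dir_deriv u (rho_x * rho_y) * psi (\<alpha> + 1)"
  proof (rule ext)
    fix v
    have "diffble (rho_x * rho_y)" by simp
    then show "dir_deriv u (psi \<alpha>) v =
        (cc (- (1 / \<alpha>)) * dir_deriv u (rho_x * rho_y) * psi (\<alpha> + 1)) v"
      by (simp add: dir_deriv_eq[OF psi_has_derivative[OF assms]] dir_deriv_eq[OF diffbleD] pw)
  qed
  then show ?thesis
    by (simp add: dir_deriv_mult)
qed

lemma dx_add: "f \<in> alg \<Longrightarrow> g \<in> alg \<Longrightarrow> dx i (f + g) = dx i f + dx i g"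
  and dy_add: "f \<in> alg \<Longrightarrow> g \<in> alg \<Longrightarrow> dy j (f + g) = dy j f + dy j g"
  and dx_mult: "f \<in> alg \<Longrightarrow> g \<in> alg \<Longrightarrow> dx i (f * g) = dx i f * g + f * dx i g"
  and dy_mult: "f \<in> alg \<Longrightarrow> g \<in> alg \<Longrightarrow> dy j (f * g) = dy j f * g + f * dy j g"
  by (simp_all add: dx_def dy_def dir_deriv_add dir_deriv_mult)

lemma dx_cc [simp]: "dx i (cc c) = 0" and dy_cc [simp]: "dy j (cc c) = 0"
  by (simp_all add: dx_def dy_def)

lemma dx_0 [simp]: "dx i 0 = 0" and dy_0 [simp]: "dy j 0 = 0"
  and dx_1 [simp]: "dx i 1 = 0" and dy_1 [simp]: "dy j 1 = 0"
  using dx_cc[of i 0] dy_cc[of j 0] dx_cc[of i 1] dy_cc[of j 1] by (simp_all only: cc_hom)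

lemma dx_cc_mult: "f \<in> alg \<Longrightarrow> dx i (cc c * f) = cc c * dx i f"
  and dy_cc_mult: "f \<in> alg \<Longrightarrow> dy j (cc c * f) = cc c * dy j f"
  by (simp_all add: dx_mult dy_mult)

lemma dx_minus: "f \<in> alg \<Longrightarrow> dx i (- f) = - dx i f"
  and dy_minus: "f \<in> alg \<Longrightarrow> dy j (- f) = - dy j f"
  using dx_cc_mult[of f i "-1"] dy_cc_mult[of f j "-1"] by (simp_all add: cc_hom)

lemma dx_diff: "f \<in> alg \<Longrightarrow> g \<in> alg \<Longrightarrow> dx i (f - g) = dx i f - dx i g"
  and dy_diff: "f \<in> alg \<Longrightarrow> g \<in> alg \<Longrightarrow> dy j (f - g) = dy j f - dy j g"
  using dx_add[of f "- g" i] dy_add[of f "- g" j] by (simp_all add: dx_minus dy_minus)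

lemma dx_sum: "(\<And>a. a \<in> I \<Longrightarrow> F a \<in> alg) \<Longrightarrow> dx i (sum F I) = (\<Sum>a\<in>I. dx i (F a))"
  and dy_sum: "(\<And>a. a \<in> I \<Longrightarrow> F a \<in> alg) \<Longrightarrow> dy j (sum F I) = (\<Sum>a\<in>I. dy j (F a))"
  by (induction I rule: infinite_finite_induct) (simp_all add: dx_add dy_add)

lemma dx_xc: "dx i (xc j) = (if i = j then 1 else 0)"
  and dx_yc [simp]: "dx i (yc j') = 0"
  and dy_yc: "dy i' (yc j') = (if i' = j' then 1 else 0)"
  and dy_xc [simp]: "dy i' (xc j) = 0"
  by (auto simp: dx_def dy_def fun_eq_iff dir_deriv_eq[OF xc_has_derivative]
      dir_deriv_eq[OF yc_has_derivative] xc_def yc_def axis_def pw)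

lemma sum_delta_fun: 
  "(\<Sum>a\<in>UNIV. (if i = a then 1 else 0) * F a) = (F i :: 'v \<Rightarrow> complex)"
  "(\<Sum>a\<in>UNIV. (if a = i then 1 else 0) * F a) = F i"
  "(\<Sum>a\<in>UNIV. F a * (if i = a then 1 else 0)) = F i"
  "(\<Sum>a\<in>UNIV. F a * (if a = i then 1 else 0)) = F i"
  for i :: "'i::finite"
proof -
  have "(if P then 1 else 0) * f = (if P then f else 0)" "f * (if P then 1 else 0) = (if P then f else 0)"
    for P and f :: "'v \<Rightarrow> complex" by (auto simp: fun_eq_iff pw)
  then show "(\<Sum>a\<in>UNIV. (if i = a then 1 else 0) * F a) = F i"
    "(\<Sum>a\<in>UNIV. (if a = i then 1 else 0) * F a) = F i"
    "(\<Sum>a\<in>UNIV. F a * (if i = a then 1 else 0)) = F i"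
    "(\<Sum>a\<in>UNIV. F a * (if a = i then 1 else 0)) = F i"
    by simp_all
qed

lemma dx_rx2 [simp]: "dx i rx2 = cc 2 * xc i" and dy_ry2 [simp]: "dy j ry2 = cc 2 * yc j"
  and dx_ry2 [simp]: "dx i ry2 = 0" and dy_rx2 [simp]: "dy j rx2 = 0"
proof -
  have 2: "cc 2 * f = 2 * f" for f :: "'v \<Rightarrow> complex"
    by (auto simp: fun_eq_iff pw)
  show "dx i rx2 = cc 2 * xc i" "dy j ry2 = cc 2 * yc j" "dx i ry2 = 0" "dy j rx2 = 0"
    by (simp_all add: rx2_conv ry2_conv dx_sum dy_sum dx_mult dy_mult dx_xc dy_yc
        sum_distrib_left[symmetric] sum_delta_fun 2)
qed

lemma rho_x_rx2: "rho_x = cc (1/2) * rx2" and rho_y_ry2: "rho_y = cc (1/2) * ry2"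
  by (auto simp: fun_eq_iff rho_x_def rho_y_def pw)

lemma dx_rho_x [simp]: "dx i rho_x = xc i" and dy_rho_y [simp]: "dy j rho_y = yc j"
  and dx_rho_y [simp]: "dx i rho_y = 0" and dy_rho_x [simp]: "dy j rho_x = 0"
  by (simp_all add: rho_x_rx2 rho_y_ry2 dx_cc_mult dy_cc_mult) (auto simp: fun_eq_iff pw)

lemma dx_psi: "\<alpha> \<notin> \<int>\<^sub>\<le>\<^sub>0 \<Longrightarrow> dx i (psi \<alpha>) = cc (- (1 / \<alpha>)) * (xc i * rho_y) * psi (\<alpha> + 1)"
  and dy_psi: "\<alpha> \<notin> \<int>\<^sub>\<le>\<^sub>0 \<Longrightarrow> dy j (psi \<alpha>) = cc (- (1 / \<alpha>)) * (yc j * rho_x) * psi (\<alpha> + 1)"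
  using dir_deriv_psi[of \<alpha> "(axis i 1, 0)"] dir_deriv_psi[of \<alpha> "(0, axis j 1)"]
  by (simp_all add: dx_def[symmetric] dy_def[symmetric] mult_ac)

lemma alg_dx [simp, intro]: "f \<in> alg \<Longrightarrow> dx i f \<in> alg"
  by (induction rule: alg.induct) (simp_all add: dx_xc dx_psi nonpos_Int_add_1 dx_add dx_mult)

lemma alg_dy [simp, intro]: "f \<in> alg \<Longrightarrow> dy i f \<in> alg"
  by (induction rule: alg.induct) (simp_all add: dy_yc dy_psi nonpos_Int_add_1 dy_add dy_mult)

text \<open>The commutator of two derivations is a derivation, so it vanishes on the algebra once it
  vanishes on the generators.\<close>

lemma dx_dx: "f \<in> alg \<Longrightarrow> dx i (dx j f) = dx j (dx i f)"
proof (induction rule: alg.induct)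
  case (psi \<alpha>)
  then show ?case
    by (simp add: dx_psi nonpos_Int_add_1 dx_mult dx_xc)
qed (simp_all add: dx_xc dx_add dx_mult algebra_simps)

lemma dy_dx: "f \<in> alg \<Longrightarrow> dy i (dx j f) = dx j (dy i f)"
proof (induction rule: alg.induct)
  case (psi \<alpha>)
  then show ?case
    by (simp add: dx_psi dy_psi nonpos_Int_add_1 dx_mult dy_mult dx_xc dy_yc)
qed (simp_all add: dx_xc dx_add dx_mult dy_yc dy_add dy_mult algebra_simps)

section \<open>Exchange of the variables x and y\<close>

definition swp :: "('p::finite, 'q::finite) cfun \<Rightarrow> ('q, 'p) cfun" where
  "swp f v = f (snd v, fst v)"

lemma swp_swp [simp]: "swp (swp f) = f"
  by (auto simp: swp_def fun_eq_iff)

lemma swp_simps [simp]: "swp (f + g) = swp f + swp g" "swp (f * g) = swp f * swp g"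
  "swp (f - g) = swp f - swp g" "swp (- f) = - swp f"
  "swp 0 = 0" "swp 1 = 1" "swp (cc c) = cc c" "swp (f ^ n) = swp f ^ n"
  "swp (cscale c f) = cscale c (swp f)"
  "swp (xc i) = yc i" "swp (yc j) = xc j" "swp rx2 = ry2" "swp ry2 = rx2"
  "swp rho_x = rho_y" "swp rho_y = rho_x" "swp (psi \<alpha>) = psi \<alpha>"
proof -
  show "swp (f ^ n) = swp f ^ n"
    by (auto simp: swp_def fun_eq_iff pw)
qed (auto simp: pw swp_def fun_eq_iff xc_def yc_def rx2_def ry2_def rho_x_def rho_y_def psi_def mult.commute)

lemma swp_sum: "swp (sum F I) = (\<Sum>i\<in>I. swp (F i))"
  by (induction I rule: infinite_finite_induct) auto

lemma swp_inj: "swp f = swp g \<longleftrightarrow> f = g"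
  by (metis swp_swp)

lemma swp_eq_0 [simp]: "swp f = 0 \<longleftrightarrow> f = 0"
  by (metis swp_swp swp_simps(5))

lemma swp_alg [simp, intro]: "f \<in> alg \<Longrightarrow> swp f \<in> alg"
  by (induction rule: alg.induct) auto

lemma dx_swp: "dx i (swp f) = swp (dy i f)" and dy_swp: "dy j (swp f) = swp (dx j f)"
  by (auto simp: dx_def dy_def dir_deriv_def swp_def fun_eq_iff)

lemma dy_dy: "f \<in> alg \<Longrightarrow> dy i (dy j f) = dy j (dy i f)"
  using dx_dx[of "swp f" i j] by (simp add: dx_swp swp_inj)

lemma Euler_x_conv: "Euler_x f = (\<Sum>i\<in>UNIV. xc i * dx i f)"
  and Euler_y_conv: "Euler_y f = (\<Sum>i\<in>UNIV. yc i * dy i f)"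
  and Lap_x_conv: "Lap_x f = (\<Sum>i\<in>UNIV. dx i (dx i f))"
  and Lap_y_conv: "Lap_y f = (\<Sum>i\<in>UNIV. dy i (dy i f))"
  by (auto simp: pw fun_eq_iff Euler_x_def Euler_y_def Lap_x_def Lap_y_def)

lemma H_op_conv: "H_op f = - Euler_x f - cc (of_nat CARD('p) / 2) * f
    + Euler_y f + cc (of_nat CARD('q) / 2) * f"
  for f :: "('p::finite, 'q::finite) cfun"
  by (auto simp: pw fun_eq_iff H_op_def)

lemma Xplus_conv: "Xplus f = cc (- (1/2)) * (Lap_x f + ry2 * f)"
  and Xminus_conv: "Xminus f = cc (1/2) * (rx2 * f + Lap_y f)"
  by (auto simp: pw fun_eq_iff Xplus_def Xminus_def)

lemma pi_pp_conv: "pi_pp i j f = xc i * dx j f - xc j * dx i f"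
  and pi_qq_conv: "pi_qq i' j' f = yc i' * dy j' f - yc j' * dy i' f"
  and pi_pq_conv: "pi_pq i j' f = cc \<i> * (xc i * yc j' * f + dx i (dy j' f))"
  by (auto simp: pw fun_eq_iff pi_pp_def pi_qq_def pi_pq_def)

lemma alg_ops [simp, intro]:
  assumes "f \<in> alg"
  shows "Euler_x f \<in> alg" "Euler_y f \<in> alg" "Lap_x f \<in> alg" "Lap_y f \<in> alg"
    "H_op f \<in> alg" "Xplus f \<in> alg" "Xminus f \<in> alg"
    "pi_pp i j f \<in> alg" "pi_qq i' j' f \<in> alg" "pi_pq i j' f \<in> alg"
proof -
  show 1: "Euler_x f \<in> alg" "Euler_y f \<in> alg" "Lap_x f \<in> alg" "Lap_y f \<in> alg"
    using assms by (auto simp: Euler_x_conv Euler_y_conv Lap_x_conv Lap_y_conv)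
  show "H_op f \<in> alg" "Xplus f \<in> alg" "Xminus f \<in> alg"
    "pi_pp i j f \<in> alg" "pi_qq i' j' f \<in> alg" "pi_pq i j' f \<in> alg"
    using assms 1 by (auto simp: H_op_conv Xplus_conv Xminus_conv pi_pp_conv pi_qq_conv pi_pq_conv)
qed

text \<open>The exchange sends (H, X^+, X^-) to (-H, -X^-, -X^+). Hence lowest weight vectors for
  (p, q) become highest weight vectors for (q, p).\<close>

lemma swp_ops: 
  "Euler_x (swp f) = swp (Euler_y f)" "Euler_y (swp f) = swp (Euler_x f)"
  "Lap_x (swp f) = swp (Lap_y f)" "Lap_y (swp f) = swp (Lap_x f)"
  "H_op (swp f) = - swp (H_op f)" "Xplus (swp f) = - swp (Xminus f)" "Xminus (swp f) = - swp (Xplus f)"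
  "pi_pp i' j' (swp f) = swp (pi_qq i' j' f)" "pi_qq i j (swp f) = swp (pi_pp i j f)"
  for f :: "('p::finite, 'q::finite) cfun"
proof -
  show *: "Euler_x (swp f) = swp (Euler_y f)" "Euler_y (swp f) = swp (Euler_x f)"
    "Lap_x (swp f) = swp (Lap_y f)" "Lap_y (swp f) = swp (Lap_x f)"
    by (simp_all add: Euler_x_conv Euler_y_conv Lap_x_conv Lap_y_conv swp_sum dx_swp dy_swp)
  show "H_op (swp f) = - swp (H_op f)" "Xplus (swp f) = - swp (Xminus f)" "Xminus (swp f) = - swp (Xplus f)"
    by (simp_all add: H_op_conv Xplus_conv Xminus_conv * algebra_simps cc_hom)
  show "pi_pp i' j' (swp f) = swp (pi_qq i' j' f)" "pi_qq i j (swp f) = swp (pi_pp i j f)"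
    by (simp_all add: pi_pp_conv pi_qq_conv dx_swp dy_swp)
qed

subsection \<open>Linear operators and the \<open>\<ss>\<ll>\<^sub>2\<close> relations\<close>

text \<open>Linearity is demanded on \<open>alg\<close> only, where differentiation is linear; the
  closure condition makes such operators composable.\<close>

definition alg_linear :: "(('p::finite, 'q::finite) cfun \<Rightarrow> ('p, 'q) cfun) \<Rightarrow> bool" where
  "alg_linear A \<longleftrightarrow> (\<forall>f\<in>alg. A f \<in> alg) \<and> (\<forall>f\<in>alg. \<forall>g\<in>alg. A (f + g) = A f + A g) \<and>
     (\<forall>c. \<forall>f\<in>alg. A (cscale c f) = cscale c (A f))"

lemma alg_linearD:
  assumes "alg_linear A"
  shows "f \<in> alg \<Longrightarrow> A f \<in> alg" "f \<in> alg \<Longrightarrow> g \<in> alg \<Longrightarrow> A (f + g) = A f + A g"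
    "f \<in> alg \<Longrightarrow> A (cscale c f) = cscale c (A f)"
    "A 0 = 0" "f \<in> alg \<Longrightarrow> g \<in> alg \<Longrightarrow> A (f - g) = A f - A g"
    "f \<in> alg \<Longrightarrow> A (- f) = - A f"
    "f \<in> alg \<Longrightarrow> A (cc c * f) = cc c * A f"
    "(\<And>i. i \<in> I \<Longrightarrow> F i \<in> alg) \<Longrightarrow> A (sum F I) = (\<Sum>i\<in>I. A (F i))"
proof -
  show 1: "A f \<in> alg" if "f \<in> alg" for f
    using assms that by (auto simp: alg_linear_def)
  show 2: "A (f + g) = A f + A g" if "f \<in> alg" "g \<in> alg" for f g
    using assms that by (auto simp: alg_linear_def)
  show 3: "A (cscale c f) = cscale c (A f)" if "f \<in> alg" for c f
    using assms that by (auto simp: alg_linear_def)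
  show 4: "A (cc c * f) = cc c * A f" if "f \<in> alg" for c f
    using 3[OF that] by (simp add: cscale_conv)
  show 5: "A 0 = 0"
    using 3[of 0 0] by (simp add: cscale_conv cc_hom)
  show 6: "A (- f) = - A f" if "f \<in> alg" for f
    using 4[of f "-1"] that by (simp add: cc_hom)
  show "A (f - g) = A f - A g" if "f \<in> alg" "g \<in> alg" for f g
    using 2[of f "- g"] 6[of g] that by simp
  show "A (sum F I) = (\<Sum>i\<in>I. A (F i))" if "\<And>i. i \<in> I \<Longrightarrow> F i \<in> alg"
    using that by (induction I rule: infinite_finite_induct) (auto simp: 2 5)
qed

lemma alg_linearI:
  assumes "\<And>f. f \<in> alg \<Longrightarrow> A f \<in> alg" "\<And>f g. f \<in> alg \<Longrightarrow> g \<in> alg \<Longrightarrow> A (f + g) = A f + A g"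
    "\<And>c f. f \<in> alg \<Longrightarrow> A (cc c * f) = cc c * A f"
  shows "alg_linear A"
  using assms by (simp add: alg_linear_def cscale_conv)

lemma alg_linear_dx: "alg_linear (dx i)" and alg_linear_dy: "alg_linear (dy j)"
  by (auto intro!: alg_linearI simp: dx_add dy_add dx_cc_mult dy_cc_mult)

lemma alg_linear_mult: "g \<in> alg \<Longrightarrow> alg_linear (\<lambda>f. g * f)"
  by (auto intro!: alg_linearI simp: algebra_simps)

lemma alg_linear_id: "alg_linear (\<lambda>f. f)"
  by (auto intro!: alg_linearI)

lemma alg_linear_comp: "alg_linear A \<Longrightarrow> alg_linear B \<Longrightarrow> alg_linear (\<lambda>f. A (B f))"
  by (auto intro!: alg_linearI simp: alg_linearD)

lemma alg_linear_add: "alg_linear A \<Longrightarrow> alg_linear B \<Longrightarrow> alg_linear (\<lambda>f. A f + B f)"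
  by (auto intro!: alg_linearI simp: alg_linearD distrib_left add_ac)

lemma alg_linear_cc_mult: "alg_linear A \<Longrightarrow> alg_linear (\<lambda>f. cc c * A f)"
  by (rule alg_linear_comp[OF alg_linear_mult]) auto

lemma alg_linear_minus: "alg_linear A \<Longrightarrow> alg_linear (\<lambda>f. - A f)"
  using alg_linear_cc_mult[of A "-1"] by (simp add: cc_hom)

lemma alg_linear_diff: "alg_linear A \<Longrightarrow> alg_linear B \<Longrightarrow> alg_linear (\<lambda>f. A f - B f)"
  using alg_linear_add[of A "\<lambda>f. - B f"] by (simp add: alg_linear_minus)

lemma alg_linear_sum: "(\<And>i. i \<in> I \<Longrightarrow> alg_linear (A i)) \<Longrightarrow> alg_linear (\<lambda>f. \<Sum>i\<in>I. A i f)"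
proof (induction I rule: infinite_finite_induct)
  case (insert x F)
  then show ?case by (simp add: alg_linear_add)
qed (auto intro!: alg_linearI)

lemma alg_linear_ops:
  fixes i j :: "'p::finite" and i' j' :: "'q::finite"
  shows "alg_linear (Euler_x :: ('p, 'q) cfun \<Rightarrow> _)" "alg_linear (Euler_y :: ('p, 'q) cfun \<Rightarrow> _)"
    "alg_linear (Lap_x :: ('p, 'q) cfun \<Rightarrow> _)" "alg_linear (Lap_y :: ('p, 'q) cfun \<Rightarrow> _)"
    "alg_linear (H_op :: ('p, 'q) cfun \<Rightarrow> _)" "alg_linear (Xplus :: ('p, 'q) cfun \<Rightarrow> _)"
    "alg_linear (Xminus :: ('p, 'q) cfun \<Rightarrow> _)"
    "alg_linear (pi_pp i j :: ('p, 'q) cfun \<Rightarrow> _)" "alg_linear (pi_qq i' j' :: ('p, 'q) cfun \<Rightarrow> _)"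
    "alg_linear (pi_pq i j' :: ('p, 'q) cfun \<Rightarrow> _)"
proof -
  note lin = alg_linear_sum alg_linear_add alg_linear_diff alg_linear_minus alg_linear_cc_mult
    alg_linear_comp[OF alg_linear_mult] alg_linear_comp[OF alg_linear_dx]
    alg_linear_comp[OF alg_linear_dy] alg_linear_dx alg_linear_dy alg_linear_id
  show 1: "alg_linear (Euler_x :: ('p, 'q) cfun \<Rightarrow> _)" "alg_linear (Euler_y :: ('p, 'q) cfun \<Rightarrow> _)"
    "alg_linear (Lap_x :: ('p, 'q) cfun \<Rightarrow> _)" "alg_linear (Lap_y :: ('p, 'q) cfun \<Rightarrow> _)"
    unfolding Euler_x_conv[abs_def] Euler_y_conv[abs_def] Lap_x_conv[abs_def] Lap_y_conv[abs_def]
    by (intro lin; simp)+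
  show "alg_linear (H_op :: ('p, 'q) cfun \<Rightarrow> _)" "alg_linear (Xplus :: ('p, 'q) cfun \<Rightarrow> _)"
    "alg_linear (Xminus :: ('p, 'q) cfun \<Rightarrow> _)"
    "alg_linear (pi_pp i j :: ('p, 'q) cfun \<Rightarrow> _)" "alg_linear (pi_qq i' j' :: ('p, 'q) cfun \<Rightarrow> _)"
    "alg_linear (pi_pq i j' :: ('p, 'q) cfun \<Rightarrow> _)"
    unfolding H_op_conv[abs_def] Xplus_conv[abs_def] Xminus_conv[abs_def]
      pi_pp_conv[abs_def] pi_qq_conv[abs_def] pi_pq_conv[abs_def]
    by (intro lin 1; simp)+
qed

lemma Lap_x_rx2:
  fixes f :: "('p::finite, 'q::finite) cfun"
  assumes "f \<in> alg"
  shows "Lap_x (rx2 * f) = rx2 * Lap_x f + cc 4 * Euler_x f + cc (2 * of_nat CARD('p)) * f"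
proof -
  have "dx i (dx i (rx2 * f)) = rx2 * dx i (dx i f) + cc 4 * (xc i * dx i f) + cc 2 * f" for i
    using assms by (simp add: dx_mult dx_add dx_xc) (simp add: fun_eq_iff pw algebra_simps)
  then show ?thesis
    by (simp add: Lap_x_conv Euler_x_conv sum.distrib sum_distrib_left[symmetric])
       (simp add: fun_eq_iff pw)
qed

lemma Lap_y_ry2:
  fixes f :: "('p::finite, 'q::finite) cfun"
  assumes "f \<in> alg"
  shows "Lap_y (ry2 * f) = ry2 * Lap_y f + cc 4 * Euler_y f + cc (2 * of_nat CARD('q)) * f"
proof -
  have "swp (Lap_x (rx2 * swp f)) =
      swp (rx2 * Lap_x (swp f) + cc 4 * Euler_x (swp f) + cc (2 * of_nat CARD('q)) * swp f)"
    using assms by (simp add: Lap_x_rx2)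
  moreover have "rx2 * swp f = swp (ry2 * f)"
    by simp
  ultimately show ?thesis
    by (simp add: swp_ops del: swp_simps(2)) simp
qed

lemma Lap_Lap: "f \<in> alg \<Longrightarrow> Lap_y (Lap_x f) = Lap_x (Lap_y f)"
proof -
  assume f: "f \<in> alg"
  have "dy j (dy j (dx i (dx i f))) = dx i (dx i (dy j (dy j f)))" for i j
    using f by (simp add: dy_dx)
  then show ?thesis
    using f by (simp add: Lap_x_conv Lap_y_conv dx_sum dy_sum) (rule sum.swap)
qed

lemma Euler_rx2: 
  assumes "f \<in> alg"
  shows "Euler_x (rx2 * f) = rx2 * Euler_x f + cc 2 * (rx2 * f)"
    "Euler_y (rx2 * f) = rx2 * Euler_y f"
proof -
  have "xc i * dx i (rx2 * f) = rx2 * (xc i * dx i f) + cc 2 * f * (xc i * xc i)" for i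
    using assms by (simp add: dx_mult algebra_simps)
  then have "Euler_x (rx2 * f) = rx2 * Euler_x f + cc 2 * f * (\<Sum>i\<in>UNIV. xc i * xc i)"
    by (simp add: Euler_x_conv sum.distrib sum_distrib_left)
  then show "Euler_x (rx2 * f) = rx2 * Euler_x f + cc 2 * (rx2 * f)"
    by (simp add: rx2_conv[symmetric] mult_ac)
  show "Euler_y (rx2 * f) = rx2 * Euler_y f"
    using assms by (simp add: Euler_y_conv dy_mult sum_distrib_left mult_ac)
qed

lemma dx_Euler_x: "f \<in> alg \<Longrightarrow> dx i (Euler_x f) = Euler_x (dx i f) + dx i f"
  by (simp add: Euler_x_conv dx_sum dx_mult dx_xc sum.distrib sum_delta_fun dx_dx[of f i] algebra_simps)

lemma dy_Euler_x: "f \<in> alg \<Longrightarrow> dy i (Euler_x f) = Euler_x (dy i f)"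
  by (simp add: Euler_x_conv dy_sum dy_mult dy_dx)

lemma Lap_x_Euler_x: 
  assumes "f \<in> alg"
  shows "Lap_x (Euler_x f) = Euler_x (Lap_x f) + cc 2 * Lap_x f"
proof -
  have "dx i (dx i (Euler_x f)) = Euler_x (dx i (dx i f)) + cc 2 * dx i (dx i f)" for i
    using assms by (simp add: dx_Euler_x dx_add) (simp add: fun_eq_iff pw)
  then show ?thesis
    using assms by (simp add: Lap_x_conv sum.distrib sum_distrib_left alg_linearD(8)[OF alg_linear_ops(1)])
qed

lemma Lap_y_Euler_x: 
  assumes "f \<in> alg"
  shows "Lap_y (Euler_x f) = Euler_x (Lap_y f)"
  using assms by (simp add: Lap_y_conv dy_Euler_x alg_linearD(8)[OF alg_linear_ops(1)])

lemma Lap_y_Euler_y: 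
  assumes "f \<in> alg"
  shows "Lap_y (Euler_y f) = Euler_y (Lap_y f) + cc 2 * Lap_y f"
  using arg_cong[OF Lap_x_Euler_x[of "swp f"], of swp] assms by (simp add: swp_ops)

lemma Xplus_Xminus:
  assumes "f \<in> alg"
  shows "Xplus (Xminus f) - Xminus (Xplus f) = H_op f"
proof -
  have "Xplus (Xminus f) = cc (- (1/2)) * (cc (1/2) * (Lap_x (rx2 * f) + Lap_x (Lap_y f))
      + ry2 * (cc (1/2) * (rx2 * f + Lap_y f)))"
    using assms by (simp add: Xplus_conv Xminus_conv alg_linearD[OF alg_linear_ops(3)])
  moreover have "Xminus (Xplus f) = cc (1/2) * (rx2 * (cc (- (1/2)) * (Lap_x f + ry2 * f))
      + cc (- (1/2)) * (Lap_y (Lap_x f) + Lap_y (ry2 * f)))"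
    using assms by (simp add: Xplus_conv Xminus_conv alg_linearD[OF alg_linear_ops(4)])
  ultimately show ?thesis
    using assms by (simp add: Lap_x_rx2 Lap_y_ry2 Lap_Lap H_op_conv)
      (simp add: fun_eq_iff pw field_simps)
qed

lemma H_op_Xminus:
  assumes "f \<in> alg"
  shows "H_op (Xminus f) - Xminus (H_op f) = cc (-2) * Xminus f"
  using assms
  by (simp add: H_op_conv Xminus_conv alg_linearD[OF alg_linear_ops(1)] alg_linearD[OF alg_linear_ops(2)]
      alg_linearD[OF alg_linear_ops(4)] Euler_rx2 Lap_y_Euler_x Lap_y_Euler_y)
    (simp add: fun_eq_iff pw field_simps)

lemma H_op_Xplus:
  fixes f :: "('p::finite, 'q::finite) cfun"
  assumes "f \<in> alg"
  shows "H_op (Xplus f) - Xplus (H_op f) = cc 2 * Xplus f"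
proof -
  have "swp (H_op (Xminus (swp f)) - Xminus (H_op (swp f))) = swp (cc (-2) * Xminus (swp f))"
    using assms by (simp add: H_op_Xminus)
  moreover have "H_op (- g) = - H_op g" "Xminus (- g) = - Xminus g" if "g \<in> alg" for g :: "('q, 'p) cfun"
    using that by (simp_all add: alg_linearD[OF alg_linear_ops(5)] alg_linearD[OF alg_linear_ops(7)])
  ultimately show ?thesis
    using assms by (simp add: swp_ops cc_hom)
qed

text \<open>Commutation with X^- is what the transport needs, since (X^-)^m carries M^+(m) to
  M^-(m). Stability of M^+(m) under \<open>pi_pq\<close> comes instead from the explicit formula in
  \<open>pi_pq_terms\<close>.\<close>

lemma Xminus_pi:
  assumes f: "f \<in> alg"
  shows "Xminus (pi_pp i j f) = pi_pp i j (Xminus f)"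
    and "Xminus (pi_qq i' j' f) = pi_qq i' j' (Xminus f)"
    and "Xminus (pi_pq i j' f) = pi_pq i j' (Xminus f)"
proof -
  have a: "Lap_y (xc i * g) = xc i * Lap_y g" if "g \<in> alg" for g i
    using that by (simp add: Lap_y_conv dy_mult sum_distrib_left)
  have b: "Lap_y (yc j * g) = yc j * Lap_y g + cc 2 * dy j g" if "g \<in> alg" for g j
  proof -
    have "dy k (dy k (yc j * g)) = yc j * dy k (dy k g) + cc 2 * ((if k = j then 1 else 0) * dy k g)" for k
      using that by (auto simp add: dy_mult dy_add dy_yc fun_eq_iff pw)
    then show ?thesis
      by (simp add: Lap_y_conv sum.distrib sum_distrib_left[symmetric] sum_delta_fun)
  qed
  have c: "Lap_y (dx i g) = dx i (Lap_y g)" "Lap_y (dy j' g) = dy j' (Lap_y g)" if "g \<in> alg" for g i j'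
    using that by (simp_all add: Lap_y_conv dx_sum dy_sum dy_dx dy_dy[of _ j'])
  note r = Xminus_conv pi_pp_conv pi_qq_conv pi_pq_conv alg_linearD[OF alg_linear_ops(4)] a b c
    dx_mult dx_add dx_diff dy_mult dy_add dy_diff dx_xc dy_yc
  show "Xminus (pi_pp i j f) = pi_pp i j (Xminus f)"
    using f by (simp add: r) (simp add: algebra_simps)
  show "Xminus (pi_qq i' j' f) = pi_qq i' j' (Xminus f)"
    using f by (simp add: r dy_dy[of _ j' i']) (simp add: algebra_simps)
  show "Xminus (pi_pq i j' f) = pi_pq i j' (Xminus f)"
    using f by (simp add: r mult.assoc) (simp add: fun_eq_iff pw algebra_simps)
qed

text \<open>An abstract triple with [e, f] = h and [h, f] = -2 f, to be used both for (X^+, X^-, H)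
  and for (X^-, X^+, -H).\<close>

context
  fixes e f h :: "('p::finite, 'q::finite) cfun \<Rightarrow> ('p, 'q) cfun" and s :: complex
  assumes lin: "alg_linear e" "alg_linear f" "alg_linear h"
    and ef: "\<And>v. v \<in> alg \<Longrightarrow> e (f v) - f (e v) = h v"
    and hf: "\<And>v. v \<in> alg \<Longrightarrow> h (f v) - f (h v) = cc (-2) * f v"
begin

lemma funpow_alg: "v \<in> alg \<Longrightarrow> (f ^^ n) v \<in> alg"
  by (induction n) (auto intro: alg_linearD(1)[OF lin(2)])

lemma sl2_weight:
  assumes v: "v \<in> alg" "h v = cc \<mu> * v"
  shows "h ((f ^^ n) v) = cc (\<mu> - 2 * of_nat n) * (f ^^ n) v"
proof (induction n)
  case (Suc n)
  have "h (f ((f ^^ n) v)) = f (h ((f ^^ n) v)) + cc (-2) * f ((f ^^ n) v)"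
    using hf[OF funpow_alg[OF v(1)], of n] by (metis add.commute diff_add_cancel)
  then show ?case
    using v(1) by (simp add: Suc alg_linearD[OF lin(2)] funpow_alg) (simp add: fun_eq_iff pw algebra_simps)
qed (use v in simp)

text \<open>Moving e through f^(n+1) collects the weights \<mu>, \<mu> - 2, ..., \<mu> - 2 n, whose
  sum is (n + 1) (\<mu> - n).\<close>

lemma sl2_raise:
  assumes v: "v \<in> alg" "h v = cc \<mu> * v" "e v = 0"
  shows "e ((f ^^ Suc n) v) = cc (of_nat (Suc n) * (\<mu> - of_nat n)) * (f ^^ n) v"
proof (induction n)
  case 0
  then show ?case using ef[OF v(1)] v by (simp add: alg_linearD[OF lin(2)])
next
  case (Suc n)
  have a: "(f ^^ n) v \<in> alg" "(f ^^ Suc n) v \<in> alg" using funpow_alg[OF v(1), of n] funpow_alg[OF v(1), of "Suc n"] by -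
  have "e ((f ^^ Suc (Suc n)) v) = f (e ((f ^^ Suc n) v)) + h ((f ^^ Suc n) v)"
    using ef[OF a(2)] by (simp add: diff_eq_eq add.commute)
  also have "\<dots> = cc (of_nat (Suc n) * (\<mu> - of_nat n)) * (f ^^ Suc n) v
      + cc (\<mu> - 2 * of_nat (Suc n)) * (f ^^ Suc n) v"
    unfolding Suc alg_linearD(7)[OF lin(2) a(1)] sl2_weight[OF v(1,2)] by simp
  also have "\<dots> = cc (of_nat (Suc (Suc n)) * (\<mu> - of_nat (Suc n))) * (f ^^ Suc n) v"
    by (simp add: fun_eq_iff pw algebra_simps)
  finally show ?case .
qed

lemma sl2_nonzero:
  assumes v: "v \<in> alg" "h v = cc (of_nat m) * v" "e v = 0" "v \<noteq> 0"
  shows "j \<le> m \<Longrightarrow> (f ^^ j) v \<noteq> 0"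
proof (induction j)
  case (Suc j)
  then have nz: "(f ^^ j) v \<noteq> 0" by simp
  show ?case
  proof
    assume "(f ^^ Suc j) v = 0"
    then have "cc (of_nat (Suc j) * (of_nat m - of_nat j)) * (f ^^ j) v = 0"
      using sl2_raise[OF v(1-3), of j] by (simp add: alg_linearD(4)[OF lin(1)])
    moreover have "of_nat (Suc j) * (of_nat m - of_nat j) \<noteq> (0 :: complex)"
      using Suc.prems by (simp del: of_nat_Suc)
    ultimately show False
      using nz by (auto simp: fun_eq_iff pw)
  qed
qed (use v in simp)

text \<open>The factors (i + 1) (m - i) with i < n are nonzero as long as n <= m. With n = m this
  makes e^m, up to a nonzero scalar, the inverse of f^m on highest weight vectors of weight
  m.\<close>

lemma sl2_raise_power:
  assumes v: "v \<in> alg" "h v = cc (of_nat m) * v" "e v = 0"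
  shows "n \<le> m \<Longrightarrow> \<exists>c. c \<noteq> 0 \<and> (e ^^ n) ((f ^^ n) v) = cc c * v"
proof (induction n)
  case 0
  then show ?case by (intro exI[of _ 1]) (simp add: cc_hom)
next
  case (Suc n)
  then obtain c where c: "c \<noteq> 0" "(e ^^ n) ((f ^^ n) v) = cc c * v"
    by auto
  define d where "d = (of_nat (Suc n) * (of_nat m - of_nat n) :: complex)"
  have d: "d \<noteq> 0"
    using Suc.prems by (simp add: d_def del: of_nat_Suc)
  have lin_pow: "alg_linear (e ^^ n)" for n
    by (induction n) (auto simp: alg_linear_id alg_linear_comp[OF lin(1)] o_def id_def)
  have "(e ^^ Suc n) ((f ^^ Suc n) v) = (e ^^ n) (cc d * (f ^^ n) v)"
    unfolding funpow_Suc_right o_apply d_def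
    using sl2_raise[OF v, of n] by (simp only: funpow.simps(2)[of n f] o_apply funpow_swap1[of f])
  also have "\<dots> = cc (d * c) * v"
    using c(2) by (simp add: alg_linearD(7)[OF lin_pow] funpow_alg v(1) cc_hom mult_ac)
  finally show ?case using c(1) d by (intro exI[of _ "d * c"]) simp
qed

end

text \<open>The operator A - ev k0 removes the summand at k0 and multiplies the one at k by ev k -
  ev k0, which is nonzero by injectivity; the induction hypothesis applies to the shorter
  sum.\<close>

lemma eigen_components:
  assumes A: "alg_linear A" and N: "cfun.subspace N" "\<And>f. f \<in> N \<Longrightarrow> A f \<in> N"
    and "finite I" "inj_on ev I" "\<And>k. k \<in> I \<Longrightarrow> g k \<in> alg"
    and "\<And>k. k \<in> I \<Longrightarrow> A (g k) = cc (ev k) * g k" "(\<Sum>k\<in>I. g k) \<in> N" "k \<in> I"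
  shows "g k \<in> N"
  using assms(4-)
proof (induction I arbitrary: g k rule: finite_induct)
  case (insert k0 F)
  let ?S = "\<Sum>k\<in>insert k0 F. g k"
  have S: "?S = g k0 + (\<Sum>k\<in>F. g k)"
    using insert.hyps by simp
  have "A ?S - cscale (ev k0) ?S = (\<Sum>k\<in>F. cc (ev k - ev k0) * g k)"
  proof -
    have "A ?S = (\<Sum>k\<in>insert k0 F. cc (ev k) * g k)"
      using insert.prems by (subst alg_linearD(8)[OF A]) auto
    then show ?thesis
      using insert.hyps
      by (simp add: cscale_conv cc_hom left_diff_distrib sum_subtractf sum_distrib_left distrib_left)
  qed
  then have S': "(\<Sum>k\<in>F. cc (ev k - ev k0) * g k) \<in> N"
    using N insert.prems(4) by (metis cfun.subspace_diff cfun.subspace_scale)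
  have *: "cc (ev l - ev k0) * g l \<in> N" if "l \<in> F" for l
  proof (rule insert.IH[of "\<lambda>k. cc (ev k - ev k0) * g k"])
    show "A (cc (ev k - ev k0) * g k) = cc (ev k) * (cc (ev k - ev k0) * g k)" if "k \<in> F" for k
    proof -
      have "A (cc (ev k - ev k0) * g k) = cc (ev k - ev k0) * A (g k)"
        using insert.prems(2) that by (intro alg_linearD(7)[OF A]) auto
      then show ?thesis
        using insert.prems(3)[of k] that by (simp add: mult.left_commute)
    qed
  qed (use insert.prems that S' in auto)
  have F: "g k \<in> N" if "k \<in> F" for k
  proof -
    have "ev k \<noteq> ev k0"
      using that insert.hyps insert.prems(1) by (auto simp: inj_on_def)
    then have "g k = cscale (1 / (ev k - ev k0)) (cc (ev k - ev k0) * g k)"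
      by (simp add: fun_eq_iff pw)
    then show ?thesis
      using *[OF that] N(1) by (metis cfun.subspace_scale)
  qed
  then have "?S - (\<Sum>k\<in>F. g k) \<in> N"
    by (intro cfun.subspace_diff[OF N(1)] cfun.subspace_sum[OF N(1)] insert.prems(4) F)
  then have "g k0 \<in> N"
    by (simp add: S)
  then show ?case
    using insert.prems(5) F by auto
qed simp

lemma eigen_components_0:
  assumes "alg_linear A" "finite I" "inj_on ev I" "\<And>k. k \<in> I \<Longrightarrow> g k \<in> alg"
    and "\<And>k. k \<in> I \<Longrightarrow> A (g k) = cc (ev k) * g k" "(\<Sum>k\<in>I. g k) = 0" "k \<in> I"
  shows "g k = 0"
proof -
  have "g k \<in> {0}"
    by (rule eigen_components[OF assms(1) _ _ assms(2-5)])
      (use assms in \<open>auto simp: cfun.subspace_def alg_linearD cscale_conv\<close>)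
  then show ?thesis by simp
qed

subsection \<open>The action of \<open>K\<close>\<close>

lemma matrix_inv_orthogonal:
  fixes a :: "real^'n::finite^'n"
  assumes "orthogonal_matrix a"
  shows "matrix_inv a = transpose a"
proof -
  have 1: "transpose a ** a = mat 1" "a ** transpose a = mat 1"
    using assms by (auto simp: orthogonal_matrix_def)
  then have "a ** matrix_inv a = mat 1"
    unfolding matrix_inv_def by (metis (mono_tags, lifting) someI)
  then have "transpose a ** (a ** matrix_inv a) = transpose a"
    by simp
  then show ?thesis
    by (simp add: matrix_mul_assoc 1)
qed

lemma K_act_eq:
  "(a, d) \<in> K_grp \<Longrightarrow> K_act (a, d) f v = f (transpose a *v fst v, transpose d *v snd v)"
  by (simp add: K_act_def K_grp_def matrix_inv_orthogonal)

lemma K_act_simps [simp]: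
  "K_act k (f + g) = K_act k f + K_act k g" "K_act k (f * g) = K_act k f * K_act k g"
  "K_act k (cc c) = cc c" "K_act k 0 = 0" "K_act k (cscale c f) = cscale c (K_act k f)"
  "K_act k (f - g) = K_act k f - K_act k g" "K_act k (- f) = - K_act k f" "K_act k 1 = 1"
  "K_act k (f ^ n) = K_act k f ^ n"
  by (auto simp: K_act_def fun_eq_iff pw)

lemma K_act_sum: "K_act k (sum F I) = (\<Sum>i\<in>I. K_act k (F i))"
  by (auto simp: K_act_def fun_eq_iff pw)

lemma K_act_swp: "K_act (a, d) (swp f) = swp (K_act (d, a) f)"
  by (simp add: K_act_def swp_def fun_eq_iff)

lemma K_grp_swap: "(a, d) \<in> K_grp \<longleftrightarrow> (d, a) \<in> K_grp"
  by (auto simp: K_grp_def)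

lemma K_act_xc:
  assumes "(a, d) \<in> K_grp"
  shows "K_act (a, d) (xc i) = (\<Sum>r\<in>UNIV. cc (of_real (a $ r $ i)) * xc r)"
  by (simp add: fun_eq_iff pw K_act_eq[OF assms] xc_def matrix_vector_mult_def transpose_def)

lemma K_act_yc:
  assumes "(a, d) \<in> K_grp"
  shows "K_act (a, d) (yc i) = (\<Sum>r\<in>UNIV. cc (of_real (d $ r $ i)) * yc r)"
  by (simp add: fun_eq_iff pw K_act_eq[OF assms] yc_def matrix_vector_mult_def transpose_def)

lemma rx2_inner: "rx2 v = of_real (fst v \<bullet> fst v)" and ry2_inner: "ry2 v = of_real (snd v \<bullet> snd v)"
  by (simp_all add: rx2_def ry2_def xc_def yc_def inner_vec_def power2_eq_square)

lemma orthogonal_inner: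
  fixes a :: "real^'n::finite^'n"
  assumes "orthogonal_matrix a"
  shows "(transpose a *v x) \<bullet> (transpose a *v x) = x \<bullet> x"
proof -
  have "orthogonal_transformation ((*v) (transpose a))"
    unfolding orthogonal_transformation_matrix
    using assms by (simp only: matrix_of_matrix_vector_mul matrix_vector_mul_linear
        orthogonal_matrix_transpose simp_thms)
  then show ?thesis
    by (simp only: orthogonal_transformation_def)
qed

lemma K_act_rho [simp]:
  assumes "k \<in> K_grp"
  shows "K_act k rx2 = rx2" "K_act k ry2 = ry2" "K_act k rho_x = rho_x" "K_act k rho_y = rho_y"
    "K_act k (psi \<alpha>) = psi \<alpha>"
proof -
  obtain a d where k: "k = (a, d)" "orthogonal_matrix a" "orthogonal_matrix d" "(a, d) \<in> K_grp"
    using assms by (auto simp: K_grp_def)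
  show 1: "K_act k rx2 = rx2" "K_act k ry2 = ry2"
    by (simp_all add: fun_eq_iff k(1) K_act_eq[OF k(4)] rx2_inner ry2_inner orthogonal_inner k(2,3)
        del: transpose_matrix_vector)
  then show 2: "K_act k rho_x = rho_x" "K_act k rho_y = rho_y"
    by (simp_all add: rho_x_rx2 rho_y_ry2)
  then have "rho_x (transpose a *v fst v, transpose d *v snd v) = rho_x v"
    "rho_y (transpose a *v fst v, transpose d *v snd v) = rho_y v" for v
    by (metis K_act_eq k(1,4))+
  then show "K_act k (psi \<alpha>) = psi \<alpha>"
    by (simp add: fun_eq_iff k(1) K_act_eq[OF k(4)] psi_def)
qed

lemma alg_K_act [simp, intro]: "f \<in> alg \<Longrightarrow> k \<in> K_grp \<Longrightarrow> K_act k f \<in> alg"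
proof (induction rule: alg.induct)
  case (xc i)
  then show ?case by (cases k) (simp add: K_act_xc)
next
  case (yc i)
  then show ?case by (cases k) (simp add: K_act_yc)
qed auto

lemma alg_linear_K_act: "k \<in> K_grp \<Longrightarrow> alg_linear (K_act k)"
  by (auto intro!: alg_linearI)

lemma orthogonal_sum:
  fixes a :: "real^'n::finite^'n"
  assumes "orthogonal_matrix a"
  shows "(\<Sum>j\<in>UNIV. complex_of_real (a $ i $ j) * of_real (a $ r $ j)) = (if i = r then 1 else 0)"
    "(\<Sum>j\<in>UNIV. complex_of_real (a $ j $ i) * of_real (a $ j $ r)) = (if i = r then 1 else 0)"
proof -
  have "(a ** transpose a) $ i $ r = (mat 1 :: real^'n^'n) $ i $ r"
    "(transpose a ** a) $ i $ r = (mat 1 :: real^'n^'n) $ i $ r"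
    using assms by (simp_all add: orthogonal_matrix_def)
  then have "(\<Sum>j\<in>UNIV. a $ i $ j * a $ r $ j) = (if i = r then 1 else 0)"
    "(\<Sum>j\<in>UNIV. a $ j $ i * a $ j $ r) = (if i = r then 1 else 0)"
    by (simp_all add: matrix_matrix_mult_def transpose_def mat_def)
  then show "(\<Sum>j\<in>UNIV. complex_of_real (a $ i $ j) * of_real (a $ r $ j)) = (if i = r then 1 else 0)"
    "(\<Sum>j\<in>UNIV. complex_of_real (a $ j $ i) * of_real (a $ j $ r)) = (if i = r then 1 else 0)"
    by (metis (mono_tags, lifting) of_real_0 of_real_1 of_real_mult of_real_sum sum.cong)+
qed

lemma sum_cc: "(\<Sum>i\<in>I. cc (F i)) = cc (\<Sum>i\<in>I. F i)"
  by (simp add: fun_eq_iff pw)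

lemma cc_if: "cc (if P then 1 else 0) = (if P then 1 else 0)"
  by (simp add: cc_hom)

lemma orthogonal_sum_fun:
  fixes a :: "real^'n::finite^'n" and F :: "'n \<Rightarrow> 'v \<Rightarrow> complex"
  assumes "orthogonal_matrix a"
  shows "(\<Sum>j\<in>UNIV. cc (of_real (a $ i $ j)) * (\<Sum>r\<in>UNIV. cc (of_real (a $ r $ j)) * F r)) = F i"
    "(\<Sum>j\<in>UNIV. cc (of_real (a $ j $ i)) * (\<Sum>r\<in>UNIV. cc (of_real (a $ j $ r)) * F r)) = F i"
proof -
  have "(\<Sum>j\<in>UNIV. cc (of_real (a $ i $ j)) * (\<Sum>r\<in>UNIV. cc (of_real (a $ r $ j)) * F r)) =
      (\<Sum>r\<in>UNIV. cc (\<Sum>j\<in>UNIV. of_real (a $ i $ j) * of_real (a $ r $ j)) * F r)"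
    unfolding sum_distrib_left
    by (subst sum.swap, intro sum.cong refl)
      (simp add: fun_eq_iff pw sum_distrib_right mult.assoc)
  then show "(\<Sum>j\<in>UNIV. cc (of_real (a $ i $ j)) * (\<Sum>r\<in>UNIV. cc (of_real (a $ r $ j)) * F r)) = F i"
    by (simp add: orthogonal_sum[OF assms] cc_if sum_delta_fun)
  have "(\<Sum>j\<in>UNIV. cc (of_real (a $ j $ i)) * (\<Sum>r\<in>UNIV. cc (of_real (a $ j $ r)) * F r)) =
      (\<Sum>r\<in>UNIV. cc (\<Sum>j\<in>UNIV. of_real (a $ j $ i) * of_real (a $ j $ r)) * F r)"
    unfolding sum_distrib_left
    by (subst sum.swap, intro sum.cong refl)
      (simp add: fun_eq_iff pw sum_distrib_right mult.assoc)
  then show "(\<Sum>j\<in>UNIV. cc (of_real (a $ j $ i)) * (\<Sum>r\<in>UNIV. cc (of_real (a $ j $ r)) * F r)) = F i"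
    by (simp add: orthogonal_sum[OF assms] cc_if sum_delta_fun)
qed

text \<open>The chain rule for an orthogonal change of variables, again tested on generators; for
  \<psi>_\<alpha> it reduces to the coordinates because rho_x and rho_y are invariant.\<close>

lemma dx_K_act:
  assumes k: "(a, d) \<in> K_grp" and f: "f \<in> alg"
  shows "dx i (K_act (a, d) f) = (\<Sum>j\<in>UNIV. cc (of_real (a $ i $ j)) * K_act (a, d) (dx j f))"
  using f
proof (induction rule: alg.induct)
  case (xc l)
  have "K_act (a, d) (if j = l then 1 else 0) = (if j = l then 1 else 0)" for j
    by simp
  moreover have "dx i (xc l) = (if i = l then 1 else 0)" for i l
    by (rule dx_xc)
  ultimately show ?case
    by (simp add: K_act_xc[OF k] dx_sum dx_cc_mult dx_xc sum_delta_fun del: K_act_simps)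
next
  case (yc l)
  then show ?case by (simp add: K_act_yc[OF k] dx_sum dx_cc_mult)
next
  case (psi \<alpha>)
  have o: "orthogonal_matrix a" using k by (simp add: K_grp_def)
  have "(\<Sum>j\<in>UNIV. cc (of_real (a $ i $ j)) * K_act (a, d) (dx j (psi \<alpha>))) =
      (\<Sum>j\<in>UNIV. cc (of_real (a $ i $ j)) * K_act (a, d) (xc j)) * (cc (- (1 / \<alpha>)) * rho_y * psi (\<alpha> + 1))"
    using psi k unfolding sum_distrib_right
    by (intro sum.cong refl) (simp add: dx_psi mult_ac)
  moreover have "(\<Sum>j\<in>UNIV. cc (of_real (a $ i $ j)) * K_act (a, d) (xc j)) = xc i"
    by (simp add: K_act_xc[OF k] orthogonal_sum_fun[OF o])
  ultimately show ?case
    using psi k by (simp add: dx_psi mult_ac)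
next
  case (add f g)
  then show ?case using k by (simp add: dx_add sum.distrib distrib_left)
next
  case (mult f g)
  have "(\<Sum>j\<in>UNIV. cc (of_real (a $ i $ j)) * K_act (a, d) (dx j (f * g))) =
      (\<Sum>j\<in>UNIV. cc (of_real (a $ i $ j)) * K_act (a, d) (dx j f)) * K_act (a, d) g +
      K_act (a, d) f * (\<Sum>j\<in>UNIV. cc (of_real (a $ i $ j)) * K_act (a, d) (dx j g))"
    unfolding sum_distrib_left sum_distrib_right sum.distrib[symmetric]
    using mult by (intro sum.cong refl) (simp add: dx_mult algebra_simps)
  then show ?case
    using k mult by (simp add: dx_mult)
qed simp

lemma K_act_dx:
  assumes k: "(a, d) \<in> K_grp" and f: "f \<in> alg"
  shows "K_act (a, d) (dx j f) = (\<Sum>i\<in>UNIV. cc (of_real (a $ i $ j)) * dx i (K_act (a, d) f))"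
proof -
  have "orthogonal_matrix a" using k by (simp add: K_grp_def)
  from orthogonal_sum_fun(2)[OF this, of j "\<lambda>r. K_act (a, d) (dx r f)"] show ?thesis
    by (simp add: dx_K_act[OF k f])
qed

lemma K_act_dy:
  assumes k: "(a, d) \<in> K_grp" and f: "f \<in> alg"
  shows "K_act (a, d) (dy j f) = (\<Sum>i\<in>UNIV. cc (of_real (d $ i $ j)) * dy i (K_act (a, d) f))"
proof -
  have "swp (K_act (d, a) (dx j (swp f))) = swp (\<Sum>i\<in>UNIV. cc (of_real (d $ i $ j)) * dx i (K_act (d, a) (swp f)))"
    using k f by (subst K_act_dx) (simp_all add: K_grp_swap[of d a])
  then show ?thesis
    by (simp add: dx_swp swp_sum K_act_swp)
qed

lemma Lap_x_K_act:
  assumes "k \<in> K_grp" and f: "f \<in> alg"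
  shows "Lap_x (K_act k f) = K_act k (Lap_x f)"
proof -
  obtain a d where k: "k = (a, d)" "(a, d) \<in> K_grp" "orthogonal_matrix a"
    using assms(1) by (auto simp: K_grp_def)
  have "Lap_x (K_act k f) = (\<Sum>i\<in>UNIV. dx i (\<Sum>j\<in>UNIV. cc (of_real (a $ i $ j)) * K_act k (dx j f)))"
    using f k by (simp add: Lap_x_conv dx_K_act)
  also have "\<dots> = (\<Sum>i\<in>UNIV. \<Sum>j\<in>UNIV. cc (of_real (a $ i $ j)) * dx i (K_act k (dx j f)))"
    using f k by (simp add: dx_sum dx_cc_mult)
  also have "\<dots> = (\<Sum>j\<in>UNIV. \<Sum>i\<in>UNIV. cc (of_real (a $ i $ j)) * dx i (K_act k (dx j f)))"
    by (rule sum.swap)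
  also have "\<dots> = (\<Sum>j\<in>UNIV. K_act k (dx j (dx j f)))"
    using f k by (simp add: K_act_dx)
  finally show ?thesis
    by (simp add: Lap_x_conv K_act_sum)
qed

lemma Lap_y_K_act: "k \<in> K_grp \<Longrightarrow> f \<in> alg \<Longrightarrow> Lap_y (K_act k f) = K_act k (Lap_y f)"
  using Lap_x_K_act[of "(snd k, fst k)" "swp f"] K_grp_swap[of "fst k" "snd k"]
  by (cases k) (simp add: K_act_swp swp_ops swp_inj)

lemma Xminus_K_act: "k \<in> K_grp \<Longrightarrow> f \<in> alg \<Longrightarrow> Xminus (K_act k f) = K_act k (Xminus f)"
  by (simp add: Xminus_conv Lap_y_K_act)

subsection \<open>Harmonic polynomials\<close>

lemmas rpf = real_polynomial_function.intros(3,4) real_polynomial_function_diff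
  real_polynomial_function.intros(2)

lemma complex_polynomial_iff:
  fixes h :: "'v::real_normed_vector \<Rightarrow> complex"
  shows "polynomial_function h \<longleftrightarrow>
    real_polynomial_function (\<lambda>x. Re (h x)) \<and> real_polynomial_function (\<lambda>x. Im (h x))"
proof (intro iffI conjI)
  assume h: "polynomial_function h"
  then show "real_polynomial_function (\<lambda>x. Re (h x))" "real_polynomial_function (\<lambda>x. Im (h x))"
    using bounded_linear_Re bounded_linear_Im unfolding polynomial_function_def o_def by blast+
next
  assume *: "real_polynomial_function (\<lambda>x. Re (h x)) \<and> real_polynomial_function (\<lambda>x. Im (h x))"
  show "polynomial_function h"
    unfolding polynomial_function_def o_def
  proof (intro allI impI)
    fix f :: "complex \<Rightarrow> real" assume f: "bounded_linear f"
    have "f (h x) = Re (h x) * f 1 + Im (h x) * f \<i>" for x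
    proof -
      have "f (h x) = f (Re (h x) *\<^sub>R 1 + Im (h x) *\<^sub>R \<i>)"
        by (simp add: scaleR_conv_of_real mult.commute complex_eq[symmetric])
      then show ?thesis
        using bounded_linear.linear[OF f] by (simp add: linear_add linear_cmul)
    qed
    then show "real_polynomial_function (\<lambda>x. f (h x))"
      using * by (simp only:) (intro rpf; simp)
  qed
qed

lemma complex_polynomial_mult:
  fixes f g :: "'v::real_normed_vector \<Rightarrow> complex"
  shows "polynomial_function f \<Longrightarrow> polynomial_function g \<Longrightarrow> polynomial_function (f * g)"
  unfolding complex_polynomial_iff by (auto simp: pw intro!: rpf)

lemma complex_polynomial_add:
  fixes f g :: "'v::real_normed_vector \<Rightarrow> complex"
  shows "polynomial_function f \<Longrightarrow> polynomial_function g \<Longrightarrow> polynomial_function (f + g)"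
  by (simp add: plus_fun_def polynomial_function_add)

lemma complex_polynomial_cc: "polynomial_function (cc c :: 'v::real_normed_vector \<Rightarrow> complex)"
  by (simp add: cc_def)

lemma complex_polynomial_diff:
  fixes f g :: "'v::real_normed_vector \<Rightarrow> complex"
  assumes "polynomial_function f" "polynomial_function g"
  shows "polynomial_function (f - g)"
  using polynomial_function_diff[OF assms] by (simp add: fun_diff_def)

lemma complex_polynomial_of_real:
  "real_polynomial_function g \<Longrightarrow> polynomial_function (\<lambda>x. complex_of_real (g x))"
  unfolding complex_polynomial_iff by (auto intro!: rpf)

lemma real_polynomial_dir_deriv:
  assumes "real_polynomial_function g"
  shows "\<exists>g'. real_polynomial_function g' \<and>
    (\<forall>x. ((\<lambda>t::real. g (x + t *\<^sub>R u)) has_real_derivative g' x) (at 0))"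
  using assms
proof (induction rule: real_polynomial_function.induct)
  case (linear f)
  have "((\<lambda>t::real. f x + t * f u) has_real_derivative f u) (at 0)" for x
    by (auto intro!: derivative_eq_intros)
  then show ?case
    using bounded_linear.linear[OF linear]
    by (intro exI[of _ "\<lambda>_. f u"]) (auto simp: linear_add linear_cmul intro!: rpf(4))
next
  case (const c)
  show ?case by (intro exI[of _ "\<lambda>_. 0"]) (auto intro!: rpf(4))
next
  case (add f g)
  then obtain f' g' where "real_polynomial_function f'" "real_polynomial_function g'"
    "\<And>x. ((\<lambda>t. f (x + t *\<^sub>R u)) has_real_derivative f' x) (at 0)"
    "\<And>x. ((\<lambda>t. g (x + t *\<^sub>R u)) has_real_derivative g' x) (at 0)" by blast
  then show ?case
    by (intro exI[of _ "\<lambda>x. f' x + g' x"]) (auto intro!: rpf(1) DERIV_add)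
next
  case (mult f g)
  then obtain f' g' where *: "real_polynomial_function f'" "real_polynomial_function g'"
    "\<And>x. ((\<lambda>t. f (x + t *\<^sub>R u)) has_real_derivative f' x) (at 0)"
    "\<And>x. ((\<lambda>t. g (x + t *\<^sub>R u)) has_real_derivative g' x) (at 0)" by blast
  have "((\<lambda>t. f (x + t *\<^sub>R u) * g (x + t *\<^sub>R u)) has_real_derivative f' x * g x + g' x * f x) (at 0)" for x
    using DERIV_mult[OF *(3,4), of x x] by simp
  then show ?case
    using mult * by (intro exI[of _ "\<lambda>x. f' x * g x + g' x * f x"])
      (auto intro!: rpf(1,2))
qed

lemma polynomial_dir_deriv:
  fixes h :: "'v::real_normed_vector \<Rightarrow> complex"
  assumes "polynomial_function h"
  shows "polynomial_function (dir_deriv u h)"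
proof -
  obtain f g where fg: "real_polynomial_function f" "real_polynomial_function g"
    "\<And>x. ((\<lambda>t. Re (h (x + t *\<^sub>R u))) has_real_derivative f x) (at 0)"
    "\<And>x. ((\<lambda>t. Im (h (x + t *\<^sub>R u))) has_real_derivative g x) (at 0)"
    using assms real_polynomial_dir_deriv[of "\<lambda>x. Re (h x)" u]
      real_polynomial_dir_deriv[of "\<lambda>x. Im (h x)" u]
    unfolding complex_polynomial_iff by blast
  have "((\<lambda>t. h (x + t *\<^sub>R u)) has_vector_derivative Complex (f x) (g x)) (at 0)" for x
  proof -
    have "((\<lambda>t. complex_of_real (Re (h (x + t *\<^sub>R u))) + \<i> * complex_of_real (Im (h (x + t *\<^sub>R u))))
        has_vector_derivative of_real (f x) + \<i> * of_real (g x)) (at 0)"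
      using fg(3,4)[of x]
      by (intro has_vector_derivative_add has_vector_derivative_mult_right has_vector_derivative_of_real)
    then show ?thesis
      by (simp only: Complex_eq[symmetric] complex_surj)
  qed
  then have "dir_deriv u h = (\<lambda>x. Complex (f x) (g x))"
    by (simp add: fun_eq_iff dir_deriv_def vector_derivative_at)
  then show ?thesis
    using fg by (simp add: complex_polynomial_iff)
qed

definition pd :: "'n \<Rightarrow> (real^'n::finite \<Rightarrow> complex) \<Rightarrow> real^'n \<Rightarrow> complex" where
  "pd i = dir_deriv (axis i 1)"

text \<open>One-variable functions are viewed on the product, so that harmonicity and homogeneity
  can be handled by the operators \<open>Lap_x\<close> and \<open>Euler_x\<close> already studied
  there.\<close>

definition liftx :: "(real^'p::finite \<Rightarrow> complex) \<Rightarrow> ('p, 'q::finite) cfun" where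
  "liftx h = (\<lambda>v. h (fst v))"

definition lifty :: "(real^'q::finite \<Rightarrow> complex) \<Rightarrow> ('p::finite, 'q) cfun" where
  "lifty h = (\<lambda>v. h (snd v))"

definition crd :: "'n \<Rightarrow> real^'n::finite \<Rightarrow> complex" where
  "crd i = (\<lambda>x. of_real (x $ i))"

lemma lift_simps [simp]:
  "liftx (f + g) = liftx f + liftx g" "liftx (f * g) = liftx f * liftx g"
  "liftx (f - g) = liftx f - liftx g" "liftx (cc c) = cc c" "liftx 0 = 0"
  "liftx (cscale c f) = cscale c (liftx f)" "liftx (crd i) = xc i"
  "swp (liftx f) = lifty f" "swp (lifty g) = liftx g"
  "dx i (liftx f) = liftx (pd i f)" "dy j (lifty g) = lifty (pd j g)"
  "dy j (liftx f) = 0" "dx i (lifty g) = 0"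
proof -
  show "dx i (liftx f) = liftx (pd i f)" "dy j (lifty g) = lifty (pd j g)"
    by (simp_all add: liftx_def lifty_def dx_def dy_def pd_def dir_deriv_fst dir_deriv_snd)
  show "dy j (liftx f) = 0" "dx i (lifty g) = 0"
    by (simp_all add: liftx_def lifty_def dx_def dy_def dir_deriv_fst dir_deriv_snd)
       (simp_all add: fun_eq_iff pw)
qed (simp_all add: liftx_def lifty_def crd_def xc_def swp_def fun_eq_iff pw)

lemma liftx_sum: "liftx (sum F I) = (\<Sum>i\<in>I. liftx (F i))"
  by (simp add: liftx_def fun_eq_iff pw)

lemma liftx_eq_0_iff [simp]: "liftx f = 0 \<longleftrightarrow> f = 0"
  by (auto simp: liftx_def fun_eq_iff pw)

lemma liftx_real_alg:
  assumes "real_polynomial_function g"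
  shows "liftx (\<lambda>x. of_real (g x)) \<in> alg"
  using assms
proof (induction rule: real_polynomial_function.induct)
  case (linear f)
  have e: "f x = (\<Sum>i\<in>UNIV. f (axis i 1) * x $ i)" for x
  proof -
    have "f x = f (\<Sum>i\<in>UNIV. (x $ i) *\<^sub>R axis i 1)"
      using basis_expansion[of x] by (simp add: scalar_mult_eq_scaleR)
    then show ?thesis
      using bounded_linear.linear[OF linear]
      by (simp add: linear_sum linear_cmul mult.commute)
  qed
  have eq: "liftx (\<lambda>x. of_real (f x)) = (\<Sum>i\<in>UNIV. cc (of_real (f (axis i 1))) * xc i)"
  proof
    fix v
    show "liftx (\<lambda>x. of_real (f x)) v = (\<Sum>i\<in>UNIV. cc (of_real (f (axis i 1))) * xc i) v"
      by (simp add: pw liftx_def xc_def e[of "fst v"])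
  qed
  show ?case unfolding eq by (intro alg_sum alg.mult alg.const alg.xc)
next
  case (const c)
  then show ?case using alg.const[of "of_real c"] by (simp add: liftx_def cc_def)
next
  case (add f g)
  then show ?case using alg.add by (fastforce simp: liftx_def plus_fun_def)
next
  case (mult f g)
  then show ?case using alg.mult by (fastforce simp: liftx_def times_fun_def)
qed

lemma liftx_alg: 
  assumes "polynomial_function h"
  shows "liftx h \<in> alg"
proof -
  have eq: "liftx h = liftx (\<lambda>x. of_real (Re (h x))) + cc \<i> * liftx (\<lambda>x. of_real (Im (h x)))"
    by (simp add: liftx_def fun_eq_iff pw complex_eq)
  show ?thesis
    using assms unfolding complex_polynomial_iff
    by (subst eq) (intro alg.add alg.mult alg.const liftx_real_alg; simp)
qed

lemma polynomial_pd: "polynomial_function h \<Longrightarrow> polynomial_function (pd i h)"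
  by (simp add: pd_def polynomial_dir_deriv)

lemma polynomial_crd: "polynomial_function (crd i)"
  unfolding crd_def
  by (intro complex_polynomial_of_real real_polynomial_function.intros(1) bounded_linear_vec_nth)

lemma Lap_x_liftx: "Lap_x (liftx h) = liftx (\<Sum>i\<in>UNIV. pd i (pd i h))"
  by (simp add: Lap_x_conv liftx_sum)

text \<open>The Laplace equation in lifted form, for any second factor; proofs about a single
  variable choose \<open>'q = 'n\<close>.\<close>

lemma harmonic_iff:
  fixes h :: "real^'n::finite \<Rightarrow> complex"
  shows "h \<in> harmonic k \<longleftrightarrow> polynomial_function h \<and>
    (\<forall>t x. h (t *\<^sub>R x) = complex_of_real t ^ k * h x) \<and> Lap_x (liftx h :: ('n, 'q::finite) cfun) = 0"
  by (simp add: harmonic_def Lap_x_liftx pd_def[symmetric]) (auto simp: fun_eq_iff pw)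

lemma harmonicD:
  fixes h :: "real^'n::finite \<Rightarrow> complex"
  assumes "h \<in> harmonic k"
  shows "polynomial_function h" "h (t *\<^sub>R x) = complex_of_real t ^ k * h x"
    "liftx h \<in> (alg :: ('n, 'q::finite) cfun set)" "Lap_x (liftx h :: ('n, 'q) cfun) = 0"
proof -
  have *: "polynomial_function h \<and> (\<forall>t x. h (t *\<^sub>R x) = complex_of_real t ^ k * h x) \<and>
      Lap_x (liftx h :: ('n, 'q) cfun) = 0"
    using assms unfolding harmonic_iff[where 'q = 'q, of h k] .
  then show "polynomial_function h" "h (t *\<^sub>R x) = complex_of_real t ^ k * h x"
    "Lap_x (liftx h :: ('n, 'q) cfun) = 0"
    by blast+
  then show "liftx h \<in> (alg :: ('n, 'q) cfun set)"
    by (simp add: liftx_alg)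
qed

lemma liftx_diffble: "polynomial_function h \<Longrightarrow> diffble h"
  for h :: "real^'a::finite \<Rightarrow> complex"
  unfolding diffble_def
proof
  fix x assume "polynomial_function h"
  then have "(\<lambda>y. (liftx h :: ('a, 'a) cfun) (y, 0)) differentiable at x"
  proof -
    have "(liftx h :: ('a, 'a) cfun) differentiable at ((\<lambda>y. (y, 0)) x)"
      using alg_diffble[OF liftx_alg[OF \<open>polynomial_function h\<close>]] by (auto simp: diffble_def)
    moreover have "(\<lambda>y. (y, 0 :: real^'a)) differentiable at x"
      by (intro derivative_intros differentiable_Pair)
    ultimately show ?thesis
      using differentiable_chain_at[of "\<lambda>y. (y, 0)" x "liftx h"] by (simp add: o_def)
  qed
  then show "h differentiable at x"
    by (simp add: liftx_def)
qed

lemma dir_deriv_scale: "diffble h \<Longrightarrow> dir_deriv (t *\<^sub>R u) h x = of_real t * dir_deriv u h x"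
  using dir_deriv_eq[OF diffbleD[of h x]] 
  by (metis diffbleD has_derivative_linear linear_cmul scaleR_conv_of_real)

lemma dir_deriv_expand:
  fixes h :: "real^'n::finite \<Rightarrow> complex"
  assumes "diffble h"
  shows "dir_deriv u h x = (\<Sum>i\<in>UNIV. of_real (u $ i) * pd i h x)"
proof -
  let ?D = "frechet_derivative h (at x)"
  have D: "(h has_derivative ?D) (at x)" using assms by (rule diffbleD)
  have l: "linear ?D" using D by (rule has_derivative_linear)
  have "?D u = ?D (\<Sum>i\<in>UNIV. (u $ i) *\<^sub>R axis i 1)"
    using basis_expansion[of u] by (simp add: scalar_mult_eq_scaleR)
  then show ?thesis
    using l by (simp add: dir_deriv_eq[OF D] pd_def linear_sum linear_cmul)
      (simp add: scaleR_conv_of_real)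
qed

text \<open>Differentiate h((1 + t) x) = (1 + t)^k h(x) at t = 0.\<close>

lemma harmonic_Euler:
  fixes h :: "real^'n::finite \<Rightarrow> complex"
  assumes "h \<in> harmonic k"
  shows "Euler_x (liftx h :: ('n, 'q::finite) cfun) = cc (of_nat k) * liftx h"
proof -
  have "(\<Sum>i\<in>UNIV. of_real (x $ i) * pd i h x) = of_nat k * h x" for x
  proof -
    have e: "(\<lambda>t. h (x + t *\<^sub>R x)) = (\<lambda>t. of_real ((1 + t) ^ k) * h x)"
    proof
      fix t
      show "h (x + t *\<^sub>R x) = of_real ((1 + t) ^ k) * h x"
        using harmonicD(2)[OF assms, of "1 + t" x] by (simp add: scaleR_add_left)
    qed
    have d: "((\<lambda>t::real. of_real ((1 + t) ^ k) * h x) has_vector_derivative of_real (of_nat k) * h x) (at 0)"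
      by (intro has_vector_derivative_mult_left has_vector_derivative_of_real)
        (auto intro!: derivative_eq_intros)
    have "dir_deriv x h x = of_nat k * h x"
      unfolding dir_deriv_def e using vector_derivative_at[OF d] by (simp only: of_real_of_nat_eq)
    then show ?thesis
      using dir_deriv_expand[OF liftx_diffble[OF harmonicD(1)[OF assms]], of x x] by simp
  qed
  then show ?thesis
    by (simp add: Euler_x_conv) (simp add: fun_eq_iff pw liftx_def xc_def)
qed

lemma eq_at_0_if_eq_off_0:
  fixes f g :: "real \<Rightarrow> complex"
  assumes "continuous_on UNIV f" "continuous_on UNIV g" "\<And>t. t \<noteq> 0 \<Longrightarrow> f t = g t"
  shows "f 0 = g 0"
proof -
  have f: "(f \<longlongrightarrow> f 0) (at 0)" and g: "(g \<longlongrightarrow> g 0) (at 0)"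
    using assms(1,2) by (auto simp: continuous_on_def)
  have "eventually (\<lambda>t. f t = g t) (at 0)"
    using assms(3) by (simp add: eventually_at_filter)
  then have "(g \<longlongrightarrow> f 0) (at 0)"
    using f by (simp cong: tendsto_cong)
  then show ?thesis
    using g by (intro tendsto_unique[of "at 0" g]) auto
qed

lemma harmonic_pd_0: "h \<in> harmonic 0 \<Longrightarrow> pd i h = 0"
proof -
  assume h: "h \<in> harmonic 0"
  have "h = cc (h 0)"
    using harmonicD(2)[OF h, of 0, symmetric] by (simp add: fun_eq_iff pw)
  then obtain c where "h = cc c"
    by blast
  then show ?thesis
    by (simp add: pd_def)
qed

lemma harmonic_pd:
  fixes h :: "real^'n::finite \<Rightarrow> complex"
  assumes h: "h \<in> harmonic (Suc k)"
  shows "pd i h \<in> harmonic k"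
  unfolding harmonic_iff[where 'q = 'n]
proof (intro conjI allI)
  note d = liftx_diffble[OF harmonicD(1)[OF h]]
  show poly: "polynomial_function (pd i h)"
    using harmonicD(1)[OF h] by (rule polynomial_pd)
  show "Lap_x (liftx (pd i h) :: ('n, 'n) cfun) = 0"
  proof -
    have "Lap_x (dx i (liftx h)) = dx i (Lap_x (liftx h :: ('n, 'n) cfun))"
      using harmonicD(3)[OF h, where 'q = 'n]
      by (simp add: Lap_x_conv dx_sum dx_dx[of _ i] del: lift_simps)
    then show ?thesis
      using harmonicD(4)[OF h, where 'q = 'n] by simp
  qed
  fix t x
  have off: "pd i h (t *\<^sub>R x) = of_real t ^ k * pd i h x" if "t \<noteq> 0" for t
  proof -
    have "of_real t * pd i h (t *\<^sub>R x) = dir_deriv (t *\<^sub>R axis i 1) h (t *\<^sub>R x)"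
      by (simp add: dir_deriv_scale[OF d] pd_def)
    also have "\<dots> = dir_deriv (axis i 1) (\<lambda>x. h (t *\<^sub>R x)) x"
      by (simp add: dir_deriv_def algebra_simps)
    also have "\<dots> = dir_deriv (axis i 1) (cc (of_real t ^ Suc k) * h) x"
      using harmonicD(2)[OF h, of t] by (simp add: times_fun_def cc_def)
    also have "\<dots> = of_real t ^ Suc k * pd i h x"
      using d by (simp add: dir_deriv_mult pd_def pw)
    finally show ?thesis
      using that by simp
  qed
  have c: "continuous_on UNIV (pd i h)"
    using poly by (rule continuous_on_polymonial_function)
  show "pd i h (t *\<^sub>R x) = of_real t ^ k * pd i h x"
  \<comment> \<open>The argument for t \<noteq> 0 divides by t. Both sides are continuous in t,
    which covers t = 0, including the value 0^0 = 1 when k = 0.\<close>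
  proof (cases "t = 0")
    case True
    have "continuous_on UNIV (\<lambda>t. pd i h (t *\<^sub>R x))"
      by (intro continuous_on_compose2[OF c] continuous_intros) auto
    then have "(\<lambda>t. pd i h (t *\<^sub>R x)) 0 = (\<lambda>t. of_real t ^ k * pd i h x) 0"
      using off by (intro eq_at_0_if_eq_off_0[where f = "\<lambda>t. pd i h (t *\<^sub>R x)"
            and g = "\<lambda>t. of_real t ^ k * pd i h x"]) (auto intro!: continuous_intros)
    then show ?thesis using True by simp
  qed (rule off)
qed

lemma Lap_x_xc: 
  assumes "g \<in> alg"
  shows "Lap_x (xc i * g) = xc i * Lap_x g + cc 2 * dx i g"
proof -
  have "dx k (dx k (xc i * g)) = xc i * dx k (dx k g) + cc 2 * ((if k = i then 1 else 0) * dx k g)" for k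
    using assms by (auto simp add: dx_mult dx_add dx_xc fun_eq_iff pw)
  then show ?thesis
    by (simp add: Lap_x_conv sum.distrib sum_distrib_left[symmetric] sum_delta_fun)
qed

lemma Lap_x_dx: "f \<in> alg \<Longrightarrow> Lap_x (dx i f) = dx i (Lap_x f)"
  by (simp add: Lap_x_conv dx_sum dx_dx[of _ i])

text \<open>The rotation field x_i \<partial>_j - x_j \<partial>_i commutes with the Laplacian,
  since the two mixed terms 2 \<partial>_i \<partial>_j cancel.\<close>

lemma harmonic_rot:
  fixes h :: "real^'n::finite \<Rightarrow> complex"
  assumes h: "h \<in> harmonic k"
  shows "crd i * pd j h - crd j * pd i h \<in> harmonic k"
  unfolding harmonic_iff[where 'q = 'n]
proof (intro conjI allI)
  let ?g = "crd i * pd j h - crd j * pd i h"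
  show "polynomial_function ?g"
    using harmonicD(1)[OF h]
    by (intro complex_polynomial_diff complex_polynomial_mult polynomial_crd polynomial_pd)
  show "Lap_x (liftx ?g :: ('n, 'n) cfun) = 0"
  proof -
    have "Lap_x (xc i * dx j (liftx h) - xc j * dx i (liftx h) :: ('n, 'n) cfun) = 0"
      using harmonicD(3,4)[OF h, where 'q = 'n] dx_dx[of "liftx h :: ('n, 'n) cfun" i j]
      by (simp add: alg_linearD[OF alg_linear_ops(3)] Lap_x_xc Lap_x_dx del: lift_simps)
    then show ?thesis by simp
  qed
  show "?g (t *\<^sub>R x) = of_real t ^ k * ?g x" for t x
  proof (cases k)
    case 0
    then show ?thesis using h harmonic_pd_0[of h] by (simp add: pw)
  next
    case (Suc m)
    then have "pd i h \<in> harmonic m" "pd j h \<in> harmonic m"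
      using h harmonic_pd by blast+
    then show ?thesis
      by (simp add: Suc pw crd_def harmonicD(2) algebra_simps)
  qed
qed

definition nrm2 :: "real^'n::finite \<Rightarrow> complex" where
  "nrm2 = (\<Sum>i\<in>UNIV. crd i * crd i)"

lemma liftx_nrm2 [simp]: "liftx nrm2 = rx2"
  by (simp add: nrm2_def liftx_sum rx2_conv)

lemma nrm2_scale: "nrm2 (t *\<^sub>R x) = of_real t ^ 2 * nrm2 x"
  by (simp add: nrm2_def pw crd_def sum_distrib_left power2_eq_square mult_ac)

lemma polynomial_nrm2: "polynomial_function nrm2"
proof -
  have "polynomial_function (\<Sum>i\<in>I. crd i * crd i)" if "finite I" for I :: "'a set"
    using that
    by (induction I)
      (simp_all add: complex_polynomial_add complex_polynomial_mult polynomial_crd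
        complex_polynomial_cc[of 0, unfolded cc_hom])
  then show ?thesis
    by (simp add: nrm2_def)
qed

text \<open>\<open>up_coeff n k\<close> makes \<open>x\<^sub>i h - up_coeff n k |x|\<^sup>2 \<partial>\<^sub>i h\<close> harmonic for \<open>h\<close> harmonic of
  degree \<open>k\<close> in \<open>n\<close> variables; if \<open>2 k + n = 2\<close> then \<open>k = 0\<close> and the value is irrelevant.\<close>

definition up_coeff :: "nat \<Rightarrow> nat \<Rightarrow> complex" where
  "up_coeff n k = 1 / (2 * of_nat k + of_nat n - 2)"

lemma up_coeff_Suc: "n > 0 \<Longrightarrow> up_coeff n (Suc k) * (2 * of_nat k + of_nat n) = 1"
proof -
  assume "n > 0"
  then have "(2 * of_nat k + of_nat n :: complex) \<noteq> 0"
    using of_nat_eq_0_iff[of "2 * k + n", where 'a = complex] by simp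
  then show ?thesis by (simp add: up_coeff_def)
qed

text \<open>The constant balances \<Delta>(x_i h) = 2 \<partial>_i h against \<Delta>(|x|^2
  \<partial>_i h) = (4 (k - 1) + 2 n) \<partial>_i h. The result is the harmonic part of x_i h in
  the decomposition of polynomials into harmonic ones times powers of |x|^2.\<close>

lemma harmonic_up:
  fixes h :: "real^'n::finite \<Rightarrow> complex"
  assumes h: "h \<in> harmonic k"
  shows "crd i * h - cc (up_coeff CARD('n) k) * (nrm2 * pd i h) \<in> harmonic (Suc k)"
  unfolding harmonic_iff[where 'q = 'n]
proof (intro conjI allI)
  let ?g = "crd i * h - cc (up_coeff CARD('n) k) * (nrm2 * pd i h)"
  show "polynomial_function ?g"
    using harmonicD(1)[OF h]
    by (intro complex_polynomial_diff complex_polynomial_mult polynomial_crd polynomial_pd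
        polynomial_nrm2 complex_polynomial_cc)
  have alg: "(liftx h :: ('n, 'n) cfun) \<in> alg" "(liftx (pd i h) :: ('n, 'n) cfun) \<in> alg"
    using harmonicD(3)[OF h, where 'q = 'n] alg_dx[of "liftx h" i] by auto
  have 1: "Lap_x (liftx ?g :: ('n, 'n) cfun) = cc 2 * liftx (pd i h)
      - cc (up_coeff CARD('n) k) * (cc 4 * Euler_x (liftx (pd i h)) + cc (2 * of_nat CARD('n)) * liftx (pd i h))"
    using alg Lap_x_dx[OF alg(1), of i] harmonicD(4)[OF h, where 'q = 'n]
    by (simp add: alg_linearD[OF alg_linear_ops(3)] Lap_x_xc Lap_x_rx2)
  show "Lap_x (liftx ?g :: ('n, 'n) cfun) = 0"
  proof (cases k)
    case 0
    then show ?thesis using h harmonic_pd_0[of h i] 1 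
      by (simp add: alg_linearD[OF alg_linear_ops(1)])
  next
    case (Suc m)
    then have "pd i h \<in> harmonic m"
      using h harmonic_pd by blast
    then have "Lap_x (liftx ?g :: ('n, 'n) cfun) =
        cc (2 - 2 * (up_coeff CARD('n) (Suc m) * (2 * of_nat m + of_nat CARD('n)))) * liftx (pd i h)"
      unfolding 1 by (simp add: harmonic_Euler Suc) (simp add: fun_eq_iff pw algebra_simps)
    then show ?thesis
      by (simp add: up_coeff_Suc cc_hom)
  qed
  show "?g (t *\<^sub>R x) = of_real t ^ Suc k * ?g x" for t x
  proof (cases k)
    case 0
    then show ?thesis using h harmonic_pd_0[of h i] harmonicD(2)[OF h]
      by (simp add: pw crd_def)
  next
    case (Suc m)
    then have "pd i h \<in> harmonic m"
      using h harmonic_pd by blast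
    then show ?thesis
      using harmonicD(2)[OF h]
      by (simp add: Suc pw crd_def harmonicD(2) nrm2_scale power2_eq_square algebra_simps)
  qed
qed

lemma harmonic_rotate:
  fixes h :: "real^'n::finite \<Rightarrow> complex"
  assumes h: "h \<in> harmonic k" and a: "orthogonal_matrix a"
  shows "(\<lambda>x. h (matrix_inv a *v x)) \<in> harmonic k"
  unfolding harmonic_iff[where 'q = 'n]
proof (intro conjI allI)
  have "polynomial_function (h \<circ> (\<lambda>x. matrix_inv a *v x))"
    by (rule polynomial_function_compose[OF polynomial_function_bounded_linear[OF
        matrix_vector_mul_bounded_linear] harmonicD(1)[OF h]])
  then show "polynomial_function (\<lambda>x. h (matrix_inv a *v x))"
    by (simp add: o_def)
  have K: "(a, mat 1) \<in> (K_grp :: ('n, 'n) rmat2 set)"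
    using a by (simp add: K_grp_def orthogonal_matrix_id)
  have "liftx (\<lambda>x. h (matrix_inv a *v x)) = K_act (a, mat 1) (liftx h :: ('n, 'n) cfun)"
    by (simp add: liftx_def K_act_def fun_eq_iff)
  then show "Lap_x (liftx (\<lambda>x. h (matrix_inv a *v x)) :: ('n, 'n) cfun) = 0"
    using Lap_x_K_act[OF K harmonicD(3)[OF h]] harmonicD(4)[OF h, where 'q = 'n] by simp
  show "h (matrix_inv a *v (t *\<^sub>R x)) = of_real t ^ k * h (matrix_inv a *v x)" for t x
    using harmonicD(2)[OF h] by (simp add: matrix_vector_mult_scaleR)
qed

section \<open>Calculus on the spaces \<open>harmonic_tensor k l\<close>\<close>

lemma HT_induct [consumes 1, case_names zero step]:
  assumes "F \<in> harmonic_tensor k l" "P 0"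
    and "\<And>c h1 h2 F. h1 \<in> harmonic k \<Longrightarrow> h2 \<in> harmonic l \<Longrightarrow> F \<in> harmonic_tensor k l \<Longrightarrow> P F \<Longrightarrow>
      P (cc c * (liftx h1 * lifty h2) + F)"
  shows "P F"
proof -
  have "F \<in> harmonic_tensor k l \<and> P F"
    using assms(1) unfolding harmonic_tensor_def
  proof (induction rule: cfun.span_induct_alt)
    case (step c x y)
    then obtain h1 h2 where h: "x = liftx h1 * lifty h2" "h1 \<in> harmonic k" "h2 \<in> harmonic l"
      by (auto simp: liftx_def lifty_def times_fun_def)
    have "cscale c x + y \<in> harmonic_tensor k l"
      unfolding harmonic_tensor_def using step
      by (intro cfun.span_add cfun.span_scale) (auto intro: cfun.span_base)
    then show ?case
      using step assms(3)[OF h(2,3), of y c]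
      by (simp only: h(1) cscale_conv[of c "liftx h1 * lifty h2"] harmonic_tensor_def simp_thms)
  qed (use assms(2) cfun.span_zero in auto)
  then show ?thesis ..
qed

lemma HT_subspace: "cfun.subspace (harmonic_tensor k l)"
  by (simp add: harmonic_tensor_def)

lemma HT_add: "F \<in> harmonic_tensor k l \<Longrightarrow> G \<in> harmonic_tensor k l \<Longrightarrow> F + G \<in> harmonic_tensor k l"
  and HT_scale: "F \<in> harmonic_tensor k l \<Longrightarrow> cc c * F \<in> harmonic_tensor k l"
  and HT_0: "0 \<in> harmonic_tensor k l"
  using cfun.subspace_scale[OF HT_subspace, of F k l c]
  by (auto simp: cscale_conv[of c F] intro: cfun.subspace_add[OF HT_subspace] cfun.subspace_0[OF HT_subspace])

lemma HT_product: "h1 \<in> harmonic k \<Longrightarrow> h2 \<in> harmonic l \<Longrightarrow> liftx h1 * lifty h2 \<in> harmonic_tensor k l"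
  unfolding harmonic_tensor_def
  by (rule cfun.span_base) (auto simp: liftx_def lifty_def times_fun_def)

lemma lifty_alg: "polynomial_function h \<Longrightarrow> lifty h \<in> alg"
  using swp_alg[OF liftx_alg[of h]] by simp

lemma harmonic_alg:
  assumes "h \<in> harmonic k"
  shows "liftx h \<in> alg" "lifty h \<in> alg" "liftx (pd i h) \<in> alg" "lifty (pd i h) \<in> alg"
  using harmonicD(1)[OF assms] by (simp_all add: liftx_alg lifty_alg polynomial_pd)

lemma HT_alg: "F \<in> harmonic_tensor k l \<Longrightarrow> F \<in> alg"
  by (induction rule: HT_induct) (auto simp: harmonic_alg)

text \<open>Linear properties of \<open>harmonic_tensor\<close> are to be checked on products h1(x)
  h2(y). The target S is an arbitrary subspace, so that stability and, with S = {0}, operator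
  identities are both covered.\<close>

lemma HT_map:
  assumes A: "alg_linear A" and S: "cfun.subspace S"
    and prod: "\<And>h1 h2. h1 \<in> harmonic k \<Longrightarrow> h2 \<in> harmonic l \<Longrightarrow> A (liftx h1 * lifty h2) \<in> S"
    and "F \<in> harmonic_tensor k l"
  shows "A F \<in> S"
  using assms(4)
proof (induction rule: HT_induct)
  case zero
  show ?case using S by (simp add: alg_linearD[OF A] cfun.subspace_0)
next
  case (step c h1 h2 F)
  have "liftx h1 * lifty h2 \<in> alg" "F \<in> alg"
    using step by (auto simp: harmonic_alg HT_alg)
  then have "A (cc c * (liftx h1 * lifty h2) + F) = cscale c (A (liftx h1 * lifty h2)) + A F"
    by (simp add: alg_linearD(2,7)[OF A] cscale_conv)
  then show ?case
    using step prod S by (simp add: cfun.subspace_add cfun.subspace_scale)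
qed

lemma HT_kernel:
  assumes A: "alg_linear A"
    and prod: "\<And>h1 h2. h1 \<in> harmonic k \<Longrightarrow> h2 \<in> harmonic l \<Longrightarrow> A (liftx h1 * lifty h2) = 0"
    and "F \<in> harmonic_tensor k l"
  shows "A F = 0"
  using HT_map[OF A, of "{0}" k l F] assms(2,3) by (auto simp: cfun.subspace_def cscale_conv)

lemma HT_swp:
  fixes F :: "('p::finite, 'q::finite) cfun"
  shows "F \<in> harmonic_tensor k l \<Longrightarrow> swp F \<in> harmonic_tensor l k"
proof (induction rule: HT_induct)
  case (step c h1 h2 F)
  have "swp (cc c * (liftx h1 * lifty h2) + F) = cc c * (liftx h2 * lifty h1) + swp F"
    by (simp add: mult.commute)
  then show ?case
    using step by (simp only:) (intro HT_add HT_scale HT_product)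
qed (use HT_0 in simp)

text \<open>Two independent index types: in \<open>lift_simps\<close> the functions \<open>f\<close>
  and \<open>g\<close> have one common domain.\<close>

lemma dx_lifty [simp]: "dx i (lifty g :: ('p::finite, 'q::finite) cfun) = 0"
  and dy_liftx [simp]: "dy j (liftx f :: ('p, 'q) cfun) = 0"
  unfolding liftx_def lifty_def dx_def dy_def dir_deriv_fst dir_deriv_snd
  by (simp_all add: zero_fun_def)

lemma HT_Lap_x:
  assumes "F \<in> harmonic_tensor k l"
  shows "Lap_x F = 0"
proof (rule HT_kernel[OF alg_linear_ops(3) _ assms])
  fix h1 :: "real^'a \<Rightarrow> complex" and h2 :: "real^'b \<Rightarrow> complex"
  assume h: "h1 \<in> harmonic k" "h2 \<in> harmonic l"
  have "Lap_x (liftx h1 * lifty h2 :: ('a, 'b) cfun) = Lap_x (liftx h1) * lifty h2"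
    unfolding Lap_x_conv sum_distrib_right
    by (simp add: dx_mult harmonic_alg[OF h(1)] harmonic_alg[OF h(2)])
  then show "Lap_x (liftx h1 * lifty h2 :: ('a, 'b) cfun) = 0"
    using harmonicD(4)[OF h(1), where 'q = 'b] by simp
qed

lemma HT_Euler_x:
  fixes F :: "('p::finite, 'q::finite) cfun"
  assumes "F \<in> harmonic_tensor k l"
  shows "Euler_x F = cc (of_nat k) * F"
proof -
  have "Euler_x F - cc (of_nat k) * F = 0"
  proof (rule HT_kernel[OF alg_linear_diff[OF alg_linear_ops(1) alg_linear_mult] _ assms])
    fix h1 :: "real^'p \<Rightarrow> complex" and h2 :: "real^'q \<Rightarrow> complex"
    assume h: "h1 \<in> harmonic k" "h2 \<in> harmonic l"
    have "Euler_x (liftx h1 * lifty h2 :: ('p, 'q) cfun) = Euler_x (liftx h1) * lifty h2"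
      unfolding Euler_x_conv sum_distrib_right
      by (simp add: dx_mult harmonic_alg[OF h(1)] harmonic_alg[OF h(2)] mult.assoc)
    then show "Euler_x (liftx h1 * lifty h2 :: ('p, 'q) cfun) - cc (of_nat k) * (liftx h1 * lifty h2) = 0"
      using harmonic_Euler[OF h(1), where 'q = 'q] by (simp add: mult.assoc)
  qed simp
  then show ?thesis by simp
qed

lemma HT_dx:
  assumes "F \<in> harmonic_tensor (Suc k) l"
  shows "dx i F \<in> harmonic_tensor k l"
  by (rule HT_map[OF alg_linear_dx HT_subspace _ assms])
    (simp add: dx_mult harmonic_alg HT_product harmonic_pd)

lemma HT_dx_0:
  assumes "F \<in> harmonic_tensor 0 l"
  shows "dx i F = 0"
  by (rule HT_kernel[OF alg_linear_dx _ assms])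
    (simp add: dx_mult harmonic_alg harmonic_pd_0)

text \<open>The part of x_i F of degree k + 1, as in \<open>harmonic_up\<close>. Together
  \<open>up_x\<close> and \<open>dx\<close> make up multiplication by x_i (see
  \<open>xc_HT\<close>); they move k to k + 1 and to k - 1.\<close>

definition up_x :: "'p \<Rightarrow> nat \<Rightarrow> ('p::finite, 'q::finite) cfun \<Rightarrow> ('p, 'q) cfun" where
  "up_x i k F = xc i * F - cc (up_coeff CARD('p) k) * (rx2 * dx i F)"

lemma alg_linear_up_x: "alg_linear (up_x i k)"
  unfolding up_x_def[abs_def]
  by (intro alg_linear_diff alg_linear_mult alg_linear_cc_mult alg_linear_comp[OF alg_linear_mult]
      alg_linear_dx; simp)

lemma HT_up_x:
  fixes F :: "('p::finite, 'q::finite) cfun"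
  assumes "F \<in> harmonic_tensor k l"
  shows "up_x i k F \<in> harmonic_tensor (Suc k) l"
proof (rule HT_map[OF alg_linear_up_x HT_subspace _ assms])
  fix h1 :: "real^'p \<Rightarrow> complex" and h2 :: "real^'q \<Rightarrow> complex"
  assume h: "h1 \<in> harmonic k" "h2 \<in> harmonic l"
  have "up_x i k (liftx h1 * lifty h2 :: ('p, 'q) cfun) =
      liftx (crd i * h1 - cc (up_coeff CARD('p) k) * (nrm2 * pd i h1)) * lifty h2"
    by (simp add: up_x_def dx_mult harmonic_alg[OF h(1)] harmonic_alg[OF h(2)])
      (simp add: algebra_simps)
  then show "up_x i k (liftx h1 * lifty h2 :: ('p, 'q) cfun) \<in> harmonic_tensor (Suc k) l"
    using HT_product[OF harmonic_up[OF h(1)] h(2)] by simp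
qed

lemma HT_pi_pp:
  fixes F :: "('p::finite, 'q::finite) cfun"
  assumes "F \<in> harmonic_tensor k l"
  shows "pi_pp i j F \<in> harmonic_tensor k l"
proof (rule HT_map[OF alg_linear_ops(8) HT_subspace _ assms])
  fix h1 :: "real^'p \<Rightarrow> complex" and h2 :: "real^'q \<Rightarrow> complex"
  assume h: "h1 \<in> harmonic k" "h2 \<in> harmonic l"
  have "pi_pp i j (liftx h1 * lifty h2 :: ('p, 'q) cfun) =
      liftx (crd i * pd j h1 - crd j * pd i h1) * lifty h2"
    by (simp add: pi_pp_conv dx_mult harmonic_alg[OF h(1)] harmonic_alg[OF h(2)])
      (simp add: algebra_simps)
  then show "pi_pp i j (liftx h1 * lifty h2 :: ('p, 'q) cfun) \<in> harmonic_tensor k l"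
    using HT_product[OF harmonic_rot[OF h(1)] h(2)] by simp
qed

lemma HT_K_act:
  fixes F :: "('p::finite, 'q::finite) cfun"
  assumes "F \<in> harmonic_tensor k l" "g \<in> K_grp"
  shows "K_act g F \<in> harmonic_tensor k l"
proof (rule HT_map[OF alg_linear_K_act[OF assms(2)] HT_subspace _ assms(1)])
  fix h1 :: "real^'p \<Rightarrow> complex" and h2 :: "real^'q \<Rightarrow> complex"
  assume h: "h1 \<in> harmonic k" "h2 \<in> harmonic l"
  obtain a d where g: "g = (a, d)" "orthogonal_matrix a" "orthogonal_matrix d"
    using assms(2) by (auto simp: K_grp_def)
  have "K_act g (liftx h1 * lifty h2 :: ('p, 'q) cfun) =
      liftx (\<lambda>x. h1 (matrix_inv a *v x)) * lifty (\<lambda>y. h2 (matrix_inv d *v y))"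
    by (simp add: g(1) K_act_def liftx_def lifty_def fun_eq_iff pw)
  then show "K_act g (liftx h1 * lifty h2 :: ('p, 'q) cfun) \<in> harmonic_tensor k l"
    using HT_product[OF harmonic_rotate[OF h(1) g(2)] harmonic_rotate[OF h(2) g(3)]] by simp
qed

lemma HT_scaled:
  assumes "F \<in> harmonic_tensor k l"
  shows "F (s *\<^sub>R x, t *\<^sub>R y) = of_real s ^ k * of_real t ^ l * F (x, y)"
  using assms
proof (induction rule: HT_induct)
  case (step c h1 h2 F)
  then show ?case
    by (simp add: pw liftx_def lifty_def harmonicD(2) algebra_simps)
qed (simp add: pw)

lemma HT_pi_qq: "F \<in> harmonic_tensor k l \<Longrightarrow> pi_qq i j F \<in> harmonic_tensor k l"
  using HT_swp[OF HT_pi_pp[OF HT_swp[of F k l], of i j]] by (simp add: swp_ops)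

lemma HT_dy: "F \<in> harmonic_tensor k (Suc l) \<Longrightarrow> dy j F \<in> harmonic_tensor k l"
  using HT_swp[OF HT_dx[OF HT_swp[of F k "Suc l"], of j]] by (simp add: dx_swp)

lemma HT_dy_0: "F \<in> harmonic_tensor k 0 \<Longrightarrow> dy j F = 0"
  using HT_dx_0[OF HT_swp[of F k 0], of j] by (simp add: dx_swp)

definition up_y :: "'q \<Rightarrow> nat \<Rightarrow> ('p::finite, 'q::finite) cfun \<Rightarrow> ('p, 'q) cfun" where
  "up_y j l F = yc j * F - cc (up_coeff CARD('q) l) * (ry2 * dy j F)"

lemma up_x_swp: "up_x i k (swp F) = swp (up_y i k F)"
  by (simp add: up_x_def up_y_def dx_swp)

lemma HT_up_y: "F \<in> harmonic_tensor k l \<Longrightarrow> up_y j l F \<in> harmonic_tensor k (Suc l)"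
  using HT_swp[OF HT_up_x[OF HT_swp[of F k l], of j]] by (simp add: up_x_swp)

lemma Euler_x_dx:
  assumes "f \<in> alg" "Euler_x f = cc c * f"
  shows "Euler_x (dx i f) = cc (c - 1) * dx i f"
proof -
  have "Euler_x (dx i f) = dx i (Euler_x f) - dx i f"
    by (simp add: dx_Euler_x assms(1))
  then show ?thesis
    unfolding assms(2) using assms(1) by (simp add: dx_cc_mult cc_hom left_diff_distrib)
qed

text \<open>A product of two rotation fields contracted over one index. Summed over i = j it yields
  the Casimir eigenvalue; for fixed i and j it expresses the raised derivative
  \<open>up_x i k (dx j F)\<close> through the Lie algebra of O(p), which drives the proof of
  irreducibility.\<close>

lemma so_squares:
  fixes f :: "('p::finite, 'q::finite) cfun"
  assumes f: "f \<in> alg" "Lap_x f = 0" "Euler_x f = cc c * f"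
  shows "(\<Sum>a\<in>UNIV. pi_pp i a (pi_pp j a f)) =
    cc (3 - of_nat CARD('p) - c) * (xc i * dx j f) - cc (c - 1) * (xc j * dx i f)
    - (if i = j then 1 else 0) * (cc c * f) + rx2 * dx i (dx j f)"
proof -
  define G where "G a = xc j * dx a f - xc a * dx j f" for a
  have G: "G a \<in> alg" for a using f(1) by (simp add: G_def)
  have E: "Euler_x (dx i f) = cc (c - 1) * dx i f" for i
    by (rule Euler_x_dx[OF f(1,3)])
  have "(\<Sum>a\<in>UNIV. dx a (G a)) = (\<Sum>a\<in>UNIV. (if a = j then 1 else 0) * dx a f + xc j * dx a (dx a f)
      - dx j f - xc a * dx a (dx j f))"
    using f(1) by (simp add: G_def dx_diff dx_mult dx_xc) (simp add: algebra_simps)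
  also have "\<dots> = dx j f + xc j * Lap_x f - of_nat CARD('p) * dx j f - Euler_x (dx j f)"
    by (simp add: sum.distrib sum_subtractf sum_delta_fun Lap_x_conv Euler_x_conv sum_distrib_left[symmetric])
  finally have 1: "(\<Sum>a\<in>UNIV. dx a (G a)) = dx j f - of_nat CARD('p) * dx j f - cc (c - 1) * dx j f"
    by (simp add: f(2) E)
  have "(\<Sum>a\<in>UNIV. xc a * dx i (G a)) = (\<Sum>a\<in>UNIV. (if i = j then 1 else 0) * (xc a * dx a f)
      + xc j * (xc a * dx a (dx i f)) - (if i = a then 1 else 0) * (xc a * dx j f) - xc a * xc a * dx i (dx j f))"
    using f(1) by (simp add: G_def dx_diff dx_mult dx_xc dx_dx[of f i]) (simp add: algebra_simps)
  also have "\<dots> = (if i = j then 1 else 0) * Euler_x f + xc j * Euler_x (dx i f) - xc i * dx j f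
      - rx2 * dx i (dx j f)"
    by (simp add: sum.distrib sum_subtractf sum_delta_fun rx2_conv Euler_x_conv
        sum_distrib_left[symmetric] sum_distrib_right[symmetric])
  finally have 2: "(\<Sum>a\<in>UNIV. xc a * dx i (G a)) = (if i = j then 1 else 0) * (cc c * f)
      + xc j * (cc (c - 1) * dx i f) - xc i * dx j f - rx2 * dx i (dx j f)"
    by (simp add: f(3) E)
  have "(\<Sum>a\<in>UNIV. pi_pp i a (pi_pp j a f)) = xc i * (\<Sum>a\<in>UNIV. dx a (G a)) - (\<Sum>a\<in>UNIV. xc a * dx i (G a))"
    by (simp add: pi_pp_conv G_def[symmetric] sum_subtractf sum_distrib_left)
  then show ?thesis
    unfolding 1 2 by (simp add: fun_eq_iff pw algebra_simps)
qed

text \<open>Ordered pairs are summed, so this is twice the spherical Laplacian: the eigenvalue in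
  degree k is -2 k (k + p - 2).\<close>

definition Casimir_x :: "('p::finite, 'q::finite) cfun \<Rightarrow> ('p, 'q) cfun" where
  "Casimir_x f = (\<Sum>i\<in>UNIV. \<Sum>a\<in>UNIV. pi_pp i a (pi_pp i a f))"

definition Casimir_y :: "('p::finite, 'q::finite) cfun \<Rightarrow> ('p, 'q) cfun" where
  "Casimir_y f = (\<Sum>i\<in>UNIV. \<Sum>a\<in>UNIV. pi_qq i a (pi_qq i a f))"

lemma Casimir_swp: "Casimir_x (swp f) = swp (Casimir_y f)"
  by (simp add: Casimir_x_def Casimir_y_def swp_ops swp_sum)

lemma Casimir_x_HT:
  fixes F :: "('p::finite, 'q::finite) cfun"
  assumes "F \<in> harmonic_tensor k l"
  shows "Casimir_x F = cc (2 * of_nat k * (2 - of_nat CARD('p) - of_nat k)) * F"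
proof -
  define E where "E = (\<Sum>i\<in>UNIV. xc i * dx i F)"
  have E: "E = cc (of_nat k) * F"
    using HT_Euler_x[OF assms] by (simp add: E_def Euler_x_conv)
  have L: "(\<Sum>i\<in>UNIV. dx i (dx i F)) = 0"
    using HT_Lap_x[OF assms] by (simp add: Lap_x_conv)
  have "Casimir_x F = cc (3 - of_nat CARD('p) - of_nat k) * E - cc (of_nat k - 1) * E
      - of_nat CARD('p) * (cc (of_nat k) * F) + rx2 * (\<Sum>i\<in>UNIV. dx i (dx i F))"
    unfolding Casimir_x_def E_def
    using so_squares[OF HT_alg[OF assms] HT_Lap_x[OF assms] HT_Euler_x[OF assms]]
    by (simp add: sum.distrib sum_subtractf sum_distrib_left[symmetric])
  then show ?thesis
    unfolding E L by (simp add: fun_eq_iff pw algebra_simps)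
qed

lemma Casimir_y_HT:
  fixes F :: "('p::finite, 'q::finite) cfun"
  assumes "F \<in> harmonic_tensor k l"
  shows "Casimir_y F = cc (2 * of_nat l * (2 - of_nat CARD('q) - of_nat l)) * F"
  using arg_cong[OF Casimir_x_HT[OF HT_swp[OF assms]], of swp]
  by (simp add: Casimir_swp)

subsection \<open>Irreducibility of \<open>\<H>\<^sup>k \<otimes> \<H>\<^sup>l\<close>\<close>

text \<open>The group is required besides its Lie algebra: under so(2) the space of harmonic
  polynomials of degree k >= 1 on the plane splits into two lines, and reflections join
  them.\<close>

definition KL_stable :: "('p::finite, 'q::finite) cfun set \<Rightarrow> bool" where
  "KL_stable W \<longleftrightarrow> cfun.subspace W \<and> (\<forall>F\<in>W. \<forall>i j. pi_pp i j F \<in> W) \<and>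
     (\<forall>F\<in>W. \<forall>i j. pi_qq i j F \<in> W) \<and> (\<forall>F\<in>W. \<forall>g\<in>K_grp. K_act g F \<in> W)"

definition KL_irreducible :: "('p::finite, 'q::finite) cfun set \<Rightarrow> bool" where
  "KL_irreducible V \<longleftrightarrow> (\<forall>W\<subseteq>V. KL_stable W \<longrightarrow> W = {0} \<or> W = V)"

lemma subspace_cc_mult: "cfun.subspace W \<Longrightarrow> F \<in> W \<Longrightarrow> cc c * F \<in> W"
  using cfun.subspace_scale[of W F c] by (simp add: cscale_conv)

lemma KL_stable_swp:
  fixes W :: "('p::finite, 'q::finite) cfun set"
  assumes "KL_stable W"
  shows "KL_stable (swp ` W)"
proof -
  have "cfun.subspace (swp ` W)"
  proof (rule cfun.subspaceI)
    have sub: "cfun.subspace W" using assms by (simp add: KL_stable_def)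
    show "0 \<in> swp ` W"
      using cfun.subspace_0[OF sub] by (rule rev_image_eqI) simp
    fix f g c assume "f \<in> swp ` W"
    then obtain f' where f: "f' \<in> W" "f = swp f'" by blast
    have "swp (cscale c f') \<in> swp ` W"
      using cfun.subspace_scale[OF sub f(1)] by (rule imageI)
    then show "cscale c f \<in> swp ` W" by (simp add: f(2))
    assume "g \<in> swp ` W"
    then obtain g' where g: "g' \<in> W" "g = swp g'" by blast
    have "swp (f' + g') \<in> swp ` W"
      using cfun.subspace_add[OF sub f(1) g(1)] by (rule imageI)
    then show "f + g \<in> swp ` W" by (simp add: f(2) g(2))
  qed
  moreover have "K_act g (swp F) \<in> swp ` W" if "F \<in> W" "g \<in> K_grp" for F g
  proof -
    have "K_act (snd g, fst g) F \<in> W"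
      using assms that K_grp_swap[of "fst g" "snd g"] by (simp add: KL_stable_def)
    then show ?thesis
      using K_act_swp[of "fst g" "snd g" F] by simp
  qed
  ultimately show ?thesis
    using assms by (auto simp: KL_stable_def swp_ops)
qed

lemma KL_irreducible_swp:
  fixes V :: "('p::finite, 'q::finite) cfun set"
  assumes V: "KL_irreducible V"
  shows "KL_irreducible (swp ` V)"
  unfolding KL_irreducible_def
proof (intro allI impI)
  fix W :: "('q, 'p) cfun set" assume W: "W \<subseteq> swp ` V" "KL_stable W"
  have "swp ` W \<subseteq> V"
    using W(1) by auto
  then have "swp ` W = {0} \<or> swp ` W = V"
    using V KL_stable_swp[OF W(2)] by (auto simp: KL_irreducible_def)
  moreover have "W = swp ` swp ` W"
    by (auto simp: image_image)
  ultimately show "W = {0} \<or> W = swp ` V"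
    by (metis image_empty image_insert swp_simps(5))
qed

lemma HT_swp_image: "swp ` (harmonic_tensor k l :: ('p::finite, 'q::finite) cfun set) = harmonic_tensor l k"
proof
  show "harmonic_tensor l k \<subseteq> swp ` (harmonic_tensor k l :: ('p, 'q) cfun set)"
  proof
    fix F :: "('q, 'p) cfun" assume "F \<in> harmonic_tensor l k"
    then have "F = swp (swp F)" "swp F \<in> harmonic_tensor k l"
      using HT_swp by auto
    then show "F \<in> swp ` (harmonic_tensor k l :: ('p, 'q) cfun set)"
      by blast
  qed
qed (use HT_swp in auto)

lemma span_map:
  assumes A: "alg_linear A" and S: "cfun.subspace S" and X: "X \<subseteq> alg"
    and gen: "\<And>f. f \<in> X \<Longrightarrow> A f \<in> S" and "f \<in> cfun.span X"
  shows "A f \<in> S"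
proof -
  have "f \<in> alg \<and> A f \<in> S"
    using assms(5)
  proof (induction rule: cfun.span_induct_alt)
    case base
    then show ?case using cfun.subspace_0[OF S] by (simp add: alg_linearD(4)[OF A])
  next
    case (step c x y)
    then show ?case
      using X gen by (auto simp: alg_linearD(2,3)[OF A] subsetD intro!: cfun.subspace_add[OF S] cfun.subspace_scale[OF S])
  qed
  then show ?thesis ..
qed

text \<open>The commutator of a rotation field with \<partial>_i is again a combination of partial
  derivatives, whence the span of all derivatives of a stable space is stable.\<close>

lemma pi_pp_dx:
  assumes "f \<in> alg"
  shows "pi_pp a b (dx i f) = dx i (pi_pp a b f) - (if i = a then 1 else 0) * dx b f
    + (if i = b then 1 else 0) * dx a f"
  using assms by (simp add: pi_pp_conv dx_diff dx_mult dx_xc dx_dx[of f i])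

lemma pi_qq_dx: "f \<in> alg \<Longrightarrow> pi_qq a b (dx i f) = dx i (pi_qq a b f)"
  by (simp add: pi_qq_conv dx_diff dx_mult dy_dx)

lemma HT_0_indep:
  assumes "G \<in> harmonic_tensor 0 l"
  shows "G (x, y) = G (0, y)"
  using HT_scaled[OF assms, of 0 x 1 y] by simp

definition refl_mat :: "'n \<Rightarrow> real^'n::finite^'n" where
  "refl_mat j = (\<chi> a b. if a = b then (if a = j then -1 else 1) else 0)"

lemma refl_mat_orthogonal: "orthogonal_matrix (refl_mat j)"
proof -
  have "transpose (refl_mat j) ** refl_mat j = mat 1"
  proof -
    have "(if k = a then (if k = j then -1 else 1) else 0) * (if k = b then (if k = j then -1 else 1) else 0)
        = (if k = a then (if a = b then 1 else 0) else (0::real))" for k a b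
      by auto
    then show ?thesis
      by (simp add: refl_mat_def transpose_def matrix_matrix_mult_def mat_def vec_eq_iff)
  qed
  then show ?thesis by (simp add: orthogonal_matrix)
qed

lemma refl_K_grp: "(refl_mat j, mat 1) \<in> K_grp"
  by (simp add: K_grp_def refl_mat_orthogonal orthogonal_matrix_id)

text \<open>In degree one F is a sum of terms x_a F_a with F_a free of x, so the reflection in the
  j-th coordinate changes the sign of a single summand.\<close>

lemma HT_1_reflect:
  fixes F :: "('p::finite, 'q::finite) cfun"
  assumes F: "F \<in> harmonic_tensor (Suc 0) l"
  shows "F - K_act (refl_mat j, mat 1) F = cc 2 * (xc j * dx j F)"
proof -
  let ?K = "K_act (refl_mat j, mat 1) :: ('p, 'q) cfun \<Rightarrow> _"
  have E: "F = (\<Sum>a\<in>UNIV. xc a * dx a F)"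
    using HT_Euler_x[OF F] by (simp add: Euler_x_conv cc_hom)
  have d: "?K (dx a F) = dx a F" for a
  proof (rule ext)
    fix v
    have "?K (dx a F) v = dx a F (transpose (refl_mat j) *v fst v, snd v)"
      by (simp add: K_act_eq[OF refl_K_grp] transpose_mat del: transpose_matrix_vector)
    also have "\<dots> = dx a F (0, snd v)"
      by (rule HT_0_indep[OF HT_dx[OF F]])
    also have "\<dots> = dx a F (fst v, snd v)"
      by (rule HT_0_indep[OF HT_dx[OF F], symmetric])
    finally show "?K (dx a F) v = dx a F v" by simp
  qed
  have x: "?K (xc a) = xc a - (if a = j then 1 else 0) * (cc 2 * xc j)" for a
  proof -
    have "?K (xc a) = (\<Sum>r\<in>UNIV. (if r = a then 1 else 0) * (cc (of_real (if a = j then -1 else 1)) * xc r))"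
      unfolding K_act_xc[OF refl_K_grp]
      by (intro sum.cong refl) (auto simp: refl_mat_def cc_hom)
    also have "\<dots> = cc (of_real (if a = j then -1 else 1)) * xc a"
      by (rule sum_delta_fun)
    also have "\<dots> = xc a - (if a = j then 1 else 0) * (cc 2 * xc j)"
      by (auto simp: fun_eq_iff pw)
    finally show ?thesis .
  qed
  have "?K F = (\<Sum>a\<in>UNIV. ?K (xc a) * ?K (dx a F))"
    by (subst E) (simp add: K_act_sum)
  also have "\<dots> = (\<Sum>a\<in>UNIV. xc a * dx a F - (if a = j then 1 else 0) * (cc 2 * (xc j * dx a F)))"
    by (simp add: d x algebra_simps)
  also have "\<dots> = F - cc 2 * (xc j * dx j F)"
    using E by (simp add: sum_subtractf sum_delta_fun)
  finally show ?thesis by simp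
qed

text \<open>Euler's identity; the correction terms of \<open>up_x\<close> add up to a multiple of
  the Laplacian of G and vanish.\<close>

lemma up_x_dx_sum:
  fixes G :: "('p::finite, 'q::finite) cfun"
  assumes "G \<in> harmonic_tensor (Suc k) l"
  shows "(\<Sum>i\<in>UNIV. up_x i k (dx i G)) = cc (of_nat (Suc k)) * G"
proof -
  have "(\<Sum>i\<in>UNIV. up_x i k (dx i G)) = Euler_x G - cc (up_coeff CARD('p) k) * (rx2 * Lap_x G)"
    by (simp add: up_x_def Euler_x_conv Lap_x_conv sum_subtractf sum_distrib_left)
  then show ?thesis
    by (simp add: HT_Euler_x[OF assms] HT_Lap_x[OF assms])
qed

lemma HT_dx_nonzero:
  assumes "F \<in> harmonic_tensor (Suc k) l" "F \<noteq> 0"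
  shows "\<exists>i. dx i F \<noteq> 0"
proof (rule ccontr)
  assume "\<nexists>i. dx i F \<noteq> 0"
  then have "cc (of_nat (Suc k)) * F = 0"
    using HT_Euler_x[OF assms(1)] by (simp add: Euler_x_conv)
  then show False
    using assms(2) by (auto simp: fun_eq_iff pw simp del: of_nat_Suc)
qed

text \<open>By \<open>so_squares\<close>, with L_ij the rotation fields, - (2 k + p - 2)
  \<open>up_x i k (dx j F)\<close> equals \<Sum>_a L_ia L_ja F - k L_ij F + \<delta>_ij (k + 1) F
  and so lies in W. The factor 2 k + p - 2 vanishes for k = 0 and p = 2; therefore degree one is
  treated by reflections.\<close>

lemma up_x_dx_mem:
  fixes W :: "('p::finite, 'q::finite) cfun set"
  assumes W: "KL_stable W" "W \<subseteq> harmonic_tensor (Suc k) l" and F: "F \<in> W"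
  shows "up_x i k (dx j F) \<in> W"
proof -
  have sub: "cfun.subspace W" and pp: "\<And>F i j. F \<in> W \<Longrightarrow> pi_pp i j F \<in> W"
    and K: "\<And>F g. F \<in> W \<Longrightarrow> g \<in> K_grp \<Longrightarrow> K_act g F \<in> W"
    using W(1) by (auto simp: KL_stable_def)
  have HT: "F \<in> harmonic_tensor (Suc k) l" using W F by blast
  note alg = HT_alg[OF HT]
  show ?thesis
  proof (cases k)
    case 0
    note HT1 = HT[unfolded 0]
    have dd: "dx a (dx b F) = 0" for a b
      by (rule HT_dx_0[OF HT_dx[OF HT1]])
    have "F - K_act (refl_mat j, mat 1) F \<in> W"
      by (intro cfun.subspace_diff[OF sub] F K refl_K_grp)
    then have "cc (1/2) * (cc 2 * (xc j * dx j F)) \<in> W"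
      unfolding HT_1_reflect[OF HT1] by (rule subspace_cc_mult[OF sub])
    moreover have "cc (1/2) * (cc 2 * (xc j * dx j F)) = xc j * dx j F"
      by (simp add: fun_eq_iff pw)
    ultimately have m: "xc j * dx j F \<in> W" by simp
    \<comment> \<open>The rotation field L_ij sends x_j to x_i and annihilates the factor free of
      x.\<close>
    have "xc i * dx j F \<in> W"
    proof (cases "i = j")
      case False
      then have "pi_pp i j (xc j * dx j F) = xc i * dx j F"
        using alg by (simp add: pi_pp_conv dx_mult dx_xc dd)
      then show ?thesis using pp[OF m, of i j] by simp
    qed (use m in simp)
    then show ?thesis
      by (simp add: 0 up_x_def dd)
  next
    case (Suc k')
    define u where "u = (2 * of_nat k + of_nat CARD('p) - 2 :: complex)"
    have u: "u \<noteq> 0"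
      using of_nat_eq_0_iff[of "2 * k' + CARD('p)", where 'a = complex] by (simp add: u_def Suc)
    have "(\<Sum>a\<in>UNIV. pi_pp i a (pi_pp j a F)) - cc (of_nat k) * pi_pp i j F
        + (if i = j then 1 else 0) * (cc (of_nat (Suc k)) * F) \<in> W"
      using F sub pp
      by (intro cfun.subspace_add cfun.subspace_diff cfun.subspace_sum subspace_cc_mult)
        (auto intro!: subspace_cc_mult cfun.subspace_0)
    moreover have "(\<Sum>a\<in>UNIV. pi_pp i a (pi_pp j a F)) - cc (of_nat k) * pi_pp i j F
        + (if i = j then 1 else 0) * (cc (of_nat (Suc k)) * F) = cc (- u) * up_x i k (dx j F)"
    proof -
      have "u * (up_coeff CARD('p) k * z) = z" for z
        using u by (simp add: up_coeff_def u_def)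
      then have "cc (- u) * up_x i k (dx j F) = cc (- u) * (xc i * dx j F) + rx2 * dx i (dx j F)"
        by (simp add: up_x_def fun_eq_iff pw right_diff_distrib)
      then show ?thesis
        unfolding so_squares[OF alg HT_Lap_x[OF HT] HT_Euler_x[OF HT]]
        by (simp add: pi_pp_conv u_def fun_eq_iff pw algebra_simps)
    qed
    ultimately have "cc (- (1 / u)) * (cc (- u) * up_x i k (dx j F)) \<in> W"
      using subspace_cc_mult[OF sub] by metis
    moreover have "cc (- (1 / u)) * (cc (- u) * up_x i k (dx j F)) = up_x i k (dx j F)"
      using u by (simp add: fun_eq_iff pw)
    ultimately show ?thesis by simp
  qed
qed

text \<open>The first derivatives of W span a nonzero stable subspace in degree k, which is
  everything by the induction hypothesis. Raising sends all of degree k into W, and Euler's identity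
  writes each G of degree k + 1 as a multiple of a sum of raised derivatives.\<close>

lemma KL_irreducible_Suc:
  assumes IH: "KL_irreducible (harmonic_tensor k l :: ('p::finite, 'q::finite) cfun set)"
  shows "KL_irreducible (harmonic_tensor (Suc k) l :: ('p, 'q) cfun set)"
  unfolding KL_irreducible_def
proof (intro allI impI)
  fix W :: "('p, 'q) cfun set"
  assume W: "W \<subseteq> harmonic_tensor (Suc k) l" "KL_stable W"
  have sub: "cfun.subspace W" and pp: "\<And>F i j. F \<in> W \<Longrightarrow> pi_pp i j F \<in> W"
    and qq: "\<And>F i j. F \<in> W \<Longrightarrow> pi_qq i j F \<in> W" and K: "\<And>F g. F \<in> W \<Longrightarrow> g \<in> K_grp \<Longrightarrow> K_act g F \<in> W"
    using W(2) by (auto simp: KL_stable_def)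
  show "W = {0} \<or> W = harmonic_tensor (Suc k) l"
  proof (cases "W = {0}")
    case False
    then obtain F0 where F0: "F0 \<in> W" "F0 \<noteq> 0"
      using cfun.subspace_0[OF sub] by auto
    define X where "X = {dx i F | i F. F \<in> W}"
    define W' where "W' = cfun.span X"
    have sub': "cfun.subspace W'" by (simp add: W'_def)
    have W_alg: "W \<subseteq> alg" using W(1) HT_alg by blast
    have X_HT: "X \<subseteq> harmonic_tensor k l"
      using W(1) by (auto simp: X_def intro!: HT_dx)
    have X_alg: "X \<subseteq> alg" using X_HT HT_alg by blast
    have gen: "dx i F \<in> W'" if "F \<in> W" for i F
      unfolding W'_def using that by (intro cfun.span_base) (auto simp: X_def)
    have "W' \<subseteq> harmonic_tensor k l"
      unfolding W'_def by (rule cfun.span_minimal[OF X_HT HT_subspace])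
    moreover have "KL_stable W'"
      unfolding KL_stable_def
    proof (intro conjI ballI allI sub')
      fix f assume f: "f \<in> W'"
      show "pi_pp a b f \<in> W'" for a b
      proof (rule span_map[OF alg_linear_ops(8) sub' X_alg _ f[unfolded W'_def]])
        fix f assume "f \<in> X"
        then obtain i F where f: "f = dx i F" "F \<in> W" by (auto simp: X_def)
        show "pi_pp a b f \<in> W'"
          unfolding f(1) pi_pp_dx[OF subsetD[OF W_alg f(2)]]
          by (intro cfun.subspace_add[OF sub'] cfun.subspace_diff[OF sub'] gen pp f)
            (auto intro: gen f cfun.subspace_0[OF sub'])
      qed
      show "pi_qq a b f \<in> W'" for a b
      proof (rule span_map[OF alg_linear_ops(9) sub' X_alg _ f[unfolded W'_def]])
        fix f assume "f \<in> X"
        then obtain i F where f: "f = dx i F" "F \<in> W" by (auto simp: X_def)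
        show "pi_qq a b f \<in> W'"
          unfolding f(1) pi_qq_dx[OF subsetD[OF W_alg f(2)]] by (intro gen qq f)
      qed
      fix g :: "('p, 'q) rmat2" assume g: "g \<in> K_grp"
      show "K_act g f \<in> W'"
      proof (rule span_map[OF alg_linear_K_act[OF g] sub' X_alg _ f[unfolded W'_def]])
        fix f assume "f \<in> X"
        then obtain i F where f: "f = dx i F" "F \<in> W" by (auto simp: X_def)
        obtain a d where ad: "g = (a, d)" by fastforce
        show "K_act g f \<in> W'"
          using g unfolding f(1) ad
          by (subst K_act_dx[OF _ subsetD[OF W_alg f(2)]])
            (auto intro!: cfun.subspace_sum[OF sub'] subspace_cc_mult[OF sub'] gen K f)
      qed
    qed
    moreover have "W' \<noteq> {0}"
      using HT_dx_nonzero[OF subsetD[OF W(1) F0(1)] F0(2)] gen[OF F0(1)] by auto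
    ultimately have W': "W' = harmonic_tensor k l"
      using IH by (auto simp: KL_irreducible_def)
    have up: "up_x i k f \<in> W" if "f \<in> harmonic_tensor k l" for i f
      by (rule span_map[OF alg_linear_up_x sub X_alg _ that[folded W', unfolded W'_def]])
        (use up_x_dx_mem[OF W(2,1)] in \<open>auto simp: X_def\<close>)
    have "G \<in> W" if G: "G \<in> harmonic_tensor (Suc k) l" for G
    proof -
      have "(\<Sum>i\<in>UNIV. up_x i k (dx i G)) \<in> W"
        by (intro cfun.subspace_sum[OF sub] up HT_dx[OF G])
      then have "cc (1 / of_nat (Suc k)) * (cc (of_nat (Suc k)) * G) \<in> W"
        unfolding up_x_dx_sum[OF G] by (rule subspace_cc_mult[OF sub])
      moreover have "cc (1 / of_nat (Suc k)) * (cc (of_nat (Suc k)) * G) = G"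
        by (simp add: fun_eq_iff pw del: of_nat_Suc)
      ultimately show ?thesis by simp
    qed
    then show ?thesis using W(1) by auto
  qed simp
qed

lemma KL_irreducible_0:
  "KL_irreducible (harmonic_tensor 0 0 :: ('p::finite, 'q::finite) cfun set)"
  unfolding KL_irreducible_def
proof (intro allI impI)
  fix W :: "('p, 'q) cfun set"
  assume W: "W \<subseteq> harmonic_tensor 0 0" "KL_stable W"
  have const: "\<exists>c. F = cc c" if "F \<in> harmonic_tensor 0 0" for F :: "('p, 'q) cfun"
  proof -
    have "F (x, y) = F (0, 0)" for x y
      using HT_scaled[OF that, of 0 x 0 y] by simp
    then have "F = cc (F (0, 0))"
      by (auto simp: fun_eq_iff pw)
    then show ?thesis by blast
  qed
  have sub: "cfun.subspace W" using W(2) by (simp add: KL_stable_def)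
  show "W = {0} \<or> W = harmonic_tensor 0 0"
  proof (cases "W = {0}")
    case False
    then obtain F0 where F0: "F0 \<in> W" "F0 \<noteq> 0"
      using cfun.subspace_0[OF sub] by auto
    then obtain c where c: "F0 = cc c" "c \<noteq> 0"
      using const W(1) by (metis cc_hom(1) subsetD)
    have "G \<in> W" if G: "G \<in> harmonic_tensor 0 0" for G
    proof -
      obtain b where "G = cc b" using const[OF G] by blast
      then have "G = cc (b / c) * F0"
        using c by (simp add: fun_eq_iff pw)
      then show ?thesis using subspace_cc_mult[OF sub F0(1)] by simp
    qed
    then show ?thesis using W(1) by auto
  qed simp
qed

lemma KL_irreducible_HT:
  "KL_irreducible (harmonic_tensor k l :: ('p::finite, 'q::finite) cfun set)"
proof -
  have x: "KL_irreducible (harmonic_tensor k l :: ('p::finite, 'q::finite) cfun set)"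
    if "KL_irreducible (harmonic_tensor 0 l :: ('p, 'q) cfun set)" for k l
    using that by (induction k) (auto intro: KL_irreducible_Suc)
  \<comment> \<open>The induction raises the x-degree only, so the y-degree is built up first in the
    exchanged spaces.\<close>
  have "KL_irreducible (harmonic_tensor l 0 :: ('q, 'p) cfun set)"
    by (induction l) (auto intro: KL_irreducible_Suc KL_irreducible_0)
  then have "KL_irreducible (harmonic_tensor 0 l :: ('p, 'q) cfun set)"
    using KL_irreducible_swp[of "harmonic_tensor l 0 :: ('q, 'p) cfun set"]
    by (simp add: HT_swp_image)
  then show ?thesis by (rule x)
qed

text \<open>The divergence of the raised vectors is (n + k - 2 k u) F with n = p and u =
  \<open>up_coeff n k\<close>. For k >= 1, clearing the denominator, it vanishes only if (n + k) (2
  k + n - 2) = 2 k, impossible for n >= 2. For n = k = 1 equality holds: x^2 is not harmonic on the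
  line.\<close>

lemma HT_up_x_nonzero:
  fixes F :: "('p::finite, 'q::finite) cfun"
  assumes F: "F \<in> harmonic_tensor k l" "F \<noteq> 0" and p: "CARD('p) \<ge> 2"
  shows "\<exists>i. up_x i k F \<noteq> 0"
proof (rule ccontr)
  assume "\<nexists>i. up_x i k F \<noteq> 0"
  then have 0: "(\<Sum>i\<in>UNIV. dx i (up_x i k F)) = 0" by simp
  note alg = HT_alg[OF F(1)]
  define u where "u = up_coeff CARD('p) k"
  have "dx i (up_x i k F) = F + xc i * dx i F - cc u * (cc 2 * (xc i * dx i F) + rx2 * dx i (dx i F))" for i
    using alg by (simp add: up_x_def u_def dx_diff dx_mult dx_xc mult.assoc)
  then have "(\<Sum>i\<in>UNIV. dx i (up_x i k F)) =
      of_nat CARD('p) * F + Euler_x F - cc u * (cc 2 * Euler_x F + rx2 * Lap_x F)"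
    by (simp add: sum.distrib sum_subtractf Euler_x_conv Lap_x_conv sum_distrib_left[symmetric])
  then have "cc (of_nat CARD('p) + of_nat k - 2 * u * of_nat k) * F = 0"
    using 0 by (simp add: HT_Euler_x[OF F(1)] HT_Lap_x[OF F(1)]) (simp add: fun_eq_iff pw algebra_simps)
  then have e: "of_nat CARD('p) + of_nat k - 2 * u * of_nat k = 0"
    using F(2) by (auto simp: fun_eq_iff pw)
  show False
  proof (cases k)
    case 0
    then show False using e p by simp
  next
    case (Suc k')
    define n where "n = CARD('p) - 2"
    have n: "CARD('p) = n + 2" using p by (simp add: n_def)
    have "u * (2 * of_nat k' + of_nat CARD('p)) = 1"
      unfolding u_def Suc by (rule up_coeff_Suc) simp
    then have "(of_nat CARD('p) + of_nat k) * (2 * of_nat k' + of_nat CARD('p)) - 2 * of_nat k = (0 :: complex)"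
      using e by algebra
    then have "of_nat ((CARD('p) + k) * (2 * k' + CARD('p))) = (of_nat (2 * k) :: complex)"
      by simp
    then have "(CARD('p) + k) * (2 * k' + CARD('p)) = 2 * k"
      by (simp only: of_nat_eq_iff)
    then show False
      by (simp add: n Suc algebra_simps)
  qed
qed

lemma HT_dy_nonzero:
  assumes "F \<in> harmonic_tensor k (Suc l)" "F \<noteq> 0"
  shows "\<exists>j. dy j F \<noteq> 0"
  using HT_dx_nonzero[OF HT_swp[OF assms(1)]] assms(2) by (simp add: dx_swp)

lemma HT_up_y_nonzero:
  fixes F :: "('p::finite, 'q::finite) cfun"
  assumes F: "F \<in> harmonic_tensor k l" "F \<noteq> 0" and q: "CARD('q) \<ge> 2"
  shows "\<exists>j. up_y j l F \<noteq> 0"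
  using HT_up_x_nonzero[OF HT_swp[OF F(1)] _ q] F(2) by (simp add: up_x_swp)

lemma cc_harmonic: "cc c \<in> (harmonic 0 :: (real^'n::finite \<Rightarrow> complex) set)"
  by (simp add: harmonic_iff[where 'q = 'n] complex_polynomial_cc Lap_x_conv) (simp add: pw)

lemma HT_nonzero:
  assumes p: "CARD('p::finite) \<ge> 2" and q: "CARD('q::finite) \<ge> 2"
  shows "\<exists>F \<in> (harmonic_tensor k l :: ('p, 'q) cfun set). F \<noteq> 0"
proof (induction k)
  case 0
  show ?case
  proof (induction l)
    case 0
    have "liftx (cc 1) * lifty (cc 1) \<in> (harmonic_tensor 0 0 :: ('p, 'q) cfun set)"
      by (intro HT_product cc_harmonic)
    moreover have "liftx (cc 1) * lifty (cc 1) \<noteq> (0 :: ('p, 'q) cfun)"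
      by (simp add: fun_eq_iff liftx_def lifty_def pw)
    ultimately show ?case by blast
  next
    case (Suc l)
    then show ?case using HT_up_y_nonzero[OF _ _ q] HT_up_y by blast
  qed
next
  case (Suc k)
  then show ?case using HT_up_x_nonzero[OF _ _ p] HT_up_x by blast
qed

subsection \<open>Isotypic components of \<open>\<E>\<close>\<close>

definition R :: "nat \<Rightarrow> nat \<Rightarrow> complex \<Rightarrow> ('p::finite, 'q::finite) cfun" where
  "R a b \<alpha> = rho_x ^ a * rho_y ^ b * psi \<alpha>"

lemma R_alg [simp, intro]: "\<alpha> \<notin> \<int>\<^sub>\<le>\<^sub>0 \<Longrightarrow> R a b \<alpha> \<in> alg"
  by (simp add: R_def)

lemma swp_R [simp]: "swp (R a b \<alpha>) = R b a \<alpha>"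
  by (simp add: R_def mult_ac)

lemma rho_R: "rho_x * R a b \<alpha> = R (Suc a) b \<alpha>" "rho_y * R a b \<alpha> = R a (Suc b) \<alpha>"
  by (simp_all add: R_def mult_ac)

lemma K_act_R [simp]: "g \<in> K_grp \<Longrightarrow> K_act g (R a b \<alpha>) = R a b \<alpha>"
  by (simp add: R_def)

lemma R_contiguous:
  assumes "\<alpha> \<notin> \<int>\<^sub>\<le>\<^sub>0"
  shows "cc \<alpha> * R a b \<alpha> = cc \<alpha> * R a b (\<alpha> + 1) - cc (1 / (\<alpha> + 1)) * R (Suc a) (Suc b) (\<alpha> + 2)"
proof (rule ext)
  fix v
  define z where "z = rho_x v ^ a * rho_y v ^ b"
  show "(cc \<alpha> * R a b \<alpha>) v =
      (cc \<alpha> * R a b (\<alpha> + 1) - cc (1 / (\<alpha> + 1)) * R (Suc a) (Suc b) (\<alpha> + 2)) v"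
    using arg_cong[OF Psi_contiguous[OF assms, of "rho_x v * rho_y v"], of "\<lambda>w. z * w"]
    by (simp add: R_def pw psi_def z_def algebra_simps)
qed

lemma dx_power: "f \<in> alg \<Longrightarrow> dx i (f ^ n) = cc (of_nat n) * (f ^ (n - 1) * dx i f)"
proof (induction n)
  case (Suc n)
  have "dx i (f ^ Suc n) = dx i f * f ^ n + f * dx i (f ^ n)"
    using Suc.prems by (simp add: dx_mult)
  also have "\<dots> = cc (of_nat (Suc n)) * (f ^ (Suc n - 1) * dx i f)"
    unfolding Suc.IH[OF Suc.prems] by (cases n) (simp_all add: fun_eq_iff pw algebra_simps)
  finally show ?case .
qed (simp add: cc_hom)

text \<open>The derivative of \<open>R a b \<alpha>\<close> with respect to rho_x, in view of
  \<partial>_i rho_x = x_i. For a = 0 the truncated exponent \<open>a - 1\<close> is multiplied by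
  0.\<close>

definition R' :: "nat \<Rightarrow> nat \<Rightarrow> complex \<Rightarrow> ('p::finite, 'q::finite) cfun" where
  "R' a b \<alpha> = cc (of_nat a) * R (a - 1) b \<alpha> - cc (1 / \<alpha>) * R a (Suc b) (\<alpha> + 1)"

lemma R'_alg [simp, intro]: "\<alpha> \<notin> \<int>\<^sub>\<le>\<^sub>0 \<Longrightarrow> R' a b \<alpha> \<in> alg"
  by (simp add: R'_def nonpos_Int_add_1)

lemma dx_R: "\<alpha> \<notin> \<int>\<^sub>\<le>\<^sub>0 \<Longrightarrow> dx i (R a b \<alpha>) = xc i * R' a b \<alpha>"
  by (simp add: R_def R'_def dx_mult dx_power dx_psi cc_hom algebra_simps)

lemma dy_R:
  fixes j :: "'q::finite"
  assumes "\<alpha> \<notin> \<int>\<^sub>\<le>\<^sub>0"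
  shows "dy j (R a b \<alpha> :: ('p::finite, 'q) cfun) =
    yc j * (cc (of_nat b) * R a (b - 1) \<alpha> - cc (1 / \<alpha>) * R (Suc a) b (\<alpha> + 1))"
proof -
  have "dy j (R a b \<alpha> :: ('p, 'q) cfun) = swp (dx j (R b a \<alpha>))"
    using dy_swp[of j "R b a \<alpha> :: ('q, 'p) cfun"] by simp
  then show ?thesis
    by (simp add: dx_R[OF assms] R'_def)
qed

text \<open>The index of the Bessel operator by which the Laplacian acts on F times a radial
  function, F harmonic of degree k in n variables; see \<open>Lap_x_radial\<close>.\<close>

definition kap :: "nat \<Rightarrow> nat \<Rightarrow> complex" where
  "kap n k = of_nat k + of_nat n / 2"

lemma kap_pos_real: "kap n k = of_real (real k + real n / 2)"
  by (simp add: kap_def)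

lemma kap_nonpos_Int: "n > 0 \<Longrightarrow> kap n k \<notin> \<int>\<^sub>\<le>\<^sub>0"
proof
  assume n: "n > 0" and "kap n k \<in> \<int>\<^sub>\<le>\<^sub>0"
  then have "real k + real n / 2 \<in> \<int>\<^sub>\<le>\<^sub>0"
    unfolding kap_pos_real by (simp only: of_real_in_nonpos_Ints_iff)
  then have "real k + real n / 2 \<le> 0"
    by (elim nonpos_Ints_cases) simp
  then show False using n by simp
qed

lemma Lap_x_radial:
  fixes F \<phi> :: "('p::finite, 'q::finite) cfun"
  assumes F: "F \<in> harmonic_tensor k l" and alg: "\<phi> \<in> alg" "\<phi>1 \<in> alg"
    and d: "\<And>i. dx i \<phi> = xc i * \<phi>1" "\<And>i. dx i \<phi>1 = xc i * \<phi>2"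
  shows "Lap_x (F * \<phi>) = F * (rx2 * \<phi>2 + cc (2 * kap CARD('p) k) * \<phi>1)"
proof -
  note F' = HT_alg[OF F]
  have "dx i (dx i (F * \<phi>)) = dx i (dx i F) * \<phi> + cc 2 * ((xc i * dx i F) * \<phi>1)
      + F * \<phi>1 + (xc i * xc i) * (F * \<phi>2)" for i
    using F' alg by (simp add: dx_mult dx_add d dx_xc) (simp add: fun_eq_iff pw algebra_simps)
  then have "Lap_x (F * \<phi>) = Lap_x F * \<phi> + cc 2 * (Euler_x F * \<phi>1) + of_nat CARD('p) * (F * \<phi>1)
      + rx2 * (F * \<phi>2)"
    by (simp add: Lap_x_conv Euler_x_conv rx2_conv sum.distrib sum_distrib_left[symmetric]
        sum_distrib_right[symmetric])
  then show ?thesis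
    by (simp add: HT_Lap_x[OF F] HT_Euler_x[OF F]) (simp add: kap_def fun_eq_iff pw algebra_simps)
qed

lemma Euler_x_radial:
  fixes F \<phi> :: "('p::finite, 'q::finite) cfun"
  assumes F: "F \<in> harmonic_tensor k l" and alg: "\<phi> \<in> alg"
    and d: "\<And>i. dx i \<phi> = xc i * \<phi>1"
  shows "Euler_x (F * \<phi>) = F * (cc (of_nat k) * \<phi> + rx2 * \<phi>1)"
proof -
  note F' = HT_alg[OF F]
  have "Euler_x (F * \<phi>) = (\<Sum>i\<in>UNIV. (xc i * dx i F) * \<phi> + (xc i * xc i) * (F * \<phi>1))"
    using F' alg by (simp add: Euler_x_conv dx_mult d) (simp add: algebra_simps)
  also have "\<dots> = Euler_x F * \<phi> + rx2 * (F * \<phi>1)"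
    by (simp add: Euler_x_conv rx2_conv sum.distrib sum_distrib_right[symmetric])
  finally show ?thesis
    by (simp add: HT_Euler_x[OF F] algebra_simps)
qed

text \<open>The radial part of -X^+: with \<phi> = \<open>R a b \<alpha>\<close> and derivatives in
  rho_x, this is rho_x \<phi>'' + \<kappa> \<phi>' + rho_y \<phi>. Again the exponent
  \<open>a - 1\<close> carries the coefficient 0 when a = 0.\<close>

definition XR :: "complex \<Rightarrow> nat \<Rightarrow> nat \<Rightarrow> complex \<Rightarrow> ('p::finite, 'q::finite) cfun" where
  "XR \<kappa> a b \<alpha> = cc (of_nat a * (of_nat a - 1 + \<kappa>)) * R (a - 1) b \<alpha>
     - cc ((2 * of_nat a + \<kappa>) / \<alpha>) * R a (Suc b) (\<alpha> + 1)
     + cc (1 / (\<alpha> * (\<alpha> + 1))) * R (Suc a) (Suc (Suc b)) (\<alpha> + 2) + R a (Suc b) \<alpha>"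

lemma Xplus_R:
  fixes F :: "('p::finite, 'q::finite) cfun"
  assumes F: "F \<in> harmonic_tensor k l" and \<alpha>: "\<alpha> \<notin> \<int>\<^sub>\<le>\<^sub>0"
  shows "Xplus (F * R a b \<alpha>) = - (F * XR (kap CARD('p) k) a b \<alpha>)"
proof -
  define \<kappa> where "\<kappa> = kap CARD('p) k"
  define \<phi>2 :: "('p, 'q) cfun" where
    "\<phi>2 = cc (of_nat a) * R' (a - 1) b \<alpha> - cc (1 / \<alpha>) * R' a (Suc b) (\<alpha> + 1)"
  have d: "dx i (R' a b \<alpha>) = xc i * \<phi>2" for i
    using \<alpha> by (simp add: R'_def[of a b] \<phi>2_def dx_diff dx_cc_mult dx_R nonpos_Int_add_1)
      (simp add: algebra_simps)
  have L: "Lap_x (F * R a b \<alpha>) = F * (rx2 * \<phi>2 + cc (2 * \<kappa>) * R' a b \<alpha>)"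
    unfolding \<kappa>_def using \<alpha> by (intro Lap_x_radial[OF F] d) (auto simp: dx_R)
  have p: "rho_x * \<phi>2 = cc (of_nat a * (of_nat a - 1)) * R (a - 1) b \<alpha>
      - cc (2 * of_nat a / \<alpha>) * R a (Suc b) (\<alpha> + 1)
      + cc (1 / (\<alpha> * (\<alpha> + 1))) * R (Suc a) (Suc (Suc b)) (\<alpha> + 2)"
  proof -
    have 1: "rho_x * \<phi>2 = cc (of_nat a) * (cc (of_nat (a - 1)) * (rho_x * R (a - 1 - 1) b \<alpha>))
        - cc (1 / \<alpha>) * (cc (of_nat a) * (rho_x * R (a - 1) (Suc b) (\<alpha> + 1)))
        - cc (1 / \<alpha>) * (cc (of_nat a) * (rho_x * R (a - 1) (Suc b) (\<alpha> + 1)))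
        + cc (1 / \<alpha>) * (cc (1 / (\<alpha> + 1)) * (rho_x * R a (Suc (Suc b)) (\<alpha> + 2)))"
      by (simp add: \<phi>2_def R'_def algebra_simps)
    have 2: "cc (of_nat a) * (rho_x * R (a - 1) (Suc b) (\<alpha> + 1)) = cc (of_nat a) * R a (Suc b) (\<alpha> + 1)"
      by (cases a) (simp_all add: rho_R cc_hom)
    have 3: "cc (of_nat a) * (cc (of_nat (a - 1)) * (rho_x * R (a - 1 - 1) b \<alpha>)) =
        cc (of_nat a * (of_nat a - 1)) * R (a - 1) b \<alpha>"
      by (cases a; cases "a - 1") (simp_all add: rho_R cc_hom mult.assoc)
    show ?thesis
      unfolding 1 2 3 by (simp add: rho_R fun_eq_iff pw algebra_simps)
  qed
  have "Xplus (F * R a b \<alpha>) = - (F * (rho_x * \<phi>2 + cc \<kappa> * R' a b \<alpha> + rho_y * R a b \<alpha>))"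
    by (simp add: Xplus_conv L rx2_rho ry2_rho fun_eq_iff pw algebra_simps)
  also have "\<dots> = - (F * XR \<kappa> a b \<alpha>)"
    unfolding p rho_R XR_def R'_def
    by (simp add: fun_eq_iff pw algebra_simps add_divide_distrib)
  finally show ?thesis by (simp add: \<kappa>_def)
qed

text \<open>The Euler fields in x and in y agree on functions of rho_x rho_y, so the terms with
  \<psi>_(\<alpha>+1) cancel in H and only the degrees remain.\<close>

lemma H_op_R:
  fixes F :: "('p::finite, 'q::finite) cfun"
  assumes F: "F \<in> harmonic_tensor k l" and \<alpha>: "\<alpha> \<notin> \<int>\<^sub>\<le>\<^sub>0"
  shows "H_op (F * R a b \<alpha>) =
    cc (kap CARD('q) l - kap CARD('p) k + 2 * (of_nat b - of_nat a)) * (F * R a b \<alpha>)"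
proof -
  \<comment> \<open>Kept general in the index types and degrees, so that its exchanged version gives
    the formula for \<open>Euler_y\<close>.\<close>
  have x: "Euler_x (F * R a b \<alpha>) = cc (of_nat k + 2 * of_nat a) * (F * R a b \<alpha>)
      - cc (2 / \<alpha>) * (F * R (Suc a) (Suc b) (\<alpha> + 1))"
    if "F \<in> harmonic_tensor k l" for F :: "('r::finite, 's::finite) cfun" and a b k l
  proof -
    have "Euler_x (F * R a b \<alpha>) = F * (cc (of_nat k) * R a b \<alpha> + rx2 * R' a b \<alpha>)"
      using \<alpha> by (intro Euler_x_radial[OF that]) (auto simp: dx_R)
    moreover have r: "rho_x * R' a b \<alpha> = cc (of_nat a) * R a b \<alpha> - cc (1 / \<alpha>) * R (Suc a) (Suc b) (\<alpha> + 1)"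
      by (cases a) (simp_all add: R'_def right_diff_distrib mult.left_commute[of rho_x] rho_R cc_hom)
    ultimately show ?thesis
      unfolding rx2_rho mult.assoc r by (simp add: fun_eq_iff pw algebra_simps)
  qed
  have y: "Euler_y (F * R a b \<alpha>) = cc (of_nat l + 2 * of_nat b) * (F * R a b \<alpha>)
      - cc (2 / \<alpha>) * (F * R (Suc a) (Suc b) (\<alpha> + 1))"
    using arg_cong[OF x[OF HT_swp[OF F], of b a], of swp] by (simp add: swp_ops(2)[symmetric])
  show ?thesis
    unfolding H_op_conv x[OF F] y by (simp add: kap_def fun_eq_iff pw field_simps)
qed

text \<open>The part of \<E> of type (k, l), given only as a span: by \<open>R_contiguous\<close>
  its generators satisfy linear relations.\<close>

definition E_comp :: "nat \<Rightarrow> nat \<Rightarrow> ('p::finite, 'q::finite) cfun set" where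
  "E_comp k l = cfun.span {F * R a b \<alpha> | F a b \<alpha>. F \<in> harmonic_tensor k l \<and> \<alpha> \<notin> \<int>\<^sub>\<le>\<^sub>0}"

lemma E_comp_subspace: "cfun.subspace (E_comp k l)"
  by (simp add: E_comp_def)

lemma E_comp_gen: "F \<in> harmonic_tensor k l \<Longrightarrow> \<alpha> \<notin> \<int>\<^sub>\<le>\<^sub>0 \<Longrightarrow> F * R a b \<alpha> \<in> E_comp k l"
  unfolding E_comp_def by (rule cfun.span_base) blast

lemma E_comp_gens_alg: "{F * R a b \<alpha> | F a b \<alpha>. F \<in> harmonic_tensor k l \<and> \<alpha> \<notin> \<int>\<^sub>\<le>\<^sub>0} \<subseteq> alg"
  using HT_alg by auto

lemma E_comp_alg: "f \<in> E_comp k l \<Longrightarrow> f \<in> alg"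
  using cfun.span_minimal[OF E_comp_gens_alg alg_subspace] unfolding E_comp_def by blast

lemma E_comp_map:
  assumes "alg_linear A" "cfun.subspace S" "f \<in> E_comp k l"
    and "\<And>F a b \<alpha>. F \<in> harmonic_tensor k l \<Longrightarrow> \<alpha> \<notin> \<int>\<^sub>\<le>\<^sub>0 \<Longrightarrow> A (F * R a b \<alpha>) \<in> S"
  shows "A f \<in> S"
  by (rule span_map[OF assms(1,2) E_comp_gens_alg _ assms(3)[unfolded E_comp_def]])
    (use assms(4) in auto)

lemma E_comp_Xplus: "f \<in> E_comp k l \<Longrightarrow> Xplus f \<in> E_comp k l"
proof (rule E_comp_map[OF alg_linear_ops(6) E_comp_subspace])
  fix F :: "('a, 'b) cfun" and a b :: nat and \<alpha> :: complex assume F: "F \<in> harmonic_tensor k l" and \<alpha>: "\<alpha> \<notin> \<int>\<^sub>\<le>\<^sub>0"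
  have \<alpha>1: "\<alpha> + 1 \<notin> \<int>\<^sub>\<le>\<^sub>0" using \<alpha> by (rule nonpos_Int_add_1)
  have \<alpha>2: "\<alpha> + 2 \<notin> \<int>\<^sub>\<le>\<^sub>0" using nonpos_Int_add_1[OF \<alpha>1] by (simp add: add.assoc)
  have cR: "F * (cc c * R a b \<beta>) \<in> E_comp k l" if "\<beta> \<notin> \<int>\<^sub>\<le>\<^sub>0" for c a b \<beta>
    using subspace_cc_mult[OF E_comp_subspace E_comp_gen[OF F that], of c] by (simp add: mult_ac)
  show "Xplus (F * R a b \<alpha>) \<in> E_comp k l"
    unfolding Xplus_R[OF F \<alpha>] XR_def distrib_left[of F] right_diff_distrib[of F]
    by (intro cfun.subspace_neg[OF E_comp_subspace] cfun.subspace_add[OF E_comp_subspace]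
        cfun.subspace_diff[OF E_comp_subspace] E_comp_gen cR F \<alpha> \<alpha>1 \<alpha>2)
qed

lemma E_comp_swp:
  assumes "f \<in> E_comp k l"
  shows "swp f \<in> E_comp l k"
  using assms unfolding E_comp_def[of k]
proof (induction rule: cfun.span_induct_alt)
  case base
  then show ?case using cfun.subspace_0[OF E_comp_subspace] by simp
next
  case (step c x y)
  then obtain F a b \<alpha> where x: "x = F * R a b \<alpha>" "F \<in> harmonic_tensor k l" "\<alpha> \<notin> \<int>\<^sub>\<le>\<^sub>0"
    by blast
  have "swp x \<in> E_comp l k"
    using E_comp_gen[OF HT_swp[OF x(2)] x(3), of b a] by (simp add: x(1))
  then show ?case
    using step by (auto intro!: cfun.subspace_add[OF E_comp_subspace] cfun.subspace_scale[OF E_comp_subspace])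
qed

lemma E_comp_Xminus: 
  assumes "f \<in> E_comp k l"
  shows "Xminus f \<in> E_comp k l"
proof -
  have "swp (- Xplus (swp f)) \<in> E_comp k l"
    by (intro E_comp_swp cfun.subspace_neg[OF E_comp_subspace] E_comp_Xplus assms)
  then show ?thesis by (simp add: swp_ops)
qed

lemma E_comp_H_op: "f \<in> E_comp k l \<Longrightarrow> H_op f \<in> E_comp k l"
  by (rule E_comp_map[OF alg_linear_ops(5) E_comp_subspace])
    (auto simp: H_op_R intro!: subspace_cc_mult[OF E_comp_subspace] E_comp_gen)

lemma span_UN_sum:
  assumes "f \<in> cfun.span (\<Union>e\<in>I. X e)"
  shows "\<exists>J g. finite J \<and> J \<subseteq> I \<and> (\<forall>e. g e \<in> cfun.span (X e)) \<and> f = (\<Sum>e\<in>J. g e)"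
proof -
  \<comment> \<open>Strengthened by g = 0 outside J, so that a new term can be added to g e0 whether
    or not e0 already belongs to J.\<close>
  have "\<exists>J g. finite J \<and> J \<subseteq> I \<and> (\<forall>e. g e \<in> cfun.span (X e)) \<and> (\<forall>e. e \<notin> J \<longrightarrow> g e = 0) \<and> f = (\<Sum>e\<in>J. g e)"
    using assms
  proof (induction rule: cfun.span_induct_alt)
    case base
    show ?case
      by (intro exI[of _ "{}"] exI[of _ "\<lambda>_. 0"]) (simp add: cfun.span_zero)
  next
    case (step c x y)
    then obtain J g e0 where J: "finite J" "J \<subseteq> I" "\<And>e. g e \<in> cfun.span (X e)" "\<And>e. e \<notin> J \<Longrightarrow> g e = 0"
      "y = (\<Sum>e\<in>J. g e)" and e0: "e0 \<in> I" "x \<in> X e0"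
      by blast
    define g' where "g' = g(e0 := cscale c x + g e0)"
    have s: "(\<Sum>e\<in>J - {e0}. g' e) = (\<Sum>e\<in>J - {e0}. g e)"
      by (rule sum.cong) (auto simp: g'_def)
    have "(\<Sum>e\<in>insert e0 J. g' e) = cscale c x + (g e0 + (\<Sum>e\<in>J - {e0}. g e))"
      using J(1) by (subst sum.insert_remove) (simp_all add: s, simp add: g'_def add.assoc)
    moreover have "g e0 + (\<Sum>e\<in>J - {e0}. g e) = y"
      using J(1,4,5) by (cases "e0 \<in> J") (simp_all add: sum.remove)
    ultimately have "cscale c x + y = (\<Sum>e\<in>insert e0 J. g' e)"
      by simp
    moreover have "g' e \<in> cfun.span (X e)" for e
      using J(3) e0(2) by (auto simp: g'_def intro!: cfun.span_add cfun.span_scale intro: cfun.span_base)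
    ultimately show ?case
      using J e0 by (intro exI[of _ "insert e0 J"] exI[of _ g']) (auto simp: g'_def)
  qed
  then show ?thesis by blast
qed

subsection \<open>Highest weight vectors in \<open>\<E>\<close>\<close>

definition entire_fps :: "complex fps \<Rightarrow> bool" where
  "entire_fps g \<longleftrightarrow> fps_conv_radius g = \<infinity>"

lemma entire_fps_const [simp]: "entire_fps (fps_const c)" and entire_fps_X [simp]: "entire_fps fps_X"
  and entire_fps_0 [simp]: "entire_fps 0"
  by (simp_all add: entire_fps_def)

lemma entire_fps_mult [simp]: "entire_fps f \<Longrightarrow> entire_fps g \<Longrightarrow> entire_fps (f * g)"
  using fps_conv_radius_mult[of f g] by (simp add: entire_fps_def)

lemma entire_fps_add [simp]: "entire_fps f \<Longrightarrow> entire_fps g \<Longrightarrow> entire_fps (f + g)"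
  using fps_conv_radius_add[of f g] by (simp add: entire_fps_def)

lemma entire_fps_diff [simp]: "entire_fps f \<Longrightarrow> entire_fps g \<Longrightarrow> entire_fps (f - g)"
  using fps_conv_radius_diff[of f g] by (simp add: entire_fps_def)

lemma entire_fps_power [simp]: "entire_fps f \<Longrightarrow> entire_fps (f ^ n)"
  using fps_conv_radius_power[of f n] by (simp add: entire_fps_def)

lemma entire_fps_deriv [simp]: "entire_fps f \<Longrightarrow> entire_fps (fps_deriv f)"
  using fps_conv_radius_deriv[of f] by (simp add: entire_fps_def)

lemma entire_Psi_fps [simp]: "\<alpha> \<notin> \<int>\<^sub>\<le>\<^sub>0 \<Longrightarrow> entire_fps (Psi_fps \<alpha>)"
  by (simp add: entire_fps_def Psi_fps_conv_radius)

lemma eval_entire [simp]: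
  assumes "entire_fps f" "entire_fps g"
  shows "eval_fps (f + g) u = eval_fps f u + eval_fps g u" "eval_fps (f - g) u = eval_fps f u - eval_fps g u"
    "eval_fps (f * g) u = eval_fps f u * eval_fps g u"
  using assms by (simp_all add: entire_fps_def eval_fps_add eval_fps_diff eval_fps_mult)

text \<open>The radial equation after the substitution u = rho_x rho_y: on F rho_y^e g(u) the
  operator -X^+ gives F rho_y^(e+1) (u g'' + \<kappa> g' + g).\<close>

definition ode_fps :: "complex \<Rightarrow> complex fps \<Rightarrow> complex fps" where
  "ode_fps \<kappa> g = fps_X * fps_deriv (fps_deriv g) + fps_const \<kappa> * fps_deriv g + g"

lemma ode_fps_linear:
  "ode_fps \<kappa> (fps_const c * f + g) = fps_const c * ode_fps \<kappa> f + ode_fps \<kappa> g"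
  by (simp add: ode_fps_def algebra_simps)

lemma entire_ode_fps [simp]: "entire_fps g \<Longrightarrow> entire_fps (ode_fps \<kappa> g)"
  by (simp add: ode_fps_def)

text \<open>The counterpart of \<open>XR\<close> for formal series, with rho_x^a replaced by u^a;
  \<open>XR_powi\<close> matches the two term by term.\<close>

lemma ode_fps_generator:
  "ode_fps \<kappa> (fps_X ^ a * Psi_fps \<alpha>) =
     fps_const (of_nat a * (of_nat a - 1 + \<kappa>)) * (fps_X ^ (a - 1) * Psi_fps \<alpha>)
     - fps_const ((2 * of_nat a + \<kappa>) / \<alpha>) * (fps_X ^ a * Psi_fps (\<alpha> + 1))
     + fps_const (1 / (\<alpha> * (\<alpha> + 1))) * (fps_X ^ Suc a * Psi_fps (\<alpha> + 2)) + fps_X ^ a * Psi_fps \<alpha>"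
proof -
  define P P1 P2 c c1 K where d: "P = Psi_fps \<alpha>" "P1 = Psi_fps (\<alpha> + 1)" "P2 = Psi_fps (\<alpha> + 2)"
    "c = fps_const (1 / \<alpha>)" "c1 = fps_const (1 / (\<alpha> + 1))" "K = fps_const \<kappa>"
  have p: "fps_deriv P = - (c * P1)" "fps_deriv P1 = - (c1 * P2)" "fps_deriv c = 0"
    using Psi_fps_deriv[of \<alpha>] Psi_fps_deriv[of "\<alpha> + 1"]
    by (simp_all add: d add.assoc flip: fps_const_neg)
  have X: "fps_deriv (fps_X ^ m) = of_nat m * (fps_X ^ (m - 1) :: complex fps)" for m
    by (simp add: fps_deriv_power fps_of_nat)
  have n: "fps_deriv (of_nat m) = (0 :: complex fps)" for m
    by (simp add: fps_of_nat[symmetric])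
  have k: "fps_const (of_nat a * (of_nat a - 1 + \<kappa>)) = of_nat a * (of_nat a - 1 + K)"
    "fps_const ((2 * of_nat a + \<kappa>) / \<alpha>) = (2 * of_nat a + K) * c"
    "fps_const (1 / (\<alpha> * (\<alpha> + 1))) = c * c1"
    by (simp_all add: d fps_of_nat[symmetric] fps_numeral_fps_const flip: fps_const_1_eq_1)
  have 1: "fps_deriv (fps_X ^ a * P) = of_nat a * (fps_X ^ (a - 1) * P) - fps_X ^ a * (c * P1)"
    by (simp add: p X mult.assoc)
  have 2: "fps_deriv (fps_deriv (fps_X ^ a * P)) =
      of_nat a * (of_nat (a - 1) * fps_X ^ (a - 1 - 1) * P - fps_X ^ (a - 1) * (c * P1))
      - (of_nat a * fps_X ^ (a - 1) * (c * P1) - fps_X ^ a * (c * (c1 * P2)))"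
    unfolding 1 by (simp add: p X n algebra_simps)
  show ?thesis
    unfolding ode_fps_def k d(1-3)[symmetric] d(6)[symmetric] 2 unfolding 1
    by (cases a; cases "a - 1") (simp_all add: algebra_simps)
qed

lemma R_powi:
  assumes "rho_y v \<noteq> 0" "int b - int a = e"
  shows "R a b \<alpha> v = rho_y v powi e * ((rho_x v * rho_y v) ^ a * Psi \<alpha> (rho_x v * rho_y v))"
proof -
  have "e + int a = int b"
    using assms(2) by simp
  then have "rho_y v powi e * rho_y v ^ a = rho_y v ^ b"
    using assms(1) by (simp add: power_int_add[symmetric] flip: power_int_of_nat)
  then show ?thesis
    by (simp add: R_def pw psi_def power_mult_distrib mult_ac)
qed

lemma XR_powi:
  assumes "rho_y v \<noteq> 0" "int b - int a = e" "\<alpha> \<notin> \<int>\<^sub>\<le>\<^sub>0"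
  shows "XR \<kappa> a b \<alpha> v = rho_y v powi (e + 1) *
    eval_fps (ode_fps \<kappa> (fps_X ^ a * Psi_fps \<alpha>)) (rho_x v * rho_y v)"
proof -
  have \<alpha>1: "\<alpha> + 1 \<notin> \<int>\<^sub>\<le>\<^sub>0" using assms(3) by (rule nonpos_Int_add_1)
  have \<alpha>2: "\<alpha> + 2 \<notin> \<int>\<^sub>\<le>\<^sub>0" using nonpos_Int_add_1[OF \<alpha>1] by (simp add: add.assoc)
  let ?u = "rho_x v * rho_y v"
  have 1: "of_nat a * R (a - 1) b \<alpha> v = of_nat a * (rho_y v powi (e + 1) * (?u ^ (a - 1) * Psi \<alpha> ?u))"
  proof (cases a)
    case (Suc a')
    then show ?thesis using assms(2) by (subst R_powi[OF assms(1), of _ _ "e + 1"]) auto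
  qed simp
  have 2: "R a (Suc b) \<beta> v = rho_y v powi (e + 1) * (?u ^ a * Psi \<beta> ?u)"
    "R (Suc a) (Suc (Suc b)) \<beta> v = rho_y v powi (e + 1) * (?u ^ Suc a * Psi \<beta> ?u)" for \<beta>
    using assms(2) by (intro R_powi assms(1); simp)+
  have "XR \<kappa> a b \<alpha> v = (of_nat a - 1 + \<kappa>) * (of_nat a * R (a - 1) b \<alpha> v)
     - (2 * of_nat a + \<kappa>) / \<alpha> * R a (Suc b) (\<alpha> + 1) v
     + 1 / (\<alpha> * (\<alpha> + 1)) * R (Suc a) (Suc (Suc b)) (\<alpha> + 2) v + R a (Suc b) \<alpha> v"
    by (simp add: XR_def pw)
  also have "\<dots> = rho_y v powi (e + 1) *
    eval_fps (ode_fps \<kappa> (fps_X ^ a * Psi_fps \<alpha>)) (rho_x v * rho_y v)"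
    unfolding 1 2 ode_fps_generator using assms(3) \<alpha>1 \<alpha>2
    by (simp add: Psi_eq_eval_fps del: power_Suc) (simp add: algebra_simps)
  finally show ?thesis .
qed

text \<open>H acts on this space by a scalar that depends on e = b - a; this degree may be
  negative.\<close>

definition E_deg :: "nat \<Rightarrow> nat \<Rightarrow> int \<Rightarrow> ('p::finite, 'q::finite) cfun set" where
  "E_deg k l e = cfun.span {F * R a b \<alpha> | F a b \<alpha>.
     F \<in> harmonic_tensor k l \<and> \<alpha> \<notin> \<int>\<^sub>\<le>\<^sub>0 \<and> int b - int a = e}"

lemma E_comp_degs:
  assumes "f \<in> E_comp k l"
  shows "\<exists>J g. finite J \<and> (\<forall>e. g e \<in> E_deg k l e) \<and> f = (\<Sum>e\<in>J. g e)"
proof -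
  have eq: "{F * R a b \<alpha> | F a b \<alpha>. F \<in> harmonic_tensor k l \<and> \<alpha> \<notin> \<int>\<^sub>\<le>\<^sub>0} =
    (\<Union>e\<in>UNIV. {F * R a b \<alpha> | F a b \<alpha>. F \<in> harmonic_tensor k l \<and> \<alpha> \<notin> \<int>\<^sub>\<le>\<^sub>0 \<and> int b - int a = e})"
    by blast
  show ?thesis
    using span_UN_sum[OF assms[unfolded E_comp_def eq]] unfolding E_deg_def by blast
qed

lemma E_deg_sub: "E_deg k l e \<subseteq> E_comp k l"
  unfolding E_deg_def E_comp_def by (rule cfun.span_mono) blast

lemma E_deg_alg: "f \<in> E_deg k l e \<Longrightarrow> f \<in> alg"
  using E_deg_sub E_comp_alg by blast

lemma E_deg_H_op:
  fixes f :: "('p::finite, 'q::finite) cfun"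
  assumes "f \<in> E_deg k l e"
  shows "H_op f = cc (kap CARD('q) l - kap CARD('p) k + 2 * of_int e) * f"
proof -
  let ?c = "kap CARD('q) l - kap CARD('p) k + 2 * of_int e"
  have "H_op f - cc ?c * f \<in> {0}"
  proof (rule span_map[OF alg_linear_diff[OF alg_linear_ops(5) alg_linear_mult[OF alg.const]] _ _ _
        assms[unfolded E_deg_def]])
    fix x :: "('p, 'q) cfun"
    assume "x \<in> {F * R a b \<alpha> | F a b \<alpha>. F \<in> harmonic_tensor k l \<and> \<alpha> \<notin> \<int>\<^sub>\<le>\<^sub>0 \<and> int b - int a = e}"
    then obtain F a b \<alpha> where x: "x = F * R a b \<alpha>" "F \<in> harmonic_tensor k l" "\<alpha> \<notin> \<int>\<^sub>\<le>\<^sub>0" "int b - int a = e"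
      by blast
    then show "H_op x - cc ?c * x \<in> {0}"
      by (simp add: H_op_R x(4)[symmetric])
  qed (use HT_alg in \<open>auto simp: cfun.subspace_def cscale_def zero_fun_def\<close>)
  then show ?thesis by simp
qed

text \<open>A presentation of f by generators yields at each v an entire series g v with f(v) =
  rho_y^e (g v)(u). It depends on the presentation, so only existence is claimed. Two features are
  carried along: g is homogeneous of degree k in x, hence changes only by a scalar along a ray, and
  its constant terms form an element G of the K-type, which is 0 for e < 0 because then every
  exponent a is positive.\<close>

lemma E_deg_profile:
  fixes f :: "('p::finite, 'q::finite) cfun"
  assumes "f \<in> E_deg k l e"
  shows "\<exists>G \<in> harmonic_tensor k l. \<exists>g. (e < 0 \<longrightarrow> G = 0) \<and>
    (\<forall>v. entire_fps (g v) \<and> fps_nth (g v) 0 = G v) \<and>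
    (\<forall>v. rho_y v \<noteq> 0 \<longrightarrow> f v = rho_y v powi e * eval_fps (g v) (rho_x v * rho_y v) \<and>
      Xplus f v = - (rho_y v powi (e + 1) * eval_fps (ode_fps (kap CARD('p) k) (g v)) (rho_x v * rho_y v))) \<and>
    (\<forall>c x y. g (c *\<^sub>R x, y) = fps_const (of_real c ^ k) * g (x, y)) \<and> f \<in> alg"
  using assms unfolding E_deg_def
proof (induction rule: cfun.span_induct_alt)
  case base
  have "(\<lambda>a. 0) = (0 :: ('p, 'q) cfun)"
    by (simp add: zero_fun_def)
  then show ?case
    by (intro bexI[of _ 0] exI[of _ "\<lambda>_. 0"])
      (simp_all add: HT_0 pw ode_fps_def alg_linearD(4)[OF alg_linear_ops(6)])
next
  case (step c x f)
  obtain F a b \<alpha> where x: "x = F * R a b \<alpha>" "F \<in> harmonic_tensor k l" "\<alpha> \<notin> \<int>\<^sub>\<le>\<^sub>0" "int b - int a = e"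
    using step(1) by blast
  obtain G g where G: "G \<in> harmonic_tensor k l" and g: "e < 0 \<Longrightarrow> G = 0"
    "\<And>v. entire_fps (g v)" "\<And>v. fps_nth (g v) 0 = G v"
    "\<And>v. rho_y v \<noteq> 0 \<Longrightarrow> f v = rho_y v powi e * eval_fps (g v) (rho_x v * rho_y v)"
    "\<And>v. rho_y v \<noteq> 0 \<Longrightarrow> Xplus f v = - (rho_y v powi (e + 1) *
        eval_fps (ode_fps (kap CARD('p) k) (g v)) (rho_x v * rho_y v))"
    "\<And>c x y. g (c *\<^sub>R x, y) = fps_const (of_real c ^ k) * g (x, y)" and f: "f \<in> alg"
    using step(2) by blast
  \<comment> \<open>Only generators with a = 0 contribute to the constant term.\<close>
  define G' where "G' = cc c * (if a = 0 then F else 0) + G"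
  define h where "h v = fps_const (F v) * (fps_X ^ a * Psi_fps \<alpha>)" for v
  define g' where "g' v = fps_const c * h v + g v" for v
  have h: "entire_fps (h v)" for v using x(3) by (simp add: h_def)
  have xa: "x \<in> alg" using x HT_alg by auto
  show ?case
  proof (intro bexI[of _ G'] exI[of _ g'] conjI allI impI)
    show "G' \<in> harmonic_tensor k l"
      using x(2) G by (auto simp: G'_def intro!: HT_add HT_scale HT_0)
    show "G' = 0" if "e < 0"
      using that x(4) g(1) by (auto simp: G'_def)
    show "entire_fps (g' v)" for v
      using h g(2) by (simp add: g'_def)
    show "fps_nth (g' v) 0 = G' v" for v
      using g(3) by (cases "a = 0") (simp_all add: g'_def h_def G'_def pw)
    show "cscale c x + f \<in> alg"
      using xa f by simp
    show "g' (s *\<^sub>R y, z) = fps_const (of_real s ^ k) * g' (y, z)" for s y z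
    proof -
      have "h (s *\<^sub>R y, z) = fps_const (of_real s ^ k) * h (y, z)"
        using HT_scaled[OF x(2), of s y 1 z] by (simp add: h_def mult_ac flip: fps_const_mult)
      then show ?thesis by (simp add: g'_def g(6) algebra_simps)
    qed
    fix v :: "('p, 'q) V" assume v: "rho_y v \<noteq> 0"
    show "(cscale c x + f) v = rho_y v powi e * eval_fps (g' v) (rho_x v * rho_y v)"
      using g(2) h x(3) unfolding g'_def
      by (simp add: pw g(4)[OF v] x(1) R_powi[OF v x(4)])
        (simp add: h_def Psi_eq_eval_fps algebra_simps)
    have "Xplus (cscale c x + f) = cc c * Xplus x + Xplus f"
      using xa f by (simp add: alg_linearD(2,3)[OF alg_linear_ops(6)] cscale_conv[of c "Xplus x"])
    moreover have "Xplus x v = - (F v * XR (kap CARD('p) k) a b \<alpha> v)"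
      unfolding x(1) Xplus_R[OF x(2,3)] by (simp add: pw)
    moreover have "ode_fps \<kappa> (h v) = fps_const (F v) * ode_fps \<kappa> (fps_X ^ a * Psi_fps \<alpha>)" for \<kappa>
      using ode_fps_linear[of \<kappa> "F v" "fps_X ^ a * Psi_fps \<alpha>" 0] by (simp add: h_def ode_fps_def)
    ultimately show "Xplus (cscale c x + f) v = - (rho_y v powi (e + 1) *
        eval_fps (ode_fps (kap CARD('p) k) (g' v)) (rho_x v * rho_y v))"
      using g(2) h x(3) unfolding g'_def ode_fps_linear
      by (simp add: pw g(5)[OF v] XR_powi[OF v x(4,3)]) (simp add: algebra_simps)
  qed
qed

lemma rho_scaled: "rho_x (c *\<^sub>R x, y) = of_real c ^ 2 * rho_x (x, y)" "rho_y (c *\<^sub>R x, y) = rho_y (x, y)"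
  by (simp_all add: rho_x_def rho_y_def rx2_inner ry2_inner power2_eq_square)

lemma rho_eq_0_iff: "rho_x v = 0 \<longleftrightarrow> fst v = 0" "rho_y v = 0 \<longleftrightarrow> snd v = 0"
  by (simp_all add: rho_x_def rho_y_def rx2_inner ry2_inner)

lemma rho_real: "rho_x v = of_real (norm (fst v) ^ 2 / 2)" "rho_y v = of_real (norm (snd v) ^ 2 / 2)"
  by (simp_all add: rho_x_def rho_y_def rx2_inner ry2_inner power2_norm_eq_inner)

lemma alg_continuous: "f \<in> alg \<Longrightarrow> continuous_on S f"
  using alg_diffble[of f] unfolding diffble_def
  by (metis continuous_at_imp_continuous_on differentiable_imp_continuous_within)

text \<open>Elements of \<open>alg\<close> are continuous and the points with x and y both nonzero
  are dense. This removes the restriction on rho_y under which profiles describe f.\<close>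

lemma alg_eq_0_dense:
  fixes f :: "('p::finite, 'q::finite) cfun"
  assumes "f \<in> alg" "\<And>v. rho_x v \<noteq> 0 \<Longrightarrow> rho_y v \<noteq> 0 \<Longrightarrow> f v = 0"
  shows "f = 0"
proof -
  let ?S = "(- {0 :: real^'p}) \<times> (- {0 :: real^'q})"
  have c: "closure ?S = UNIV"
    by (simp add: closure_Times closure_complement)
  have "f v = 0" for v
  proof (rule continuous_constant_on_closure[of ?S f 0 v])
    show "continuous_on (closure ?S) f" using assms(1) by (rule alg_continuous)
    show "f x = 0" if "x \<in> ?S" for x
      using that by (intro assms(2)) (auto simp: rho_eq_0_iff)
  qed (simp add: c)
  then show ?thesis by (auto simp: fun_eq_iff pw)
qed

text \<open>When x is rescaled, g v changes by a scalar only while u runs through all positive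
  numbers; so X^+ f = 0 makes the formal series \<open>ode_fps \<kappa> (g v)\<close> vanish. Then g
  v = G(v) \<Psi>_\<kappa> by \<open>Psi_fps_unique\<close>, and e < 0 would force G = 0 and f =
  0.\<close>

lemma highest_weight_deg:
  fixes f :: "('p::finite, 'q::finite) cfun"
  assumes f: "f \<in> E_deg k l e" "Xplus f = 0" "f \<noteq> 0"
  shows "\<exists>d F. e = int d \<and> F \<in> harmonic_tensor k l \<and> f = F * R 0 d (kap CARD('p) k)"
proof -
  define \<kappa> where "\<kappa> = kap CARD('p) k"
  have \<kappa>: "\<kappa> \<notin> \<int>\<^sub>\<le>\<^sub>0" unfolding \<kappa>_def by (rule kap_nonpos_Int) simp
  obtain G g where G: "G \<in> harmonic_tensor k l" and g: "e < 0 \<Longrightarrow> G = 0"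
    "\<And>v. entire_fps (g v)" "\<And>v. fps_nth (g v) 0 = G v"
    "\<And>v. rho_y v \<noteq> 0 \<Longrightarrow> f v = rho_y v powi e * eval_fps (g v) (rho_x v * rho_y v)"
    "\<And>v. rho_y v \<noteq> 0 \<Longrightarrow> Xplus f v = - (rho_y v powi (e + 1) *
        eval_fps (ode_fps \<kappa> (g v)) (rho_x v * rho_y v))"
    "\<And>c x y. g (c *\<^sub>R x, y) = fps_const (of_real c ^ k) * g (x, y)" and alg: "f \<in> alg"
    using E_deg_profile[OF f(1)] unfolding \<kappa>_def by blast
  have val: "f v = rho_y v powi e * (G v * Psi \<kappa> (rho_x v * rho_y v))"
    if v: "rho_x v \<noteq> 0" "rho_y v \<noteq> 0" for v
  proof -
    have "ode_fps \<kappa> (g v) = 0"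
    proof (rule fps_eq_0_if_eval_pos)
      show "fps_conv_radius (ode_fps \<kappa> (g v)) = \<infinity>"
        using g(2) entire_ode_fps by (simp add: entire_fps_def)
      fix w :: real assume w: "w > 0"
      define u where "u = norm (fst v) ^ 2 / 2 * (norm (snd v) ^ 2 / 2)"
      have u: "u > 0" "rho_x v * rho_y v = of_real u"
        using v by (simp_all add: u_def rho_real)
      \<comment> \<open>The scale at which rho_x rho_y takes the prescribed value w, rho_x being
        quadratic in x.\<close>
      define c where "c = sqrt (w / u)"
      have c: "c \<noteq> 0" "c ^ 2 * u = w"
        using u(1) w by (simp_all add: c_def)
      let ?v = "(c *\<^sub>R fst v, snd v)"
      have y: "rho_y ?v = rho_y v"
        using rho_scaled(2)[of c "fst v" "snd v"] by simp
      have "rho_x ?v * rho_y ?v = of_real w"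
        using rho_scaled[of c "fst v" "snd v"] u(2) c(2) by (simp add: mult.assoc flip: of_real_power of_real_mult)
      moreover have "g ?v = fps_const (of_real c ^ k) * g v"
        using g(6)[of c "fst v" "snd v"] by simp
      moreover have "ode_fps \<kappa> (fps_const z * h) = fps_const z * ode_fps \<kappa> h" for z h
        using ode_fps_linear[of \<kappa> z h 0] by (simp add: ode_fps_def)
      ultimately have "0 = rho_y v powi (e + 1) * (of_real c ^ k * eval_fps (ode_fps \<kappa> (g v)) (of_real w))"
        using g(5)[of ?v] v(2) y g(2) f(2) by (simp add: pw)
      then show "eval_fps (ode_fps \<kappa> (g v)) (of_real w) = 0"
        using v(2) c(1) by simp
    qed
    then have "g v = fps_const (G v) * Psi_fps \<kappa>"
      using Psi_fps_unique[of "g v" \<kappa>] \<kappa> g(3) by (simp add: ode_fps_def)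
    then show ?thesis
      using g(4)[OF v(2)] \<kappa> by (simp add: Psi_eq_eval_fps)
  qed
  have e: "e \<ge> 0"
  proof (rule ccontr)
    assume "\<not> e \<ge> 0"
    then have "f = 0"
      using g(1) val by (intro alg_eq_0_dense[OF alg]) (simp add: pw)
    then show False using f(3) by simp
  qed
  define d where "d = nat e"
  have "f - G * R 0 d \<kappa> = 0"
  proof (rule alg_eq_0_dense)
    show "f - G * R 0 d \<kappa> \<in> alg"
      using alg HT_alg[OF G] \<kappa> by simp
    show "(f - G * R 0 d \<kappa>) v = 0" if "rho_x v \<noteq> 0" "rho_y v \<noteq> 0" for v
      using val[OF that] R_powi[OF that(2), of d 0 e \<kappa>] e by (simp add: pw d_def)
  qed
  then show ?thesis
    using e G unfolding \<kappa>_def d_def by (intro exI[of _ "nat e"] exI[of _ G]) simp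
qed

text \<open>Different degrees e belong to different eigenvalues of H, so the weight of f selects a
  single degree, to which \<open>highest_weight_deg\<close> applies.\<close>

lemma highest_weight:
  fixes f :: "('p::finite, 'q::finite) cfun"
  assumes f: "f \<in> E_comp k l" "H_op f = cc \<mu> * f" "Xplus f = 0" "f \<noteq> 0"
  shows "\<exists>d F. F \<in> harmonic_tensor k l \<and> f = F * R 0 d (kap CARD('p) k) \<and>
    \<mu> = kap CARD('q) l - kap CARD('p) k + 2 * of_nat d"
proof -
  let ?c = "\<lambda>e. kap CARD('q) l - kap CARD('p) k + 2 * of_int e"
  obtain J g where J: "finite J" "\<And>e. g e \<in> E_deg k l e" "f = (\<Sum>e\<in>J. g e)"
    using E_comp_degs[OF f(1)] by blast
  have alg: "g e \<in> alg" for e using J(2) E_deg_alg by blast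
  have H: "H_op (g e) = cc (?c e) * g e" for e
    using E_deg_H_op[OF J(2)] by blast
  have z: "cc (?c e - \<mu>) * g e = 0" if "e \<in> J" for e
  proof (rule eigen_components_0[OF alg_linear_ops(5) J(1), of ?c "\<lambda>e. cc (?c e - \<mu>) * g e"])
    show "inj_on ?c J" by (auto simp: inj_on_def)
    show "H_op (cc (?c e - \<mu>) * g e) = cc (?c e) * (cc (?c e - \<mu>) * g e)" for e
      by (simp only: alg_linearD(7)[OF alg_linear_ops(5) alg] H mult.left_commute)
    have "H_op f = (\<Sum>e\<in>J. cc (?c e) * g e)"
      unfolding J(3) using alg by (simp add: alg_linearD(8)[OF alg_linear_ops(5)] H)
    then show "(\<Sum>e\<in>J. cc (?c e - \<mu>) * g e) = 0"
      using f(2) by (simp add: J(3) cc_hom left_diff_distrib sum_subtractf sum_distrib_left)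
  qed (use alg that in auto)
  have ne: "?c e = \<mu>" if "e \<in> J" "g e \<noteq> 0" for e
    using z[OF that(1)] that(2) by (auto simp: fun_eq_iff pw)
  obtain e0 where e0: "e0 \<in> J" "g e0 \<noteq> 0"
    using f(4) J(3) by (metis sum.neutral)
  have "g e = 0" if "e \<in> J - {e0}" for e
    using ne[of e] ne[OF e0] that by force
  then have "f = g e0"
    using J(1,3) e0(1) by (simp add: sum.remove)
  then obtain d F where "e0 = int d" "F \<in> harmonic_tensor k l" "f = F * R 0 d (kap CARD('p) k)"
    using highest_weight_deg[of f k l e0] J(2)[of e0] f(3,4) by auto
  then show ?thesis
    using ne[OF e0] by auto
qed

subsection \<open>Separation of \<open>K\<close>-types\<close>

text \<open>The x-part and the y-part have integer eigenvalues, so the real and imaginary parts of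
  one complex eigenvalue keep the two degrees apart. Being built from the actions of the Lie algebra
  and of K, the operator preserves every stable subspace.\<close>

definition type_op :: "('p::finite, 'q::finite) cfun \<Rightarrow> ('p, 'q) cfun" where
  "type_op f = (Casimir_x f + K_act (- mat 1, mat 1) f) + cc \<i> * (Casimir_y f + K_act (mat 1, - mat 1) f)"

definition type_ev :: "nat \<Rightarrow> nat \<Rightarrow> int" where
  "type_ev n k = 2 * int k * (2 - int n - int k) + (- 1) ^ k"

text \<open>The parity term \<open>(- 1) ^ k\<close> is needed for \<open>n = 1\<close> only, where the Casimir operator does not
  distinguish \<open>k = 0\<close> and \<open>k = 1\<close>.\<close>

lemma type_ev_inj:
  assumes "n > 0" "type_ev n k = type_ev n k'"
  shows "k = k'"
proof -
  \<comment> \<open>The right-hand side exceeds the left by 2 (n - 1 + 2 k) + 2 (-1)^k, which is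
    positive because (-1)^k = -1 entails k >= 1.\<close>
  have "type_ev n (Suc k) < type_ev n k" for k
  proof -
    have "(- 1) ^ k = (1 :: int) \<or> (- 1) ^ k = (- 1 :: int) \<and> k > 0"
      by (cases "even k") (auto intro: Nat.gr0I)
    then show ?thesis
      using assms(1) by (auto simp: type_ev_def algebra_simps)
  qed
  then have "strict_mono (\<lambda>k. - type_ev n k)"
    by (simp add: strict_mono_Suc_iff)
  then show ?thesis
    using assms(2) strict_mono_eq[of "\<lambda>k. - type_ev n k" k k'] by simp
qed

definition type_ev2 :: "nat \<Rightarrow> nat \<Rightarrow> nat \<times> nat \<Rightarrow> complex" where
  "type_ev2 p q i = of_int (type_ev p (fst i)) + \<i> * of_int (type_ev q (snd i))"

lemma type_ev2_inj: "p > 0 \<Longrightarrow> q > 0 \<Longrightarrow> inj_on (type_ev2 p q) I"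
proof (rule inj_onI)
  fix i j assume pq: "p > 0" "q > 0" and "type_ev2 p q i = type_ev2 p q j"
  then have "type_ev p (fst i) = type_ev p (fst j)" "type_ev q (snd i) = type_ev q (snd j)"
    by (simp_all add: type_ev2_def complex_eq_iff)
  then show "i = j"
    using type_ev_inj pq by (auto simp: prod_eq_iff)
qed

lemma minus_mat_orthogonal: "orthogonal_matrix (- mat 1 :: real^'n::finite^'n)"
proof -
  have "transpose (- mat 1 :: real^'n^'n) = - mat 1"
    by (simp add: transpose_def mat_def vec_eq_iff)
  moreover have "(- mat 1 :: real^'n^'n) ** (- mat 1) = mat 1"
  proof -
    have "- (if i = k then 1 else 0) * - (if k = j then 1 else 0) =
        (if i = k then (if i = j then 1 else 0) else (0 :: real))" for i j k :: 'n
      by auto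
    then show ?thesis
      by (simp only: matrix_matrix_mult_def mat_def vec_eq_iff vec_lambda_beta uminus_vec_def)
         (simp add: sum.delta)
  qed
  ultimately show ?thesis by (simp add: orthogonal_matrix)
qed

lemma parity_K_grp: "(- mat 1, mat 1) \<in> K_grp" "(mat 1, - mat 1) \<in> K_grp"
  by (simp_all add: K_grp_def minus_mat_orthogonal orthogonal_matrix_id)

lemma minus_mat_mult: "transpose (- mat 1 :: real^'n::finite^'n) *v x = - x"
proof -
  have "transpose (- mat 1 :: real^'n^'n) = - mat 1"
    by (simp add: transpose_def mat_def vec_eq_iff)
  moreover have "- (if i = j then 1 else 0) * x $ j = (if i = j then - x $ j else 0)" for i j
    by auto
  then have "(- mat 1 :: real^'n^'n) *v x = - x"
    by (simp only: matrix_vector_mult_def mat_def vec_eq_iff vec_lambda_beta uminus_vec_def)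
       (simp add: sum.delta)
  ultimately show ?thesis by simp
qed

lemma K_act_parity:
  "K_act (- mat 1, mat 1) f v = f (- fst v, snd v)" "K_act (mat 1, - mat 1) f v = f (fst v, - snd v)"
  by (simp_all add: K_act_eq parity_K_grp transpose_mat minus_mat_mult del: transpose_matrix_vector)

lemma alg_linear_Casimir: "alg_linear Casimir_x" "alg_linear Casimir_y"
  unfolding Casimir_x_def[abs_def] Casimir_y_def[abs_def]
  by (intro alg_linear_sum alg_linear_comp[OF alg_linear_ops(8) alg_linear_ops(8)]
      alg_linear_comp[OF alg_linear_ops(9) alg_linear_ops(9)])+

lemma alg_linear_type_op: "alg_linear type_op"
  unfolding type_op_def[abs_def]
  by (intro alg_linear_add alg_linear_cc_mult alg_linear_Casimir alg_linear_K_act parity_K_grp)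

lemma pi_pp_R:
  assumes "F \<in> alg" "\<alpha> \<notin> \<int>\<^sub>\<le>\<^sub>0"
  shows "pi_pp i j (F * R a b \<alpha>) = pi_pp i j F * R a b \<alpha>"
  using assms by (simp add: pi_pp_conv dx_mult dx_R) (simp add: algebra_simps)

lemma pi_qq_R:
  assumes "F \<in> alg" "\<alpha> \<notin> \<int>\<^sub>\<le>\<^sub>0"
  shows "pi_qq i j (F * R a b \<alpha>) = pi_qq i j F * R a b \<alpha>"
  using assms by (simp add: pi_qq_conv dy_mult dy_R) (simp add: algebra_simps)

lemma type_op_R:
  fixes F :: "('p::finite, 'q::finite) cfun"
  assumes F: "F \<in> harmonic_tensor k l" and \<alpha>: "\<alpha> \<notin> \<int>\<^sub>\<le>\<^sub>0"
  shows "type_op (F * R a b \<alpha>) = cc (type_ev2 CARD('p) CARD('q) (k, l)) * (F * R a b \<alpha>)"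
proof -
  have "Casimir_x (F * R a b \<alpha>) = Casimir_x F * R a b \<alpha>" "Casimir_y (F * R a b \<alpha>) = Casimir_y F * R a b \<alpha>"
    using HT_alg[OF F] \<alpha> by (simp_all add: Casimir_x_def Casimir_y_def pi_pp_R pi_qq_R sum_distrib_right)
  moreover have "K_act (- mat 1, mat 1) F = cc ((- 1) ^ k) * F" "K_act (mat 1, - mat 1) F = cc ((- 1) ^ l) * F"
    using HT_scaled[OF F, of "-1" _ 1] HT_scaled[OF F, of 1 _ "-1"]
    by (auto simp: fun_eq_iff pw K_act_parity)
  ultimately show ?thesis
    by (simp add: type_op_def parity_K_grp Casimir_x_HT[OF F] Casimir_y_HT[OF F])
      (simp add: type_ev2_def type_ev_def fun_eq_iff pw algebra_simps)
qed

lemma type_op_E_comp: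
  fixes f :: "('p::finite, 'q::finite) cfun"
  assumes "f \<in> E_comp k l"
  shows "type_op f = cc (type_ev2 CARD('p) CARD('q) (k, l)) * f"
proof -
  have "type_op f - cc (type_ev2 CARD('p) CARD('q) (k, l)) * f \<in> {0}"
    by (rule E_comp_map[OF alg_linear_diff[OF alg_linear_type_op alg_linear_mult] _ assms])
      (auto simp: type_op_R cfun.subspace_def cscale_def zero_fun_def)
  then show ?thesis by simp
qed

lemma E_components:
  fixes N :: "('p::finite, 'q::finite) cfun set"
  assumes "cfun.subspace N" "\<And>f. f \<in> N \<Longrightarrow> type_op f \<in> N" "finite J"
    and "\<And>i. i \<in> J \<Longrightarrow> g i \<in> E_comp (fst i) (snd i)" "(\<Sum>i\<in>J. g i) \<in> N" "i \<in> J"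
  shows "g i \<in> N"
  by (rule eigen_components[OF alg_linear_type_op assms(1,2,3) type_ev2_inj[of "CARD('p)" "CARD('q)"] _ _ assms(5,6)])
    (use assms(4) E_comp_alg type_op_E_comp in \<open>force+\<close>)

lemma E_components_0:
  fixes g :: "nat \<times> nat \<Rightarrow> ('p::finite, 'q::finite) cfun"
  assumes "finite J" "\<And>i. i \<in> J \<Longrightarrow> g i \<in> E_comp (fst i) (snd i)" "(\<Sum>i\<in>J. g i) = 0" "i \<in> J"
  shows "g i = 0"
proof -
  have "g i \<in> {0}"
    by (rule E_components[OF _ _ assms(1,2) _ assms(4)])
      (use assms(3) in \<open>auto simp: cfun.subspace_def cscale_def zero_fun_def alg_linearD(4)[OF alg_linear_type_op, unfolded zero_fun_def]\<close>)
  then show ?thesis by simp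
qed

lemma E_comp_sub_E_space: "E_comp k l \<subseteq> E_space"
proof
  fix f :: "('a, 'b) cfun" assume f: "f \<in> E_comp k l"
  have sub: "cfun.subspace (E_space :: ('a, 'b) cfun set)" by (simp add: E_space_def)
  show "f \<in> E_space"
  proof (rule E_comp_map[OF alg_linear_id sub f])
    fix F :: "('a, 'b) cfun" and a b :: nat and \<alpha> :: complex
    assume F: "F \<in> harmonic_tensor k l" and \<alpha>: "\<alpha> \<notin> \<int>\<^sub>\<le>\<^sub>0"
    have "R a b \<alpha> * F \<in> E_space"
    proof (rule HT_map[OF alg_linear_mult sub _ F])
      fix h1 :: "real^'a \<Rightarrow> complex" and h2 :: "real^'b \<Rightarrow> complex"
      assume h: "h1 \<in> harmonic k" "h2 \<in> harmonic l"
      have "R a b \<alpha> * (liftx h1 * lifty h2) =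
          (\<lambda>v. h1 (fst v) * h2 (snd v) * rho_x v ^ a * rho_y v ^ b * psi \<alpha> v)"
        by (simp add: fun_eq_iff R_def pw liftx_def lifty_def)
      then show "R a b \<alpha> * (liftx h1 * lifty h2) \<in> E_space"
        unfolding E_space_def using h \<alpha> by (intro cfun.span_base) blast
    qed (use \<alpha> in simp)
    then show "F * R a b \<alpha> \<in> E_space" by (simp add: mult.commute)
  qed
qed

lemma E_space_subspace: "cfun.subspace E_space"
  by (simp add: E_space_def)

lemma E_space_components:
  assumes "f \<in> E_space"
  shows "\<exists>J g. finite J \<and> (\<forall>i. g i \<in> E_comp (fst i) (snd i)) \<and> f = (\<Sum>i\<in>J. g i)"
proof -
  define X :: "nat \<times> nat \<Rightarrow> ('a, 'b) cfun set" where "X i =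
    {(\<lambda>v. h1 (fst v) * h2 (snd v) * rho_x v ^ a * rho_y v ^ b * psi \<alpha> v)
      | h1 h2 a b \<alpha>. h1 \<in> harmonic (fst i) \<and> h2 \<in> harmonic (snd i) \<and> \<alpha> \<notin> \<int>\<^sub>\<le>\<^sub>0}" for i
  have "f \<in> cfun.span (\<Union>i\<in>UNIV. X i)"
  proof -
    have "{(\<lambda>v. h1 (fst v) * h2 (snd v) * rho_x v ^ a * rho_y v ^ b * psi \<alpha> v)
      | h1 h2 k l a b \<alpha>. h1 \<in> harmonic k \<and> h2 \<in> harmonic l \<and> \<alpha> \<notin> \<int>\<^sub>\<le>\<^sub>0} \<subseteq> (\<Union>i\<in>UNIV. X i)"
      unfolding X_def by fastforce
    then show ?thesis
      using assms cfun.span_mono unfolding E_space_def by blast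
  qed
  moreover have "cfun.span (X i) \<subseteq> E_comp (fst i) (snd i)" for i
  proof (rule cfun.span_minimal[OF _ E_comp_subspace])
    show "X i \<subseteq> E_comp (fst i) (snd i)"
    proof
      fix f assume "f \<in> X i"
      then obtain h1 h2 a b \<alpha> where f: "f = (\<lambda>v. h1 (fst v) * h2 (snd v) * rho_x v ^ a * rho_y v ^ b * psi \<alpha> v)"
        "h1 \<in> harmonic (fst i)" "h2 \<in> harmonic (snd i)" "\<alpha> \<notin> \<int>\<^sub>\<le>\<^sub>0"
        unfolding X_def by blast
      have "f = liftx h1 * lifty h2 * R a b \<alpha>"
        by (simp add: f(1) fun_eq_iff R_def pw liftx_def lifty_def)
      then show "f \<in> E_comp (fst i) (snd i)"
        using E_comp_gen[OF HT_product[OF f(2,3)] f(4)] by simp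
    qed
  qed
  ultimately show ?thesis
    using span_UN_sum[of f X UNIV] by blast
qed

lemma E_space_alg: "f \<in> E_space \<Longrightarrow> f \<in> alg"
  using E_space_components[of f] E_comp_alg by (metis alg_sum)

lemma E_space_stable:
  assumes A: "alg_linear A" "\<And>k l g. g \<in> E_comp k l \<Longrightarrow> A g \<in> E_comp k l" and "f \<in> E_space"
  shows "A f \<in> E_space"
proof -
  obtain J g where g: "finite J" "\<And>i. g i \<in> E_comp (fst i) (snd i)" "f = (\<Sum>i\<in>J. g i)"
    using E_space_components[OF assms(3)] by blast
  have "A f = (\<Sum>i\<in>J. A (g i))"
    unfolding g(3) by (intro alg_linearD(8)[OF A(1)] E_comp_alg[OF g(2)])
  moreover have "A (g i) \<in> E_space" for i
    using A(2)[OF g(2)[of i]] E_comp_sub_E_space by blast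
  ultimately show ?thesis
    by (simp only:) (intro cfun.subspace_sum[OF E_space_subspace])
qed

lemma funpow_alg_linear: "alg_linear A \<Longrightarrow> alg_linear (A ^^ n)"
proof (induction n)
  case 0
  then show ?case using alg_linear_id by (simp add: id_def)
next
  case (Suc n)
  then show ?case using alg_linear_comp[of A "A ^^ n"] by (simp add: o_def)
qed

lemma funpow_E_comp: 
  "f \<in> E_comp k l \<Longrightarrow> (Xminus ^^ n) f \<in> E_comp k l" "f \<in> E_comp k l \<Longrightarrow> (Xplus ^^ n) f \<in> E_comp k l"
  by (induction n) (auto intro: E_comp_Xminus E_comp_Xplus)

lemma funpow_E_space: 
  "f \<in> E_space \<Longrightarrow> (Xminus ^^ n) f \<in> E_space" "f \<in> E_space \<Longrightarrow> (Xplus ^^ n) f \<in> E_space"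
  by (induction n)
    (auto intro: E_space_stable[OF alg_linear_ops(7) E_comp_Xminus] E_space_stable[OF alg_linear_ops(6) E_comp_Xplus])

section \<open>M^+(m) and M^-(m) as weight spaces of the sl2 triple\<close>

lemmas sl2_plus = alg_linear_ops(6,7,5) Xplus_Xminus H_op_Xminus

lemma sl2_minus:
  "alg_linear Xminus" "alg_linear Xplus" "alg_linear (\<lambda>f. - H_op f)"
  "f \<in> alg \<Longrightarrow> Xminus (Xplus f) - Xplus (Xminus f) = - H_op f"
  "f \<in> alg \<Longrightarrow> - H_op (Xplus f) - Xplus (- H_op f) = cc (-2) * Xplus f"
proof -
  show "alg_linear Xminus" "alg_linear Xplus" "alg_linear (\<lambda>f. - H_op f)"
    by (intro alg_linear_ops alg_linear_minus)+
  show "Xminus (Xplus f) - Xplus (Xminus f) = - H_op f" if "f \<in> alg"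
    using Xplus_Xminus[OF that] by (metis minus_diff_eq)
  show "- H_op (Xplus f) - Xplus (- H_op f) = cc (-2) * Xplus f" if "f \<in> alg"
    using H_op_Xplus[OF that] that
    by (simp add: alg_linearD(6)[OF alg_linear_ops(6)] cc_hom) (metis minus_diff_eq minus_diff_commute)
qed

text \<open>For f \<noteq> 0 the conditions (X^-)^j f \<noteq> 0 follow from the weight and X^+ f =
  0 by \<open>sl2_nonzero\<close>. What remains are linear equations, so that
  \<open>M_plus m\<close> is visibly a subspace.\<close>

lemma M_plus_eq:
  "M_plus m = {f \<in> E_space. H_op f = cc (of_nat m) * f \<and> Xplus f = 0 \<and> (Xminus ^^ (m + 1)) f = 0}"
    (is "_ = ?R")
proof
  have z: "(Xminus ^^ (m + 1)) 0 = 0"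
    by (rule alg_linearD(4)[OF funpow_alg_linear[OF alg_linear_ops(7)]])
  show "M_plus m \<subseteq> ?R"
    using cfun.subspace_0[OF E_space_subspace] z
    by (auto simp: M_plus_def cscale_conv alg_linearD(4)[OF alg_linear_ops(5)] alg_linearD(4)[OF alg_linear_ops(6)])
  show "?R \<subseteq> M_plus m"
  proof
    fix f assume f: "f \<in> ?R"
    then show "f \<in> M_plus m"
      using sl2_nonzero[OF sl2_plus, of f m] E_space_alg[of f]
      by (cases "f = 0") (auto simp: M_plus_def cscale_conv)
  qed
qed

lemma M_minus_eq:
  "M_minus m = {f \<in> E_space. H_op f = cc (- of_nat m) * f \<and> Xminus f = 0 \<and> (Xplus ^^ (m + 1)) f = 0}"
    (is "_ = ?R")
proof
  have z: "(Xplus ^^ (m + 1)) 0 = 0"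
    by (rule alg_linearD(4)[OF funpow_alg_linear[OF alg_linear_ops(6)]])
  show "M_minus m \<subseteq> ?R"
    using cfun.subspace_0[OF E_space_subspace] z
    by (auto simp: M_minus_def cscale_conv alg_linearD(4)[OF alg_linear_ops(5)] alg_linearD(4)[OF alg_linear_ops(7)])
  show "?R \<subseteq> M_minus m"
  proof
    fix f assume f: "f \<in> ?R"
    then show "f \<in> M_minus m"
      using sl2_nonzero[OF sl2_minus, of f m] E_space_alg[of f]
      by (cases "f = 0") (auto simp: M_minus_def cscale_conv cc_hom)
  qed
qed

lemma kernel_subspace:
  assumes "alg_linear A" "cfun.subspace S" "S \<subseteq> alg"
  shows "cfun.subspace {f \<in> S. A f = 0}"
  using assms cfun.subspace_add[OF assms(2)] cfun.subspace_scale[OF assms(2)] cfun.subspace_0[OF assms(2)]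
  by (intro cfun.subspaceI) (auto simp: alg_linearD(2,3,4)[OF assms(1)] subsetD cfun.scale_zero_right)

lemma M_plus_subspace: "cfun.subspace (M_plus m :: ('p::finite, 'q::finite) cfun set)"
proof -
  have "M_plus m = {f \<in> {f \<in> {f \<in> E_space :: ('p, 'q) cfun set. H_op f - cc (of_nat m) * f = 0}. Xplus f = 0}.
      (Xminus ^^ (m + 1)) f = 0}"
    unfolding M_plus_eq by auto
  moreover have "cfun.subspace \<dots>"
    by (intro kernel_subspace funpow_alg_linear alg_linear_ops alg_linear_diff alg_linear_mult alg.const E_space_subspace)
      (use E_space_alg in auto)
  ultimately show ?thesis by (simp only:)
qed

declare uminus_apply [simp del] minus_apply [simp del]

subsection \<open>The \<open>K\<close>-type formula\<close>

text \<open>The weight equation of \<open>highest_weight\<close>, doubled to clear the halves, so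
  that it can be handled over the naturals.\<close>

lemma kap_eq_iff:
  "(of_nat m :: complex) = kap q l - kap p k + 2 * of_nat j \<longleftrightarrow> 2 * k + p + 2 * m = 2 * l + q + 4 * j"
proof -
  let ?x = "kap q l - kap p k + 2 * of_nat j"
  have "2 * ((of_nat m :: complex) - ?x) = of_nat (2 * k + p + 2 * m) - of_nat (2 * l + q + 4 * j)"
    by (simp add: kap_def algebra_simps)
  moreover have "(of_nat m :: complex) = ?x \<longleftrightarrow> 2 * (of_nat m - ?x) = 0"
    by (simp only: mult_eq_0_iff right_minus_eq) simp
  ultimately have "(of_nat m :: complex) = ?x \<longleftrightarrow>
      (of_nat (2 * k + p + 2 * m) :: complex) = of_nat (2 * l + q + 4 * j)"
    by (simp only: right_minus_eq)
  then show ?thesis by (simp only: of_nat_eq_iff)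
qed

lemma K_type_index_iff:
  "(k, l) \<in> K_type_index p q m \<longleftrightarrow> (\<exists>j\<le>m. 2 * k + p + 2 * m = 2 * l + q + 4 * j)"
proof -
  have "real k - real l + (real p - real q) / 2 = - real m + 2 * real j \<longleftrightarrow>
      2 * k + p + 2 * m = 2 * l + q + 4 * j" for j
  proof -
    have "real k - real l + (real p - real q) / 2 = - real m + 2 * real j \<longleftrightarrow>
        real (2 * k + p + 2 * m) = real (2 * l + q + 4 * j)"
      by (simp add: field_simps)
    then show ?thesis by (simp only: of_nat_eq_iff)
  qed
  then show ?thesis
    by (auto simp: K_type_index_def Lambda_def)
qed

text \<open>The exponent of rho_y in the highest weight vectors of type (k, l), that is, the j of
  \<open>K_type_index_iff\<close>; on the index set subtraction and division are exact.\<close>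

definition wt_index :: "nat \<Rightarrow> nat \<Rightarrow> nat \<Rightarrow> nat \<times> nat \<Rightarrow> nat" where
  "wt_index p q m i = (2 * fst i + p + 2 * m - (2 * snd i + q)) div 4"

lemma wt_index_eq: "2 * k + p + 2 * m = 2 * l + q + 4 * j \<Longrightarrow> wt_index p q m (k, l) = j"
  by (simp add: wt_index_def)

lemma K_type_index_wt:
  assumes "(k, l) \<in> K_type_index p q m"
  shows "wt_index p q m (k, l) \<le> m" "2 * k + p + 2 * m = 2 * l + q + 4 * wt_index p q m (k, l)"
  using assms wt_index_eq[of k p m l q] unfolding K_type_index_iff by auto

text \<open>Multiplication by this K-invariant function embeds the type (k, l) into M^+(m) when (k,
  l) belongs to the index set.\<close>

definition hw :: "nat \<Rightarrow> nat \<times> nat \<Rightarrow> ('p::finite, 'q::finite) cfun" where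
  "hw m i = R 0 (wt_index CARD('p) CARD('q) m i) (kap CARD('p) (fst i))"

lemma hw_eq:
  "2 * k + CARD('p) + 2 * m = 2 * l + CARD('q) + 4 * j \<Longrightarrow>
    (hw m (k, l) :: ('p::finite, 'q::finite) cfun) = R 0 j (kap CARD('p) k)"
  using wt_index_eq[of k "CARD('p)" m l "CARD('q)" j] by (simp add: hw_def)

lemma hw_alg [simp, intro]: "hw m i \<in> alg"
  by (simp add: hw_def kap_nonpos_Int)

lemma hw_K_act [simp]: "g \<in> K_grp \<Longrightarrow> K_act g (hw m i) = hw m i"
  by (simp add: hw_def)

lemma hw_E_comp: "F \<in> harmonic_tensor (fst i) (snd i) \<Longrightarrow> F * hw m i \<in> E_comp (fst i) (snd i)"
  unfolding hw_def by (intro E_comp_gen kap_nonpos_Int) simp_all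

text \<open>For a = 0 and \<alpha> = \<kappa> the surviving terms of \<open>XR\<close> are the
  three-term relation divided by \<kappa>: \<Psi>_\<kappa> solves its differential equation.\<close>

lemma XR_0:
  assumes "\<kappa> \<notin> \<int>\<^sub>\<le>\<^sub>0"
  shows "XR \<kappa> 0 j \<kappa> = 0"
proof -
  have n: "\<kappa> \<noteq> 0" using assms by auto
  show ?thesis
  proof (rule ext)
    fix v
    have "\<kappa> * R 0 (Suc j) \<kappa> v = \<kappa> * R 0 (Suc j) (\<kappa> + 1) v
        - 1 / (\<kappa> + 1) * R (Suc 0) (Suc (Suc j)) (\<kappa> + 2) v"
      using fun_cong[OF R_contiguous[OF assms, of 0 "Suc j"], of v] by (simp add: pw)
    moreover have "\<kappa> * XR \<kappa> 0 j \<kappa> v = \<kappa> * R 0 (Suc j) \<kappa> v - \<kappa> * R 0 (Suc j) (\<kappa> + 1) v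
        + 1 / (\<kappa> + 1) * R (Suc 0) (Suc (Suc j)) (\<kappa> + 2) v"
    proof -
      have "\<kappa> + 1 \<noteq> 0" using nonpos_Int_add_1[OF assms] by auto
      then show ?thesis
        using n by (simp add: XR_def pw divide_simps) (simp add: algebra_simps)
    qed
    ultimately have "\<kappa> * XR \<kappa> 0 j \<kappa> v = 0"
      by simp
    then show "XR \<kappa> 0 j \<kappa> v = 0 v"
      using n by (simp add: pw)
  qed
qed

text \<open>Write K1 = \<open>kap CARD('p) k\<close> and K2 = \<open>kap CARD('q) l\<close>. The
  equation X^+ f = 0 gives the shape of f and m = K2 - K1 + 2 j. The bound j <= m comes from the
  other end of the string: (X^-)^m f is a lowest weight vector of weight -m, and after exchanging x
  and y the same classification gives m = K1 - K2 + 2 d with d >= 0. Hence m = j + d.\<close>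

lemma M_plus_component:
  fixes f :: "('p::finite, 'q::finite) cfun"
  assumes f: "f \<in> E_comp k l" "H_op f = cc (of_nat m) * f" "Xplus f = 0" "(Xminus ^^ (m + 1)) f = 0" "f \<noteq> 0"
  shows "\<exists>F. (k, l) \<in> K_type_index CARD('p) CARD('q) m \<and> F \<in> harmonic_tensor k l \<and> f = F * hw m (k, l)"
proof -
  note alg = E_comp_alg[OF f(1)]
  obtain j F where F: "F \<in> harmonic_tensor k l" "f = F * R 0 j (kap CARD('p) k)"
    "of_nat m = kap CARD('q) l - kap CARD('p) k + 2 * of_nat j"
    using highest_weight[OF f(1,2,3,5)] by blast
  define g where "g = (Xminus ^^ m) f"
  have g0: "g \<noteq> 0"
    unfolding g_def by (rule sl2_nonzero[OF sl2_plus alg f(2,3,5)]) simp_all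
  have gE: "g \<in> E_comp k l"
    unfolding g_def by (rule funpow_E_comp(1)[OF f(1)])
  have Hg: "H_op g = cc (- of_nat m) * g"
    using sl2_weight[OF sl2_plus alg f(2), of m] by (simp add: g_def)
  have Xg: "Xminus g = 0"
    using f(4) by (simp add: g_def)
  have "H_op (swp g) = cc (of_nat m) * swp g"
    by (simp add: swp_ops Hg cc_hom)
  moreover have "Xplus (swp g) = 0"
    by (simp add: swp_ops Xg)
  ultimately obtain d G where "of_nat m = kap CARD('p) k - kap CARD('q) l + 2 * of_nat d"
    using highest_weight[OF E_comp_swp[OF gE]] g0 by (metis swp_eq_0)
  moreover have "kap CARD('p) k - kap CARD('q) l = - (of_nat m - 2 * of_nat j)"
    using F(3) by (simp add: algebra_simps)
  ultimately have "of_nat (2 * m) = (of_nat (2 * j + 2 * d) :: complex)"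
    by (simp add: algebra_simps)
  then have "j \<le> m"
    by (simp only: of_nat_eq_iff)
  moreover have e: "2 * k + CARD('p) + 2 * m = 2 * l + CARD('q) + 4 * j"
    using F(3) by (simp only: kap_eq_iff)
  ultimately have "(k, l) \<in> K_type_index CARD('p) CARD('q) m"
    unfolding K_type_index_iff by blast
  then show ?thesis
    using F(1,2) hw_eq[OF e] by auto
qed

text \<open>The vector (X^-)^(m+1) f is killed by X^+ and has weight -m - 2. Were it nonzero, the
  classification of highest weight vectors would supply an exponent d >= 0 with j = d + m + 1,
  against j <= m.\<close>

lemma M_plus_hw:
  fixes F :: "('p::finite, 'q::finite) cfun"
  assumes F: "F \<in> harmonic_tensor k l" and i: "(k, l) \<in> K_type_index CARD('p) CARD('q) m"
  shows "F * hw m (k, l) \<in> M_plus m"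
proof -
  define \<kappa> j where "\<kappa> = kap CARD('p) k" and "j = wt_index CARD('p) CARD('q) m (k, l)"
  have \<kappa>: "\<kappa> \<notin> \<int>\<^sub>\<le>\<^sub>0" unfolding \<kappa>_def by (rule kap_nonpos_Int) simp
  have j: "j \<le> m" "2 * k + CARD('p) + 2 * m = 2 * l + CARD('q) + 4 * j"
    using K_type_index_wt[OF i] by (simp_all add: j_def)
  define f where "f = F * R 0 j \<kappa>"
  have fE: "f \<in> E_comp k l"
    unfolding f_def by (rule E_comp_gen[OF F \<kappa>])
  note alg = E_comp_alg[OF fE]
  have m: "(of_nat m :: complex) = kap CARD('q) l - \<kappa> + 2 * of_nat j"
    using j(2) unfolding \<kappa>_def by (simp only: kap_eq_iff)
  have H: "H_op f = cc (of_nat m) * f"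
    unfolding f_def H_op_R[OF F \<kappa>] m by (simp add: \<kappa>_def)
  have X: "Xplus f = 0"
    unfolding f_def Xplus_R[OF F \<kappa>] by (simp add: XR_0[OF \<kappa>] flip: \<kappa>_def)
  have "(Xminus ^^ (m + 1)) f = 0"
  proof (rule ccontr)
    assume nz: "(Xminus ^^ (m + 1)) f \<noteq> 0"
    have "Xplus ((Xminus ^^ Suc m) f) = cc (of_nat (Suc m) * (of_nat m - of_nat m)) * (Xminus ^^ m) f"
      by (rule sl2_raise[OF sl2_plus alg H X])
    then have "Xplus ((Xminus ^^ (m + 1)) f) = 0"
      by (simp add: cc_hom)
    then obtain d where "of_nat m - 2 * of_nat (m + 1) = kap CARD('q) l - \<kappa> + 2 * (of_nat d :: complex)"
      using highest_weight[OF funpow_E_comp(1)[OF fE] sl2_weight[OF sl2_plus alg H] _ nz]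
      unfolding \<kappa>_def by blast
    moreover have "kap CARD('q) l - \<kappa> = of_nat m - 2 * of_nat j"
      using m by (simp add: algebra_simps)
    ultimately have "of_nat (2 * j) = (of_nat (2 * d + 2 * m + 2) :: complex)"
      by (simp add: algebra_simps)
    then have "2 * j = 2 * d + 2 * m + 2" by (simp only: of_nat_eq_iff)
    then show False using j(1) by simp
  qed
  then have "f \<in> M_plus m"
    using subsetD[OF E_comp_sub_E_space fE] H X by (simp add: M_plus_eq)
  then show ?thesis
    using hw_eq[OF j(2)] by (simp add: f_def \<kappa>_def)
qed

text \<open>The defining equations of M^+(m) are given by operators that respect the isotypic parts,
  so each part of f satisfies them separately.\<close>

lemma M_plus_sum:
  fixes f :: "('p::finite, 'q::finite) cfun"
  assumes f: "f \<in> M_plus m"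
  shows "\<exists>J G. finite J \<and> J \<subseteq> K_type_index CARD('p) CARD('q) m \<and>
    (\<forall>i\<in>J. G i \<in> harmonic_tensor (fst i) (snd i)) \<and> f = (\<Sum>i\<in>J. G i * hw m i)"
proof -
  have f': "f \<in> E_space" "H_op f = cc (of_nat m) * f" "Xplus f = 0" "(Xminus ^^ (m + 1)) f = 0"
    using f by (auto simp: M_plus_eq)
  obtain J g where g: "finite J" "\<And>i. g i \<in> E_comp (fst i) (snd i)" "f = (\<Sum>i\<in>J. g i)"
    using E_space_components[OF f'(1)] by blast
  have alg: "g i \<in> alg" for i using g(2) E_comp_alg by blast
  have ker: "A (g i) = 0" if A: "alg_linear A" "\<And>k l h. h \<in> E_comp k l \<Longrightarrow> A h \<in> E_comp k l" "A f = 0"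
    and i: "i \<in> J" for A i
  proof (rule E_components_0[OF g(1) _ _ i])
    show "A (g i) \<in> E_comp (fst i) (snd i)" for i
      by (rule A(2)[OF g(2)])
    show "(\<Sum>i\<in>J. A (g i)) = 0"
      using A(3) alg unfolding g(3) by (simp add: alg_linearD(8)[OF A(1)])
  qed
  have H: "H_op (g i) = cc (of_nat m) * g i" if "i \<in> J" for i
  proof -
    have "H_op (g i) - cc (of_nat m) * g i = 0"
      using f'(2) that
      by (intro ker[where A = "\<lambda>f. H_op f - cc (of_nat m) * f"] alg_linear_diff alg_linear_ops
        alg_linear_mult alg.const cfun.subspace_diff[OF E_comp_subspace] E_comp_H_op
        subspace_cc_mult[OF E_comp_subspace]) auto
    then show ?thesis by simp
  qed
  have X: "Xplus (g i) = 0" if "i \<in> J" for i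
    by (rule ker[OF alg_linear_ops(6) E_comp_Xplus f'(3) that])
  have Y: "(Xminus ^^ (m + 1)) (g i) = 0" if "i \<in> J" for i
    by (rule ker[OF funpow_alg_linear[OF alg_linear_ops(7)] funpow_E_comp(1) f'(4) that])
  define J' where "J' = {i \<in> J. g i \<noteq> 0}"
  have "\<exists>F. i \<in> K_type_index CARD('p) CARD('q) m \<and> F \<in> harmonic_tensor (fst i) (snd i) \<and> g i = F * hw m i"
    if "i \<in> J'" for i
    using M_plus_component[OF g(2)[of i] H[of i] X[of i] Y[of i]] that by (simp add: J'_def)
  then obtain G where G: "\<And>i. i \<in> J' \<Longrightarrow> i \<in> K_type_index CARD('p) CARD('q) m"
    "\<And>i. i \<in> J' \<Longrightarrow> G i \<in> harmonic_tensor (fst i) (snd i)" "\<And>i. i \<in> J' \<Longrightarrow> g i = G i * hw m i"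
    by metis
  have "f = (\<Sum>i\<in>J'. g i)"
    unfolding g(3) J'_def using g(1) by (intro sum.mono_neutral_right) auto
  also have "\<dots> = (\<Sum>i\<in>J'. G i * hw m i)"
    using G(3) by (intro sum.cong) auto
  finally show ?thesis
    using G(1,2) g(1) by (intro exI[of _ J'] exI[of _ G]) (auto simp: J'_def)
qed

text \<open>Where F(v) \<noteq> 0, scaling x lets rho_x rho_y sweep the positive reals while F stays
  nonzero, so \<Psi>_\<kappa> would vanish identically, contrary to its constant term 1.\<close>

lemma hw_cancel:
  fixes F :: "('p::finite, 'q::finite) cfun"
  assumes F: "F \<in> harmonic_tensor (fst i) (snd i)" and z: "F * hw m i = 0"
  shows "F = 0"
proof (rule alg_eq_0_dense[OF HT_alg[OF F]])
  fix v :: "('p, 'q) V" assume v: "rho_x v \<noteq> 0" "rho_y v \<noteq> 0"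
  define \<kappa> where "\<kappa> = kap CARD('p) (fst i)"
  have \<kappa>: "\<kappa> \<notin> \<int>\<^sub>\<le>\<^sub>0" unfolding \<kappa>_def by (rule kap_nonpos_Int) simp
  show "F v = 0"
  proof (rule ccontr)
    assume F0: "F v \<noteq> 0"
    have "Psi_fps \<kappa> = 0"
    proof (rule fps_eq_0_if_eval_pos[OF Psi_fps_conv_radius[OF \<kappa>]])
      fix w :: real assume w: "w > 0"
      define u where "u = norm (fst v) ^ 2 / 2 * (norm (snd v) ^ 2 / 2)"
      have u: "u > 0" "rho_x v * rho_y v = of_real u"
        using v by (simp_all add: u_def rho_real)
      define c where "c = sqrt (w / u)"
      have c: "c \<noteq> 0" "c ^ 2 * u = w"
        using u(1) w by (simp_all add: c_def)
      let ?v = "(c *\<^sub>R fst v, snd v)"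
      have y: "rho_y ?v = rho_y v"
        using rho_scaled(2)[of c "fst v" "snd v"] by simp
      have x: "rho_x ?v * rho_y ?v = of_real w"
        using rho_scaled[of c "fst v" "snd v"] u(2) c(2) by (simp add: mult.assoc flip: of_real_power of_real_mult)
      have "F ?v = of_real c ^ fst i * F v"
        using HT_scaled[OF F, of c "fst v" 1 "snd v"] by simp
      moreover have "F ?v * (rho_y ?v ^ wt_index CARD('p) CARD('q) m i * Psi \<kappa> (rho_x ?v * rho_y ?v)) = 0"
        using fun_cong[OF z, of ?v] by (simp add: hw_def R_def pw psi_def \<kappa>_def)
      ultimately have "Psi \<kappa> (of_real w) = 0"
        using F0 c(1) v(2) unfolding y x[unfolded y] by simp
      then show "eval_fps (Psi_fps \<kappa>) (of_real w) = 0"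
        by (simp add: Psi_eq_eval_fps)
    qed
    then show False
      using Psi_fps_nth_0[of \<kappa>] by simp
  qed
qed

text \<open>The isomorphism multiplies each component by the K-invariant \<open>hw m i\<close> and
  adds up. It is injective because parts of different type are independent and
  \<open>hw_cancel\<close> applies within one type, and surjective by
  \<open>M_plus_sum\<close>.\<close>

lemma M_plus_K_iso:
  "K_iso_direct_sum (M_plus m :: ('p::finite, 'q::finite) cfun set)
     (K_type_index CARD('p) CARD('q) m) (\<lambda>(k, l). harmonic_tensor k l)"
proof -
  let ?I = "K_type_index CARD('p) CARD('q) m"
  let ?D = "direct_sum ?I (\<lambda>(k, l). harmonic_tensor k l :: ('p, 'q) cfun set)"
  define T :: "(nat \<times> nat \<Rightarrow> ('p, 'q) cfun) \<Rightarrow> ('p, 'q) cfun" where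
    "T F = (\<Sum>i | F i \<noteq> 0. F i * hw m i)" for F
  have D: "F i \<in> harmonic_tensor (fst i) (snd i)" "finite {i. F i \<noteq> 0}" "F i \<noteq> 0 \<Longrightarrow> i \<in> ?I"
    if "F \<in> ?D" for F i
  proof -
    show "F i \<in> harmonic_tensor (fst i) (snd i)"
      using that by (cases i; cases "i \<in> ?I") (auto simp: direct_sum_def HT_0)
  qed (use that in \<open>cases i; auto simp: direct_sum_def\<close>)+
  have T: "T F = (\<Sum>i\<in>S. F i * hw m i)" if "finite S" "{i. F i \<noteq> 0} \<subseteq> S" for F S
    unfolding T_def using that by (intro sum.mono_neutral_left) auto
  have inj: "inj_on T ?D"
  proof (rule inj_onI)
    fix F G assume F: "F \<in> ?D" and G: "G \<in> ?D" and e: "T F = T G"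
    define S where "S = {i. F i \<noteq> 0} \<union> {i. G i \<noteq> 0}"
    have S: "finite S" using D(2)[OF F] D(2)[OF G] by (simp add: S_def)
    have "(\<Sum>i\<in>S. (F i - G i) * hw m i) = 0"
      using e T[OF S, of F] T[OF S, of G] by (simp add: S_def left_diff_distrib sum_subtractf)
    then have "(F i - G i) * hw m i = 0" if "i \<in> S" for i
      using D(1)[OF F] D(1)[OF G] that
      by (intro E_components_0[OF S, where g = "\<lambda>i. (F i - G i) * hw m i"] hw_E_comp
          cfun.subspace_diff[OF HT_subspace]) auto
    then have "F i - G i = 0" if "i \<in> S" for i
      using that D(1)[OF F] D(1)[OF G] by (intro hw_cancel[of "F i - G i" i m] cfun.subspace_diff[OF HT_subspace]) auto
    then show "F = G"
      by (force simp: S_def fun_eq_iff[of F G])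
  qed
  have surj: "T ` ?D = M_plus m"
  proof
    show "T ` ?D \<subseteq> M_plus m"
    proof
      fix f assume "f \<in> T ` ?D"
      then obtain F where F: "F \<in> ?D" "f = T F" by blast
      have "F i * hw m i \<in> M_plus m" if "F i \<noteq> 0" for i
        using M_plus_hw[of "F i" "fst i" "snd i" m] D(1,3)[OF F(1)] that by simp
      then show "f \<in> M_plus m"
        unfolding F(2) T_def by (intro cfun.subspace_sum[OF M_plus_subspace]) auto
    qed
    show "M_plus m \<subseteq> T ` ?D"
    proof
      fix f :: "('p, 'q) cfun" assume "f \<in> M_plus m"
      then obtain J G where J: "finite J" "J \<subseteq> ?I" "\<And>i. i \<in> J \<Longrightarrow> G i \<in> harmonic_tensor (fst i) (snd i)"
        "f = (\<Sum>i\<in>J. G i * hw m i)"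
        using M_plus_sum[of f m] by blast
      define F where "F i = (if i \<in> J then G i else 0)" for i
      have s: "{i. F i \<noteq> 0} \<subseteq> J" by (auto simp: F_def)
      have "F \<in> ?D"
        using J(1-3) finite_subset[OF s J(1)] HT_0 by (auto simp: direct_sum_def F_def)
      moreover have "T F = f"
        unfolding T[OF J(1) s] J(4) by (intro sum.cong) (auto simp: F_def)
      ultimately show "f \<in> T ` ?D" by blast
    qed
  qed
  show ?thesis
    unfolding K_iso_direct_sum_def
  proof (intro exI[of _ T] conjI ballI allI)
    show "bij_betw T ?D (M_plus m)"
      using inj surj by (simp add: bij_betw_def)
    fix F assume F: "F \<in> ?D"
    note fin = D(2)[OF F]
    show "T (F + G) = T F + T G" if G: "G \<in> ?D" for G
    proof -
      define S where "S = {i. F i \<noteq> 0} \<union> {i. G i \<noteq> 0}"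
      have S: "finite S" using fin D(2)[OF G] by (simp add: S_def)
      have "{i. (F + G) i \<noteq> 0} \<subseteq> S" by (auto simp: S_def plus_fun_apply)
      then show ?thesis
        using T[OF S, of F] T[OF S, of G] T[OF S, of "F + G"]
        by (simp add: S_def plus_fun_apply distrib_right sum.distrib)
    qed
    show "T (\<lambda>i. cscale c (F i)) = cscale c (T F)" for c
    proof -
      have "{i. cscale c (F i) \<noteq> 0} \<subseteq> {i. F i \<noteq> 0}" by auto
      from T[OF fin this] show ?thesis
        by (simp add: T_def cscale_conv sum_distrib_left mult.assoc)
    qed
    show "T (\<lambda>i. K_act g (F i)) = K_act g (T F)" if g: "g \<in> K_grp" for g
    proof -
      have "{i. K_act g (F i) \<noteq> 0} \<subseteq> {i. F i \<noteq> 0}" by auto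
      from T[OF fin this] show ?thesis
        using g by (simp add: T_def K_act_sum)
    qed
  qed
qed

section \<open>Transport from M^+(m) to M^-(m)\<close>

lemma K_iso_transfer:
  assumes iso: "K_iso_direct_sum M I W" and bij: "bij_betw \<phi> M M'"
    and add: "\<And>f g. f \<in> M \<Longrightarrow> g \<in> M \<Longrightarrow> \<phi> (f + g) = \<phi> f + \<phi> g"
    and scale: "\<And>c f. f \<in> M \<Longrightarrow> \<phi> (cscale c f) = cscale c (\<phi> f)"
    and K: "\<And>k f. k \<in> K_grp \<Longrightarrow> f \<in> M \<Longrightarrow> \<phi> (K_act k f) = K_act k (\<phi> f)"
  shows "K_iso_direct_sum M' I W"
proof -
  obtain T where T: "bij_betw T (direct_sum I W) M"
    "\<And>F G. F \<in> direct_sum I W \<Longrightarrow> G \<in> direct_sum I W \<Longrightarrow> T (F + G) = T F + T G"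
    "\<And>c F. F \<in> direct_sum I W \<Longrightarrow> T (\<lambda>i. cscale c (F i)) = cscale c (T F)"
    "\<And>k F. k \<in> K_grp \<Longrightarrow> F \<in> direct_sum I W \<Longrightarrow> T (\<lambda>i. K_act k (F i)) = K_act k (T F)"
    using iso unfolding K_iso_direct_sum_def by blast
  have m: "T F \<in> M" if "F \<in> direct_sum I W" for F
    using T(1) that by (rule bij_betwE[THEN bspec])
  show ?thesis
    unfolding K_iso_direct_sum_def
    using bij_betw_trans[OF T(1) bij] T(2-4) m add scale K
    by (intro exI[of _ "\<phi> \<circ> T"]) auto
qed

lemma Xminus_funpow_M_plus:
  assumes f: "f \<in> M_plus m"
  shows "(Xminus ^^ m) f \<in> M_minus m"
proof -
  have f': "f \<in> E_space" "H_op f = cc (of_nat m) * f" "Xplus f = 0" "(Xminus ^^ (m + 1)) f = 0"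
    using f by (auto simp: M_plus_eq)
  note alg = E_space_alg[OF f'(1)]
  obtain c where c: "(Xplus ^^ m) ((Xminus ^^ m) f) = cc c * f"
    using sl2_raise_power[OF sl2_plus alg f'(2,3), of m] by blast
  have "(Xplus ^^ (m + 1)) ((Xminus ^^ m) f) = 0"
    using c f'(3) alg by (simp add: alg_linearD(7)[OF alg_linear_ops(6)])
  moreover have "H_op ((Xminus ^^ m) f) = cc (- of_nat m) * (Xminus ^^ m) f"
    using sl2_weight[OF sl2_plus alg f'(2), of m] by simp
  ultimately show ?thesis
    using f'(4) funpow_E_space(1)[OF f'(1)] by (simp add: M_minus_eq)
qed

lemma Xplus_funpow_M_minus:
  assumes f: "f \<in> M_minus m"
  shows "(Xplus ^^ m) f \<in> M_plus m"
proof -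
  have f': "f \<in> E_space" "- H_op f = cc (of_nat m) * f" "Xminus f = 0" "(Xplus ^^ (m + 1)) f = 0"
    using f by (auto simp: M_minus_eq cc_hom)
  note alg = E_space_alg[OF f'(1)]
  obtain c where c: "(Xminus ^^ m) ((Xplus ^^ m) f) = cc c * f"
    using sl2_raise_power[OF sl2_minus alg f'(2,3), of m] by blast
  have "(Xminus ^^ (m + 1)) ((Xplus ^^ m) f) = 0"
    using c f'(3) alg by (simp add: alg_linearD(7)[OF alg_linear_ops(7)])
  moreover have "- H_op ((Xplus ^^ m) f) = cc (- of_nat m) * (Xplus ^^ m) f"
    using sl2_weight[OF sl2_minus alg f'(2), of m] by simp
  then have "H_op ((Xplus ^^ m) f) = cc (of_nat m) * (Xplus ^^ m) f"
    by (simp add: cc_hom)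
  ultimately show ?thesis
    using f'(4) funpow_E_space(2)[OF f'(1)] by (simp add: M_plus_eq)
qed

text \<open>Injectivity is \<open>sl2_nonzero\<close> at the last admissible power j = m. A preimage
  of g is (X^+)^m g, up to the scalar of \<open>sl2_raise_power\<close> for the triple (X^-, X^+,
  -H).\<close>

lemma Xminus_funpow_bij: "bij_betw (Xminus ^^ m) (M_plus m) (M_minus m)"
  unfolding bij_betw_def
proof
  have lin: "alg_linear (Xminus ^^ m)" by (rule funpow_alg_linear[OF alg_linear_ops(7)])
  have M_alg: "f \<in> alg" if "f \<in> M_plus m" for f using that E_space_alg by (auto simp: M_plus_eq)
  show "inj_on (Xminus ^^ m) (M_plus m)"
  proof (rule inj_onI)
    fix f g assume f: "f \<in> M_plus m" and g: "g \<in> M_plus m" and e: "(Xminus ^^ m) f = (Xminus ^^ m) g"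
    have d: "f - g \<in> M_plus m" by (rule cfun.subspace_diff[OF M_plus_subspace f g])
    have z: "(Xminus ^^ m) (f - g) = 0"
      using e by (simp add: alg_linearD(5)[OF lin] M_alg f g)
    show "f = g"
      using sl2_nonzero[OF sl2_plus M_alg[OF d], of m m] d z by (auto simp: M_plus_eq)
  qed
  show "(Xminus ^^ m) ` M_plus m = M_minus m"
  proof
    show "M_minus m \<subseteq> (Xminus ^^ m) ` M_plus m"
    proof
      fix g assume g: "g \<in> M_minus m"
      have g': "g \<in> alg" "- H_op g = cc (of_nat m) * g" "Xminus g = 0"
        using g E_space_alg by (auto simp: M_minus_eq cc_hom)
      obtain c where c: "c \<noteq> 0" "(Xminus ^^ m) ((Xplus ^^ m) g) = cc c * g"
        using sl2_raise_power[OF sl2_minus g', of m] by blast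
      have M: "cc (1 / c) * (Xplus ^^ m) g \<in> M_plus m"
        by (intro subspace_cc_mult[OF M_plus_subspace] Xplus_funpow_M_minus g)
      have "(Xminus ^^ m) (cc (1 / c) * (Xplus ^^ m) g) = cc (1 / c) * (cc c * g)"
        using M_alg[OF Xplus_funpow_M_minus[OF g]] by (simp add: alg_linearD(7)[OF lin] c(2))
      also have "\<dots> = g" using c(1) by (simp add: fun_eq_iff pw)
      finally show "g \<in> (Xminus ^^ m) ` M_plus m"
        using M by (metis imageI)
    qed
  qed (use Xminus_funpow_M_plus in auto)
qed

lemma funpow_commute_on:
  assumes "\<And>f. f \<in> alg \<Longrightarrow> X (A f) = A (X f)" "alg_linear X" "f \<in> alg"
  shows "(X ^^ n) (A f) = A ((X ^^ n) f)"
proof (induction n)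
  case (Suc n)
  then show ?case
    using assms(1)[of "(X ^^ n) f"] alg_linearD(1)[OF funpow_alg_linear[OF assms(2)] assms(3)] by simp
qed simp

lemma M_minus_K_iso:
  "K_iso_direct_sum (M_minus m :: ('p::finite, 'q::finite) cfun set)
     (K_type_index CARD('p) CARD('q) m) (\<lambda>(k, l). harmonic_tensor k l)"
proof (rule K_iso_transfer[OF M_plus_K_iso Xminus_funpow_bij])
  have lin: "alg_linear (Xminus ^^ m)" by (rule funpow_alg_linear[OF alg_linear_ops(7)])
  have M_alg: "f \<in> alg" if "f \<in> M_plus m" for f :: "('p, 'q) cfun"
    using that E_space_alg by (auto simp: M_plus_eq)
  show "(Xminus ^^ m) (f + g) = (Xminus ^^ m) f + (Xminus ^^ m) g"
    if "f \<in> M_plus m" "g \<in> M_plus m" for f g :: "('p, 'q) cfun"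
    using that M_alg by (simp add: alg_linearD(2)[OF lin])
  show "(Xminus ^^ m) (cscale c f) = cscale c ((Xminus ^^ m) f)"
    if "f \<in> M_plus m" for c and f :: "('p, 'q) cfun"
    using that M_alg by (simp add: alg_linearD(3)[OF lin])
  show "(Xminus ^^ m) (K_act k f) = K_act k ((Xminus ^^ m) f)"
    if "k \<in> K_grp" "f \<in> M_plus m" for k and f :: "('p, 'q) cfun"
    using that M_alg by (intro funpow_commute_on alg_linear_ops(7) Xminus_K_act)
qed

subsection \<open>The action of \<open>\<pi>(X\<^sup>-\<^sub>i\<^sub>j)\<close> on \<open>K\<close>-types\<close>

lemma up_coeff_kap: "2 * up_coeff n k = 1 / (kap n k - 1)"
proof -
  have e: "2 * of_nat k + of_nat n - 2 = 2 * (kap n k - 1)"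
    by (simp add: kap_def algebra_simps)
  have "2 * (1 / (2 * x)) = 1 / x" for x :: complex by simp
  then show ?thesis
    unfolding up_coeff_def e .
qed

lemma kap_Suc: "kap n (Suc k) = kap n k + 1"
  by (simp add: kap_def)

lemma xc_HT: "xc i * F = up_x i k F + cc (2 * up_coeff CARD('p) k) * (rho_x * dx i F)"
  for F :: "('p::finite, 'q::finite) cfun"
  by (simp add: up_x_def rx2_rho fun_eq_iff pw)

lemma yc_HT: "yc j * F = up_y j l F + cc (2 * up_coeff CARD('q) l) * (rho_y * dy j F)"
  for F :: "('p::finite, 'q::finite) cfun"
  by (simp add: up_y_def ry2_rho fun_eq_iff pw)

lemma dx_HT_radial:
  fixes F :: "('p::finite, 'q::finite) cfun"
  assumes "F \<in> alg" "\<phi> \<in> alg" "dx i \<phi> = xc i * \<phi>s"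
  shows "dx i (F * \<phi>) = dx i F * (\<phi> + cc (2 * up_coeff CARD('p) k) * (rho_x * \<phi>s)) + up_x i k F * \<phi>s"
proof -
  have "dx i (F * \<phi>) = dx i F * \<phi> + (xc i * F) * \<phi>s"
    using assms by (simp add: dx_mult mult_ac)
  then show ?thesis
    unfolding xc_HT[of i F k] by (simp add: algebra_simps)
qed

lemma dy_HT_radial:
  fixes F :: "('p::finite, 'q::finite) cfun"
  assumes "F \<in> alg" "\<phi> \<in> alg" "dy j \<phi> = yc j * \<phi>t"
  shows "dy j (F * \<phi>) = dy j F * (\<phi> + cc (2 * up_coeff CARD('q) l) * (rho_y * \<phi>t)) + up_y j l F * \<phi>t"
proof -
  have "dy j (F * \<phi>) = dy j F * \<phi> + (yc j * F) * \<phi>t"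
    using assms by (simp add: dy_mult mult_ac)
  then show ?thesis
    unfolding yc_HT[of j F l] by (simp add: algebra_simps)
qed

text \<open>Here \<open>\<phi>s\<close>, \<open>\<phi>t\<close> and \<open>\<phi>ts\<close> are the
  derivatives of \<phi> in rho_x, in rho_y and in both. Splitting products with x_i and y_j into a
  raised part and a radial multiple of a derivative sorts the result by the four neighbouring
  K-types.\<close>

lemma pi_pq_expand:
  fixes F :: "('p::finite, 'q::finite) cfun"
  assumes F: "F \<in> alg" and \<phi>: "\<phi> \<in> alg" "\<phi>t \<in> alg"
    and d: "dx i \<phi> = xc i * \<phi>s" "dy j \<phi> = yc j * \<phi>t" "dx i \<phi>t = xc i * \<phi>ts"
    and w: "w = 2 * up_coeff CARD('p) k" and z: "z = 2 * up_coeff CARD('q) l"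
  shows "pi_pq i j (F * \<phi>) = cc \<i> *
    (up_x i k (up_y j l F) * (\<phi> + \<phi>ts)
     + up_x i k (dy j F) * (\<phi>s + cc z * (rho_y * (\<phi> + \<phi>ts)))
     + dx i (up_y j l F) * (\<phi>t + cc w * (rho_x * (\<phi> + \<phi>ts)))
     + dx i (dy j F) * (\<phi> + cc z * (rho_y * \<phi>t) + cc w * (rho_x * (\<phi>s + cc z * (rho_y * (\<phi> + \<phi>ts))))))"
proof -
  define Q where "Q = up_y j l F"
  define G where "G = dy j F"
  have alg: "Q \<in> alg" "G \<in> alg" using F by (simp_all add: Q_def G_def up_y_def)
  define \<eta> where "\<eta> = \<phi> + cc z * (rho_y * \<phi>t)"
  have \<eta>: "\<eta> \<in> alg" "dx i \<eta> = xc i * (\<phi>s + cc z * (rho_y * \<phi>ts))"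
    using \<phi> d by (simp_all add: \<eta>_def dx_add dx_mult) (simp add: algebra_simps)
  have dy: "dy j (F * \<phi>) = G * \<eta> + Q * \<phi>t"
    unfolding dy_HT_radial[OF F \<phi>(1) d(2), of l] by (simp add: \<eta>_def Q_def G_def z)
  have 1: "dx i (dy j (F * \<phi>)) = dx i G * (\<eta> + cc w * (rho_x * (\<phi>s + cc z * (rho_y * \<phi>ts))))
      + up_x i k G * (\<phi>s + cc z * (rho_y * \<phi>ts)) + (dx i Q * (\<phi>t + cc w * (rho_x * \<phi>ts)) + up_x i k Q * \<phi>ts)"
    unfolding dy w using alg \<eta> \<phi>(2)
    by (simp add: dx_add dx_HT_radial[OF alg(2) \<eta>, of k] dx_HT_radial[OF alg(1) \<phi>(2) d(3), of k])
  have 2: "xc i * yc j * (F * \<phi>) = (up_x i k Q + cc w * (rho_x * dx i Q)) * \<phi>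
      + cc z * (rho_y * ((up_x i k G + cc w * (rho_x * dx i G)) * \<phi>))"
  proof -
    have "xc i * yc j * (F * \<phi>) = xc i * (yc j * F) * \<phi>" by (simp add: mult_ac)
    also have "\<dots> = (xc i * Q) * \<phi> + cc z * (rho_y * ((xc i * G) * \<phi>))"
      unfolding yc_HT[of j F l] by (simp add: Q_def G_def z algebra_simps)
    finally show ?thesis
      unfolding xc_HT[of i Q k] xc_HT[of i G k] by (simp add: w)
  qed
  show ?thesis
    unfolding pi_pq_conv 1 2 Q_def[symmetric] G_def[symmetric] \<eta>_def
    by (simp add: algebra_simps)
qed

text \<open>The radial factors of \<open>pi_pq_expand\<close> mix the parameters \<kappa>, \<kappa>
  + 1 and \<kappa> + 2. Contiguity at \<kappa> and at \<kappa> - 1 reduces each to one term with the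
  parameter of the target type, k + 1 or k - 1; the number left in front decides whether that
  neighbour is reached.\<close>

lemma pi_pq_R:
  fixes F :: "('p::finite, 'q::finite) cfun"
  assumes F: "F \<in> harmonic_tensor k l"
    and \<kappa>: "\<kappa> = kap CARD('p) k" and z: "z = 2 * up_coeff CARD('q) l"
  shows "pi_pq i j (F * R 0 d \<kappa>) = cc \<i> *
    (cc ((\<kappa> - of_nat d - 1) / \<kappa>) * (up_x i k (up_y j l F) * R 0 d (\<kappa> + 1))
     + cc ((z * (\<kappa> - of_nat d - 1) - 1) / \<kappa>) * (up_x i k (dy j F) * R 0 (Suc d) (\<kappa> + 1))
     + cc (of_nat d) * (dx i (up_y j l F) * R 0 (d - 1) (\<kappa> - 1))
     + cc (1 + z * of_nat d) * (dx i (dy j F) * R 0 d (\<kappa> - 1)))"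
proof -
  have \<kappa>0: "\<kappa> \<notin> \<int>\<^sub>\<le>\<^sub>0" unfolding \<kappa> by (rule kap_nonpos_Int) simp
  have \<kappa>1: "\<kappa> + 1 \<notin> \<int>\<^sub>\<le>\<^sub>0" using \<kappa>0 by (rule nonpos_Int_add_1)
  have \<kappa>2: "\<kappa> + 2 \<notin> \<int>\<^sub>\<le>\<^sub>0" using nonpos_Int_add_1[OF \<kappa>1] by (simp add: add.assoc)
  have n: "\<kappa> \<noteq> 0" "\<kappa> + 1 \<noteq> 0" using \<kappa>0 \<kappa>1 by auto
  define \<phi> \<phi>s \<phi>t \<phi>ts :: "('p, 'q) cfun" where
    "\<phi> = R 0 d \<kappa>" and "\<phi>s = R' 0 d \<kappa>"
    and "\<phi>t = cc (of_nat d) * R 0 (d - 1) \<kappa> - cc (1 / \<kappa>) * R (Suc 0) d (\<kappa> + 1)"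
    and "\<phi>ts = cc (of_nat d) * R' 0 (d - 1) \<kappa> - cc (1 / \<kappa>) * R' (Suc 0) d (\<kappa> + 1)"
  have alg: "\<phi> \<in> alg" "\<phi>t \<in> alg" using \<kappa>0 \<kappa>1 by (simp_all add: \<phi>_def \<phi>t_def)
  have dd: "dx i \<phi> = xc i * \<phi>s" "dy j \<phi> = yc j * \<phi>t" "dx i \<phi>t = xc i * \<phi>ts"
    using \<kappa>0 \<kappa>1
    by (simp_all add: \<phi>_def \<phi>s_def \<phi>t_def \<phi>ts_def dx_R dy_R dx_diff dx_cc_mult) (simp add: algebra_simps)
  define B where "B = (R 0 d (\<kappa> + 1) :: ('p, 'q) cfun)"
  define C where "C = (R (Suc 0) (Suc d) (\<kappa> + 2) :: ('p, 'q) cfun)"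
  have ts: "\<phi>ts = cc (- (of_nat d + 1) / \<kappa>) * B + cc (1 / (\<kappa> * (\<kappa> + 1))) * C"
  proof -
    have "cc (of_nat d) * R 0 (Suc (d - 1)) (\<kappa> + 1) = cc (of_nat d) * B"
      by (cases d) (simp_all add: B_def cc_hom)
    then have a: "cc (of_nat d) * R' 0 (d - 1) \<kappa> = cc (- (of_nat d) / \<kappa>) * B"
      using n(1) by (simp add: R'_def cc_hom fun_eq_iff pw)
    have b: "R' (Suc 0) d (\<kappa> + 1) = B - cc (1 / (\<kappa> + 1)) * C"
      by (simp add: R'_def B_def C_def cc_hom add.assoc)
    show ?thesis
      unfolding \<phi>ts_def a b using n by (simp add: fun_eq_iff pw divide_simps) (simp add: algebra_simps)
  qed
  \<comment> \<open>Contiguity at \<kappa>; the terms with parameter \<kappa> + 2 then cancel in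
    \<phi> + \<open>\<phi>ts\<close>.\<close>
  have cB: "\<phi> = B - cc (1 / (\<kappa> * (\<kappa> + 1))) * C"
  proof (rule ext)
    fix v
    have "\<kappa> * \<phi> v = \<kappa> * B v - 1 / (\<kappa> + 1) * C v"
      using fun_cong[OF R_contiguous[OF \<kappa>0, of 0 d], of v] by (simp add: pw \<phi>_def B_def C_def)
    then show "\<phi> v = (B - cc (1 / (\<kappa> * (\<kappa> + 1))) * C) v"
      using n by (simp add: pw divide_simps) (simp add: algebra_simps)
  qed
  have 1: "\<phi> + \<phi>ts = cc ((\<kappa> - of_nat d - 1) / \<kappa>) * B"
    unfolding ts cB using n by (simp add: fun_eq_iff pw divide_simps) (simp add: algebra_simps)
  have s: "\<phi>s = cc (- 1 / \<kappa>) * R 0 (Suc d) (\<kappa> + 1)"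
    by (simp add: \<phi>s_def R'_def fun_eq_iff pw)
  have 2: "\<phi>s + cc z * (rho_y * (\<phi> + \<phi>ts)) =
      cc ((z * (\<kappa> - of_nat d - 1) - 1) / \<kappa>) * R 0 (Suc d) (\<kappa> + 1)"
    unfolding 1 s mult.left_commute[of rho_y] B_def rho_R
    using n by (simp add: fun_eq_iff pw divide_simps) (simp add: algebra_simps)
  define w where "w = 2 * up_coeff CARD('p) k"
  have D: "dx i G * (\<phi>t + cc w * (rho_x * (\<phi> + \<phi>ts))) = cc (of_nat d) * (dx i G * R 0 (d - 1) (\<kappa> - 1))"
    "dx i G * (\<phi> + cc z * (rho_y * \<phi>t) + cc w * (rho_x * (\<phi>s + cc z * (rho_y * (\<phi> + \<phi>ts)))))
      = cc (1 + z * of_nat d) * (dx i G * R 0 d (\<kappa> - 1))"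
    if G: "G \<in> harmonic_tensor k l'" for G l'
  proof -
    have "\<phi>t + cc w * (rho_x * (\<phi> + \<phi>ts)) = cc (of_nat d) * R 0 (d - 1) (\<kappa> - 1) \<and>
      \<phi> + cc z * (rho_y * \<phi>t) + cc w * (rho_x * (\<phi>s + cc z * (rho_y * (\<phi> + \<phi>ts))))
      = cc (1 + z * of_nat d) * R 0 d (\<kappa> - 1)" if "k > 0"
    proof
      \<comment> \<open>For k > 0 the parameter \<kappa> - 1 belongs to degree k - 1 and is
        admissible; for k = 0 the derivative \<open>dx i G\<close> is zero.\<close>
      have k1: "\<kappa> - 1 \<notin> \<int>\<^sub>\<le>\<^sub>0"
        using that kap_nonpos_Int[of "CARD('p)" "k - 1"] kap_Suc[of "CARD('p)" "k - 1"] by (simp add: \<kappa>)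
      then have n1: "\<kappa> - 1 \<noteq> 0" by auto
      have w: "w = 1 / (\<kappa> - 1)"
        by (simp add: w_def up_coeff_kap \<kappa>)
      have con: "R 0 b (\<kappa> - 1) v = R 0 b \<kappa> v - 1 / (\<kappa> * (\<kappa> - 1)) * R (Suc 0) (Suc b) (\<kappa> + 1) v"
        for b and v :: "('p, 'q) V"
      proof -
        have "(\<kappa> - 1) * R 0 b (\<kappa> - 1) v = (\<kappa> - 1) * R 0 b \<kappa> v - 1 / \<kappa> * R (Suc 0) (Suc b) (\<kappa> + 1) v"
        proof -
          have e: "\<kappa> - 1 + 1 = \<kappa>" "\<kappa> - 1 + 2 = \<kappa> + 1" by simp_all
          show ?thesis
            using fun_cong[OF R_contiguous[OF k1, of 0 b, unfolded e], of v] by (simp add: pw)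
        qed
        moreover have "x = y - 1 / (\<kappa> * (\<kappa> - 1)) * z" if "(\<kappa> - 1) * x = (\<kappa> - 1) * y - 1 / \<kappa> * z" for x y z
        proof -
          have "(\<kappa> - 1) * x = (\<kappa> - 1) * (y - 1 / (\<kappa> * (\<kappa> - 1)) * z)"
            unfolding that using n n1 by (simp add: divide_simps)
          then show ?thesis using n1 by simp
        qed
        ultimately show ?thesis by blast
      qed
      have e: "of_nat d * R (Suc 0) (Suc (d - 1)) (\<kappa> + 1) v = of_nat d * R (Suc 0) d (\<kappa> + 1) v" for v :: "('p, 'q) V"
        by (cases d) simp_all
      show "\<phi>t + cc w * (rho_x * (\<phi> + \<phi>ts)) = cc (of_nat d) * R 0 (d - 1) (\<kappa> - 1)"
      proof (rule ext)
        fix v :: "('p, 'q) V"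
        have "(cc (of_nat d) * R 0 (d - 1) (\<kappa> - 1)) v =
            of_nat d * R 0 (d - 1) \<kappa> v - 1 / (\<kappa> * (\<kappa> - 1)) * (of_nat d * R (Suc 0) (Suc (d - 1)) (\<kappa> + 1) v)"
          unfolding pw con by (simp add: algebra_simps)
        then show "(\<phi>t + cc w * (rho_x * (\<phi> + \<phi>ts))) v = (cc (of_nat d) * R 0 (d - 1) (\<kappa> - 1)) v"
          unfolding 1 e w \<phi>t_def B_def mult.left_commute[of rho_x] rho_R using n n1
          by (simp add: pw divide_simps) (simp add: algebra_simps)
      qed
      have rt: "rho_y * \<phi>t = cc (of_nat d) * \<phi> - cc (1 / \<kappa>) * R (Suc 0) (Suc d) (\<kappa> + 1)"
        unfolding \<phi>t_def \<phi>_def right_diff_distrib mult.left_commute[of rho_y] rho_R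
        by (cases d) (simp_all add: cc_hom)
      show "\<phi> + cc z * (rho_y * \<phi>t) + cc w * (rho_x * (\<phi>s + cc z * (rho_y * (\<phi> + \<phi>ts))))
        = cc (1 + z * of_nat d) * R 0 d (\<kappa> - 1)"
      proof (rule ext)
        fix v :: "('p, 'q) V"
        show "(\<phi> + cc z * (rho_y * \<phi>t) + cc w * (rho_x * (\<phi>s + cc z * (rho_y * (\<phi> + \<phi>ts))))) v
          = (cc (1 + z * of_nat d) * R 0 d (\<kappa> - 1)) v"
          unfolding 2 unfolding rt w mult.left_commute[of rho_x] rho_R
          unfolding pw con \<phi>_def using n n1
          by (simp add: divide_simps) (simp add: algebra_simps)
      qed
    qed
    moreover have "dx i G = 0" if "k = 0"
      using HT_dx_0 G that by blast
    ultimately show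
      "dx i G * (\<phi>t + cc w * (rho_x * (\<phi> + \<phi>ts))) = cc (of_nat d) * (dx i G * R 0 (d - 1) (\<kappa> - 1))"
      "dx i G * (\<phi> + cc z * (rho_y * \<phi>t) + cc w * (rho_x * (\<phi>s + cc z * (rho_y * (\<phi> + \<phi>ts)))))
        = cc (1 + z * of_nat d) * (dx i G * R 0 d (\<kappa> - 1))"
      by (cases "k = 0"; simp add: mult_ac)+
  qed
  have G: "up_y j l F \<in> harmonic_tensor k (Suc l)" "dy j F = 0 \<or> dy j F \<in> harmonic_tensor k (l - 1)"
    using HT_up_y[OF F] F HT_dy[of F k "l - 1" j] HT_dy_0[of F k j] by (cases l; simp)+
  have D2: "dx i (dy j F) * (\<phi> + cc z * (rho_y * \<phi>t) + cc w * (rho_x * (\<phi>s + cc z * (rho_y * (\<phi> + \<phi>ts)))))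
      = cc (1 + z * of_nat d) * (dx i (dy j F) * R 0 d (\<kappa> - 1))"
    using G(2) D(2) by auto
  show ?thesis
    unfolding \<phi>_def[symmetric] pi_pq_expand[OF HT_alg[OF F] alg dd w_def z] D(1)[OF G(1)] D2
    unfolding 2 unfolding 1 B_def
    by (simp add: mult_ac)
qed

text \<open>The four \<open>K\<close>-types occurring in \<open>\<pi>(X\<^sup>-\<^sub>i\<^sub>j) (F * hw m (k, l))\<close>; the boundary cases, where a
  neighbour of \<open>(k, l)\<close> lies outside the index set, are those with vanishing coefficient.\<close>

lemma kap_rel:
  assumes "2 * k + p + 2 * m = 2 * l + q + 4 * d"
  shows "kap p k - kap q l = 2 * of_nat d - of_nat m"
  using iffD2[OF kap_eq_iff assms] by (simp add: algebra_simps)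

lemma pi_pq_terms:
  fixes F :: "('p::finite, 'q::finite) cfun" and m k l d :: nat and i :: 'p and j :: 'q
  assumes F: "F \<in> harmonic_tensor k l"
    and d: "2 * k + CARD('p) + 2 * m = 2 * l + CARD('q) + 4 * d" "d \<le> m"
  defines "\<kappa> \<equiv> kap CARD('p) k" and "z \<equiv> 2 * up_coeff CARD('q) l"
  defines "t1 \<equiv> cc ((\<kappa> - of_nat d - 1) / \<kappa>) * (up_x i k (up_y j l F) * R 0 d (\<kappa> + 1))"
    and "t2 \<equiv> cc ((z * (\<kappa> - of_nat d - 1) - 1) / \<kappa>) * (up_x i k (dy j F) * R 0 (Suc d) (\<kappa> + 1))"
    and "t3 \<equiv> cc (of_nat d) * (dx i (up_y j l F) * R 0 (d - 1) (\<kappa> - 1))"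
    and "t4 \<equiv> cc (1 + z * of_nat d) * (dx i (dy j F) * R 0 d (\<kappa> - 1))"
  shows "pi_pq i j (F * hw m (k, l)) = cc \<i> * (t1 + t2 + t3 + t4)"
    and "t1 \<in> E_comp (k + 1) (l + 1)" "t1 \<in> M_plus m"
    and "t2 \<in> E_comp (k + 1) (l - 1)" "t2 \<in> M_plus m"
    and "t3 \<in> E_comp (k - 1) (l + 1)" "t3 \<in> M_plus m"
    and "t4 \<in> E_comp (k - 1) (l - 1)" "t4 \<in> M_plus m"
proof -
  \<comment> \<open>A term lies in M^+(m) either because its type belongs to the index set or
    because its coefficient is 0.\<close>
  have comp: "cc c * (G * R 0 e (kap CARD('p) a)) \<in> E_comp a b \<and> cc c * (G * R 0 e (kap CARD('p) a)) \<in> M_plus m"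
    if "G \<in> harmonic_tensor a b" "2 * a + CARD('p) + 2 * m = 2 * b + CARD('q) + 4 * e" "c = 0 \<or> e \<le> m"
    for c e a b and G :: "('p, 'q) cfun"
  proof
    show "cc c * (G * R 0 e (kap CARD('p) a)) \<in> E_comp a b"
      by (intro subspace_cc_mult[OF E_comp_subspace] E_comp_gen that kap_nonpos_Int) simp
    show "cc c * (G * R 0 e (kap CARD('p) a)) \<in> M_plus m"
    proof (cases "c = 0")
      case True
      then show ?thesis using cfun.subspace_0[OF M_plus_subspace] by (simp add: cc_hom)
    next
      case False
      then have "(a, b) \<in> K_type_index CARD('p) CARD('q) m"
        using that by (auto simp: K_type_index_iff)
      from M_plus_hw[OF that(1) this] show ?thesis
        using hw_eq[OF that(2)] by (simp add: subspace_cc_mult[OF M_plus_subspace])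
    qed
  qed
  have zero: "(0 :: ('p, 'q) cfun) \<in> E_comp a b" "(0 :: ('p, 'q) cfun) \<in> M_plus m" for a b
    using cfun.subspace_0[OF E_comp_subspace] cfun.subspace_0[OF M_plus_subspace] by auto
  have \<kappa>S: "\<kappa> + 1 = kap CARD('p) (Suc k)" "\<kappa> - 1 = kap CARD('p) (k - 1)" if "k > 0"
    using that kap_Suc[of "CARD('p)" "k - 1"] by (simp_all add: \<kappa>_def kap_Suc)
  have \<kappa>1: "\<kappa> + 1 = kap CARD('p) (Suc k)" by (simp add: \<kappa>_def kap_Suc)
  have Q: "up_y j l F \<in> harmonic_tensor k (Suc l)" by (rule HT_up_y[OF F])
  show "pi_pq i j (F * hw m (k, l)) = cc \<i> * (t1 + t2 + t3 + t4)"
    unfolding hw_eq[OF d(1)] t1_def t2_def t3_def t4_def \<kappa>_def z_def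
    by (rule pi_pq_R[OF F refl refl])
  have "t1 \<in> E_comp (Suc k) (Suc l) \<and> t1 \<in> M_plus m"
    unfolding t1_def \<kappa>1 using d by (intro comp HT_up_x Q) auto
  then show "t1 \<in> E_comp (k + 1) (l + 1)" "t1 \<in> M_plus m" by simp_all
  have "t2 \<in> E_comp (Suc k) (l - 1) \<and> t2 \<in> M_plus m"
  proof (cases l)
    case 0
    then have "t2 = 0"
      using F HT_dy_0[of F k j] by (simp add: t2_def alg_linearD(4)[OF alg_linear_up_x])
    then show ?thesis using zero by simp
  next
    case (Suc l')
    \<comment> \<open>At d = m the target exponent d + 1 is out of range. There \<kappa> - d - 1
      equals \<open>kap CARD('q) l\<close> - 1, the reciprocal of z, so the coefficient
      vanishes.\<close>
    have c: "(z * (\<kappa> - of_nat d - 1) - 1) / \<kappa> = 0 \<or> Suc d \<le> m"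
    proof (cases "d = m")
      case True
      have n: "kap CARD('q) l - 1 \<noteq> 0"
        using kap_nonpos_Int[of "CARD('q)" l'] kap_Suc[of "CARD('q)" l'] by (auto simp: Suc)
      have "\<kappa> - of_nat d - 1 = kap CARD('q) l - 1"
        using kap_rel[OF d(1)] True by (simp add: \<kappa>_def algebra_simps)
      then have "z * (\<kappa> - of_nat d - 1) = 1"
        using n by (simp add: z_def up_coeff_kap)
      then show ?thesis by simp
    qed (use d in auto)
    have "up_x i k (dy j F) \<in> harmonic_tensor (Suc k) l'"
      using F Suc by (intro HT_up_x HT_dy) simp
    then show ?thesis
      unfolding t2_def \<kappa>1 Suc diff_Suc_1 using d(1) c Suc by (intro comp) auto
  qed
  then show "t2 \<in> E_comp (k + 1) (l - 1)" "t2 \<in> M_plus m" by simp_all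
  have "t3 \<in> E_comp (k - 1) (Suc l) \<and> t3 \<in> M_plus m"
  proof (cases k)
    case 0
    then have "t3 = 0"
      using Q HT_dx_0[of "up_y j l F" "Suc l" i] by (simp add: t3_def)
    then show ?thesis using zero by simp
  next
    case (Suc k')
    show ?thesis
    \<comment> \<open>At d = 0 no lower exponent exists, and the coefficient d vanishes.\<close>
    proof (cases d)
      case 0
      then show ?thesis using zero by (simp add: t3_def cc_hom)
    next
      case (Suc d')
      have "dx i (up_y j l F) \<in> harmonic_tensor (k - 1) (Suc l)"
        using Q \<open>k = Suc k'\<close> by (intro HT_dx) simp
      moreover have "\<kappa> - 1 = kap CARD('p) (k - 1)"
        using \<open>k = Suc k'\<close> by (intro \<kappa>S(2)) simp
      ultimately show ?thesis
        unfolding t3_def using d Suc \<open>k = Suc k'\<close> by (simp only:) (intro comp; simp)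
    qed
  qed
  then show "t3 \<in> E_comp (k - 1) (l + 1)" "t3 \<in> M_plus m" by simp_all
  have "t4 \<in> E_comp (k - 1) (l - 1) \<and> t4 \<in> M_plus m"
  proof (cases "k = 0 \<or> l = 0")
    case True
    have "t4 = 0"
    proof (cases l)
      case 0
      then show ?thesis using F HT_dy_0[of F k j] by (simp add: t4_def)
    next
      case (Suc l')
      then have "dx i (dy j F) = 0"
        using True F HT_dy[of F k l' j] HT_dx_0[of "dy j F" l' i] by simp
      then show ?thesis by (simp add: t4_def)
    qed
    then show ?thesis using zero by simp
  next
    case False
    then obtain k' l' where kl: "k = Suc k'" "l = Suc l'" by (metis not0_implies_Suc)
    have "dx i (dy j F) \<in> harmonic_tensor (k - 1) (l - 1)"
      using F kl by (simp add: HT_dx HT_dy)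
    then show ?thesis
      unfolding t4_def using d kl
      by (simp only: \<kappa>S(2)) (intro comp; simp)
  qed
  then show "t4 \<in> E_comp (k - 1) (l - 1)" "t4 \<in> M_plus m" by simp_all
qed

lemma pi_op_conv:
  "pi_op A f = cc (1/2) * (\<Sum>i\<in>UNIV. \<Sum>j\<in>UNIV. cc (A $ Inl i $ Inl j) * pi_pp i j f)
    + cc (1/2) * (\<Sum>i\<in>UNIV. \<Sum>j\<in>UNIV. cc (A $ Inr i $ Inr j) * pi_qq i j f)
    + (\<Sum>i\<in>UNIV. \<Sum>j\<in>UNIV. cc (A $ Inl i $ Inr j) * pi_pq i j f)"
  by (simp add: fun_eq_iff pw pi_op_def)

lemma gK_stableI:
  assumes M: "cfun.subspace M" and "\<And>f i j. f \<in> M \<Longrightarrow> pi_pp i j f \<in> M"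
    "\<And>f i j. f \<in> M \<Longrightarrow> pi_qq i j f \<in> M" "\<And>f i j. f \<in> M \<Longrightarrow> pi_pq i j f \<in> M"
    "\<And>g f. g \<in> K_grp \<Longrightarrow> f \<in> M \<Longrightarrow> K_act g f \<in> M"
  shows "gK_stable pi_op K_act M"
  unfolding gK_stable_def pi_op_conv
  using assms by (auto intro!: cfun.subspace_add[OF M] subspace_cc_mult[OF M] cfun.subspace_sum[OF M])

lemma gK_stableD:
  assumes "gK_stable pi_op K_act M"
  shows "cfun.subspace M" "f \<in> M \<Longrightarrow> pi_pp i j f \<in> M" "f \<in> M \<Longrightarrow> pi_qq i' j' f \<in> M"
    "f \<in> M \<Longrightarrow> pi_pq i j' f \<in> M" "g \<in> K_grp \<Longrightarrow> f \<in> M \<Longrightarrow> K_act g f \<in> M"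
    "f \<in> M \<Longrightarrow> type_op f \<in> M"
proof -
  show M: "cfun.subspace M" and pp: "f \<in> M \<Longrightarrow> pi_pp i j f \<in> M" and qq: "f \<in> M \<Longrightarrow> pi_qq i' j' f \<in> M"
    and "f \<in> M \<Longrightarrow> pi_pq i j' f \<in> M" and K: "g \<in> K_grp \<Longrightarrow> f \<in> M \<Longrightarrow> K_act g f \<in> M" for f i j i' j' g
    using assms X_in_opq pi_op_X unfolding gK_stable_def by metis+
  show "f \<in> M \<Longrightarrow> type_op f \<in> M"
    unfolding type_op_def Casimir_x_def Casimir_y_def
    by (intro cfun.subspace_add[OF M] cfun.subspace_sum[OF M] subspace_cc_mult[OF M] pp qq K parity_K_grp)
qed

text \<open>By \<open>M_plus_sum\<close> each operator need only be applied to products F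
  \<open>hw m (k, l)\<close>. Rotations and K do not affect the radial factor, and
  \<open>pi_pq_terms\<close> settles \<open>pi_pq\<close>.\<close>

lemma M_plus_stable: "gK_stable pi_op K_act (M_plus m :: ('p::finite, 'q::finite) cfun set)"
proof -
  have ext: "A f \<in> M_plus m"
    if A: "alg_linear A" and f: "f \<in> M_plus m"
      and gen: "\<And>F k l. F \<in> harmonic_tensor k l \<Longrightarrow> (k, l) \<in> K_type_index CARD('p) CARD('q) m \<Longrightarrow>
        A (F * hw m (k, l)) \<in> M_plus m"
    for A and f :: "('p, 'q) cfun"
  proof -
    obtain J G where J: "finite J" "J \<subseteq> K_type_index CARD('p) CARD('q) m"
      "\<And>i. i \<in> J \<Longrightarrow> G i \<in> harmonic_tensor (fst i) (snd i)" "f = (\<Sum>i\<in>J. G i * hw m i)"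
      using M_plus_sum[OF f] by blast
    have "A f = (\<Sum>i\<in>J. A (G i * hw m i))"
      unfolding J(4) by (intro alg_linearD(8)[OF A] alg.mult hw_alg HT_alg[OF J(3)])
    moreover have "A (G i * hw m i) \<in> M_plus m" if "i \<in> J" for i
      using gen[OF J(3)[OF that]] J(2) that by auto
    ultimately show ?thesis
      by (simp only:) (intro cfun.subspace_sum[OF M_plus_subspace])
  qed
  show ?thesis
  proof (rule gK_stableI[OF M_plus_subspace])
    show "pi_pp i j f \<in> M_plus m" if "f \<in> M_plus m" for f :: "('p, 'q) cfun" and i j
    proof (rule ext[OF alg_linear_ops(8) that])
      fix F :: "('p, 'q) cfun" and k l
      assume *: "F \<in> harmonic_tensor k l" "(k, l) \<in> K_type_index CARD('p) CARD('q) m"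
      have "pi_pp i j (F * hw m (k, l)) = pi_pp i j F * hw m (k, l)"
        unfolding hw_def by (intro pi_pp_R HT_alg[OF *(1)] kap_nonpos_Int) simp
      then show "pi_pp i j (F * hw m (k, l)) \<in> M_plus m"
        using M_plus_hw[OF HT_pi_pp[OF *(1)] *(2)] by simp
    qed
    show "pi_qq i j f \<in> M_plus m" if "f \<in> M_plus m" for f :: "('p, 'q) cfun" and i j
    proof (rule ext[OF alg_linear_ops(9) that])
      fix F :: "('p, 'q) cfun" and k l
      assume *: "F \<in> harmonic_tensor k l" "(k, l) \<in> K_type_index CARD('p) CARD('q) m"
      have "pi_qq i j (F * hw m (k, l)) = pi_qq i j F * hw m (k, l)"
        unfolding hw_def by (intro pi_qq_R HT_alg[OF *(1)] kap_nonpos_Int) simp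
      then show "pi_qq i j (F * hw m (k, l)) \<in> M_plus m"
        using M_plus_hw[OF HT_pi_qq[OF *(1)] *(2)] by simp
    qed
    show "pi_pq i j f \<in> M_plus m" if "f \<in> M_plus m" for f :: "('p, 'q) cfun" and i j
    proof (rule ext[OF alg_linear_ops(10) that])
      fix F :: "('p, 'q) cfun" and k l
      assume *: "F \<in> harmonic_tensor k l" "(k, l) \<in> K_type_index CARD('p) CARD('q) m"
      note t = pi_pq_terms[OF *(1) K_type_index_wt(2,1)[OF *(2)]]
      show "pi_pq i j (F * hw m (k, l)) \<in> M_plus m"
        unfolding t(1) by (intro subspace_cc_mult[OF M_plus_subspace] cfun.subspace_add[OF M_plus_subspace] t)
    qed
    show "K_act g f \<in> M_plus m" if g: "g \<in> K_grp" and "f \<in> M_plus m" for f :: "('p, 'q) cfun" and g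
    proof (rule ext[OF alg_linear_K_act[OF g] that(2)])
      fix F :: "('p, 'q) cfun" and k l
      assume *: "F \<in> harmonic_tensor k l" "(k, l) \<in> K_type_index CARD('p) CARD('q) m"
      show "K_act g (F * hw m (k, l)) \<in> M_plus m"
        using M_plus_hw[OF HT_K_act[OF *(1) g] *(2)] g by simp
    qed
  qed
qed

lemma E_comp_four:
  fixes N :: "('p::finite, 'q::finite) cfun set"
  assumes N: "cfun.subspace N" "\<And>f. f \<in> N \<Longrightarrow> type_op f \<in> N"
    and t: "t1 \<in> E_comp (k + 1) (l + 1)" "t2 \<in> E_comp (k + 1) (l - 1)" "t3 \<in> E_comp (k - 1) (l + 1)"
      "t4 \<in> E_comp (k - 1) (l - 1)" and s: "t1 + t2 + t3 + t4 \<in> N"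
  shows "t1 \<in> N" "t2 \<in> N" "t3 \<in> N" "t4 \<in> N"
proof -
  define g where "g i = (if i = (k + 1, l + 1) then t1 else if i = (k + 1, l - 1) then t2
    else if i = (k - 1, l + 1) then t3 else t4)" for i :: "nat \<times> nat"
  define J where "J = {(k + 1, l + 1), (k + 1, l - 1), (k - 1, l + 1), (k - 1, l - 1)}"
  \<comment> \<open>Truncated subtraction gives k - 1 = 0 for k = 0, still different from k + 1; so
    the four indices are distinct at the boundary too.\<close>
  have ne: "k + 1 \<noteq> k - 1" "l + 1 \<noteq> l - 1" by auto
  have sum: "(\<Sum>i\<in>J. g i) \<in> N"
    using s ne by (simp add: J_def g_def add.assoc)
  have E: "g i \<in> E_comp (fst i) (snd i)" if "i \<in> J" for i
    using that t ne by (auto simp: J_def g_def)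
  have m: "g i \<in> N" if "i \<in> J" for i
    by (rule E_components[OF N _ E sum that]) (simp_all add: J_def)
  show "t1 \<in> N" "t2 \<in> N" "t3 \<in> N" "t4 \<in> N"
    using m[of "(k + 1, l + 1)"] m[of "(k + 1, l - 1)"] m[of "(k - 1, l + 1)"] m[of "(k - 1, l - 1)"] ne
    by (simp_all add: J_def g_def)
qed

subsection \<open>Irreducibility\<close>

text \<open>The \<open>K\<close>-types of \<open>M_plus m\<close> lie on \<open>m + 1\<close> parallel diagonals, each of which is connected by
  the moves \<open>(1, 1)\<close>; the moves \<open>(1, -1)\<close> lead from one diagonal to the next.\<close>

lemma K_type_band_connected:
  assumes rel: "\<And>k l. (k, l) \<in> I \<longleftrightarrow> (\<exists>d\<le>m. 2 * k + p + 2 * m = 2 * l + q + 4 * (d::nat))"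
    and S: "S \<subseteq> I" "(k0, l0) \<in> S"
    and up: "\<And>k l. (k, l) \<in> S \<Longrightarrow> (Suc k, Suc l) \<in> S"
    and down: "\<And>k l. (Suc k, Suc l) \<in> S \<Longrightarrow> (k, l) \<in> S"
    and right: "\<And>k l d. (k, Suc l) \<in> S \<Longrightarrow> 2 * k + p + 2 * m = 2 * Suc l + q + 4 * d \<Longrightarrow> d < m \<Longrightarrow> (Suc k, l) \<in> S"
    and left: "\<And>k l d. (Suc k, l) \<in> S \<Longrightarrow> 2 * Suc k + p + 2 * m = 2 * l + q + 4 * d \<Longrightarrow> 0 < d \<Longrightarrow> (k, Suc l) \<in> S"
  shows "S = I"
proof
  show "I \<subseteq> S"
  proof
    fix i assume "i \<in> I"
    then obtain k l d where i: "i = (k, l)" "2 * k + p + 2 * m = 2 * l + q + 4 * d" "d \<le> m"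
      using rel by (metis prod.exhaust)
    obtain d0 where d0: "2 * k0 + p + 2 * m = 2 * l0 + q + 4 * d0" "d0 \<le> m"
      using S rel by blast
    have ups: "(a + n, b + n) \<in> S" if "(a, b) \<in> S" for a b n
      using that by (induction n) (auto intro: up)
    have downs: "(a + n, b + n) \<in> S \<Longrightarrow> (a, b) \<in> S" for a b n
      by (induction n) (auto intro: down)
    \<comment> \<open>Going up k + l + m steps leaves room for at most m sideways moves inside the
      quadrant and ensures arrival above the target (k, l).\<close>
    define n where "n = k + l + m"
    have start: "(k0 + n, l0 + n) \<in> S" by (rule ups[OF S(2)])
    \<comment> \<open>It suffices to meet the diagonal of the target at some (k + r, l + r);
      \<open>downs\<close> then descends to (k, l).\<close>
    have "\<exists>r. (k + r, l + r) \<in> S"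
    proof (cases "d0 \<le> d")
      case True
      have "(k0 + n + e, l0 + n - e) \<in> S" if "e \<le> d - d0" for e
        using that
      proof (induction e)
        case (Suc e)
        then have "(k0 + n + e, l0 + n - e) \<in> S" by simp
        moreover have "l0 + n - e = Suc (l0 + n - Suc e)"
          using Suc.prems i(3) by (simp add: n_def)
        moreover have "2 * (k0 + n + e) + p + 2 * m = 2 * Suc (l0 + n - Suc e) + q + 4 * (d0 + e)"
          using Suc.prems i(3) d0 by (simp add: n_def)
        ultimately show ?case
          using right[of "k0 + n + e" "l0 + n - Suc e" "d0 + e"] Suc.prems i(3) by simp
      qed (use start in simp)
      from this[of "d - d0"] have "(k0 + n + (d - d0), l0 + n - (d - d0)) \<in> S" by simp
      moreover have "k0 + n + (d - d0) = k + (k0 + n + (d - d0) - k)" by (simp add: n_def)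
      moreover have "l0 + n - (d - d0) = l + (k0 + n + (d - d0) - k)"
        using i d0 True by (simp add: n_def)
      ultimately show ?thesis by metis
    next
      case False
      have "(k0 + n - e, l0 + n + e) \<in> S" if "e \<le> d0 - d" for e
        using that
      proof (induction e)
        case (Suc e)
        then have "(k0 + n - e, l0 + n + e) \<in> S" by simp
        moreover have "k0 + n - e = Suc (k0 + n - Suc e)"
          using Suc.prems d0(2) by (simp add: n_def)
        moreover have "2 * Suc (k0 + n - Suc e) + p + 2 * m = 2 * (l0 + n + e) + q + 4 * (d0 - e)"
          using Suc.prems d0 by (simp add: n_def)
        ultimately show ?case
          using left[of "k0 + n - Suc e" "l0 + n + e" "d0 - e"] Suc.prems by simp
      qed (use start in simp)
      from this[of "d0 - d"] have "(k0 + n - (d0 - d), l0 + n + (d0 - d)) \<in> S" by simp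
      moreover have "l0 + n + (d0 - d) = l + (l0 + n + (d0 - d) - l)" by (simp add: n_def)
      moreover have "k0 + n - (d0 - d) = k + (l0 + n + (d0 - d) - l)"
        using i d0 False by (simp add: n_def)
      ultimately show ?thesis by metis
    qed
    then show "i \<in> S"
      using downs i(1) by blast
  qed
qed (rule S(1))

text \<open>S collects the K-types wholly contained in N. One nonzero vector of a type puts the type
  into S (\<open>full\<close>, by irreducibility of the type), a nonzero element of N supplies a
  first member through its isotypic parts, and S then absorbs every neighbour that is reached with
  nonzero coefficient.\<close>

lemma M_plus_simple:
  fixes N :: "('p::finite, 'q::finite) cfun set"
  assumes pq: "CARD('p) \<ge> 2" "CARD('q) \<ge> 2" and m: "2 * m + 6 \<le> CARD('p) + CARD('q)"
    and N: "N \<subseteq> M_plus m" "gK_stable pi_op K_act N"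
  shows "N = {0} \<or> N = M_plus m"
proof (cases "N = {0}")
  case False
  let ?I = "K_type_index CARD('p) CARD('q) m"
  note sub = gK_stableD(1)[OF N(2)]
  note tp = gK_stableD(6)[OF N(2)]
  have wt_alg: "kap CARD('p) k \<notin> \<int>\<^sub>\<le>\<^sub>0" for k by (rule kap_nonpos_Int) simp
  define S where "S = {i \<in> ?I. \<forall>F \<in> harmonic_tensor (fst i) (snd i). F * hw m i \<in> N}"
  have full: "(k, l) \<in> S"
    if i: "(k, l) \<in> ?I" and F: "F \<in> harmonic_tensor k l" "F * hw m (k, l) \<in> N" "F \<noteq> 0" for k l F
  proof -
    define W where "W = {F \<in> harmonic_tensor k l. F * hw m (k, l) \<in> N}"
    have "KL_stable W"
      unfolding KL_stable_def
    proof (intro conjI ballI allI)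
      show "cfun.subspace W"
      proof (rule cfun.subspaceI)
        show "0 \<in> W" using HT_0 cfun.subspace_0[OF sub] by (simp add: W_def)
        show "f + g \<in> W" if "f \<in> W" "g \<in> W" for f g
          using that cfun.subspace_add[OF sub] by (simp add: W_def HT_add distrib_right)
        show "cscale c f \<in> W" if "f \<in> W" for c f
          using that subspace_cc_mult[OF sub] by (simp add: W_def HT_scale cscale_conv[of c f] mult.assoc)
      qed
      fix F assume F: "F \<in> W"
      then have F': "F \<in> harmonic_tensor k l" "F * hw m (k, l) \<in> N" by (simp_all add: W_def)
      show "pi_pp i j F \<in> W" for i j
        using gK_stableD(2)[OF N(2) F'(2), of i j] HT_pi_pp[OF F'(1)] pi_pp_R[OF HT_alg[OF F'(1)] wt_alg]
        by (simp add: W_def hw_def)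
      show "pi_qq i j F \<in> W" for i j
        using gK_stableD(3)[OF N(2) F'(2), of i j] HT_pi_qq[OF F'(1)] pi_qq_R[OF HT_alg[OF F'(1)] wt_alg]
        by (simp add: W_def hw_def)
      show "K_act g F \<in> W" if "g \<in> K_grp" for g
        using gK_stableD(5)[OF N(2) that F'(2)] HT_K_act[OF F'(1) that] that by (simp add: W_def)
    qed
    moreover have "W \<subseteq> harmonic_tensor k l" by (auto simp: W_def)
    moreover have "W \<noteq> {0}" using F by (auto simp: W_def)
    ultimately have "W = harmonic_tensor k l"
      using KL_irreducible_HT[of k l, where 'p = 'p and 'q = 'q] unfolding KL_irreducible_def by blast
    then show ?thesis
      using i by (auto simp: S_def W_def)
  qed
  have step: "(a, b) \<in> S"
    if t: "cc c * (G * R 0 e (kap CARD('p) a)) \<in> N" and "c \<noteq> 0" "G \<noteq> 0" "G \<in> harmonic_tensor a b"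
      and e: "2 * a + CARD('p) + 2 * m = 2 * b + CARD('q) + 4 * e" "e \<le> m" for a b c e G
  proof (rule full)
    show "(a, b) \<in> ?I" using e by (auto simp: K_type_index_iff)
    have "cc (1 / c) * (cc c * (G * R 0 e (kap CARD('p) a))) \<in> N"
      by (rule subspace_cc_mult[OF sub t])
    moreover have "cc (1 / c) * (cc c * (G * R 0 e (kap CARD('p) a))) = G * R 0 e (kap CARD('p) a)"
      using \<open>c \<noteq> 0\<close> by (simp add: fun_eq_iff pw)
    ultimately show "G * hw m (a, b) \<in> N"
      using hw_eq[OF e(1)] by simp
  qed (use that in auto)
  have terms:
    "cc ((kap CARD('p) k - of_nat d - 1) / kap CARD('p) k) *
      (up_x i k (up_y j l F) * R 0 d (kap CARD('p) k + 1)) \<in> N"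
    "cc ((2 * up_coeff CARD('q) l * (kap CARD('p) k - of_nat d - 1) - 1) / kap CARD('p) k) *
      (up_x i k (dy j F) * R 0 (Suc d) (kap CARD('p) k + 1)) \<in> N"
    "cc (of_nat d) * (dx i (up_y j l F) * R 0 (d - 1) (kap CARD('p) k - 1)) \<in> N"
    "cc (1 + 2 * up_coeff CARD('q) l * of_nat d) * (dx i (dy j F) * R 0 d (kap CARD('p) k - 1)) \<in> N"
    if S: "(k, l) \<in> S" and F: "F \<in> harmonic_tensor k l"
      and d: "2 * k + CARD('p) + 2 * m = 2 * l + CARD('q) + 4 * d" "d \<le> m" for k l d i j F
  proof -
    note t = pi_pq_terms[OF F d, of i j]
    let ?t = "\<lambda>f. cc (- \<i>) * f"
    have "F * hw m (k, l) \<in> N" using S F by (auto simp: S_def)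
    then have n: "?t (pi_pq i j (F * hw m (k, l))) \<in> N"
      by (intro subspace_cc_mult[OF sub] gK_stableD(4)[OF N(2)])
    have c: "?t (cc \<i> * f) = f" for f :: "('p, 'q) cfun"
      by (simp add: fun_eq_iff pw)
    note four = E_comp_four[OF sub tp t(2,4,6,8) n[unfolded t(1) c]]
    show "cc ((kap CARD('p) k - of_nat d - 1) / kap CARD('p) k) *
      (up_x i k (up_y j l F) * R 0 d (kap CARD('p) k + 1)) \<in> N"
      by (rule four(1))
    show "cc ((2 * up_coeff CARD('q) l * (kap CARD('p) k - of_nat d - 1) - 1) / kap CARD('p) k) *
      (up_x i k (dy j F) * R 0 (Suc d) (kap CARD('p) k + 1)) \<in> N"
      by (rule four(2))
    show "cc (of_nat d) * (dx i (up_y j l F) * R 0 (d - 1) (kap CARD('p) k - 1)) \<in> N"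
      by (rule four(3))
    show "cc (1 + 2 * up_coeff CARD('q) l * of_nat d) * (dx i (dy j F) * R 0 d (kap CARD('p) k - 1)) \<in> N"
      by (rule four(4))
  qed
  have kap0: "kap CARD('p) k \<noteq> 0" for k using wt_alg[of k] by auto
  have kap1: "kap CARD('p) (Suc k) - 1 = kap CARD('p) k" for k by (simp add: kap_Suc)
  have kapq: "kap CARD('q) l \<noteq> 0" for l using kap_nonpos_Int[of "CARD('q)" l] by auto
  have S_I: "\<exists>d. 2 * k + CARD('p) + 2 * m = 2 * l + CARD('q) + 4 * d \<and> d \<le> m" if "(k, l) \<in> S" for k l
    using that K_type_index_iff by (auto simp: S_def)
  have nonzero: "\<exists>F \<in> harmonic_tensor k l. F \<noteq> (0 :: ('p, 'q) cfun)" for k l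
    by (rule HT_nonzero[OF pq])
  obtain k0 l0 where start: "(k0, l0) \<in> S"
  proof -
    obtain f where f: "f \<in> N" "f \<noteq> 0" using False cfun.subspace_0[OF sub] by auto
    obtain J G where J: "finite J" "J \<subseteq> ?I" "\<And>i. i \<in> J \<Longrightarrow> G i \<in> harmonic_tensor (fst i) (snd i)"
      "f = (\<Sum>i\<in>J. G i * hw m i)"
      using M_plus_sum[of f m] f(1) N(1) by blast
    have "\<not> (\<forall>i\<in>J. G i * hw m i = 0)"
    proof
      assume "\<forall>i\<in>J. G i * hw m i = 0"
      then have "f = 0" unfolding J(4) by (intro sum.neutral)
      then show False using f(2) by simp
    qed
    then obtain i where i: "i \<in> J" "G i * hw m i \<noteq> 0" by blast
    have "G i * hw m i \<in> N"
      by (rule E_components[where g = "\<lambda>i. G i * hw m i", OF sub tp J(1) hw_E_comp[OF J(3)]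
          f(1)[unfolded J(4)] i(1)])
    then have "(fst i, snd i) \<in> S"
      using J(2,3) i by (intro full[of _ _ "G i"]) auto
    then show thesis by (rule that)
  qed
  have "S = ?I"
  proof (rule K_type_band_connected[OF K_type_index_iff _ start])
    show "S \<subseteq> ?I" by (auto simp: S_def)
    show "(Suc k, Suc l) \<in> S" if S: "(k, l) \<in> S" for k l
    proof -
      obtain d where d: "2 * k + CARD('p) + 2 * m = 2 * l + CARD('q) + 4 * d" "d \<le> m" using S_I[OF S] by blast
      obtain F where F: "F \<in> harmonic_tensor k l" "F \<noteq> (0 :: ('p, 'q) cfun)" using nonzero by blast
      obtain j where j: "up_y j l F \<noteq> 0" using HT_up_y_nonzero[OF F pq(2)] by blast
      obtain i where i: "up_x i k (up_y j l F) \<noteq> 0"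
        using HT_up_x_nonzero[OF HT_up_y[OF F(1)] j pq(1)] by blast
      \<comment> \<open>The number 4 (\<kappa> - d - 1), rewritten by the index equation; 2 m + 6 <=
        p + q makes it at least 2.\<close>
      define X where "X = 2 * k + 2 * l + (CARD('p) + CARD('q) - 2 * m - 4)"
      have "4 * k + 2 * CARD('p) = 4 * d + 4 + X"
        using d(1) m by (simp add: X_def)
      then have "(of_nat (4 * k + 2 * CARD('p)) :: complex) = of_nat (4 * d + 4 + X)"
        by (simp only:)
      then have "4 * (kap CARD('p) k - of_nat d - 1) = of_nat X"
        by (simp add: kap_def algebra_simps)
      moreover have "(of_nat X :: complex) \<noteq> 0"
        using m by (simp add: X_def of_nat_eq_0_iff del: of_nat_add)
      ultimately have "kap CARD('p) k - of_nat d - 1 \<noteq> 0"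
        by (metis mult_zero_right)
      then show ?thesis
        using kap0[of k] i d HT_up_x[OF HT_up_y[OF F(1)], of i j]
        by (intro step[OF terms(1)[OF S F(1) d, of i j, folded kap_Suc]]) auto
    qed
    show "(k, l) \<in> S" if S: "(Suc k, Suc l) \<in> S" for k l
    proof -
      obtain d where d: "2 * Suc k + CARD('p) + 2 * m = 2 * Suc l + CARD('q) + 4 * d" "d \<le> m"
        using S_I[OF S] by blast
      obtain F where F: "F \<in> harmonic_tensor (Suc k) (Suc l)" "F \<noteq> (0 :: ('p, 'q) cfun)" using nonzero by blast
      obtain j where j: "dy j F \<noteq> 0" using HT_dy_nonzero[OF F] by blast
      obtain i where i: "dx i (dy j F) \<noteq> 0" using HT_dx_nonzero[OF HT_dy[OF F(1)] j] by blast
      have z: "2 * up_coeff CARD('q) (Suc l) = 1 / kap CARD('q) l"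
        by (simp add: up_coeff_kap kap_Suc)
      \<comment> \<open>The sum is \<open>kap CARD('q) (l + d)\<close>, a positive number.\<close>
      have "kap CARD('q) l + of_nat d \<noteq> 0"
        using kapq[of "l + d"] by (simp add: kap_def add_ac)
      then have "1 + 2 * up_coeff CARD('q) (Suc l) * of_nat d \<noteq> 0"
        unfolding z using kapq[of l] by (simp add: divide_simps)
      then show ?thesis
        using i d HT_dx[OF HT_dy[OF F(1)], of i j]
        by (intro step[OF terms(4)[OF S F(1) d, of i j, unfolded kap1]]) auto
    qed
    show "(Suc k, l) \<in> S"
      if S: "(k, Suc l) \<in> S" and d: "2 * k + CARD('p) + 2 * m = 2 * Suc l + CARD('q) + 4 * d" "d < m" for k l d
    proof -
      obtain F where F: "F \<in> harmonic_tensor k (Suc l)" "F \<noteq> (0 :: ('p, 'q) cfun)" using nonzero by blast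
      obtain j where j: "dy j F \<noteq> 0" using HT_dy_nonzero[OF F] by blast
      obtain i where i: "up_x i k (dy j F) \<noteq> 0" using HT_up_x_nonzero[OF HT_dy[OF F(1)] j pq(1)] by blast
      have z: "2 * up_coeff CARD('q) (Suc l) = 1 / kap CARD('q) l"
        by (simp add: up_coeff_kap kap_Suc)
      have k: "kap CARD('p) k - of_nat d - 1 = kap CARD('q) l + (of_nat d - of_nat m)"
        using kap_rel[OF d(1)] by (simp add: kap_Suc algebra_simps)
      \<comment> \<open>The coefficient of the move (1, -1) is thus proportional to d - m and
        vanishes on the last diagonal d = m alone.\<close>
      have "2 * up_coeff CARD('q) (Suc l) * (kap CARD('p) k - of_nat d - 1) - 1 =
          (of_nat d - of_nat m) / kap CARD('q) l"
        unfolding z k using kapq[of l] by (simp add: divide_simps)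
      then have "2 * up_coeff CARD('q) (Suc l) * (kap CARD('p) k - of_nat d - 1) - 1 \<noteq> 0"
        using kapq[of l] d(2) by simp
      then show ?thesis
        using i d kap0[of k] HT_up_x[OF HT_dy[OF F(1)], of i j]
        by (intro step[OF terms(2)[OF S F(1) d(1) less_imp_le[OF d(2)], of i j, folded kap_Suc[of "CARD('p)"]]]) auto
    qed
    show "(k, Suc l) \<in> S"
      if S: "(Suc k, l) \<in> S" and d: "2 * Suc k + CARD('p) + 2 * m = 2 * l + CARD('q) + 4 * d" "0 < d" for k l d
    proof -
      have dm: "d \<le> m" using S_I[OF S] d(1) by auto
      obtain F where F: "F \<in> harmonic_tensor (Suc k) l" "F \<noteq> (0 :: ('p, 'q) cfun)" using nonzero by blast
      obtain j where j: "up_y j l F \<noteq> 0" using HT_up_y_nonzero[OF F pq(2)] by blast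
      obtain i where i: "dx i (up_y j l F) \<noteq> 0" using HT_dx_nonzero[OF HT_up_y[OF F(1)] j] by blast
      show ?thesis
        using i d dm HT_dx[OF HT_up_y[OF F(1)], of i j]
        by (intro step[OF terms(3)[OF S F(1) d(1) dm, of i j, unfolded kap1]]) auto
    qed
  qed
  have "f \<in> N" if f: "f \<in> M_plus m" for f
  proof -
    obtain J G where J: "J \<subseteq> ?I" "\<And>i. i \<in> J \<Longrightarrow> G i \<in> harmonic_tensor (fst i) (snd i)"
      "f = (\<Sum>i\<in>J. G i * hw m i)"
      using M_plus_sum[OF f] by blast
    have "G i * hw m i \<in> N" if "i \<in> J" for i
    proof -
      have "i \<in> S" using that J(1) \<open>S = ?I\<close> by blast
      then show ?thesis using J(2)[OF that] unfolding S_def by blast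
    qed
    then show ?thesis
      unfolding J(3) by (rule cfun.subspace_sum[OF sub])
  qed
  then show ?thesis using N(1) by blast
qed simp

subsection \<open>The module axioms\<close>

lemma alg_linear_pi_op: "alg_linear (pi_op A)"
  unfolding pi_op_conv[abs_def]
  by (intro alg_linear_add alg_linear_cc_mult alg_linear_sum alg_linear_ops)

lemma pi_op_add: "pi_op (A + B) f = pi_op A f + pi_op B f"
  by (simp add: pi_op_conv cc_hom distrib_left distrib_right sum.distrib)

lemma pi_op_mscale: "pi_op (mscale c A) f = cscale c (pi_op A f)"
  by (simp add: pi_op_conv mscale_def cscale_conv cc_hom distrib_left sum_distrib_left mult_ac)

text \<open>For skew a the sum with factor 1/2 in \<open>pi_op\<close> collapses to this
  (\<open>skew_sum\<close>). Together \<open>PX\<close>, \<open>PY\<close>, \<open>MZ\<close> and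
  \<open>DZ\<close> express the action through the blocks of a matrix, so that brackets become
  matrix products of blocks.\<close>

definition PX :: "('p \<Rightarrow> 'p \<Rightarrow> complex) \<Rightarrow> ('p::finite, 'q::finite) cfun \<Rightarrow> ('p, 'q) cfun" where
  "PX a f = (\<Sum>i\<in>UNIV. \<Sum>j\<in>UNIV. cc (a i j) * (xc i * dx j f))"

definition PY :: "('q \<Rightarrow> 'q \<Rightarrow> complex) \<Rightarrow> ('p::finite, 'q::finite) cfun \<Rightarrow> ('p, 'q) cfun" where
  "PY a f = (\<Sum>i\<in>UNIV. \<Sum>j\<in>UNIV. cc (a i j) * (yc i * dy j f))"

definition MZ :: "('p \<Rightarrow> 'q \<Rightarrow> complex) \<Rightarrow> ('p::finite, 'q::finite) cfun" where
  "MZ b = (\<Sum>i\<in>UNIV. \<Sum>j\<in>UNIV. cc (b i j) * (xc i * yc j))"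

definition DZ :: "('p \<Rightarrow> 'q \<Rightarrow> complex) \<Rightarrow> ('p::finite, 'q::finite) cfun \<Rightarrow> ('p, 'q) cfun" where
  "DZ b f = (\<Sum>i\<in>UNIV. \<Sum>j\<in>UNIV. cc (b i j) * dx i (dy j f))"

lemma skew_sum:
  fixes G :: "'i::finite \<Rightarrow> 'i \<Rightarrow> 'v \<Rightarrow> complex"
  assumes "\<And>i j. a i j = - a j i"
  shows "cc (1/2) * (\<Sum>i\<in>UNIV. \<Sum>j\<in>UNIV. cc (a i j) * (G i j - G j i)) =
    (\<Sum>i\<in>UNIV. \<Sum>j\<in>UNIV. cc (a i j) * G i j)"
proof -
  let ?S = "\<Sum>i\<in>UNIV. \<Sum>j\<in>UNIV. cc (a i j) * G i j"
  have "(\<Sum>i\<in>UNIV. \<Sum>j\<in>UNIV. cc (a i j) * G j i) = (\<Sum>j\<in>UNIV. \<Sum>i\<in>UNIV. cc (a i j) * G j i)"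
    by (rule sum.swap)
  also have "\<dots> = (\<Sum>j\<in>UNIV. \<Sum>i\<in>UNIV. - (cc (a j i) * G j i))"
    by (intro sum.cong refl) (subst assms, simp add: cc_hom)
  finally have "(\<Sum>i\<in>UNIV. \<Sum>j\<in>UNIV. cc (a i j) * (G i j - G j i)) = ?S + ?S"
    by (simp add: right_diff_distrib sum_subtractf sum_negf)
  then show ?thesis
    by (simp add: fun_eq_iff pw)
qed

lemma pi_op_skew:
  assumes "A \<in> opq"
  shows "pi_op A f = PX (\<lambda>i j. A $ Inl i $ Inl j) f + PY (\<lambda>i j. A $ Inr i $ Inr j) f
    + cc \<i> * (MZ (\<lambda>i j. A $ Inl i $ Inr j) * f + DZ (\<lambda>i j. A $ Inl i $ Inr j) f)"
proof -
  have sk: "A $ Inl i $ Inl j = - A $ Inl j $ Inl i" "A $ Inr i' $ Inr j' = - A $ Inr j' $ Inr i'" for i j i' j'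
    using assms unfolding opq_iff by blast+
  have "(\<Sum>i\<in>UNIV. \<Sum>j\<in>UNIV. cc (A $ Inl i $ Inr j) * pi_pq i j f) =
      cc \<i> * (MZ (\<lambda>i j. A $ Inl i $ Inr j) * f + DZ (\<lambda>i j. A $ Inl i $ Inr j) f)"
    by (simp add: MZ_def DZ_def pi_pq_conv sum_distrib_left sum_distrib_right distrib_left sum.distrib mult_ac)
  then show ?thesis
    unfolding pi_op_conv PX_def PY_def
    using skew_sum[OF sk(1), where G = "\<lambda>i j. xc i * dx j f"] skew_sum[OF sk(2), where G = "\<lambda>i j. yc i * dy j f"]
    by (simp add: pi_pp_conv pi_qq_conv)
qed

lemma alg_linear_PX: "alg_linear (PX a)" and alg_linear_PY: "alg_linear (PY b)"
  and alg_linear_DZ: "alg_linear (DZ c)"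
  unfolding PX_def[abs_def] PY_def[abs_def] DZ_def[abs_def]
  by (intro alg_linear_sum alg_linear_cc_mult alg_linear_comp[OF alg_linear_mult] alg_linear_dx alg_linear_dy
      alg_linear_comp[OF alg_linear_dx alg_linear_dy]; simp)+

lemma MZ_alg [simp, intro]: "MZ b \<in> alg"
  by (simp add: MZ_def)

lemma PX_alg [simp, intro]: "f \<in> alg \<Longrightarrow> PX a f \<in> alg" and PY_alg [simp, intro]: "f \<in> alg \<Longrightarrow> PY b f \<in> alg"
  and DZ_alg [simp, intro]: "f \<in> alg \<Longrightarrow> DZ c f \<in> alg"
  by (simp_all add: alg_linearD(1)[OF alg_linear_PX] alg_linearD(1)[OF alg_linear_PY] alg_linearD(1)[OF alg_linear_DZ])

lemma PY_swp: "PY a f = swp (PX a (swp f))"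
  by (simp add: PX_def PY_def swp_sum dx_swp)

lemma PX_mult: "f \<in> alg \<Longrightarrow> g \<in> alg \<Longrightarrow> PX a (f * g) = PX a f * g + f * PX a g"
  by (simp add: PX_def dx_mult sum_distrib_left sum_distrib_right sum.distrib[symmetric] algebra_simps)

lemma PX_cc [simp]: "PX a (cc c) = 0" and PY_cc [simp]: "PY b (cc c) = 0"
  and PX_0 [simp]: "PX a 0 = 0"
  by (simp_all add: PX_def PY_def)

lemma PX_xc: "PX a (xc k) = (\<Sum>i\<in>UNIV. cc (a i k) * xc i)"
proof -
  have "PX a (xc k) = (\<Sum>i\<in>UNIV. \<Sum>j\<in>UNIV. (cc (a i j) * xc i) * (if j = k then 1 else 0))"
    unfolding PX_def dx_xc by (simp only: mult.assoc)
  then show ?thesis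
    by (simp only: sum_delta_fun)
qed

lemma PX_yc [simp]: "PX a (yc k) = 0"
  by (simp add: PX_def)

text \<open>A linear vector field with skew matrix is tangent to the spheres about 0, so it
  annihilates functions of rho_x.\<close>

lemma PX_psi:
  assumes "\<And>i j. a i j = - a j i" "\<alpha> \<notin> \<int>\<^sub>\<le>\<^sub>0"
  shows "PX a (psi \<alpha>) = 0"
proof -
  have "PX a (psi \<alpha>) = cc (- (1 / \<alpha>)) * (rho_y * psi (\<alpha> + 1)) * (\<Sum>i\<in>UNIV. \<Sum>j\<in>UNIV. cc (a i j) * (xc i * xc j))"
    by (simp add: PX_def dx_psi[OF assms(2)] sum_distrib_left mult_ac)
  also have "(\<Sum>i\<in>UNIV. \<Sum>j\<in>UNIV. cc (a i j) * (xc i * xc j)) = 0"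
    using skew_sum[where a = a and G = "\<lambda>i j. xc i * xc j", OF assms(1)] by (simp add: mult.commute)
  finally show ?thesis by simp
qed

text \<open>Both sides are derivations of \<open>alg\<close>, so it suffices to compare them on
  generators. On coordinates this is matrix multiplication; on \<psi>_\<alpha> all terms vanish, the
  commutator of skew matrices being skew.\<close>

lemma PX_commutator:
  fixes f :: "('p::finite, 'q::finite) cfun"
  assumes a: "\<And>i j. a i j = - a j i" and c: "\<And>i j. c i j = - c j i" and f: "f \<in> alg"
  shows "PX a (PX c f) - PX c (PX a f) =
    PX (\<lambda>i j. (\<Sum>k\<in>UNIV. a i k * c k j) - (\<Sum>k\<in>UNIV. c i k * a k j)) f"
proof -
  define b where "b i j = (\<Sum>k\<in>UNIV. a i k * c k j) - (\<Sum>k\<in>UNIV. c i k * a k j)" for i j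
  have b: "b i j = - b j i" for i j
  proof -
    have "a i k * c k j = c j k * a k i" "c i k * a k j = a j k * c k i" for k
      using a[of i k] c[of k j] a[of k j] c[of i k] by simp_all
    then show ?thesis by (simp add: b_def)
  qed
  have xx: "PX a (PX c (xc l)) = (\<Sum>r\<in>UNIV. cc (\<Sum>k\<in>UNIV. a r k * c k l) * xc r :: ('p, 'q) cfun)" for a c l
  proof -
    have "PX a (PX c (xc l)) = (\<Sum>i\<in>UNIV. cc (c i l) * PX a (xc i) :: ('p, 'q) cfun)"
      unfolding PX_xc[of c] by (simp add: alg_linearD(7,8)[OF alg_linear_PX])
    also have "\<dots> = (\<Sum>i\<in>UNIV. \<Sum>r\<in>UNIV. cc (a r i * c i l) * xc r)"
      by (simp add: PX_xc sum_distrib_left cc_hom mult_ac)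
    also have "\<dots> = (\<Sum>r\<in>UNIV. \<Sum>i\<in>UNIV. cc (a r i * c i l) * xc r)"
      by (rule sum.swap)
    finally show ?thesis
      by (simp add: sum_cc[symmetric] sum_distrib_right)
  qed
  have "PX a (PX c f) - PX c (PX a f) = PX b f"
    using f
  proof (induction rule: alg.induct)
    case (const s)
    show ?case by simp
  next
    case (xc l)
    show ?case unfolding xx PX_xc[of b]
      by (simp add: b_def cc_hom left_diff_distrib sum_subtractf)
  next
    case (yc l)
    show ?case by simp
  next
    case (psi \<alpha>)
    then show ?case by (simp add: PX_psi[OF a] PX_psi[OF b] PX_psi[OF c])
  next
    case (add f g)
    have "PX a (PX c (f + g)) = PX a (PX c f) + PX a (PX c g)" "PX c (PX a (f + g)) = PX c (PX a f) + PX c (PX a g)"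
      "PX b (f + g) = PX b f + PX b g"
      using add.hyps by (simp_all add: alg_linearD(2)[OF alg_linear_PX])
    then show ?case
      using add.IH by (simp add: algebra_simps)
  next
    case (mult f g)
    have "PX a (PX c (f * g)) - PX c (PX a (f * g)) =
        (PX a (PX c f) - PX c (PX a f)) * g + f * (PX a (PX c g) - PX c (PX a g))"
      using mult.hyps by (simp add: PX_mult alg_linearD(2)[OF alg_linear_PX]) (simp add: algebra_simps)
    then show ?case
      using mult.IH mult.hyps by (simp add: PX_mult)
  qed
  then show ?thesis unfolding b_def .
qed

lemma PX_dx: 
  assumes "f \<in> alg"
  shows "PX a (dx i f) = dx i (PX a f) - (\<Sum>j\<in>UNIV. cc (a i j) * dx j f)"
proof -
  have "dx i (PX a f) = (\<Sum>k\<in>UNIV. \<Sum>j\<in>UNIV. (if i = k then 1 else 0) * (cc (a k j) * dx j f)) + PX a (dx i f)"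
    using assms
    by (simp add: PX_def dx_sum dx_cc_mult dx_mult dx_xc dx_dx[of f i] sum.distrib distrib_left mult_ac)
  also have "(\<Sum>k\<in>UNIV. \<Sum>j\<in>UNIV. (if i = k then 1 else 0) * (cc (a k j) * dx j f)) = (\<Sum>j\<in>UNIV. cc (a i j) * dx j f)"
    by (simp add: sum_distrib_left[symmetric] sum_delta_fun)
  finally show ?thesis by simp
qed

lemma PX_dy: "f \<in> alg \<Longrightarrow> PX a (dy i f) = dy i (PX a f)"
  by (simp add: PX_def dy_sum dy_mult dy_dx)

lemma PX_PY: "f \<in> alg \<Longrightarrow> PX a (PY b f) = PY b (PX a f)"
  by (simp add: PY_def alg_linearD(7,8)[OF alg_linear_PX] PX_mult PX_dy)

lemma PX_MZ: "PX a (MZ b) = MZ (\<lambda>i j. \<Sum>k\<in>UNIV. a i k * b k j)"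
proof -
  have "PX a (MZ b) = (\<Sum>k\<in>UNIV. \<Sum>j\<in>UNIV. \<Sum>i\<in>UNIV. cc (a i k * b k j) * (xc i * yc j))"
    by (simp add: MZ_def alg_linearD(7,8)[OF alg_linear_PX] PX_mult PX_xc sum_distrib_left sum_distrib_right
        cc_hom mult_ac)
  also have "\<dots> = (\<Sum>i\<in>UNIV. \<Sum>j\<in>UNIV. \<Sum>k\<in>UNIV. cc (a i k * b k j) * (xc i * yc j))"
    by (subst sum.swap, subst (2) sum.swap, subst sum.swap) (rule refl)
  finally show ?thesis
    by (simp add: MZ_def sum_cc[symmetric] sum_distrib_right)
qed

lemma PX_DZ:
  assumes a: "\<And>i j. a i j = - a j i" and f: "f \<in> alg"
  shows "PX a (DZ b f) = DZ b (PX a f) + DZ (\<lambda>i j. \<Sum>k\<in>UNIV. a i k * b k j) f"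
proof -
  have "PX a (DZ b f) = (\<Sum>k\<in>UNIV. \<Sum>j\<in>UNIV. cc (b k j) * (dx k (dy j (PX a f)) - (\<Sum>i\<in>UNIV. cc (a k i) * dx i (dy j f))))"
    using f by (simp add: DZ_def alg_linearD(7,8)[OF alg_linear_PX] PX_dx PX_dy)
  also have "\<dots> = DZ b (PX a f) - (\<Sum>k\<in>UNIV. \<Sum>j\<in>UNIV. \<Sum>i\<in>UNIV. cc (b k j * a k i) * dx i (dy j f))"
    by (simp add: DZ_def right_diff_distrib sum_subtractf sum_distrib_left cc_hom mult.assoc)
  also have "(\<Sum>k\<in>UNIV. \<Sum>j\<in>UNIV. \<Sum>i\<in>UNIV. cc (b k j * a k i) * dx i (dy j f)) =
      (\<Sum>i\<in>UNIV. \<Sum>j\<in>UNIV. \<Sum>k\<in>UNIV. cc (b k j * a k i) * dx i (dy j f))"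
    by (subst sum.swap, subst (2) sum.swap, subst sum.swap) (rule refl)
  also have "\<dots> = - DZ (\<lambda>i j. \<Sum>k\<in>UNIV. a i k * b k j) f"
    unfolding DZ_def sum_negf[symmetric] sum_cc[symmetric] sum_distrib_right
    by (intro sum.cong refl) (subst a, simp add: cc_hom mult_ac)
  finally show ?thesis by simp
qed

lemma DZ_comm:
  assumes f: "f \<in> alg"
  shows "DZ b (DZ c f) = DZ c (DZ b f)"
proof -
  have x: "dx i (DZ b g) = DZ b (dx i g)" "dy j (DZ b g) = DZ b (dy j g)" if "g \<in> alg" for g i j
    using that by (simp_all add: DZ_def dx_sum dy_sum dx_cc_mult dy_cc_mult dy_dx dx_dx[of _ i] dy_dy[of _ j])
  show ?thesis
    unfolding DZ_def[of c] using f by (simp add: alg_linearD(7,8)[OF alg_linear_DZ] x)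
qed

text \<open>By the Leibniz rule: two derivatives falling on \<open>MZ c\<close> leave the pairing of
  b with c, one derivative leaves a first-order operator. The pairing is symmetric in b and c and
  drops out of \<open>PZ_commutator\<close>.\<close>

lemma DZ_MZ:
  assumes f: "f \<in> alg"
  shows "DZ b (MZ c * f) - MZ c * DZ b f = cc (\<Sum>i\<in>UNIV. \<Sum>j\<in>UNIV. b i j * c i j) * f
    + PX (\<lambda>k i. \<Sum>j\<in>UNIV. c k j * b i j) f + PY (\<lambda>l j. \<Sum>i\<in>UNIV. c i l * b i j) f"
proof -
  have dxM: "dx i (MZ c) = (\<Sum>l\<in>UNIV. cc (c i l) * yc l)" for i
  proof -
    have "dx i (MZ c) = (\<Sum>k\<in>UNIV. (if i = k then 1 else 0) * (\<Sum>l\<in>UNIV. cc (c k l) * yc l))"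
      by (simp add: MZ_def dx_sum dx_mult dx_xc sum_distrib_left mult_ac)
    then show ?thesis by (simp only: sum_delta_fun)
  qed
  have dyM: "dy j (MZ c) = (\<Sum>k\<in>UNIV. cc (c k j) * xc k)" for j
  proof -
    have "dy j (MZ c) = (\<Sum>k\<in>UNIV. \<Sum>l\<in>UNIV. (if j = l then 1 else 0) * (cc (c k l) * xc k))"
      by (simp add: MZ_def dy_sum dy_mult dy_yc mult_ac)
    then show ?thesis by (simp only: sum_delta_fun)
  qed
  have dxyM: "dx i (dy j (MZ c)) = cc (c i j)" for i j
  proof -
    have "dx i (dy j (MZ c)) = (\<Sum>k\<in>UNIV. (if i = k then 1 else 0) * cc (c k j))"
      by (simp add: dyM dx_sum dx_mult dx_xc mult_ac)
    then show ?thesis by (simp only: sum_delta_fun)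
  qed
  have "dx i (dy j (MZ c * f)) = MZ c * dx i (dy j f) + cc (c i j) * f
      + (\<Sum>l\<in>UNIV. cc (c i l) * yc l) * dy j f + (\<Sum>k\<in>UNIV. cc (c k j) * xc k) * dx i f" for i j
    using f by (simp add: dx_mult dy_mult dx_add dxyM) (simp add: dxM dyM algebra_simps)
  then have "DZ b (MZ c * f) = MZ c * DZ b f + (\<Sum>i\<in>UNIV. \<Sum>j\<in>UNIV. cc (b i j * c i j)) * f
      + (\<Sum>i\<in>UNIV. \<Sum>j\<in>UNIV. \<Sum>l\<in>UNIV. cc (c i l * b i j) * (yc l * dy j f))
      + (\<Sum>i\<in>UNIV. \<Sum>j\<in>UNIV. \<Sum>k\<in>UNIV. cc (c k j * b i j) * (xc k * dx i f))"
    by (simp add: DZ_def distrib_left sum.distrib sum_distrib_left sum_distrib_right cc_hom mult_ac)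
  also have "(\<Sum>i\<in>UNIV. \<Sum>j\<in>UNIV. \<Sum>l\<in>UNIV. cc (c i l * b i j) * (yc l * dy j f)) =
      PY (\<lambda>l j. \<Sum>i\<in>UNIV. c i l * b i j) f"
    unfolding PY_def sum_cc[symmetric] sum_distrib_right
    by (subst sum.swap, subst (2) sum.swap, subst sum.swap) (rule refl)
  also have "(\<Sum>i\<in>UNIV. \<Sum>j\<in>UNIV. \<Sum>k\<in>UNIV. cc (c k j * b i j) * (xc k * dx i f)) =
      PX (\<lambda>k i. \<Sum>j\<in>UNIV. c k j * b i j) f"
    unfolding PX_def sum_cc[symmetric] sum_distrib_right
    by (subst (2) sum.swap, subst sum.swap) (rule refl)
  finally show ?thesis
    by (simp add: sum_cc)
qed

lemma sum_UNIV_sum: "(\<Sum>k\<in>UNIV. F k) = (\<Sum>i\<in>UNIV. F (Inl i)) + (\<Sum>j\<in>UNIV. F (Inr j))"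
  for F :: "'a::finite + 'b::finite \<Rightarrow> 'c::comm_monoid_add"
  by (simp add: sum.Plus flip: UNIV_Plus_UNIV)

lemma PX_minus: "PX (\<lambda>i j. a i j - b i j) f = PX a f - PX b f"
  and PY_minus: "PY (\<lambda>i j. c i j - d i j) f = PY c f - PY d f"
  by (simp_all add: PX_def PY_def cc_hom left_diff_distrib sum_subtractf)

text \<open>The action of the off-diagonal block without its factor \<i>.\<close>

definition PZ :: "('p \<Rightarrow> 'q \<Rightarrow> complex) \<Rightarrow> ('p::finite, 'q::finite) cfun \<Rightarrow> ('p, 'q) cfun" where
  "PZ b f = MZ b * f + DZ b f"

lemma PZ_minus: "PZ (\<lambda>i j. a i j - b i j) f = PZ a f - PZ b f"
  by (simp add: PZ_def MZ_def DZ_def cc_hom left_diff_distrib sum_subtractf)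

lemma alg_linear_PZ: "alg_linear (PZ b)"
  unfolding PZ_def[abs_def]
  by (intro alg_linear_add alg_linear_mult alg_linear_DZ MZ_alg)

lemma swp_PZ: "swp (PZ b f) = PZ (\<lambda>j i. b i j) (swp f)" if "f \<in> alg"
proof -
  have "swp (MZ b) = MZ (\<lambda>j i. b i j)"
    unfolding MZ_def swp_sum by (subst sum.swap) (simp add: mult_ac)
  moreover have "swp (DZ b f) = DZ (\<lambda>j i. b i j) (swp f)"
    unfolding DZ_def swp_sum using that by (subst sum.swap) (simp add: dx_swp dy_swp dy_dx)
  ultimately show ?thesis by (simp add: PZ_def)
qed

lemma PX_PZ_commutator:
  assumes "\<And>i j. a i j = - a j i" "f \<in> alg"
  shows "PX a (PZ b f) - PZ b (PX a f) = PZ (\<lambda>i j. \<Sum>k\<in>UNIV. a i k * b k j) f"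
  using assms(2)
  by (simp add: PZ_def alg_linearD(2)[OF alg_linear_PX] PX_mult PX_MZ PX_DZ[of a, OF assms(1)] distrib_left)

lemma PY_commutator:
  assumes "\<And>i j. a i j = - a j i" "\<And>i j. c i j = - c j i" and f: "f \<in> alg"
  shows "PY a (PY c f) - PY c (PY a f) =
    PY (\<lambda>i j. (\<Sum>k\<in>UNIV. a i k * c k j) - (\<Sum>k\<in>UNIV. c i k * a k j)) f"
  using arg_cong[OF PX_commutator[of a c "swp f", OF assms(1,2)], of swp] f by (simp add: PY_swp)

lemma PY_PZ_commutator:
  assumes "\<And>i j. d i j = - d j i" and f: "f \<in> alg"
  shows "PY d (PZ b f) - PZ b (PY d f) = - PZ (\<lambda>i j. \<Sum>k\<in>UNIV. b i k * d k j) f"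
proof -
  have "d j k * b i k = - (b i k * d k j)" for i j k
    by (subst assms(1)) simp
  then have "(\<Sum>k\<in>UNIV. d j k * b i k) = 0 - (\<Sum>k\<in>UNIV. b i k * d k j)" for i j
    by (simp add: sum_negf)
  moreover have "PY d (PZ b f) - PZ b (PY d f) = PZ (\<lambda>i j. \<Sum>k\<in>UNIV. d j k * b i k) f"
    using arg_cong[OF PX_PZ_commutator[of d "swp f" "\<lambda>j i. b i j", OF assms(1)], of swp] f
    by (simp add: PY_swp swp_PZ)
  moreover have "PZ (\<lambda>i j. 0) f = 0"
    by (simp add: PZ_def MZ_def DZ_def cc_hom)
  ultimately show ?thesis
    using PZ_minus[of "\<lambda>i j. 0" "\<lambda>i j. \<Sum>k\<in>UNIV. b i k * d k j" f] by simp
qed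

lemma PZ_commutator:
  assumes f: "f \<in> alg"
  shows "PZ b (PZ c f) - PZ c (PZ b f) =
    PX (\<lambda>i j. (\<Sum>k\<in>UNIV. c i k * b j k) - (\<Sum>k\<in>UNIV. b i k * c j k)) f +
    PY (\<lambda>i j. (\<Sum>k\<in>UNIV. c k i * b k j) - (\<Sum>k\<in>UNIV. b k i * c k j)) f"
proof -
  have "PZ b (PZ c f) - PZ c (PZ b f) =
      (DZ b (MZ c * f) - MZ c * DZ b f) - (DZ c (MZ b * f) - MZ b * DZ c f)"
    using f by (simp add: PZ_def alg_linearD(2)[OF alg_linear_DZ] DZ_comm[of f c b] algebra_simps)
  then show ?thesis
    unfolding DZ_MZ[OF f] PX_minus PY_minus by (simp add: mult.commute)
qed

lemma pi_op_PZ: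
  assumes "A \<in> opq"
  shows "pi_op A f = PX (\<lambda>i j. A $ Inl i $ Inl j) f + PY (\<lambda>i j. A $ Inr i $ Inr j) f
    + cc \<i> * PZ (\<lambda>i j. A $ Inl i $ Inr j) f"
  unfolding PZ_def by (rule pi_op_skew[OF assms])

lemma opqD:
  assumes "A \<in> opq"
  shows "A $ Inl i $ Inl j = - A $ Inl j $ Inl i" "A $ Inr i' $ Inr j' = - A $ Inr j' $ Inr i'"
    "A $ Inr j' $ Inl i = A $ Inl i $ Inr j'"
  using assms unfolding opq_iff by blast+

lemma lie_bracket_opq:
  fixes A B :: "('a::finite, 'b::finite) cmat"
  assumes "A \<in> opq" "B \<in> opq"
  shows "lie_bracket A B \<in> opq"
proof -
  have neg: "(- C) ** D = - (C ** D)" "C ** (- D) = - (C ** D)"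
    and diff: "(C - C') ** D = C ** D - C' ** D" "C ** (D - D') = C ** D - C ** D'"
    and tr: "transpose (C - D) = transpose C - transpose D" for C C' D D' :: "('a, 'b) cmat"
    by (simp_all add: matrix_matrix_mult_def transpose_def vec_eq_iff sum_negf left_diff_distrib
        right_diff_distrib sum_subtractf)
  have "transpose A ** I_pq = - (I_pq ** A)" "transpose B ** I_pq = - (I_pq ** B)"
    using assms by (simp_all add: opq_def eq_neg_iff_add_eq_0)
  then have "transpose (A ** B) ** I_pq = I_pq ** (B ** A)" "transpose (B ** A) ** I_pq = I_pq ** (A ** B)"
    by (simp_all add: matrix_transpose_mul matrix_mul_assoc[symmetric] neg)
      (simp_all add: matrix_mul_assoc neg)
  then show ?thesis
    by (simp add: opq_def lie_bracket_def tr diff)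
qed

text \<open>Pure bilinearity, stated for abstract operators; \<i>^2 = -1 accounts for the sign of
  the commutator of T and T'.\<close>

lemma commutator_expand:
  fixes P Q T P' Q' T' :: "('p::finite, 'q::finite) cfun \<Rightarrow> ('p, 'q) cfun"
  assumes "alg_linear P" "alg_linear Q" "alg_linear T" "alg_linear P'" "alg_linear Q'" "alg_linear T'"
    and "f \<in> alg"
  shows "P (P' f + Q' f + cc \<i> * T' f) + Q (P' f + Q' f + cc \<i> * T' f) + cc \<i> * T (P' f + Q' f + cc \<i> * T' f)
    - (P' (P f + Q f + cc \<i> * T f) + Q' (P f + Q f + cc \<i> * T f) + cc \<i> * T' (P f + Q f + cc \<i> * T f)) =
    (P (P' f) - P' (P f)) + (P (Q' f) - Q' (P f)) + (Q (P' f) - P' (Q f)) + (Q (Q' f) - Q' (Q f))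
    - (T (T' f) - T' (T f))
    + cc \<i> * ((P (T' f) - T' (P f)) + (Q (T' f) - T' (Q f)) + (T (P' f) - P' (T f)) + (T (Q' f) - Q' (T f)))"
proof -
  have "cc \<i> * (cc \<i> * g) = - g" for g :: "('p, 'q) cfun"
    by (simp add: fun_eq_iff pw)
  then show ?thesis
    using assms by (simp add: alg_linearD(1,2,7) distrib_left right_diff_distrib)
qed

text \<open>The diagonal blocks of [A, B] combine commutators of diagonal blocks with products of
  off-diagonal ones, and the off-diagonal block consists of mixed products. Each piece is matched by
  one of the commutator lemmas.\<close>

lemma pi_op_lie_bracket:
  assumes A: "A \<in> opq" and B: "B \<in> opq" and f: "f \<in> alg"
  shows "pi_op (lie_bracket A B) f = pi_op A (pi_op B f) - pi_op B (pi_op A f)"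
proof -
  let ?a = "\<lambda>i j. A $ Inl i $ Inl j" and ?b = "\<lambda>i j. B $ Inl i $ Inl j"
    and ?c = "\<lambda>i j. A $ Inr i $ Inr j" and ?d = "\<lambda>i j. B $ Inr i $ Inr j"
    and ?z = "\<lambda>i j. A $ Inl i $ Inr j" and ?w = "\<lambda>i j. B $ Inl i $ Inr j"
  note e = commutator_expand[OF alg_linear_PX[of ?a] alg_linear_PY[of ?c] alg_linear_PZ[of ?z]
      alg_linear_PX[of ?b] alg_linear_PY[of ?d] alg_linear_PZ[of ?w] f]
  have neg: "PZ ?z (PX ?b f) - PX ?b (PZ ?z f) = - PZ (\<lambda>i j. \<Sum>k\<in>UNIV. ?b i k * ?z k j) f"
    "PZ ?z (PY ?d f) - PY ?d (PZ ?z f) = PZ (\<lambda>i j. \<Sum>k\<in>UNIV. ?z i k * ?d k j) f"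
    using PX_PZ_commutator[of ?b f ?z, OF opqD(1)[OF B] f] PY_PZ_commutator[of ?d f ?z, OF opqD(2)[OF B] f]
    by (simp_all add: algebra_simps)
  have entries: "lie_bracket A B $ Inl i $ Inl j = ((\<Sum>k\<in>UNIV. ?a i k * ?b k j) - (\<Sum>k\<in>UNIV. ?b i k * ?a k j))
      - ((\<Sum>k\<in>UNIV. ?w i k * ?z j k) - (\<Sum>k\<in>UNIV. ?z i k * ?w j k))"
    "lie_bracket A B $ Inr i' $ Inr j' = ((\<Sum>k\<in>UNIV. ?c i' k * ?d k j') - (\<Sum>k\<in>UNIV. ?d i' k * ?c k j'))
      - ((\<Sum>k\<in>UNIV. ?w k i' * ?z k j') - (\<Sum>k\<in>UNIV. ?z k i' * ?w k j'))"
    "lie_bracket A B $ Inl i $ Inr j' = ((\<Sum>k\<in>UNIV. ?a i k * ?w k j') - (\<Sum>k\<in>UNIV. ?w i k * ?c k j'))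
      - ((\<Sum>k\<in>UNIV. ?b i k * ?z k j') - (\<Sum>k\<in>UNIV. ?z i k * ?d k j'))" for i j i' j'
    by (simp_all add: lie_bracket_def matrix_matrix_mult_def sum_UNIV_sum opqD(3)[OF A] opqD(3)[OF B])
  show ?thesis
    unfolding pi_op_PZ[OF A] pi_op_PZ[OF B] pi_op_PZ[OF lie_bracket_opq[OF A B]] e entries
    unfolding PX_commutator[of ?a ?b, OF opqD(1)[OF A] opqD(1)[OF B] f]
      PY_commutator[of ?c ?d, OF opqD(2)[OF A] opqD(2)[OF B] f] PZ_commutator[OF f]
      PX_PZ_commutator[of ?a f ?w, OF opqD(1)[OF A] f] PY_PZ_commutator[of ?c f ?w, OF opqD(2)[OF A] f] neg
      PX_PY[OF f]
    unfolding PX_minus PY_minus PZ_minus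
    by (simp add: algebra_simps)
qed

section \<open>Compatibility of the action with conjugation by K\<close>

lemma sum_conjugate:
  fixes H :: "'i::finite \<Rightarrow> 'j::finite \<Rightarrow> 'v \<Rightarrow> complex"
  shows "(\<Sum>r\<in>UNIV. \<Sum>s\<in>UNIV. cc (b r s) * (\<Sum>i\<in>UNIV. \<Sum>j\<in>UNIV. cc (u i r * w j s) * H i j)) =
    (\<Sum>i\<in>UNIV. \<Sum>j\<in>UNIV. cc (\<Sum>s\<in>UNIV. (\<Sum>r\<in>UNIV. u i r * b r s) * w j s) * H i j)"
proof (rule ext)
  fix v
  have "(\<Sum>(r, s)\<in>UNIV. \<Sum>(i, j)\<in>UNIV. b r s * (u i r * w j s) * H i j v) =
      (\<Sum>(i, j)\<in>UNIV. \<Sum>(r, s)\<in>UNIV. b r s * (u i r * w j s) * H i j v)"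
    unfolding case_prod_unfold by (rule sum.swap)
  then have "(\<Sum>r\<in>UNIV. \<Sum>s\<in>UNIV. \<Sum>i\<in>UNIV. \<Sum>j\<in>UNIV. b r s * (u i r * w j s) * H i j v) =
      (\<Sum>i\<in>UNIV. \<Sum>j\<in>UNIV. \<Sum>r\<in>UNIV. \<Sum>s\<in>UNIV. b r s * (u i r * w j s) * H i j v)"
    unfolding UNIV_Times_UNIV[symmetric] sum.cartesian_product[symmetric] .
  also have "\<dots> = (\<Sum>i\<in>UNIV. \<Sum>j\<in>UNIV. \<Sum>s\<in>UNIV. \<Sum>r\<in>UNIV. b r s * (u i r * w j s) * H i j v)"
    by (intro sum.cong refl sum.swap)
  finally show "(\<Sum>r\<in>UNIV. \<Sum>s\<in>UNIV. cc (b r s) * (\<Sum>i\<in>UNIV. \<Sum>j\<in>UNIV. cc (u i r * w j s) * H i j)) v =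
    (\<Sum>i\<in>UNIV. \<Sum>j\<in>UNIV. cc (\<Sum>s\<in>UNIV. (\<Sum>r\<in>UNIV. u i r * b r s) * w j s) * H i j) v"
    by (simp add: pw sum_distrib_left sum_distrib_right mult_ac)
qed

lemma blk_simps [simp]:
  "blk k $ Inl i $ Inl j = of_real (fst k $ i $ j)" "blk k $ Inr i' $ Inr j' = of_real (snd k $ i' $ j')"
  "blk k $ Inl i $ Inr j' = 0" "blk k $ Inr i' $ Inl j = 0"
  by (simp_all add: blk_def)

lemma blk_conjugate:
  fixes A :: "('p::finite, 'q::finite) cmat"
  assumes "(a, d) \<in> K_grp"
  defines "A' \<equiv> blk (a, d) ** A ** blk (K_inv (a, d))"
  shows "A' $ Inl i $ Inl j = (\<Sum>s\<in>UNIV. (\<Sum>r\<in>UNIV. of_real (a $ i $ r) * A $ Inl r $ Inl s) * of_real (a $ j $ s))"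
    "A' $ Inr i' $ Inr j' = (\<Sum>s\<in>UNIV. (\<Sum>r\<in>UNIV. of_real (d $ i' $ r) * A $ Inr r $ Inr s) * of_real (d $ j' $ s))"
    "A' $ Inl i $ Inr j' = (\<Sum>s\<in>UNIV. (\<Sum>r\<in>UNIV. of_real (a $ i $ r) * A $ Inl r $ Inr s) * of_real (d $ j' $ s))"
    "A' $ Inr j' $ Inl i = (\<Sum>s\<in>UNIV. (\<Sum>r\<in>UNIV. of_real (d $ j' $ r) * A $ Inr r $ Inl s) * of_real (a $ i $ s))"
  using assms(1) unfolding A'_def
  by (simp_all add: K_inv_def K_grp_def matrix_inv_orthogonal matrix_matrix_mult_def sum_UNIV_sum transpose_def)

lemma blk_conjugate_opq:
  fixes A :: "('p::finite, 'q::finite) cmat"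
  assumes k: "(a, d) \<in> K_grp" and A: "A \<in> opq"
  shows "blk (a, d) ** A ** blk (K_inv (a, d)) \<in> opq"
proof -
  have swap: "(\<Sum>s\<in>UNIV. (\<Sum>r\<in>UNIV. u i r * b r s) * w j s) = (\<Sum>s\<in>UNIV. (\<Sum>r\<in>UNIV. w j r * b s r) * u i s)"
    for u :: "'i \<Rightarrow> 'a::finite \<Rightarrow> complex" and w :: "'j \<Rightarrow> 'b::finite \<Rightarrow> complex" and b i j
    unfolding sum_distrib_right by (subst sum.swap) (simp add: mult_ac)
  have neg: "- (\<Sum>s\<in>UNIV. (\<Sum>r\<in>UNIV. u r * b r s) * w s) = (\<Sum>s\<in>UNIV. (\<Sum>r\<in>UNIV. u r * - b r s) * w s)"
    for u :: "'a::finite \<Rightarrow> complex" and w :: "'b::finite \<Rightarrow> complex" and b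
    by (simp add: sum_negf)
  note sk = opqD[OF A]
  show ?thesis
    unfolding opq_iff blk_conjugate[OF k] neg
  proof (intro conjI allI)
    show "(\<Sum>s\<in>UNIV. (\<Sum>r\<in>UNIV. of_real (a $ i $ r) * A $ Inl r $ Inl s) * of_real (a $ j $ s)) =
        (\<Sum>s\<in>UNIV. (\<Sum>r\<in>UNIV. of_real (a $ j $ r) * - A $ Inl r $ Inl s) * of_real (a $ i $ s))" for i j
      unfolding sk(1)[symmetric] by (rule swap)
    show "(\<Sum>s\<in>UNIV. (\<Sum>r\<in>UNIV. of_real (d $ i $ r) * A $ Inr r $ Inr s) * of_real (d $ j $ s)) =
        (\<Sum>s\<in>UNIV. (\<Sum>r\<in>UNIV. of_real (d $ j $ r) * - A $ Inr r $ Inr s) * of_real (d $ i $ s))" for i j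
      unfolding sk(2)[symmetric] by (rule swap)
    show "(\<Sum>s\<in>UNIV. (\<Sum>r\<in>UNIV. of_real (d $ j $ r) * A $ Inr r $ Inl s) * of_real (a $ i $ s)) =
        (\<Sum>s\<in>UNIV. (\<Sum>r\<in>UNIV. of_real (a $ i $ r) * A $ Inl r $ Inr s) * of_real (d $ j $ s))" for i j
      unfolding sk(3) by (rule swap)
  qed
qed

text \<open>Coordinates and derivatives transform by the same orthogonal matrices a and d, so
  substitution in each block conjugates its coefficient matrix.\<close>

lemma K_act_pi_op:
  assumes "k \<in> K_grp" and A: "A \<in> opq" and f: "f \<in> alg"
  shows "K_act k (pi_op A f) = pi_op (blk k ** A ** blk (K_inv k)) (K_act k f)"
proof -
  obtain a d where k: "k = (a, d)" "(a, d) \<in> K_grp"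
    using assms(1) by (cases k) auto
  let ?K = "K_act (a, d)"
  have PX: "?K (PX b f) = PX (\<lambda>i j. \<Sum>s\<in>UNIV. (\<Sum>r\<in>UNIV. of_real (a $ i $ r) * b r s) * of_real (a $ j $ s)) (?K f)" for b
    unfolding PX_def sum_conjugate[symmetric] using k f
    by (simp add: K_act_sum K_act_xc K_act_dx sum_product cc_hom mult_ac)
  have PY: "?K (PY b f) = PY (\<lambda>i j. \<Sum>s\<in>UNIV. (\<Sum>r\<in>UNIV. of_real (d $ i $ r) * b r s) * of_real (d $ j $ s)) (?K f)" for b
    unfolding PY_def sum_conjugate[symmetric] using k f
    by (simp add: K_act_sum K_act_yc K_act_dy sum_product cc_hom mult_ac)
  have MZ: "?K (MZ b) = MZ (\<lambda>i j. \<Sum>s\<in>UNIV. (\<Sum>r\<in>UNIV. of_real (a $ i $ r) * b r s) * of_real (d $ j $ s))" for b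
    unfolding MZ_def sum_conjugate[symmetric] using k f
    by (simp add: K_act_sum K_act_xc K_act_yc sum_product cc_hom mult_ac)
  have DZ: "?K (DZ b f) = DZ (\<lambda>i j. \<Sum>s\<in>UNIV. (\<Sum>r\<in>UNIV. of_real (a $ i $ r) * b r s) * of_real (d $ j $ s)) (?K f)" for b
    unfolding DZ_def sum_conjugate[symmetric] using k f
    by (simp add: K_act_sum K_act_dx K_act_dy dx_sum dx_cc_mult) (simp add: sum_distrib_left cc_hom mult_ac)
  show ?thesis
    unfolding k(1) pi_op_PZ[OF A] pi_op_PZ[OF blk_conjugate_opq[OF k(2) A]] blk_conjugate[OF k(2)]
    by (simp add: PX PY MZ DZ PZ_def)
qed

section \<open>Local finiteness, continuity and differential of the action of K\<close>

lemma span_mult: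
  assumes "f \<in> cfun.span B" "g \<in> cfun.span C"
  shows "f * g \<in> cfun.span {b * c | b c. b \<in> B \<and> c \<in> C}" (is "_ \<in> cfun.span ?BC")
  using assms(1)
proof (induction rule: cfun.span_induct_alt)
  case base
  then show ?case by (simp add: cfun.span_zero)
next
  case (step c b f)
  have "b * g \<in> cfun.span ?BC"
    using assms(2)
  proof (induction rule: cfun.span_induct_alt)
    case base
    then show ?case by (simp add: cfun.span_zero)
  next
    case (step c' b' g)
    have "cscale c' (b * b') + b * g \<in> cfun.span ?BC"
      using step \<open>b \<in> B\<close> by (intro cfun.span_add[OF cfun.span_scale[OF cfun.span_base]]) auto
    moreover have "b * (cscale c' b' + g) = cscale c' (b * b') + b * g"
      by (simp add: fun_eq_iff pw algebra_simps)
    ultimately show ?case by simp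
  qed
  then have "cscale c (b * g) + f * g \<in> cfun.span ?BC"
    using step by (intro cfun.span_add[OF cfun.span_scale]) auto
  moreover have "(cscale c b + f) * g = cscale c (b * g) + f * g"
    by (simp add: fun_eq_iff pw algebra_simps)
  ultimately show ?case by simp
qed

text \<open>The K-orbit of each generator spans a finite-dimensional space, and sums and products of
  such functions inherit this. The span of \<open>B\<close> contains the orbit without being claimed
  stable.\<close>

lemma alg_K_finite:
  "f \<in> alg \<Longrightarrow> \<exists>B. finite B \<and> (\<forall>k\<in>K_grp. K_act k f \<in> cfun.span B)"
proof (induction rule: alg.induct)
  case (const c)
  show ?case by (intro exI[of _ "{cc c}"]) (simp add: cfun.span_base)
next
  case (xc i)
  show ?case
    by (intro exI[of _ "range xc"])
      (auto simp: K_act_xc cscale_conv[symmetric] intro!: cfun.span_sum[OF cfun.span_scale] cfun.span_base[OF rangeI])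
next
  case (yc j)
  show ?case
    by (intro exI[of _ "range yc"])
      (auto simp: K_act_yc cscale_conv[symmetric] intro!: cfun.span_sum[OF cfun.span_scale] cfun.span_base[OF rangeI])
next
  case (psi \<alpha>)
  show ?case by (intro exI[of _ "{psi \<alpha>}"]) (simp add: cfun.span_base)
next
  case (add f g)
  then obtain B C where B: "finite B" "\<forall>k\<in>K_grp. K_act k f \<in> cfun.span B"
    and C: "finite C" "\<forall>k\<in>K_grp. K_act k g \<in> cfun.span C"
    by blast
  have "K_act k (f + g) \<in> cfun.span (B \<union> C)" if "k \<in> K_grp" for k
    using B C that cfun.span_mono[of B "B \<union> C"] cfun.span_mono[of C "B \<union> C"]
    by (auto intro!: cfun.span_add)
  then show ?case using B(1) C(1) by blast
next
  case (mult f g)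
  then obtain B C where B: "finite B" "\<forall>k\<in>K_grp. K_act k f \<in> cfun.span B"
    and C: "finite C" "\<forall>k\<in>K_grp. K_act k g \<in> cfun.span C"
    by blast
  have "K_act k (f * g) \<in> cfun.span {b * c | b c. b \<in> B \<and> c \<in> C}" if "k \<in> K_grp" for k
    using B C that by (auto intro!: span_mult)
  moreover have "finite {b * c | b c. b \<in> B \<and> c \<in> C}"
    by (intro finite_image_set2) (simp_all add: B(1) C(1))
  ultimately show ?case by (intro exI[of _ "{b * c | b c. b \<in> B \<and> c \<in> C}"]) simp
qed

lemma K_act_one: "K_act K_one f = f"
proof -
  have "(mat 1, mat 1) \<in> K_grp" by (simp add: K_grp_def orthogonal_matrix_id)
  from K_act_eq[OF this] show ?thesis by (intro ext) (simp add: K_one_def)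
qed

lemma K_mult_K_grp: "k \<in> K_grp \<Longrightarrow> k' \<in> K_grp \<Longrightarrow> K_mult k k' \<in> K_grp"
  by (auto simp: K_grp_def K_mult_def orthogonal_matrix_mul)

lemma K_act_mult:
  assumes "k \<in> K_grp" "k' \<in> K_grp"
  shows "K_act (K_mult k k') f = K_act k (K_act k' f)"
proof -
  obtain a d a' d' where k: "k = (a, d)" "k' = (a', d')" by (cases k; cases k') auto
  then have "(a, d) \<in> K_grp" "(a', d') \<in> K_grp" "(a ** a', d ** d') \<in> K_grp"
    using assms K_mult_K_grp[OF assms] by (simp_all add: K_mult_def)
  then show ?thesis
    by (simp add: fun_eq_iff k K_mult_def K_act_eq matrix_transpose_mul matrix_vector_mul_assoc
        del: transpose_matrix_vector)
qed

lemma bounded_linear_transpose_act: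
  "bounded_linear (\<lambda>k :: ('p::finite, 'q::finite) rmat2. (transpose (fst k) *v x, transpose (snd k) *v y))"
  unfolding linear_conv_bounded_linear[symmetric]
  by (rule linearI) (simp_all add: vec_eq_iff matrix_vector_mult_def transpose_def sum.distrib
      distrib_right sum_distrib_left mult.assoc)

lemma K_act_continuous:
  fixes f :: "('p::finite, 'q::finite) cfun"
  assumes "f \<in> alg"
  shows "continuous_on K_grp (\<lambda>k. K_act k f v)"
proof -
  have "continuous_on K_grp (\<lambda>k. f (transpose (fst k) *v fst v, transpose (snd k) *v snd v))"
    by (rule continuous_on_compose2[OF alg_continuous[OF assms, of UNIV]])
      (rule linear_continuous_on[OF bounded_linear_transpose_act], simp)
  then show ?thesis
    by (rule continuous_on_eq) (auto simp: K_act_eq)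
qed

lemma alg_derivative_expand:
  fixes f :: "('p::finite, 'q::finite) cfun"
  assumes "f \<in> alg"
  shows "(f has_derivative (\<lambda>u. (\<Sum>i\<in>UNIV. of_real (fst u $ i) * dx i f v)
    + (\<Sum>j\<in>UNIV. of_real (snd u $ j) * dy j f v))) (at v)"
proof -
  let ?D = "frechet_derivative f (at v)"
  have D: "(f has_derivative ?D) (at v)" using assms by (intro diffbleD) simp
  then have l: "linear ?D" by (rule has_derivative_linear)
  have l1: "linear (\<lambda>x. ?D (x, 0))" and l2: "linear (\<lambda>y. ?D (0, y))"
    by (auto intro!: linear_compose[OF _ l, unfolded o_def] linearI)
  have "?D = (\<lambda>u. (\<Sum>i\<in>UNIV. of_real (fst u $ i) * dx i f v) + (\<Sum>j\<in>UNIV. of_real (snd u $ j) * dy j f v))"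
  proof (rule ext)
    fix u :: "('p, 'q) V"
    have "?D u = ?D (fst u, 0) + ?D (0, snd u)"
      using linear_add[OF l, of "(fst u, 0)" "(0, snd u)"] by simp
    also have "?D (fst u, 0) = ?D (\<Sum>i\<in>UNIV. (fst u $ i) *\<^sub>R axis i 1, 0)"
      using basis_expansion[of "fst u"] by (simp add: scalar_mult_eq_scaleR)
    also have "\<dots> = (\<Sum>i\<in>UNIV. of_real (fst u $ i) * dx i f v)"
      by (simp add: linear_sum[OF l1] linear_cmul[OF l1] dx_def dir_deriv_eq[OF D])
        (simp add: scaleR_conv_of_real)
    also have "?D (0, snd u) = ?D (0, \<Sum>i\<in>UNIV. (snd u $ i) *\<^sub>R axis i 1)"
      using basis_expansion[of "snd u"] by (simp add: scalar_mult_eq_scaleR)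
    also have "\<dots> = (\<Sum>i\<in>UNIV. of_real (snd u $ i) * dy i f v)"
      by (simp add: linear_sum[OF l2] linear_cmul[OF l2] dy_def dir_deriv_eq[OF D])
        (simp add: scaleR_conv_of_real)
    finally show "?D u = (\<Sum>i\<in>UNIV. of_real (fst u $ i) * dx i f v) + (\<Sum>j\<in>UNIV. of_real (snd u $ j) * dy j f v)" .
  qed
  then show ?thesis using D by (simp only:)
qed

text \<open>Differentiate a^T a = 1 at t = 0, where a is the identity.\<close>

lemma orthogonal_curve_velocity:
  fixes a :: "real \<Rightarrow> real^'n::finite^'n"
  assumes "\<And>t. orthogonal_matrix (a t)" "a 0 = mat 1" "(a has_vector_derivative \<xi>) (at 0)"
  shows "\<xi> $ i $ j = - \<xi> $ j $ i"
proof -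
  have d: "((\<lambda>t. a t $ r $ s) has_real_derivative \<xi> $ r $ s) (at 0)" for r s
    unfolding has_real_derivative_iff_has_vector_derivative
    using bounded_linear.has_vector_derivative[OF bounded_linear_compose[OF bounded_linear_vec_nth bounded_linear_vec_nth] assms(3)]
    by simp
  have "((\<lambda>t. \<Sum>k\<in>UNIV. a t $ k $ i * a t $ k $ j) has_real_derivative
      (\<Sum>k\<in>UNIV. a 0 $ k $ i * \<xi> $ k $ j + \<xi> $ k $ i * a 0 $ k $ j)) (at 0)"
    by (intro DERIV_sum DERIV_mult' d)
  moreover have "(\<Sum>k\<in>UNIV. a t $ k $ i * a t $ k $ j) = (mat 1 :: real^'n^'n) $ i $ j" for t
  proof -
    have "(transpose (a t) ** a t) $ i $ j = (mat 1 :: real^'n^'n) $ i $ j"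
      using assms(1)[of t] by (simp add: orthogonal_matrix_def)
    then show ?thesis by (simp add: matrix_matrix_mult_def transpose_def)
  qed
  ultimately have "(\<Sum>k\<in>UNIV. a 0 $ k $ i * \<xi> $ k $ j + \<xi> $ k $ i * a 0 $ k $ j) = 0"
    using DERIV_unique[OF _ DERIV_const] by simp
  moreover have "(\<Sum>k\<in>UNIV. a 0 $ k $ i * \<xi> $ k $ j + \<xi> $ k $ i * a 0 $ k $ j) = \<xi> $ i $ j + \<xi> $ j $ i"
  proof -
    have "(mat 1 :: real^'n^'n) $ k $ i * z = (if k = i then z else 0)" "z * (mat 1 :: real^'n^'n) $ k $ j = (if k = j then z else 0)"
      for k z by (simp_all add: mat_def)
    then show ?thesis by (simp add: assms(2) sum.distrib)
  qed
  ultimately show ?thesis by simp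
qed

text \<open>On K the inverse is the transpose, so k moves the point v by an expression linear in k,
  and differentiability of \<gamma> at 0 suffices for the chain rule. The velocity X^T x paired with
  the gradient is the sum of X_ij x_i \<partial>_j, which is \<open>PX\<close>.\<close>

lemma K_act_differential:
  fixes f :: "('p::finite, 'q::finite) cfun"
  assumes \<gamma>: "\<And>t::real. \<gamma> t \<in> K_grp" "\<gamma> 0 = K_one" "(\<gamma> has_vector_derivative X) (at 0)" and f: "f \<in> alg"
  shows "((\<lambda>t. K_act (\<gamma> t) f v) has_vector_derivative pi_op (blk X) f v) (at 0)"
proof -
  let ?w = "\<lambda>k. (transpose (fst k) *v fst v, transpose (snd k) *v snd v)"
  have K: "orthogonal_matrix (fst (\<gamma> t))" "orthogonal_matrix (snd (\<gamma> t))" for t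
    using \<gamma>(1)[of t] by (auto simp: K_grp_def)
  have "fst X $ i $ j = - fst X $ j $ i" for i j
    by (rule orthogonal_curve_velocity[of "\<lambda>t. fst (\<gamma> t)"])
      (use K \<gamma>(2) bounded_linear.has_vector_derivative[OF bounded_linear_fst \<gamma>(3)] in \<open>auto simp: K_one_def\<close>)
  moreover have "snd X $ i $ j = - snd X $ j $ i" for i j
    by (rule orthogonal_curve_velocity[of "\<lambda>t. snd (\<gamma> t)"])
      (use K \<gamma>(2) bounded_linear.has_vector_derivative[OF bounded_linear_snd \<gamma>(3)] in \<open>auto simp: K_one_def\<close>)
  ultimately have X: "blk X \<in> opq"
    unfolding opq_iff blk_simps by (metis of_real_minus)
  have 0: "?w (\<gamma> 0) = v"
    by (simp add: \<gamma>(2) K_one_def)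
  have "((\<lambda>t. ?w (\<gamma> t)) has_derivative (\<lambda>t. t *\<^sub>R ?w X)) (at 0)"
    using bounded_linear.has_vector_derivative[OF bounded_linear_transpose_act \<gamma>(3)]
    unfolding has_vector_derivative_def .
  from has_derivative_compose[OF this alg_derivative_expand[OF f]]
  have "((\<lambda>t. f (?w (\<gamma> t))) has_derivative (\<lambda>t. (\<Sum>i\<in>UNIV. of_real (fst (t *\<^sub>R ?w X) $ i) * dx i f v)
    + (\<Sum>j\<in>UNIV. of_real (snd (t *\<^sub>R ?w X) $ j) * dy j f v))) (at 0)"
    unfolding 0 .
  moreover have "(\<Sum>i\<in>UNIV. of_real (fst (t *\<^sub>R ?w X) $ i) * dx i f v)
    + (\<Sum>j\<in>UNIV. of_real (snd (t *\<^sub>R ?w X) $ j) * dy j f v) = t *\<^sub>R pi_op (blk X) f v" for t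
  proof -
    have "(\<Sum>j\<in>UNIV. of_real ((transpose (fst X) *v fst v) $ j) * dx j f v) = PX (\<lambda>i j. of_real (fst X $ i $ j)) f v"
      unfolding PX_def pw
      by (subst sum.swap) (simp add: matrix_vector_mult_def transpose_def xc_def sum_distrib_right mult.assoc
        del: transpose_matrix_vector)
    moreover have "(\<Sum>j\<in>UNIV. of_real ((transpose (snd X) *v snd v) $ j) * dy j f v) = PY (\<lambda>i j. of_real (snd X $ i $ j)) f v"
      unfolding PY_def pw
      by (subst sum.swap) (simp add: matrix_vector_mult_def transpose_def yc_def sum_distrib_right mult.assoc
        del: transpose_matrix_vector)
    moreover have "PZ (\<lambda>i j. 0) f = 0"
      by (simp add: PZ_def MZ_def DZ_def cc_hom)
    moreover have "t *\<^sub>R z = of_real t * z" for z :: complex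
      by (rule scaleR_conv_of_real)
    ultimately show ?thesis
      unfolding pi_op_PZ[OF X]
      by (simp add: pw distrib_left sum_distrib_left[symmetric] mult.assoc del: transpose_matrix_vector)
  qed
  moreover have "K_act (\<gamma> t) f v = f (?w (\<gamma> t))" for t
    using K_act_eq[of "fst (\<gamma> t)" "snd (\<gamma> t)" f v] \<gamma>(1)[of t] by simp
  ultimately show ?thesis
    by (simp add: has_vector_derivative_def)
qed

text \<open>W is the span of the K-orbit of f, inside M by stability and finite-dimensional by
  \<open>alg_K_finite\<close>.\<close>

lemma gK_stable_locally_finite:
  fixes M :: "('p::finite, 'q::finite) cfun set"
  assumes M: "gK_stable pi_op K_act M" "M \<subseteq> alg" and f: "f \<in> M"
  shows "\<exists>W B. f \<in> W \<and> W \<subseteq> M \<and> cfun.subspace W \<and> finite B \<and> W \<subseteq> cfun.span B \<and>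
    (\<forall>k\<in>K_grp. \<forall>g\<in>W. K_act k g \<in> W)"
proof -
  define W where "W = cfun.span {K_act k f | k. k \<in> K_grp}"
  obtain B where B: "finite B" "\<forall>k\<in>K_grp. K_act k f \<in> cfun.span B"
    using alg_K_finite[OF subsetD[OF M(2) f]] by blast
  have 1: "(K_one :: ('p, 'q) rmat2) \<in> K_grp"
    by (simp add: K_grp_def K_one_def orthogonal_matrix_id)
  have "f \<in> W"
    unfolding W_def using 1 K_act_one[of f] by (intro cfun.span_base CollectI exI[of _ K_one]) simp
  moreover have "W \<subseteq> M"
    unfolding W_def using f by (intro cfun.span_minimal gK_stableD(1)[OF M(1)]) (auto intro: gK_stableD(5)[OF M(1)])
  moreover have "W \<subseteq> cfun.span B"
    unfolding W_def by (rule cfun.span_minimal) (use B in auto)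
  moreover have "K_act k g \<in> W" if k: "k \<in> K_grp" and "g \<in> W" for k g
    using \<open>g \<in> W\<close> unfolding W_def
  proof (induction rule: cfun.span_induct_alt)
    case base
    then show ?case by (simp add: cfun.span_zero)
  next
    case (step c b g)
    then obtain k' where "k' \<in> K_grp" "b = K_act k' f" by blast
    then have "K_act k b = K_act (K_mult k k') f" "K_mult k k' \<in> K_grp"
      using k by (simp_all add: K_act_mult K_mult_K_grp)
    then have "K_act k b \<in> cfun.span {K_act k f | k. k \<in> K_grp}"
      by (intro cfun.span_base) blast
    then show ?case
      using step.IH by (simp add: cfun.span_add cfun.span_scale)
  qed
  ultimately show ?thesis
    using B(1) cfun.subspace_span[of "{K_act k f | k. k \<in> K_grp}"] W_def
    by (intro exI[of _ W] exI[of _ B]) simp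
qed

text \<open>Besides stability and local finiteness the axioms are identities and regularity
  statements valid on \<open>alg\<close>, so every stable subspace of \<open>alg\<close> qualifies,
  M^+(m) and M^-(m) alike.\<close>

lemma gK_module_alg:
  fixes M :: "('p::finite, 'q::finite) cfun set"
  assumes M: "gK_stable pi_op K_act M" "M \<subseteq> alg"
  shows "gK_module pi_op K_act M"
proof -
  have alg: "f \<in> alg" if "f \<in> M" for f using that M(2) by blast
  show ?thesis
    unfolding gK_module_def
  proof (intro conjI ballI allI impI, goal_cases)
    case 1
    show ?case by (rule M(1))
  next
    case (2 A f g)
    then show ?case by (intro alg_linearD(2)[OF alg_linear_pi_op] alg)
  next
    case (3 A c f)
    then show ?case by (intro alg_linearD(3)[OF alg_linear_pi_op] alg)
  next
    case (6 A B f)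
    then show ?case by (intro pi_op_lie_bracket alg)
  next
    case (11 f)
    then show ?case by (intro gK_stable_locally_finite M)
  next
    case (12 f v)
    then show ?case by (intro K_act_continuous alg)
  next
    case (13 k A f)
    then show ?case by (intro K_act_pi_op alg)
  next
    case (14 \<gamma> X f v)
    then have "\<gamma> t \<in> K_grp" "\<gamma> 0 = K_one" "(\<gamma> has_vector_derivative X) (at 0)" for t
      by blast+
    then show ?case using 14(2) by (intro K_act_differential alg)
  qed (simp_all only: pi_op_add pi_op_mscale K_act_one K_act_mult K_act_simps)
qed

lemma Xminus_pi_op: "f \<in> alg \<Longrightarrow> Xminus (pi_op A f) = pi_op A (Xminus f)"
  by (simp add: pi_op_conv alg_linearD(2,7,8)[OF alg_linear_ops(7)] Xminus_pi)

text \<open>A stable N inside M' is pulled back to the vectors of M that T sends into N; this set is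
  stable because T commutes with both actions, and its image is N because T is onto.\<close>

lemma irreducible_gK_module_image:
  fixes M :: "('p::finite, 'q::finite) cfun set"
  assumes T: "alg_linear T" "bij_betw T M M'"
    and comm: "\<And>A f. f \<in> alg \<Longrightarrow> T (pi_op A f) = pi_op A (T f)"
      "\<And>k f. k \<in> K_grp \<Longrightarrow> f \<in> alg \<Longrightarrow> T (K_act k f) = K_act k (T f)"
    and M: "irreducible_gK_module pi_op K_act M" "M \<subseteq> alg"
  shows "irreducible_gK_module pi_op K_act M'"
proof -
  have stable: "gK_stable pi_op K_act M" and ne: "M \<noteq> {0}"
    and simple: "\<And>N. N \<subseteq> M \<Longrightarrow> gK_stable pi_op K_act N \<Longrightarrow> N = {0} \<or> N = M"
    using M(1) unfolding irreducible_gK_module_def gK_module_def by blast+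
  have M': "M' = T ` M" and inj: "inj_on T M"
    using T(2) by (auto simp: bij_betw_def)
  have sub: "cfun.subspace M" "0 \<in> M" by (rule gK_stableD(1)[OF stable], rule cfun.subspace_0[OF gK_stableD(1)[OF stable]])
  have alg: "f \<in> alg" if "f \<in> M" for f using that M(2) by blast
  have act: "A \<in> opq \<Longrightarrow> pi_op A f \<in> M" "k \<in> K_grp \<Longrightarrow> K_act k f \<in> M" if "f \<in> M" for A k f
    using stable that unfolding gK_stable_def by blast+
  have "cfun.subspace M'"
  proof (rule cfun.subspaceI)
    show "0 \<in> M'" using sub(2) alg_linearD(4)[OF T(1)] M' by force
    show "f + g \<in> M'" if fg: "f \<in> M'" "g \<in> M'" for f g
    proof -
      obtain f' g' where "f' \<in> M" "g' \<in> M" "f = T f'" "g = T g'" using fg M' by blast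
      then have "f + g = T (f' + g')" "f' + g' \<in> M"
        using alg_linearD(2)[OF T(1)] alg cfun.subspace_add[OF sub(1)] by simp_all
      then show ?thesis unfolding M' by blast
    qed
    show "cscale c f \<in> M'" if f: "f \<in> M'" for c f
    proof -
      obtain f' where "f' \<in> M" "f = T f'" using f M' by blast
      then have "cscale c f = T (cscale c f')" "cscale c f' \<in> M"
        using alg_linearD(3)[OF T(1)] alg cfun.subspace_scale[OF sub(1)] by simp_all
      then show ?thesis unfolding M' by blast
    qed
  qed
  moreover have "pi_op A f \<in> M'" if "f \<in> M'" "A \<in> opq" for A f
    using that act(1) alg unfolding M' by (auto simp flip: comm(1))
  moreover have "K_act k f \<in> M'" if f: "f \<in> M'" and "k \<in> K_grp" for k f
  proof -
    obtain f' where "f' \<in> M" "f = T f'" using f M' by blast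
    then have "K_act k f = T (K_act k f')" "K_act k f' \<in> M"
      using comm(2) act(2) alg \<open>k \<in> K_grp\<close> by simp_all
    then show ?thesis unfolding M' by blast
  qed
  ultimately have "gK_stable pi_op K_act M'"
    unfolding gK_stable_def by blast
  moreover have "M' \<subseteq> alg"
    using alg_linearD(1)[OF T(1)] alg unfolding M' by blast
  ultimately have "gK_module pi_op K_act M'"
    by (rule gK_module_alg)
  moreover have "M' \<noteq> {0}"
  proof
    assume M0: "M' = {0}"
    have "f = 0" if f: "f \<in> M" for f
    proof (rule inj_onD[OF inj _ f sub(2)])
      have "T f \<in> M'" using f M' by simp
      then show "T f = T 0" using M0 by (simp add: alg_linearD(4)[OF T(1)])
    qed
    then have "M = {0}" using sub(2) by blast
    then show False using ne by simp
  qed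
  moreover have "N = {0} \<or> N = M'" if N: "N \<subseteq> M'" "gK_stable pi_op K_act N" for N
  proof -
    define L where "L = {f \<in> M. T f \<in> N}"
    have N': "cfun.subspace N" "\<And>A f. A \<in> opq \<Longrightarrow> f \<in> N \<Longrightarrow> pi_op A f \<in> N"
      "\<And>k f. k \<in> K_grp \<Longrightarrow> f \<in> N \<Longrightarrow> K_act k f \<in> N"
      using N(2) unfolding gK_stable_def by blast+
    have "cfun.subspace L"
      unfolding cfun.subspace_def L_def
      by (simp add: sub(2) alg alg_linearD(2,3,4)[OF T(1)] cfun.subspace_0[OF N'(1)]
          cfun.subspace_add[OF sub(1)] cfun.subspace_scale[OF sub(1)]
          cfun.subspace_add[OF N'(1)] cfun.subspace_scale[OF N'(1)])
    then have "gK_stable pi_op K_act L"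
      unfolding gK_stable_def L_def
      by (simp add: act N'(2,3) comm alg)
    then have "L = {0} \<or> L = M"
      by (intro simple) (auto simp: L_def)
    moreover have "N = T ` L"
      using N(1) unfolding M' L_def by blast
    ultimately show ?thesis
      by (elim disjE) (simp_all add: alg_linearD(4)[OF T(1)] M')
  qed
  ultimately show ?thesis
    unfolding irreducible_gK_module_def by blast
qed

text \<open>The witnesses lie on the coordinate axes with j = 0; evenness of p + q makes the halves
  integral.\<close>

lemma K_type_index_nonempty:
  assumes "even (p + q)"
  shows "K_type_index p q m \<noteq> {}"
proof (cases "p + 2 * m \<le> q")
  case True
  then have "((q - (p + 2 * m)) div 2, 0) \<in> K_type_index p q m"
    using assms by (auto simp: K_type_index_iff intro!: exI[of _ 0])
  then show ?thesis by blast
next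
  case False
  then have "(0, (p + 2 * m - q) div 2) \<in> K_type_index p q m"
    using assms by (auto simp: K_type_index_iff intro!: exI[of _ 0])
  then show ?thesis by blast
qed

theorem theorem4p6:
  fixes m :: nat
  assumes "even (CARD('p::finite) + CARD('q::finite))"
    and "real m + 3 \<le> (real CARD('p) + real CARD('q)) / 2"
  shows
    "K_iso_direct_sum (M_plus m :: ('p, 'q) cfun set)
       (K_type_index CARD('p) CARD('q) m) (\<lambda>(k, l). harmonic_tensor k l) \<and>
     K_iso_direct_sum (M_minus m :: ('p, 'q) cfun set)
       (K_type_index CARD('p) CARD('q) m) (\<lambda>(k, l). harmonic_tensor k l) \<and>
     (CARD('p) \<ge> 2 \<and> CARD('q) \<ge> 2 \<longrightarrow>
       irreducible_gK_module pi_op K_act (M_plus m :: ('p, 'q) cfun set) \<and>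
       irreducible_gK_module pi_op K_act (M_minus m :: ('p, 'q) cfun set))"
proof (intro conjI impI M_plus_K_iso M_minus_K_iso; elim conjE)
  assume pq: "CARD('p) \<ge> 2" "CARD('q) \<ge> 2"
  let ?M = "M_plus m :: ('p, 'q) cfun set"
  have M_alg: "?M \<subseteq> alg"
    using E_space_alg by (auto simp: M_plus_eq)
  have "2 * real m + 6 \<le> real CARD('p) + real CARD('q)"
    using assms(2) by simp
  then have m: "2 * m + 6 \<le> CARD('p) + CARD('q)"
    by linarith
  \<comment> \<open>Irreducibility includes M \<noteq> {0}, so some K-type has to occur and to be
    nonzero.\<close>
  obtain k l where kl: "(k, l) \<in> K_type_index CARD('p) CARD('q) m"
    using K_type_index_nonempty[OF assms(1), of m] by auto
  obtain F :: "('p, 'q) cfun" where F: "F \<in> harmonic_tensor k l" "F \<noteq> 0"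
    using HT_nonzero[OF pq] by blast
  have "F * hw m (k, l) \<in> ?M" "F * hw m (k, l) \<noteq> 0"
    using M_plus_hw[OF F(1) kl] hw_cancel[of F "(k, l)"] F by auto
  then have "?M \<noteq> {0}" by auto
  then show plus: "irreducible_gK_module pi_op K_act ?M"
    unfolding irreducible_gK_module_def
    using gK_module_alg[OF M_plus_stable M_alg] M_plus_simple[OF pq m] by blast
  show "irreducible_gK_module pi_op K_act (M_minus m :: ('p, 'q) cfun set)"
    by (rule irreducible_gK_module_image[OF _ Xminus_funpow_bij _ _ plus M_alg])
      (simp_all add: funpow_alg_linear alg_linear_ops funpow_commute_on Xminus_pi_op Xminus_K_act)
qed

end
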